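(* Let $q=2$ and consider the degenerate elliptic-parabolic setting described in the context: the domain $\Omega=\Omega_1\cup\Omega_2$ with the stated weights $a_\ell,b_\ell,g_\ell$, the functions $\alpha,\beta$ satisfying the $p$-structure conditions (P1)--(P4), a nonnegative $\gamma\in L^\infty(\Omega)$, and a source $f\in\mathcal{V}^*$ with functionals $f_\ell\in\mathcal{V}_\ell^*$, $\ell=1,2$, such that $\langle f,v\rangle_{\mathcal{V}^*\times\mathcal{V}}=\sum_{\ell=1}^2\langle f_\ell,\mathcal{R}_\ell v\rangle_{\mathcal{V}_\ell^*\times\mathcal{V}_\ell}$ for all $v\in\mathcal{V}$. Let $u\in\mathcal{W}$ be the solution of $\mathcal{F}u=0$ in $\mathcal{V}^*$ and assume that $u\in D(\mathcal{F}_1)\cap D(\mathcal{F}_2)$. Let $s>0$ be arbitrary, let $u_2^0\in D(\mathcal{F}_2)$, and let $(u_1^{n+1},u_2^{n+1})\in D(\mathcal{F}_1)\times D(\mathcal{F}_2)$, $n=0,1,2,\ldots$, be generated either by the Peaceman--Rachford scheme $$(sI+\mathcal{F}_1)u_1^{n+1}=(sI-\mathcal{F}_2)u_2^{n},\qquad (sI+\mathcal{F}_2)u_2^{n+1}=(sI-\mathcal{F}_1)u_1^{n+1},$$ or by the Douglas--Rachford scheme $$(sI+\mathcal{F}_1)u_1^{n+1}=(sI-\mathcal{F}_2)u_2^{n},\qquad (sI+\mathcal{F}_2)u_2^{n+1}=su_1^{n+1}+\mathcal{F}_2u_2^{n}.$$ Then, with a constant $c>0$, $$\lim_{n\to\i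nfty}\sum_{\ell=1}^2\Bigl(c\bigl\|\nabla\mathcal{R}_\ell(u_\ell^n-u)\bigr\|^p_{L^p(0,T;L^p(\Omega_\ell,a_\ell)^d)}+c\bigl\|\mathcal{R}_\ell(u_\ell^n-u)\bigr\|^p_{L^p(0,T;L^p(\Omega_\ell,b_\ell))}\Bigr)=0.$$
   Context: **Domains and weights.** $\Omega\subset\mathbb{R}^d$ is a bounded Lipschitz domain, $T>0$, $p\in[2,\infty)$. $\Omega=\bigcup_{\ell=1}^q\Omega_\ell$, where each $\Omega_\ell$ is a Lipschitz domain or a finite union of pairwise disjoint Lipschitz domains. $E_\ell\colon L^2(\Omega_\ell)\to L^2(\Omega)$ is extension by zero and $R_\ell\colon L^2(\Omega)\to L^2(\Omega_\ell)$, $R_\ell u=u|_{\Omega_\ell}$ (both also applied to functions in other spaces). The weights $a_\ell\in W_0^{1,\infty}(\Omega_\ell)$, $b_\ell\in L^\infty(\Omega_\ell)$ with $b_\ell\ge c_b>0$ a.e., and $g_\ell\in L^\infty(\Omega_\ell)$ are all positive a.e. on $\Omega_\ell$ and their zero extensions form partitions of unity: $\sum_\ell E_\ell a_\ell=\sum_\ell E_\ell b_\ell=\sum_\ell E_\ell g_\ell=1$ on $\Omega$. **Spaces.** $\|u\|_{L^p(\Omega_\ell,w)}=(\int_{\Omega_\ell}w|u|^p\,\mathrm{d}x)^{1/p}$. Put $H=L^2(\Omega)$, $V=W^{1,p}(\Omega)$, $H_\ell=L^2(\Omega_\ell)$, and let $V_\ell$ be the set of $u\in L^p(\Omega_\ell,b_\ell)$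 for which there exist $z_j\in L^p(\Omega_\ell,a_\ell)$, $j=1,\ldots,d$, with $$-\int_{\Omega_\ell}u\,\partial_j(a_\ell v)\,\mathrm{d}x=\int_{\Omega_\ell}a_\ell z_jv\,\mathrm{d}x\quad\text{for all }v\in W_0^{1,p}(\Omega_\ell);$$ one writes $\nabla u=(z_1,\ldots,z_d)$ and uses the norm $\|u\|_{V_\ell}=\bigl(\|\nabla u\|^p_{L^p(\Omega_\ell,a_\ell)^d}+\|u\|^p_{L^p(\Omega_\ell,b_\ell)}\bigr)^{1/p}$. $V_\ell$ is a separable, reflexive Banach space densely embedded in $H_\ell$. Put $\mathcal{H}=L^2(0,T;H)$, $\mathcal{V}=L^p(0,T;V)$, $\mathcal{V}^*\cong L^{p/(p-1)}(0,T;V^* )$, $\mathcal{V}\hookrightarrow\mathcal{H}\hookrightarrow\mathcal{V}^*$, and analogously $\mathcal{H}_\ell,\mathcal{V}_\ell$. $\mathcal{E}_\ell,\mathcal{R}_\ell$ are the operators $(\mathcal{E}_\ell u)(t)=E_\ell u(t)$, $(\mathcal{R}_\ell u)(t)=R_\ell u(t)$. **Conditions on $\alpha,\beta$.** $\alpha\colon\Omega\times(0,T)\times\mathbb{R}^d\to\mathbb{R}^d$, $\beta\colon\Omega\times(0,T)\times\mathbb{R}\to\mathbb{R}$; there are constants $c,C>0$, a nonnegative $d_1\in L^{p/(p-1)}(\Omega\times(0,T))$ and $d_2\in L^1(\Omega\times(0,T))$ such that for a.e. $(x,t)\in\Omega\times(0,T)$: (P1) $\alpha(x,t,z),\beta(x,t,y)$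 are measurable in $(x,t)$ and continuous in $z$, $y$ respectively; (P2) $|\alpha(x,t,z)|\le C|z|^{p-1}+d_1(x,t)$ and $|\beta(x,t,y)|\le C|y|^{p-1}+d_1(x,t)$ for all $y\in\mathbb{R}$, $z\in\mathbb{R}^d$; (P3) $(\alpha(x,t,z_1)-\alpha(x,t,z_2))\cdot(z_1-z_2)+(\beta(x,t,y_1)-\beta(x,t,y_2))(y_1-y_2)\ge c(|z_1-z_2|^p+|y_1-y_2|^p)$ for all $y_1,y_2\in\mathbb{R}$, $z_1,z_2\in\mathbb{R}^d$; (P4) $\alpha(x,t,z)\cdot z+\beta(x,t,y)y\ge c(|z|^p+|y|^p)-d_2(x,t)$ for all $y\in\mathbb{R}$, $z\in\mathbb{R}^d$. **Operators.** (The $x$-argument is suppressed.) $Mu=\gamma u$ on $H$ and $M_\ell u=g_\ell(R_\ell\gamma)u$ on $H_\ell$; $$\langle A(t)u,v\rangle_{V^*\times V}=\int_\Omega\alpha(t,\nabla u)\cdot\nabla v+\beta(t,u)v\,\mathrm{d}x,\quad u,v\in V,$$ $$\langle A_\ell(t)u,v\rangle_{V_\ell^*\times V_\ell}=\int_{\Omega_\ell}a_\ell\,\alpha(t,\nabla u)\cdot\nabla v+b_\ell\,\beta(t,u)v\,\mathrm{d}x,\quad u,v\in V_\ell.$$ The induced operators are $(\mathcal{M}u)(t)=Mu(t)$, $(\mathcal{A}u)(t)=A(t)u(t)$ with $\mathcal{A}\colon\mathcal{V}\to\mathcal{V}^*$, and likewise $\mathcal{M}_\ell$, $\mathcal{A}_\ell\colon\mathcal{V}_\ell\to\mathcal{V}_\ell^*$.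 The operator $\mathrm{d}/\mathrm{d}t$ on $\mathcal{V}^*$ has domain $\{u\in W^{1,p/(p-1)}(0,T;V^* ):u(0)=0\}$, and analogously on $\mathcal{V}_\ell^*$; $\mathcal{W}=\{u\in\mathcal{V}:\mathcal{M}u\in D(\mathrm{d}/\mathrm{d}t)\}$ and $\mathcal{W}_\ell=\{u\in\mathcal{V}_\ell:\mathcal{M}_\ell u\in D(\mathrm{d}/\mathrm{d}t)\}$. Finally $\mathcal{F}u=\mathrm{d}/\mathrm{d}t\,\mathcal{M}u+\mathcal{A}u+f\in\mathcal{V}^*$ for $u\in\mathcal{W}$, and $$D(\mathcal{F}_\ell)=\{u\in\mathcal{H}:\mathcal{R}_\ell u\in\mathcal{W}_\ell,\ (\mathrm{d}/\mathrm{d}t\,\mathcal{M}_\ell+\mathcal{A}_\ell)\mathcal{R}_\ell u+f_\ell\in\mathcal{H}_\ell\},$$ $$\mathcal{F}_\ell u=\mathcal{E}_\ell\bigl((\mathrm{d}/\mathrm{d}t\,\mathcal{M}_\ell+\mathcal{A}_\ell)\mathcal{R}_\ell u+f_\ell\bigr)\in\mathcal{H},\quad u\in D(\mathcal{F}_\ell).$$ For every $s>0$ the operator $sI+\mathcal{F}_\ell\colon D(\mathcal{F}_\ell)\to\mathcal{H}$ is bijective, so the schemes are well defined.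
   Formalization: The weights a_ℓ are only required to lie in W^{1,∞}(Ω_ℓ) with zero extension in W^{1,∞}(Ω), i.e. to vanish on the part of ∂Ω_ℓ inside Ω; literal a_ℓ ∈ W_0^{1,∞}(Ω_ℓ) would contradict the partition of unity near ∂Ω. *)

theory Defs
  imports "HOL-Analysis.Analysis"
begin

text \<open>
  The space \<open>R^d\<close> is a type \<open>'a::euclidean_space\<close> with \<open>d = DIM('a)\<close>; the coordinate directions
  are the elements of \<^term>\<open>Basis\<close>, and an \<open>R^d\<close>-valued function is a function into \<open>'a\<close>.

  Elements of Lebesgue and Sobolev spaces over a set \<open>S\<close> are represented by total functions whose
  values outside \<open>S\<close> are irrelevant.  Two functions are the same element iff they agree almost
  everywhere on \<open>S\<close>; norms are therefore seminorms on representatives, and equality in a space is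
  always written as equality almost everywhere.
\<close>


section \<open>Lipschitz domains\<close>

text \<open>Near every boundary point the set is the strict epigraph, in some direction \<open>e\<close>, of a Lipschitz
  function \<open>\<phi>\<close> on the hyperplane orthogonal to \<open>e\<close>.\<close>

definition lipschitz_domain :: "'a::euclidean_space set \<Rightarrow> bool" where
  "lipschitz_domain S \<longleftrightarrow> open S \<and> connected S \<and> S \<noteq> {} \<and>
     (\<forall>x\<in>frontier S. \<exists>r>0. \<exists>e L. \<exists>\<phi> :: 'a \<Rightarrow> real. norm e = 1 \<and>
        L-lipschitz_on {w. w \<bullet> e = 0} \<phi> \<and>
        S \<inter> ball x r = {y \<in> ball x r. \<phi> (y - (y \<bullet> e) *\<^sub>R e) < y \<bullet> e})"

definition lipschitz_domain_union :: "'a::euclidean_space set \<Rightarrow> bool" where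
  "lipschitz_domain_union S \<longleftrightarrow>
     (\<exists>D. finite D \<and> D \<noteq> {} \<and> pairwise disjnt D \<and> (\<forall>G\<in>D. lipschitz_domain G) \<and> S = \<Union>D)"


section \<open>Lebesgue and Sobolev spaces\<close>

definition ext_zero :: "'a set \<Rightarrow> ('a \<Rightarrow> real) \<Rightarrow> 'a \<Rightarrow> real" where
  "ext_zero S u = (\<lambda>x. if x \<in> S then u x else 0)"

definition Lp_space ::
    "'a::euclidean_space set \<Rightarrow> ('a \<Rightarrow> real) \<Rightarrow> real \<Rightarrow> ('a \<Rightarrow> real) set" where
  "Lp_space S w p = {u. u \<in> borel_measurable (lebesgue_on S) \<and>
     integrable (lebesgue_on S) (\<lambda>x. w x * \<bar>u x\<bar> powr p)}"

definition Lp_norm ::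
    "'a::euclidean_space set \<Rightarrow> ('a \<Rightarrow> real) \<Rightarrow> real \<Rightarrow> ('a \<Rightarrow> 'b::real_normed_vector) \<Rightarrow> real" where
  "Lp_norm S w p u = (LINT x|lebesgue_on S. w x * norm (u x) powr p) powr (1 / p)"

text \<open>\<open>L^p(S, w)^d\<close>; its norm is \<^const>\<open>Lp_norm\<close> with the Euclidean norm of the value.\<close>

definition Lp_vec ::
    "'a::euclidean_space set \<Rightarrow> ('a \<Rightarrow> real) \<Rightarrow> real \<Rightarrow> ('a \<Rightarrow> 'a) set" where
  "Lp_vec S w p = {z. \<forall>j\<in>Basis. (\<lambda>x. z x \<bullet> j) \<in> Lp_space S w p}"

definition Linf_space :: "'a::euclidean_space set \<Rightarrow> ('a \<Rightarrow> real) set" where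
  "Linf_space S = {u. u \<in> borel_measurable (lebesgue_on S) \<and>
     (\<exists>K. AE x in lebesgue_on S. \<bar>u x\<bar> \<le> K)}"

primrec Ck :: "nat \<Rightarrow> ('a::euclidean_space \<Rightarrow> real) \<Rightarrow> bool" where
  "Ck 0 f \<longleftrightarrow> continuous_on UNIV f"
| "Ck (Suc k) f \<longleftrightarrow> (\<exists>g. (\<forall>x. GDERIV f x :> g x) \<and> (\<forall>j\<in>Basis. Ck k (\<lambda>x. g x \<bullet> j)))"

text \<open>\<open>C_c^\<infinity>(S)\<close>, every function being extended by zero.\<close>

definition test_fun :: "'a::euclidean_space set \<Rightarrow> ('a \<Rightarrow> real) set" where
  "test_fun S = {\<phi>. (\<forall>k. Ck k \<phi>) \<and> compact (closure {x. \<phi> x \<noteq> 0}) \<and> closure {x. \<phi> x \<noteq> 0} \<subseteq> S}"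

definition loc_integrable :: "'a::euclidean_space set \<Rightarrow> ('a \<Rightarrow> real) \<Rightarrow> bool" where
  "loc_integrable S u \<longleftrightarrow> (\<forall>K. compact K \<and> K \<subseteq> S \<longrightarrow> integrable (lebesgue_on K) u)"

definition is_weak_grad ::
    "'a::euclidean_space set \<Rightarrow> ('a \<Rightarrow> real) \<Rightarrow> ('a \<Rightarrow> 'a) \<Rightarrow> bool" where
  "is_weak_grad S u z \<longleftrightarrow> loc_integrable S u \<and>
     (\<forall>j\<in>Basis. loc_integrable S (\<lambda>x. z x \<bullet> j) \<and>
        (\<forall>\<phi>\<in>test_fun S.
           - (LINT x|lebesgue_on S. u x * frechet_derivative \<phi> (at x) j) =
             (LINT x|lebesgue_on S. (z x \<bullet> j) * \<phi> x)))"

definition weak_grad :: "'a::euclidean_space set \<Rightarrow> ('a \<Rightarrow> real) \<Rightarrow> 'a \<Rightarrow> 'a" where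
  "weak_grad S u = (SOME z. is_weak_grad S u z)"

definition W1p :: "'a::euclidean_space set \<Rightarrow> real \<Rightarrow> ('a \<Rightarrow> real) set" where
  "W1p S p = {u \<in> Lp_space S (\<lambda>_. 1) p. \<exists>z\<in>Lp_vec S (\<lambda>_. 1) p. is_weak_grad S u z}"

definition W1p_norm :: "'a::euclidean_space set \<Rightarrow> real \<Rightarrow> ('a \<Rightarrow> real) \<Rightarrow> real" where
  "W1p_norm S p u =
     (Lp_norm S (\<lambda>_. 1) p (weak_grad S u) powr p + Lp_norm S (\<lambda>_. 1) p u powr p) powr (1 / p)"

definition W1p_zero :: "'a::euclidean_space set \<Rightarrow> real \<Rightarrow> ('a \<Rightarrow> real) set" where
  "W1p_zero S p = {u \<in> W1p S p. \<exists>\<phi>. (\<forall>n::nat. \<phi> n \<in> test_fun S) \<and>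
     (\<lambda>n. W1p_norm S p (\<lambda>x. \<phi> n x - u x)) \<longlonglongrightarrow> 0}"

definition W1inf :: "'a::euclidean_space set \<Rightarrow> ('a \<Rightarrow> real) set" where
  "W1inf S = {u \<in> Linf_space S.
     \<exists>z. (\<forall>j\<in>Basis. (\<lambda>x. z x \<bullet> j) \<in> Linf_space S) \<and> is_weak_grad S u z}"

text \<open>The weights \<open>a \<in> W_0^{1,\<infinity>}(S)\<close> of a subdomain \<open>S\<close> of \<open>\<Omega>\<close> vanish on the interface, i.e. on the
  part of the boundary of \<open>S\<close> inside \<open>\<Omega>\<close>: their zero extension is in \<open>W^{1,\<infinity>}(\<Omega>)\<close>.  Zero traces on
  the whole boundary of \<open>S\<close> imply this condition, but cannot be demanded of all the weights: a
  partition of unity on \<open>\<Omega>\<close> does not tend to zero at the boundary of \<open>\<Omega>\<close>.\<close>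

definition W1inf_zero :: "'a::euclidean_space set \<Rightarrow> 'a set \<Rightarrow> ('a \<Rightarrow> real) set" where
  "W1inf_zero \<Omega> S = {a \<in> W1inf S. ext_zero S a \<in> W1inf \<Omega>}"


section \<open>The weighted space of a subdomain\<close>

definition is_wgrad ::
    "'a::euclidean_space set \<Rightarrow> ('a \<Rightarrow> real) \<Rightarrow> real \<Rightarrow> ('a \<Rightarrow> real) \<Rightarrow> ('a \<Rightarrow> 'a) \<Rightarrow> bool" where
  "is_wgrad S a p u z \<longleftrightarrow> z \<in> Lp_vec S a p \<and>
     (\<forall>j\<in>Basis. \<forall>v\<in>W1p_zero S p.
        - (LINT x|lebesgue_on S. u x * (weak_grad S (\<lambda>y. a y * v y) x \<bullet> j)) =
          (LINT x|lebesgue_on S. a x * (z x \<bullet> j) * v x))"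

definition wgrad ::
    "'a::euclidean_space set \<Rightarrow> ('a \<Rightarrow> real) \<Rightarrow> real \<Rightarrow> ('a \<Rightarrow> real) \<Rightarrow> 'a \<Rightarrow> 'a" where
  "wgrad S a p u = (SOME z. is_wgrad S a p u z)"

definition Vw :: "'a::euclidean_space set \<Rightarrow> ('a \<Rightarrow> real) \<Rightarrow> ('a \<Rightarrow> real) \<Rightarrow> real \<Rightarrow>
    ('a \<Rightarrow> real) set" where
  "Vw S a b p = {u \<in> Lp_space S b p. \<exists>z. is_wgrad S a p u z}"

definition Vw_norm :: "'a::euclidean_space set \<Rightarrow> ('a \<Rightarrow> real) \<Rightarrow> ('a \<Rightarrow> real) \<Rightarrow> real \<Rightarrow>
    ('a \<Rightarrow> real) \<Rightarrow> real" where
  "Vw_norm S a b p u =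
     (Lp_norm S a p (wgrad S a p u) powr p + Lp_norm S b p u powr p) powr (1 / p)"


section \<open>Bochner spaces and the time derivative\<close>

text \<open>A space is given by a set \<open>X\<close> of real-valued functions on \<open>'y\<close> with a seminorm \<open>N\<close>.  For
  function spaces \<open>'y\<close> is \<open>R^d\<close>; for dual spaces \<open>'y\<close> is the type of the elements of the predual.\<close>

definition bochner_simple :: "real \<Rightarrow> ('y \<Rightarrow> real) set \<Rightarrow> (real \<Rightarrow> 'y \<Rightarrow> real) \<Rightarrow> bool" where
  "bochner_simple T X s \<longleftrightarrow> finite (s ` {0<..<T}) \<and> s ` {0<..<T} \<subseteq> X \<and>
     (\<forall>x. {t \<in> {0<..<T}. s t = x} \<in> sets lebesgue)"

definition bochner_measurable ::
    "real \<Rightarrow> ('y \<Rightarrow> real) set \<Rightarrow> (('y \<Rightarrow> real) \<Rightarrow> real) \<Rightarrow> (real \<Rightarrow> 'y \<Rightarrow> real) \<Rightarrow> bool" where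
  "bochner_measurable T X N u \<longleftrightarrow>
     (AE t in lebesgue_on {0<..<T}. u t \<in> X) \<and>
     (\<exists>s. (\<forall>n::nat. bochner_simple T X (s n)) \<and>
        (AE t in lebesgue_on {0<..<T}. (\<lambda>n. N (\<lambda>y. s n t y - u t y)) \<longlonglongrightarrow> 0))"

text \<open>\<open>L^r(0, T; X)\<close>\<close>

definition bochner_Lp ::
    "real \<Rightarrow> ('y \<Rightarrow> real) set \<Rightarrow> (('y \<Rightarrow> real) \<Rightarrow> real) \<Rightarrow> real \<Rightarrow> (real \<Rightarrow> 'y \<Rightarrow> real) set" where
  "bochner_Lp T X N r = {u. bochner_measurable T X N u \<and>
     integrable (lebesgue_on {0<..<T}) (\<lambda>t. N (u t) powr r)}"

definition bochner_norm :: "real \<Rightarrow> ('x \<Rightarrow> real) \<Rightarrow> real \<Rightarrow> (real \<Rightarrow> 'x) \<Rightarrow> real" where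
  "bochner_norm T N r u = (LINT t|lebesgue_on {0<..<T}. N (u t) powr r) powr (1 / r)"

text \<open>Bounded linear functionals on \<open>(X, N)\<close>; only their values on \<open>X\<close> matter.\<close>

definition dual_space ::
    "('y \<Rightarrow> real) set \<Rightarrow> (('y \<Rightarrow> real) \<Rightarrow> real) \<Rightarrow> (('y \<Rightarrow> real) \<Rightarrow> real) set" where
  "dual_space X N = {\<psi>.
     (\<forall>u\<in>X. \<forall>v\<in>X. \<psi> (\<lambda>y. u y + v y) = \<psi> u + \<psi> v) \<and>
     (\<forall>k. \<forall>u\<in>X. \<psi> (\<lambda>y. k * u y) = k * \<psi> u) \<and>
     (\<exists>K. \<forall>u\<in>X. \<bar>\<psi> u\<bar> \<le> K * N u)}"

definition dual_norm ::
    "('y \<Rightarrow> real) set \<Rightarrow> (('y \<Rightarrow> real) \<Rightarrow> real) \<Rightarrow> (('y \<Rightarrow> real) \<Rightarrow> real) \<Rightarrow> real" where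
  "dual_norm X N \<psi> = (SUP u\<in>{u \<in> X. N u \<le> 1}. \<bar>\<psi> u\<bar>)"

text \<open>\<open>L^r(0, T; X*)\<close>, which for \<open>r = p / (p - 1)\<close> is the dual of \<open>L^p(0, T; X)\<close>, and its pairing.\<close>

definition bochner_dual ::
    "real \<Rightarrow> ('y \<Rightarrow> real) set \<Rightarrow> (('y \<Rightarrow> real) \<Rightarrow> real) \<Rightarrow> real \<Rightarrow>
     (real \<Rightarrow> ('y \<Rightarrow> real) \<Rightarrow> real) set" where
  "bochner_dual T X N r = bochner_Lp T (dual_space X N) (dual_norm X N) r"

definition pairing :: "real \<Rightarrow> (real \<Rightarrow> 'x \<Rightarrow> real) \<Rightarrow> (real \<Rightarrow> 'x) \<Rightarrow> real" where
  "pairing T f v = (LINT t|lebesgue_on {0<..<T}. f t (v t))"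

text \<open>\<open>g\<close> is the weak derivative of \<open>u\<close> on \<open>(0, T)\<close>.  The Bochner integral of an \<open>X*\<close>-valued function
  is the functional that maps \<open>v\<close> to the integral of the values at \<open>v\<close>.\<close>

definition is_ddt :: "real \<Rightarrow> ('y \<Rightarrow> real) set \<Rightarrow> (('y \<Rightarrow> real) \<Rightarrow> real) \<Rightarrow> real \<Rightarrow>
    (real \<Rightarrow> ('y \<Rightarrow> real) \<Rightarrow> real) \<Rightarrow> (real \<Rightarrow> ('y \<Rightarrow> real) \<Rightarrow> real) \<Rightarrow> bool" where
  "is_ddt T X N r u g \<longleftrightarrow> g \<in> bochner_dual T X N r \<and>
     (\<forall>\<phi>\<in>test_fun {0<..<T}. \<forall>v\<in>X.
        - (LINT t|lebesgue_on {0<..<T}. deriv \<phi> t * u t v) =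
          (LINT t|lebesgue_on {0<..<T}. \<phi> t * g t v))"

text \<open>\<open>u(0) = 0\<close> for the representative of \<open>u\<close> that is continuous from \<open>[0, T]\<close> to \<open>X*\<close>.\<close>

definition zero_initial :: "real \<Rightarrow> ('y \<Rightarrow> real) set \<Rightarrow> (('y \<Rightarrow> real) \<Rightarrow> real) \<Rightarrow>
    (real \<Rightarrow> ('y \<Rightarrow> real) \<Rightarrow> real) \<Rightarrow> bool" where
  "zero_initial T X N u \<longleftrightarrow>
     (\<exists>U. (AE t in lebesgue_on {0<..<T}. \<forall>v\<in>X. U t v = u t v) \<and>
        (\<forall>t\<in>{0..T}. U t \<in> dual_space X N) \<and>
        (\<forall>t\<in>{0..T}. ((\<lambda>s. dual_norm X N (\<lambda>v. U s v - U t v)) \<longlongrightarrow> 0) (at t within {0..T})) \<and>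
        (\<forall>v\<in>X. U 0 v = 0))"

definition ddt_dom :: "real \<Rightarrow> ('y \<Rightarrow> real) set \<Rightarrow> (('y \<Rightarrow> real) \<Rightarrow> real) \<Rightarrow> real \<Rightarrow>
    (real \<Rightarrow> ('y \<Rightarrow> real) \<Rightarrow> real) set" where
  "ddt_dom T X N r =
     {u \<in> bochner_dual T X N r. (\<exists>g. is_ddt T X N r u g) \<and> zero_initial T X N u}"

definition ddt :: "real \<Rightarrow> ('y \<Rightarrow> real) set \<Rightarrow> (('y \<Rightarrow> real) \<Rightarrow> real) \<Rightarrow> real \<Rightarrow>
    (real \<Rightarrow> ('y \<Rightarrow> real) \<Rightarrow> real) \<Rightarrow> real \<Rightarrow> ('y \<Rightarrow> real) \<Rightarrow> real" where
  "ddt T X N r u = (SOME g. is_ddt T X N r u g)"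


section \<open>The elliptic-parabolic operators\<close>

text \<open>Constants \<open>c\<close>, \<open>C\<close> and functions \<open>d1\<close>, \<open>d2\<close> of the growth, monotonicity and coercivity bounds are
  common to \<open>\<alpha>\<close> and \<open>\<beta>\<close>.\<close>

definition p_structure :: "'a::euclidean_space set \<Rightarrow> real \<Rightarrow> real \<Rightarrow>
    ('a \<Rightarrow> real \<Rightarrow> 'a \<Rightarrow> 'a) \<Rightarrow> ('a \<Rightarrow> real \<Rightarrow> real \<Rightarrow> real) \<Rightarrow> bool" where
  "p_structure \<Omega> T p \<alpha> \<beta> \<longleftrightarrow>
     (let Q = lebesgue_on (\<Omega> \<times> {0<..<T}) in
      \<exists>c C d1 d2. c > 0 \<and> C > 0 \<and>
        d1 \<in> Lp_space (\<Omega> \<times> {0<..<T}) (\<lambda>_. 1) (p / (p - 1)) \<and> (AE q in Q. 0 \<le> d1 q) \<and>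
        integrable Q d2 \<and>
        (\<forall>z. (\<lambda>(x, t). \<alpha> x t z) \<in> borel_measurable Q) \<and>
        (\<forall>y. (\<lambda>(x, t). \<beta> x t y) \<in> borel_measurable Q) \<and>
        (AE (x, t) in Q.
           continuous_on UNIV (\<alpha> x t) \<and> continuous_on UNIV (\<beta> x t) \<and>
           (\<forall>z. norm (\<alpha> x t z) \<le> C * norm z powr (p - 1) + d1 (x, t)) \<and>
           (\<forall>y. \<bar>\<beta> x t y\<bar> \<le> C * \<bar>y\<bar> powr (p - 1) + d1 (x, t)) \<and>
           (\<forall>y1 y2 z1 z2.
              (\<alpha> x t z1 - \<alpha> x t z2) \<bullet> (z1 - z2) + (\<beta> x t y1 - \<beta> x t y2) * (y1 - y2)
                \<ge> c * (norm (z1 - z2) powr p + \<bar>y1 - y2\<bar> powr p)) \<and>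
           (\<forall>y z. \<alpha> x t z \<bullet> z + \<beta> x t y * y
                \<ge> c * (norm z powr p + \<bar>y\<bar> powr p) - d2 (x, t))))"

text \<open>Multiplication by \<open>m\<close>, as an element of the dual space via the \<open>L\<^sup>2(S)\<close> inner product.\<close>

definition mult_op :: "'a::euclidean_space set \<Rightarrow> ('a \<Rightarrow> real) \<Rightarrow>
    (real \<Rightarrow> 'a \<Rightarrow> real) \<Rightarrow> real \<Rightarrow> ('a \<Rightarrow> real) \<Rightarrow> real" where
  "mult_op S m u t v = (LINT x|lebesgue_on S. m x * u t x * v x)"

text \<open>\<open>D\<close> is the gradient of the space at hand.  On \<open>\<Omega>\<close> both weights are 1.\<close>

definition flux_op :: "'a::euclidean_space set \<Rightarrow> ('a \<Rightarrow> real) \<Rightarrow> ('a \<Rightarrow> real) \<Rightarrow>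
    (('a \<Rightarrow> real) \<Rightarrow> 'a \<Rightarrow> 'a) \<Rightarrow>
    ('a \<Rightarrow> real \<Rightarrow> 'a \<Rightarrow> 'a) \<Rightarrow> ('a \<Rightarrow> real \<Rightarrow> real \<Rightarrow> real) \<Rightarrow>
    (real \<Rightarrow> 'a \<Rightarrow> real) \<Rightarrow> real \<Rightarrow> ('a \<Rightarrow> real) \<Rightarrow> real" where
  "flux_op S a b D \<alpha> \<beta> u t v =
     (LINT x|lebesgue_on S. a x * (\<alpha> x t (D (u t) x) \<bullet> D v x) + b x * \<beta> x t (u t x) * v x)"

definition evol_space :: "real \<Rightarrow> real \<Rightarrow> 'a::euclidean_space set \<Rightarrow> ('a \<Rightarrow> real) set \<Rightarrow>
    (('a \<Rightarrow> real) \<Rightarrow> real) \<Rightarrow> ('a \<Rightarrow> real) \<Rightarrow> (real \<Rightarrow> 'a \<Rightarrow> real) set" where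
  "evol_space T p S X N m =
     {u \<in> bochner_Lp T X N p. mult_op S m u \<in> ddt_dom T X N (p / (p - 1))}"

definition W_full :: "real \<Rightarrow> real \<Rightarrow> 'a::euclidean_space set \<Rightarrow> ('a \<Rightarrow> real) \<Rightarrow>
    (real \<Rightarrow> 'a \<Rightarrow> real) set" where
  "W_full T p \<Omega> \<gamma> = evol_space T p \<Omega> (W1p \<Omega> p) (W1p_norm \<Omega> p) \<gamma>"

definition F_full :: "real \<Rightarrow> real \<Rightarrow> 'a::euclidean_space set \<Rightarrow> ('a \<Rightarrow> real) \<Rightarrow>
    ('a \<Rightarrow> real \<Rightarrow> 'a \<Rightarrow> 'a) \<Rightarrow> ('a \<Rightarrow> real \<Rightarrow> real \<Rightarrow> real) \<Rightarrow>
    (real \<Rightarrow> ('a \<Rightarrow> real) \<Rightarrow> real) \<Rightarrow>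
    (real \<Rightarrow> 'a \<Rightarrow> real) \<Rightarrow> real \<Rightarrow> ('a \<Rightarrow> real) \<Rightarrow> real" where
  "F_full T p \<Omega> \<gamma> \<alpha> \<beta> f u t v =
     ddt T (W1p \<Omega> p) (W1p_norm \<Omega> p) (p / (p - 1)) (mult_op \<Omega> \<gamma> u) t v
     + flux_op \<Omega> (\<lambda>_. 1) (\<lambda>_. 1) (weak_grad \<Omega>) \<alpha> \<beta> u t v + f t v"

definition W_sub :: "real \<Rightarrow> real \<Rightarrow> 'a::euclidean_space set \<Rightarrow> ('a \<Rightarrow> real) \<Rightarrow> ('a \<Rightarrow> real) \<Rightarrow>
    ('a \<Rightarrow> real) \<Rightarrow> ('a \<Rightarrow> real) \<Rightarrow> (real \<Rightarrow> 'a \<Rightarrow> real) set" where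
  "W_sub T p S a b g \<gamma> = evol_space T p S (Vw S a b p) (Vw_norm S a b p) (\<lambda>x. g x * \<gamma> x)"

text \<open>The element \<open>(d/dt M + A) w + f\<close> of the dual of \<open>L^p(0, T; V)\<close> for a subdomain \<open>S\<close>.\<close>

definition residual_sub :: "real \<Rightarrow> real \<Rightarrow> 'a::euclidean_space set \<Rightarrow> ('a \<Rightarrow> real) \<Rightarrow>
    ('a \<Rightarrow> real) \<Rightarrow> ('a \<Rightarrow> real) \<Rightarrow> ('a \<Rightarrow> real) \<Rightarrow>
    ('a \<Rightarrow> real \<Rightarrow> 'a \<Rightarrow> 'a) \<Rightarrow> ('a \<Rightarrow> real \<Rightarrow> real \<Rightarrow> real) \<Rightarrow>
    (real \<Rightarrow> ('a \<Rightarrow> real) \<Rightarrow> real) \<Rightarrow>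
    (real \<Rightarrow> 'a \<Rightarrow> real) \<Rightarrow> real \<Rightarrow> ('a \<Rightarrow> real) \<Rightarrow> real" where
  "residual_sub T p S a b g \<gamma> \<alpha> \<beta> f w t v =
     ddt T (Vw S a b p) (Vw_norm S a b p) (p / (p - 1)) (mult_op S (\<lambda>x. g x * \<gamma> x) w) t v
     + flux_op S a b (wgrad S a p) \<alpha> \<beta> w t v + f t v"

definition L2_time :: "real \<Rightarrow> 'a::euclidean_space set \<Rightarrow> (real \<Rightarrow> 'a \<Rightarrow> real) set" where
  "L2_time T S = bochner_Lp T (Lp_space S (\<lambda>_. 1) 2) (Lp_norm S (\<lambda>_. 1) 2) 2"

text \<open>Equality of elements of \<open>L\<^sup>2(0, T; L\<^sup>2(S))\<close>.\<close>

definition eq_L2 :: "real \<Rightarrow> 'a::euclidean_space set \<Rightarrow> (real \<Rightarrow> 'a \<Rightarrow> real) \<Rightarrow>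
    (real \<Rightarrow> 'a \<Rightarrow> real) \<Rightarrow> bool" where
  "eq_L2 T S u v \<longleftrightarrow> (AE t in lebesgue_on {0<..<T}. AE x in lebesgue_on S. u t x = v t x)"

text \<open>\<open>h\<close> is the element of \<open>L\<^sup>2(0, T; L\<^sup>2(S))\<close> that represents the time-dependent functional \<open>\<psi>\<close> on
  the predual space \<open>X\<close> of functions on \<open>S\<close>.\<close>

definition L2_represents :: "real \<Rightarrow> 'a::euclidean_space set \<Rightarrow> ('a \<Rightarrow> real) set \<Rightarrow>
    (real \<Rightarrow> ('a \<Rightarrow> real) \<Rightarrow> real) \<Rightarrow> (real \<Rightarrow> 'a \<Rightarrow> real) \<Rightarrow> bool" where
  "L2_represents T S X \<psi> h \<longleftrightarrow> h \<in> L2_time T S \<and>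
     (AE t in lebesgue_on {0<..<T}. \<forall>v\<in>X. \<psi> t v = (LINT x|lebesgue_on S. h t x * v x))"

definition restr_time :: "'a set \<Rightarrow> (real \<Rightarrow> 'a \<Rightarrow> real) \<Rightarrow> real \<Rightarrow> 'a \<Rightarrow> real" where
  "restr_time S u = (\<lambda>t. restrict (u t) S)"

definition F_sub_dom :: "real \<Rightarrow> real \<Rightarrow> 'a::euclidean_space set \<Rightarrow> 'a set \<Rightarrow> ('a \<Rightarrow> real) \<Rightarrow>
    ('a \<Rightarrow> real) \<Rightarrow> ('a \<Rightarrow> real) \<Rightarrow> ('a \<Rightarrow> real) \<Rightarrow>
    ('a \<Rightarrow> real \<Rightarrow> 'a \<Rightarrow> 'a) \<Rightarrow> ('a \<Rightarrow> real \<Rightarrow> real \<Rightarrow> real) \<Rightarrow>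
    (real \<Rightarrow> ('a \<Rightarrow> real) \<Rightarrow> real) \<Rightarrow> (real \<Rightarrow> 'a \<Rightarrow> real) set" where
  "F_sub_dom T p \<Omega> S a b g \<gamma> \<alpha> \<beta> f =
     {u \<in> L2_time T \<Omega>. restr_time S u \<in> W_sub T p S a b g \<gamma> \<and>
        (\<exists>h. L2_represents T S (Vw S a b p)
               (residual_sub T p S a b g \<gamma> \<alpha> \<beta> f (restr_time S u)) h)}"

definition F_sub :: "real \<Rightarrow> real \<Rightarrow> 'a::euclidean_space set \<Rightarrow> ('a \<Rightarrow> real) \<Rightarrow>
    ('a \<Rightarrow> real) \<Rightarrow> ('a \<Rightarrow> real) \<Rightarrow> ('a \<Rightarrow> real) \<Rightarrow>
    ('a \<Rightarrow> real \<Rightarrow> 'a \<Rightarrow> 'a) \<Rightarrow> ('a \<Rightarrow> real \<Rightarrow> real \<Rightarrow> real) \<Rightarrow>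
    (real \<Rightarrow> ('a \<Rightarrow> real) \<Rightarrow> real) \<Rightarrow> (real \<Rightarrow> 'a \<Rightarrow> real) \<Rightarrow> real \<Rightarrow> 'a \<Rightarrow> real" where
  "F_sub T p S a b g \<gamma> \<alpha> \<beta> f u = (\<lambda>t. ext_zero S
     ((SOME h. L2_represents T S (Vw S a b p)
         (residual_sub T p S a b g \<gamma> \<alpha> \<beta> f (restr_time S u)) h) t))"


section \<open>The splitting schemes\<close>

definition peaceman_rachford :: "real \<Rightarrow> 'a::euclidean_space set \<Rightarrow> real \<Rightarrow>
    ((real \<Rightarrow> 'a \<Rightarrow> real) \<Rightarrow> real \<Rightarrow> 'a \<Rightarrow> real) \<Rightarrow>
    ((real \<Rightarrow> 'a \<Rightarrow> real) \<Rightarrow> real \<Rightarrow> 'a \<Rightarrow> real) \<Rightarrow>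
    (nat \<Rightarrow> real \<Rightarrow> 'a \<Rightarrow> real) \<Rightarrow> (nat \<Rightarrow> real \<Rightarrow> 'a \<Rightarrow> real) \<Rightarrow> bool" where
  "peaceman_rachford T \<Omega> s F1 F2 u1 u2 \<longleftrightarrow> (\<forall>n.
     eq_L2 T \<Omega> (\<lambda>t x. s * u1 (Suc n) t x + F1 (u1 (Suc n)) t x)
              (\<lambda>t x. s * u2 n t x - F2 (u2 n) t x) \<and>
     eq_L2 T \<Omega> (\<lambda>t x. s * u2 (Suc n) t x + F2 (u2 (Suc n)) t x)
              (\<lambda>t x. s * u1 (Suc n) t x - F1 (u1 (Suc n)) t x))"

definition douglas_rachford :: "real \<Rightarrow> 'a::euclidean_space set \<Rightarrow> real \<Rightarrow>
    ((real \<Rightarrow> 'a \<Rightarrow> real) \<Rightarrow> real \<Rightarrow> 'a \<Rightarrow> real) \<Rightarrow>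
    ((real \<Rightarrow> 'a \<Rightarrow> real) \<Rightarrow> real \<Rightarrow> 'a \<Rightarrow> real) \<Rightarrow>
    (nat \<Rightarrow> real \<Rightarrow> 'a \<Rightarrow> real) \<Rightarrow> (nat \<Rightarrow> real \<Rightarrow> 'a \<Rightarrow> real) \<Rightarrow> bool" where
  "douglas_rachford T \<Omega> s F1 F2 u1 u2 \<longleftrightarrow> (\<forall>n.
     eq_L2 T \<Omega> (\<lambda>t x. s * u1 (Suc n) t x + F1 (u1 (Suc n)) t x)
              (\<lambda>t x. s * u2 n t x - F2 (u2 n) t x) \<and>
     eq_L2 T \<Omega> (\<lambda>t x. s * u2 (Suc n) t x + F2 (u2 (Suc n)) t x)
              (\<lambda>t x. s * u1 (Suc n) t x + F2 (u2 n) t x))"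

end

theory Submission
  imports Defs
begin

text \<open>
  In the Hilbert space \<open>L\<^sup>2(0, T; L\<^sup>2(\<Omega>))\<close> the operators satisfy
  \<open>(F\<^sub>l v - F\<^sub>l w, v - w) \<ge> c (\<parallel>\<nabla>R\<^sub>l(v - w)\<parallel>\<^sup>p + \<parallel>R\<^sub>l(v - w)\<parallel>\<^sup>p)\<close>: the \<open>p\<close>-structure bounds the elliptic part,
  and \<open>\<integral> \<langle>d/dt M w, w\<rangle> \<ge> 0\<close> when \<open>M w\<close> starts at 0, because the difference quotients satisfy
  \<open>\<langle>M w(t) - M w(t - h), w(t)\<rangle> \<ge> (\<langle>M w(t), w(t)\<rangle> - \<langle>M w(t - h), w(t - h)\<rangle>) / 2\<close> and the right-hand side telescopes.
  Testing the equation for \<open>u\<close> with functions of \<open>x\<close> alone and using the partitions of unity gives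
  \<open>F\<^sub>1 u + F\<^sub>2 u = 0\<close>.  Both schemes then decrease \<open>\<parallel>s (u\<^sub>2 - u) + F\<^sub>2 u\<^sub>2 - F\<^sub>2 u\<parallel>\<^sup>2\<close>
  by at least \<open>2 s\<close> times the monotonicity terms, which are therefore summable in \<open>n\<close>.
\<close>

text \<open>Two facts behind the overview carry most of the work. Functions of \<open>W1p\<close> on
  the whole domain must lie in every \<open>Vw\<close> with the same gradient, or the equation for
  \<open>u\<close> could not be tested against the subdomain functionals. The weighted gradient is
  tested with products \<open>a v\<close> of two functions that are only weakly differentiable, so
  this rests on a Leibniz rule obtained by mollification and on uniqueness of weak gradients, which
  needs a supply of smooth bumps. Secondly, the difference quotients of \<open>M w\<close> have to
  be paired with \<open>w\<close> itself in the limit. Paired with a fixed \<open>v\<close> they are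
  backward averages of an integrable function and converge in L^1; simple functions of time replace
  \<open>w\<close>, with Young's inequality bounding the remainder uniformly in \<open>h\<close>.
  Since \<gamma> may vanish, \<open>M w\<close> does not control \<open>w\<close>, and no energy
  identity is differentiated. Null sets shape the statements throughout: gradients, time derivatives
  and representing functions are choices fixed only almost everywhere, and an identity valid for
  each test function outside its own null set of times is extended to all of them through countable
  families built on rational boxes.\<close>

lemma Ck_const [simp]: "Ck k (\<lambda>x::'a::euclidean_space. c)"
proof (induction k arbitrary: c)
  case (Suc k)
  show ?case
    by (auto intro!: exI[of _ "\<lambda>_. 0"] GDERIV_const simp: Suc.IH)
qed simp

text \<open>The recursion in \<open>Ck\<close> passes to the partial derivatives, so even the
  inclusion of the classes needs an induction. Its only analytic input is that a differentiable
  function is continuous.\<close>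

lemma Ck_SucD: "Ck (Suc k) f \<Longrightarrow> Ck k f"
proof (induction k arbitrary: f)
  case 0
  then obtain g where "\<forall>x. GDERIV f x :> g x" by auto
  then show ?case
    by (auto simp: gderiv_def continuous_on_eq_continuous_at intro!: has_derivative_continuous)
next
  case (Suc k)
  then obtain g where g: "\<forall>x. GDERIV f x :> g x" "\<forall>j\<in>Basis. Ck (Suc k) (\<lambda>x. g x \<bullet> j)" by auto
  then have "\<forall>j\<in>Basis. Ck k (\<lambda>x. g x \<bullet> j)" using Suc.IH by blast
  with g show ?case by auto
qed

lemma Ck_add: "Ck k f \<Longrightarrow> Ck k h \<Longrightarrow> Ck k (\<lambda>x. f x + h x)"
proof (induction k arbitrary: f h)
  case 0 then show ?case by (auto intro: continuous_on_add)
next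
  case (Suc k)
  then obtain f' h' where f: "\<forall>x. GDERIV f x :> f' x" "\<forall>j\<in>Basis. Ck k (\<lambda>x. f' x \<bullet> j)"
    and h: "\<forall>x. GDERIV h x :> h' x" "\<forall>j\<in>Basis. Ck k (\<lambda>x. h' x \<bullet> j)" by auto
  show ?case
    using f h Suc.IH by (auto intro!: exI[of _ "\<lambda>x. f' x + h' x"] GDERIV_add simp: inner_add_left)
qed

lemma Ck_mult: "Ck k f \<Longrightarrow> Ck k h \<Longrightarrow> Ck k (\<lambda>x. f x * h x)"
proof (induction k arbitrary: f h)
  case 0 then show ?case by (auto intro: continuous_on_mult)
next
  case (Suc k)
  then obtain f' h' where f: "\<forall>x. GDERIV f x :> f' x" "\<forall>j\<in>Basis. Ck k (\<lambda>x. f' x \<bullet> j)"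
    and h: "\<forall>x. GDERIV h x :> h' x" "\<forall>j\<in>Basis. Ck k (\<lambda>x. h' x \<bullet> j)" by auto
  have "Ck k f" "Ck k h" using Suc.prems Ck_SucD by blast+
  then have "\<forall>j\<in>Basis. Ck k (\<lambda>x. (f x *\<^sub>R h' x + h x *\<^sub>R f' x) \<bullet> j)"
    using f h Suc.IH by (auto intro!: Ck_add simp: inner_add_left)
  then show ?case
    using f h unfolding Ck.simps
    by (intro exI[of _ "\<lambda>x. f x *\<^sub>R h' x + h x *\<^sub>R f' x"]) (auto intro!: GDERIV_mult)
qed

lemma Ck_prod: "finite I \<Longrightarrow> (\<And>i. i \<in> I \<Longrightarrow> Ck k (f i)) \<Longrightarrow> Ck k (\<lambda>x. \<Prod>i\<in>I. f i x)"
  by (induction I rule: finite_induct) (auto intro!: Ck_mult)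

text \<open>Supplies the translates, dilates and, with \<open>c = -1\<close>, the reflections of
  cutoffs and mollifiers.\<close>

lemma Ck_affine: "Ck k f \<Longrightarrow> Ck k (\<lambda>y::'a::euclidean_space. f (c *\<^sub>R y + w))"
proof (induction k arbitrary: f)
  case 0 then show ?case by (auto intro!: continuous_intros continuous_on_compose2[of UNIV f])
next
  case (Suc k)
  then obtain f' where f: "\<forall>x. GDERIV f x :> f' x" "\<forall>j\<in>Basis. Ck k (\<lambda>x. f' x \<bullet> j)" by auto
  have "GDERIV (\<lambda>y. f (c *\<^sub>R y + w)) x :> c *\<^sub>R f' (c *\<^sub>R x + w)" for x
  proof -
    have "((\<lambda>y. c *\<^sub>R y + w) has_derivative (\<lambda>h. c *\<^sub>R h)) (at x)"
      by (auto intro!: derivative_eq_intros)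
    moreover have "(f has_derivative (\<lambda>h. h \<bullet> f' (c *\<^sub>R x + w))) (at (c *\<^sub>R x + w))"
      using f by (simp add: gderiv_def)
    ultimately have "((\<lambda>y. f (c *\<^sub>R y + w)) has_derivative (\<lambda>h. c *\<^sub>R h \<bullet> f' (c *\<^sub>R x + w))) (at x)"
      using has_derivative_compose by fastforce
    then show ?thesis by (simp add: gderiv_def)
  qed
  moreover have "\<forall>j\<in>Basis. Ck k (\<lambda>x. (c *\<^sub>R f' (c *\<^sub>R x + w)) \<bullet> j)"
  proof
    fix j :: 'a assume "j \<in> Basis"
    then have "Ck k (\<lambda>x. f' (c *\<^sub>R x + w) \<bullet> j)" using f Suc.IH[of "\<lambda>x. f' x \<bullet> j"] by simp
    then show "Ck k (\<lambda>x. (c *\<^sub>R f' (c *\<^sub>R x + w)) \<bullet> j)"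
      using Ck_mult[OF Ck_const] by fastforce
  qed
  ultimately show ?case
    unfolding Ck.simps by (intro exI[of _ "\<lambda>x. c *\<^sub>R f' (c *\<^sub>R x + w)"]) blast
qed

text \<open>Lifts a smooth step on the line to one that depends on a single coordinate, the factor
  from which box bumps are multiplied together.\<close>

lemma Ck_comp_inner: "Ck k (h :: real \<Rightarrow> real) \<Longrightarrow> Ck k (\<lambda>x::'a::euclidean_space. h (x \<bullet> i))"
proof (induction k arbitrary: h)
  case 0 then show ?case by (auto intro!: continuous_intros continuous_on_compose2[of UNIV h])
next
  case (Suc k)
  then obtain h' where h: "\<forall>x. GDERIV h x :> h' x" "Ck k h'" by auto
  have "GDERIV (\<lambda>y. h (y \<bullet> i)) x :> h' (x \<bullet> i) *\<^sub>R i" for x :: 'a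
  proof -
    have "(h has_derivative (\<lambda>y. y * h' (x \<bullet> i))) (at (x \<bullet> i))"
      using h by (simp add: has_field_derivative_def mult.commute[of _ "h' (x \<bullet> i)"])
    moreover have "((\<lambda>y. y \<bullet> i) has_derivative (\<lambda>y. y \<bullet> i)) (at x)"
      by (auto intro!: derivative_eq_intros)
    ultimately have "((\<lambda>y. h (y \<bullet> i)) has_derivative (\<lambda>y. (y \<bullet> i) * h' (x \<bullet> i))) (at x)"
      using has_derivative_compose by fastforce
    then show ?thesis by (simp add: gderiv_def mult.commute)
  qed
  moreover have "\<forall>j\<in>Basis. Ck k (\<lambda>x::'a. (h' (x \<bullet> i) *\<^sub>R i) \<bullet> j)"
    using Suc.IH[OF h(2)] by (auto intro!: Ck_mult)
  ultimately show ?case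
    unfolding Ck.simps by (intro exI[of _ "\<lambda>x. h' (x \<bullet> i) *\<^sub>R i"]) blast
qed

lemma Ck_Suc_real_iff: "Ck (Suc k) (h :: real \<Rightarrow> real) \<longleftrightarrow> (\<exists>h'. (\<forall>x. DERIV h x :> h' x) \<and> Ck k h')"
  by simp

section \<open>A smooth monotone step function\<close>

lemma power_div_fact_le_exp: "0 \<le> x \<Longrightarrow> x ^ n / fact n \<le> exp (x :: real)"
proof -
  assume x: "0 \<le> x"
  have "(\<Sum>k\<in>{n}. inverse (fact k) * x ^ k) \<le> (\<Sum>k. inverse (fact k) * x ^ k)"
    using summable_exp[of x] x by (intro sum_le_suminf) auto
  then show ?thesis by (simp add: exp_def divide_inverse scaleR_conv_of_real mult.commute)
qed

text \<open>The powers of \<open>x\<close> in the denominator make the family closed under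
  differentiation up to linear combinations, so that smoothness of all members follows by one
  induction over the order.\<close>

definition exp_inv :: "nat \<Rightarrow> real \<Rightarrow> real" where
  "exp_inv m x = (if x > 0 then exp (- (1 / x)) / x ^ m else 0)"

text \<open>One term of the exponential series at \<open>1 / x\<close> beats the power in the
  denominator with two powers to spare. The resulting quadratic decay at 0 makes the difference
  quotient there vanish.\<close>

lemma exp_inv_bound: "\<bar>exp_inv m x\<bar> \<le> fact (m + 2) * x\<^sup>2"
proof (cases "x > 0")
  case True
  have *: "(1 / x) ^ (m + 2) / fact (m + 2) \<le> exp (1 / x)"
    using True by (intro power_div_fact_le_exp) auto
  have "exp (- (1 / x)) / x ^ m = x\<^sup>2 * (exp (- (1 / x)) * (1 / x) ^ (m + 2))"
    using True by (simp add: power_add power_one_over power2_eq_square)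
  also have "\<dots> \<le> x\<^sup>2 * (exp (- (1 / x)) * (fact (m + 2) * exp (1 / x)))"
    using * by (intro mult_left_mono) (simp_all add: divide_le_eq mult.commute del: fact_Suc power_Suc add_2_eq_Suc')
  also have "\<dots> = fact (m + 2) * x\<^sup>2"
    by (simp add: exp_minus)
  finally have "exp (- (1 / x)) / x ^ m \<le> fact (m + 2) * x\<^sup>2" .
  then show ?thesis using True by (simp add: exp_inv_def)
qed (simp add: exp_inv_def)

lemma DERIV_exp_inv: "DERIV (exp_inv m) x :> exp_inv (m + 2) x - real m * exp_inv (m + 1) x"
proof -
  consider "x > 0" | "x < 0" | "x = 0" by linarith
  then show ?thesis
  proof cases
    case 1
    have "((\<lambda>x. exp (- (1 / x)) / x ^ m) has_real_derivative
        exp (- (1 / x)) / x ^ (m + 2) - real m * (exp (- (1 / x)) / x ^ (m + 1))) (at x)"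
    proof (rule DERIV_cong)
      show "((\<lambda>x. exp (- (1 / x)) / x ^ m) has_real_derivative
          (exp (- (1 / x)) * (1 / x\<^sup>2) * x ^ m - exp (- (1 / x)) * (real m * x ^ (m - 1))) / (x ^ m * x ^ m)) (at x)"
        using 1 by (auto intro!: derivative_eq_intros simp: power2_eq_square)
      have m: "real m * x ^ (m - 1) = real m * x ^ m / x" using 1 by (cases m) auto
      show "(exp (- (1 / x)) * (1 / x\<^sup>2) * x ^ m - exp (- (1 / x)) * (real m * x ^ (m - 1))) / (x ^ m * x ^ m)
          = exp (- (1 / x)) / x ^ (m + 2) - real m * (exp (- (1 / x)) / x ^ (m + 1))"
        unfolding m using 1 by (simp add: power2_eq_square field_simps)
    qed
    then have "((\<lambda>x. exp (- (1 / x)) / x ^ m) has_real_derivative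
        exp_inv (m + 2) x - real m * exp_inv (m + 1) x) (at x)"
      using 1 by (simp add: exp_inv_def)
    then show ?thesis
      by (rule DERIV_cong_ev[THEN iffD1, rotated -1])
         (use 1 in \<open>auto simp: exp_inv_def eventually_nhds intro!: exI[of _ "{0<..}"]\<close>)
  next
    case 2
    have "((\<lambda>x. 0) has_real_derivative exp_inv (m + 2) x - real m * exp_inv (m + 1) x) (at x)"
      using 2 by (simp add: exp_inv_def)
    then show ?thesis
      by (rule DERIV_cong_ev[THEN iffD1, rotated -1])
         (use 2 in \<open>auto simp: exp_inv_def eventually_nhds intro!: exI[of _ "{..<0}"]\<close>)
  next
    case 3
    \<comment> \<open>By \<open>exp_inv_bound\<close> the quotient at 0 is at most a constant times
      the absolute value of \<open>h\<close>, and the claimed derivative is 0 there by the case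
      distinction in \<open>exp_inv\<close>.\<close>
    have "((\<lambda>h. exp_inv m h / h) \<longlongrightarrow> 0) (at 0)"
    proof (rule Lim_null_comparison)
      show "\<forall>\<^sub>F h in at 0. norm (exp_inv m h / h) \<le> fact (m + 2) * \<bar>h\<bar>"
      proof -
        have "norm (exp_inv m h / h) \<le> fact (m + 2) * \<bar>h\<bar>" if "h \<noteq> 0" for h
          using exp_inv_bound[of m h] that
          by (simp add: divide_le_eq power2_eq_square mult.assoc del: fact_Suc add_2_eq_Suc')
        then show ?thesis by (simp only: eventually_at_filter) simp
      qed
      show "((\<lambda>h::real. fact (m + 2) * \<bar>h\<bar>) \<longlongrightarrow> 0) (at 0)"
        by (rule tendsto_eq_rhs, (rule tendsto_intros)+) simp
    qed
    then show ?thesis using 3 by (simp add: has_field_derivative_iff exp_inv_def)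
  qed
qed

lemma Ck_exp_inv: "Ck k (exp_inv m)"
proof (induction k arbitrary: m)
  case 0
  show ?case using DERIV_isCont[OF DERIV_exp_inv] by (simp add: continuous_on_eq_continuous_at)
next
  case (Suc k)
  have "Ck k (\<lambda>x. exp_inv (m + 2) x + (- real m) * exp_inv (m + 1) x)"
    by (intro Ck_add Ck_mult Ck_const Suc.IH)
  then show ?case using DERIV_exp_inv unfolding Ck_Suc_real_iff
    by (intro exI[of _ "\<lambda>x. exp_inv (m + 2) x - real m * exp_inv (m + 1) x"]) auto
qed

text \<open>The step is the normalised primitive of a nonnegative smooth bump that is positive
  exactly on the open unit interval.\<close>

lemma smooth_step_exists:
  "\<exists>H. (\<forall>k. Ck k H) \<and> (\<forall>x\<le>0. H x = 0) \<and> (\<forall>x\<ge>1. H x = 1) \<and> mono (H :: real \<Rightarrow> real)"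
proof -
  define e where "e x = exp_inv 0 x * exp_inv 0 (1 - x)" for x
  have Ce: "Ck k e" for k
  proof -
    have "Ck k (\<lambda>x. exp_inv 0 ((-1) *\<^sub>R x + 1))" by (rule Ck_affine[OF Ck_exp_inv])
    then show ?thesis unfolding e_def by (intro Ck_mult Ck_exp_inv) simp
  qed
  have conte: "continuous_on UNIV e" using Ce[of 0] by simp
  have e_ge: "e x \<ge> 0" for x by (simp add: e_def exp_inv_def)
  have e0: "e x = 0" if "x \<le> 0 \<or> x \<ge> 1" for x using that by (auto simp: e_def exp_inv_def)
  have e_pos: "e (1/2) > 0" by (simp add: e_def exp_inv_def)
  \<comment> \<open>Starting the integral at -1, left of the support of \<open>e\<close>, makes 0 an
    interior point of the interval to which the fundamental theorem is applied.\<close>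
  define F where "F x = integral {-1..x} e" for x
  have DF: "DERIV F x :> e x" for x
  proof (cases "x < 0")
    case True
    have "F y = 0" if "y < 0" for y
      unfolding F_def by (rule integral_unique, rule has_integral_is_0) (use that e0 in auto)
    then have "((\<lambda>_. 0) has_real_derivative e x) (at x) \<longleftrightarrow> (F has_real_derivative e x) (at x)"
      using True by (intro DERIV_cong_ev) (auto simp: eventually_nhds intro!: exI[of _ "{..<0}"])
    then show ?thesis using e0 True by simp
  next
    case False
    have "(F has_vector_derivative e x) (at x within {-1..x+1})"
      unfolding F_def using False
      by (intro integral_has_vector_derivative continuous_on_subset[OF conte]) auto
    then have "(F has_real_derivative e x) (at x within {-1..x+1})"
      by (simp add: has_real_derivative_iff_has_vector_derivative)
    then show ?thesis using False by (subst (asm) at_within_Icc_at) auto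
  qed
  have mF: "mono F"
    by (rule monoI, rule DERIV_nonneg_imp_nondecreasing) (use DF e_ge in auto)
  have F0: "F x = 0" if "x \<le> 0" for x
    unfolding F_def by (rule integral_unique, rule has_integral_is_0) (use that e0 in auto)
  have F1: "F x = F 1" if "x \<ge> 1" for x
  proof (cases "x = 1")
    case False
    then have "\<exists>z>1. z < x \<and> F x - F 1 = (x - 1) * e z" using that DF by (intro MVT2) auto
    then show ?thesis using e0 by auto
  qed simp
  \<comment> \<open>Otherwise the monotone function \<open>F\<close> would vanish on the whole unit
    interval, against its derivative \<open>e (1/2) > 0\<close>. This makes the normalisation
    legitimate.\<close>
  have "F 1 > 0"
  proof (rule ccontr)
    assume "\<not> F 1 > 0"
    then have "F x = 0" if "x \<in> {0<..<1}" for x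
      using monoD[OF mF, of 0 x] monoD[OF mF, of x 1] F0[of 0] that by auto
    then have "((\<lambda>_. 0) has_real_derivative e (1/2)) (at (1/2)) \<longleftrightarrow> (F has_real_derivative e (1/2)) (at (1/2))"
      by (intro DERIV_cong_ev) (auto simp: eventually_nhds intro!: exI[of _ "{0<..<1}"])
    then have "e (1/2) = 0" using DF DERIV_unique[OF _ DERIV_const] by blast
    then show False using e_pos by simp
  qed
  define H where "H x = (1 / F 1) * F x" for x
  have "Ck k F" for k
  proof (cases k)
    case 0 then show ?thesis using DERIV_isCont[OF DF] by (simp add: continuous_on_eq_continuous_at)
  next
    case (Suc n) then show ?thesis using DF Ce by auto
  qed
  then have "Ck k H" for k unfolding H_def by (intro Ck_mult Ck_const)
  moreover have "\<forall>x\<le>0. H x = 0" using F0 by (simp add: H_def)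
  moreover have "\<forall>x\<ge>1. H x = 1"
  proof (intro allI impI)
    fix x :: real assume "x \<ge> 1"
    from F1[OF this] show "H x = 1" using \<open>F 1 > 0\<close> by (simp add: H_def)
  qed
  moreover have "mono H" unfolding H_def using mF \<open>F 1 > 0\<close> by (auto simp: mono_def divide_right_mono)
  ultimately show ?thesis by blast
qed

definition smooth_step :: "real \<Rightarrow> real" where
  "smooth_step = (SOME H. (\<forall>k. Ck k H) \<and> (\<forall>x\<le>0. H x = 0) \<and> (\<forall>x\<ge>1. H x = 1) \<and> mono H)"

lemma smooth_step: "Ck k smooth_step" "x \<le> 0 \<Longrightarrow> smooth_step x = 0" "x \<ge> 1 \<Longrightarrow> smooth_step x = 1"
    "mono smooth_step"
  using someI_ex[OF smooth_step_exists] unfolding smooth_step_def by blast+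

lemma smooth_step_bounds: "0 \<le> smooth_step x" "smooth_step x \<le> 1"
  using monoD[OF smooth_step(4), of "min 0 x" x] monoD[OF smooth_step(4), of x "max 1 x"]
  by (simp_all add: smooth_step)

text \<open>All members vanish at 0, so the limit is the indicator of the open half line. This is
  the reason why the bumps built from these steps converge to indicators of open boxes.\<close>

lemma smooth_step_scaled_limit: "(\<lambda>n. smooth_step (real (Suc n) * x)) \<longlonglongrightarrow> (if 0 < x then 1 else 0)"
proof (cases "0 < x")
  case True
  obtain N where N: "1 / x < real N" using reals_Archimedean2 by blast
  have "smooth_step (real (Suc n) * x) = 1" if "n \<ge> N" for n
  proof -
    have "1 / x < real (Suc n)" using N that by linarith
    then have "1 \<le> real (Suc n) * x" using True by (simp add: divide_less_eq)
    then show ?thesis by (rule smooth_step(3))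
  qed
  then have "\<forall>\<^sub>F n in sequentially. smooth_step (real (Suc n) * x) = 1"
    unfolding eventually_sequentially by blast
  then show ?thesis using True by (simp add: tendsto_eventually)
next
  case False
  then have "smooth_step (real (Suc n) * x) = 0" for n
    by (intro smooth_step(2)) (simp add: mult_nonneg_nonpos)
  then show ?thesis using False by simp
qed

section \<open>Smooth bumps on boxes, test functions and classical gradients\<close>

definition box_bump :: "'a::euclidean_space \<Rightarrow> 'a \<Rightarrow> nat \<Rightarrow> 'a \<Rightarrow> real" where
  "box_bump a b n x = (\<Prod>i\<in>Basis. smooth_step (real (Suc n) * ((x - a) \<bullet> i)) *
     smooth_step (real (Suc n) * ((b - x) \<bullet> i)))"

lemma Ck_box_bump: "Ck k (box_bump a b n)"
proof -
  have "Ck k (\<lambda>x. smooth_step ((real (Suc n) *\<^sub>R x + (- real (Suc n) *\<^sub>R a)) \<bullet> i) *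
       smooth_step ((- real (Suc n) *\<^sub>R x + (real (Suc n) *\<^sub>R b)) \<bullet> i))" for i
    by (intro Ck_mult Ck_affine[where f="\<lambda>x. smooth_step (x \<bullet> i)"] Ck_comp_inner smooth_step)
  then show ?thesis
    unfolding box_bump_def
    by (intro Ck_prod) (simp_all add: inner_diff_left inner_add_left algebra_simps)
qed

lemma box_bump_bounds: "0 \<le> box_bump a b n x" "box_bump a b n x \<le> 1"
  unfolding box_bump_def
  by (auto intro!: prod_nonneg prod_le_1 mult_le_one mult_nonneg_nonneg smooth_step_bounds)

lemma box_bump_outside: "x \<notin> box a b \<Longrightarrow> box_bump a b n x = 0"
proof -
  assume "x \<notin> box a b"
  then obtain i where i: "i \<in> Basis" "x \<bullet> i \<le> a \<bullet> i \<or> b \<bullet> i \<le> x \<bullet> i" by (force simp: mem_box)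
  then have "smooth_step (real (Suc n) * ((x - a) \<bullet> i)) * smooth_step (real (Suc n) * ((b - x) \<bullet> i)) = 0"
    by (auto simp: inner_diff_left mult_nonneg_nonpos intro!: smooth_step(2))
  then show ?thesis unfolding box_bump_def using i(1) by (intro prod_zero) auto
qed

lemma box_bump_limit: "(\<lambda>n. box_bump a b n x) \<longlonglongrightarrow> indicator (box a b) x"
proof -
  have "(\<lambda>n. box_bump a b n x) \<longlonglongrightarrow>
     (\<Prod>i\<in>Basis. (if 0 < (x - a) \<bullet> i then 1 else 0) * (if 0 < (b - x) \<bullet> i then 1 else 0))"
    unfolding box_bump_def by (intro tendsto_prod tendsto_mult smooth_step_scaled_limit)
  also have "(\<Prod>i\<in>Basis. (if 0 < (x - a) \<bullet> i then 1 else 0) * (if 0 < (b - x) \<bullet> i then 1 else (0::real))) =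
     indicator (box a b) x"
  proof (cases "x \<in> box a b")
    case True then show ?thesis by (auto simp: mem_box inner_diff_left intro!: prod.neutral)
  next
    case False
    then obtain i where "i \<in> Basis" "x \<bullet> i \<le> a \<bullet> i \<or> b \<bullet> i \<le> x \<bullet> i" by (force simp: mem_box)
    then show ?thesis using False by (auto simp: inner_diff_left intro!: prod_zero bexI[of _ i])
  qed
  finally show ?thesis .
qed

text \<open>Any compact set outside of which the function vanishes contains the closure of its
  support, which spares computing that closure.\<close>

lemma test_funI:
  assumes "\<And>k. Ck k \<phi>" "compact K" "K \<subseteq> S" "\<And>x. x \<notin> K \<Longrightarrow> \<phi> x = 0"
  shows "\<phi> \<in> test_fun S"
proof -
  have "closure {x. \<phi> x \<noteq> 0} \<subseteq> K"
    using assms by (intro closure_minimal compact_imp_closed) auto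
  then have "K \<inter> closure {x. \<phi> x \<noteq> 0} = closure {x. \<phi> x \<noteq> 0}" by blast
  then have "compact (closure {x. \<phi> x \<noteq> 0})"
    using compact_Int_closed[OF assms(2) closed_closure, of "{x. \<phi> x \<noteq> 0}"] by simp
  with \<open>closure _ \<subseteq> K\<close> show ?thesis using assms unfolding test_fun_def by blast
qed

lemma test_funE:
  assumes "\<phi> \<in> test_fun S"
  obtains K where "compact K" "K \<subseteq> S" "\<And>x. x \<notin> K \<Longrightarrow> \<phi> x = 0"
proof
  show "compact (closure {x. \<phi> x \<noteq> 0})" "closure {x. \<phi> x \<noteq> 0} \<subseteq> S" using assms by (auto simp: test_fun_def)
  show "\<phi> x = 0" if "x \<notin> closure {x. \<phi> x \<noteq> 0}" for x
    using that closure_subset[of "{x. \<phi> x \<noteq> 0}"] by auto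
qed

lemma test_fun_Ck: "\<phi> \<in> test_fun S \<Longrightarrow> Ck k \<phi>"
  by (simp add: test_fun_def)

lemma test_fun_mono: "S \<subseteq> S' \<Longrightarrow> test_fun S \<subseteq> test_fun S'"
  by (auto simp: test_fun_def)

lemma box_bump_test_fun: "cbox a b \<subseteq> S \<Longrightarrow> box_bump a b n \<in> test_fun S"
  using box_subset_cbox[of a b] by (intro test_funI[of _ "cbox a b"] Ck_box_bump) (auto intro!: box_bump_outside)

lemma test_fun_mult_Ck:
  assumes "\<phi> \<in> test_fun S" "\<And>k. Ck k \<psi>"
  shows "(\<lambda>x. \<phi> x * \<psi> x) \<in> test_fun S"
proof -
  from assms(1) obtain K where "compact K" "K \<subseteq> S" "\<And>x. x \<notin> K \<Longrightarrow> \<phi> x = 0"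
    by (rule test_funE) blast
  then show ?thesis using assms by (intro test_funI[where K=K] Ck_mult) (simp_all add: test_fun_Ck)
qed

text \<open>Collects into one vector the partial derivatives that \<open>is_weak_grad\<close> reads
  off from \<open>frechet_derivative\<close>, so that the rules for \<open>GDERIV\<close>, such as
  the product rule, apply to test functions.\<close>

definition cgrad :: "('a::euclidean_space \<Rightarrow> real) \<Rightarrow> 'a \<Rightarrow> 'a" where
  "cgrad f x = (\<Sum>j\<in>Basis. frechet_derivative f (at x) j *\<^sub>R j)"

lemma cgrad_inner: "j \<in> Basis \<Longrightarrow> cgrad f x \<bullet> j = frechet_derivative f (at x) j"
  by (simp add: cgrad_def)

lemma cgrad_eqI:
  assumes "GDERIV f x :> g" shows "cgrad f x = g"
proof (rule euclidean_eqI)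
  fix j :: 'a assume "j \<in> Basis"
  have "frechet_derivative f (at x) = (\<lambda>h. h \<bullet> g)"
    using assms frechet_derivative_at by (metis gderiv_def)
  then show "cgrad f x \<bullet> j = g \<bullet> j" using \<open>j \<in> Basis\<close> by (simp add: cgrad_inner inner_commute[of j])
qed

lemma Ck_GDERIV: "Ck (Suc k) f \<Longrightarrow> GDERIV f x :> cgrad f x"
proof -
  assume "Ck (Suc k) f"
  then obtain g where "GDERIV f x :> g x" by auto
  with cgrad_eqI[OF this] show ?thesis by simp
qed

lemma Ck_cgrad: "Ck (Suc k) f \<Longrightarrow> j \<in> Basis \<Longrightarrow> Ck k (\<lambda>x. cgrad f x \<bullet> j)"
proof -
  assume "Ck (Suc k) f" "j \<in> Basis"
  then obtain g where "\<forall>x. GDERIV f x :> g x" "Ck k (\<lambda>x. g x \<bullet> j)" by auto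
  moreover from this have "cgrad f = g" using cgrad_eqI by fastforce
  ultimately show ?thesis by simp
qed

lemma cgrad_mult:
  assumes "Ck (Suc 0) f" "Ck (Suc 0) h"
  shows "cgrad (\<lambda>x. f x * h x) x = f x *\<^sub>R cgrad h x + h x *\<^sub>R cgrad f x"
  by (intro cgrad_eqI GDERIV_mult Ck_GDERIV[of 0] assms)

lemma cgrad_zero: "compact K \<Longrightarrow> (\<And>x. x \<notin> K \<Longrightarrow> f x = 0) \<Longrightarrow> x \<notin> K \<Longrightarrow> cgrad f x = 0"
proof -
  assume K: "compact K" "\<And>x. x \<notin> K \<Longrightarrow> f x = 0" "x \<notin> K"
  have "open (- K)" using K compact_imp_closed by auto
  then have "(f has_derivative (\<lambda>h. 0)) (at x)"
    by (rule has_derivative_transform_within_open[OF has_derivative_const, where s="-K"]) (use K in auto)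
  then show ?thesis by (intro cgrad_eqI) (simp add: gderiv_def)
qed

lemma cgrad_continuous: "Ck (Suc 0) f \<Longrightarrow> continuous_on UNIV (cgrad f)"
  using Ck_cgrad[of 0 f] by (subst continuous_on_componentwise) simp

section \<open>Lebesgue integrals over subsets and mollification\<close>

text \<open>Translation, reflection and Fubini are available for \<open>lborel\<close> on the whole
  space. A Lebesgue measurable function on \<open>S\<close> is therefore exchanged for a Borel
  function that vanishes off \<open>S\<close> and has the same integral.\<close>

lemma borel_representative:
  fixes f :: "'a::euclidean_space \<Rightarrow> real"
  assumes f: "integrable (lebesgue_on S) f" and S: "S \<in> sets borel"
  obtains f' where "f' \<in> borel_measurable borel" "integrable lborel f'" "\<And>x. x \<notin> S \<Longrightarrow> f' x = 0"
    "AE x in lborel. x \<in> S \<longrightarrow> f' x = f x" "AE x in lebesgue_on S. f' x = f x"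
    "(LINT x|lebesgue_on S. f x) = (LINT x|lborel. f' x)"
proof -
  have i: "integrable lebesgue (\<lambda>x. indicator S x *\<^sub>R f x)"
    using f S by (subst (asm) integrable_restrict_space) (auto simp: sets_completionI_sets)
  then have "(\<lambda>x. indicator S x *\<^sub>R f x) \<in> borel_measurable (completion lborel)" by simp
  from completion_ex_borel_measurable_real[OF this] obtain g where g: "g \<in> borel_measurable lborel"
    "AE x in lborel. indicator S x *\<^sub>R f x = g x" by blast
  define f' where "f' x = indicator S x * g x" for x
  have m: "f' \<in> borel_measurable borel" unfolding f'_def using g S by simp
  have eq: "AE x in lborel. f' x = indicator S x *\<^sub>R f x"
    using g(2) by eventually_elim (auto simp: f'_def split: split_indicator)
  then have eq': "AE x in lebesgue. f' x = indicator S x *\<^sub>R f x" by (rule AE_completion)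
  have i': "integrable lebesgue f'"
    by (rule integrable_cong_AE_imp[OF i]) (use m eq' in \<open>auto intro: measurable_completion\<close>)
  then have i'': "integrable lborel f'" using m by (simp add: integrable_completion)
  have "(LINT x|lebesgue_on S. f x) = (LINT x|lebesgue. indicator S x *\<^sub>R f x)"
    using S by (intro integral_restrict_space) (auto simp: sets_completionI_sets)
  also have "\<dots> = (LINT x|lebesgue. f' x)"
    by (rule integral_cong_AE) (use i i' eq' in auto)
  also have "\<dots> = (LINT x|lborel. f' x)" using m by (simp add: integral_completion)
  finally have "(LINT x|lebesgue_on S. f x) = (LINT x|lborel. f' x)" .
  moreover have "AE x in lebesgue_on S. f' x = f x"
    using S eq' by (subst AE_restrict_space_iff) (auto simp: sets_completionI_sets)
  moreover have "AE x in lborel. x \<in> S \<longrightarrow> f' x = f x" using eq by eventually_elim auto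
  ultimately show ?thesis using that[OF m i''] f'_def by auto
qed

lemma lebesgue_on_AE_lborel:
  assumes "S \<in> sets borel"
  shows "(AE x in lebesgue_on S. P x) \<longleftrightarrow> (AE x in lborel. x \<in> S \<longrightarrow> P x)"
  using assms by (subst AE_restrict_space_iff) (auto simp: sets_completionI_sets AE_completion_iff)

lemma open_sets_lebesgue: "open S \<Longrightarrow> S \<in> sets lebesgue"
  by (simp add: sets_completionI_sets)

section \<open>Rational boxes and the fundamental lemma of the calculus of variations\<close>

definition rat_points :: "'a::euclidean_space set" where
  "rat_points = {a. \<forall>i\<in>Basis. a \<bullet> i \<in> \<rat>}"

lemma countable_rat_points: "countable (rat_points :: 'a::euclidean_space set)"
proof -
  have "(rat_points :: 'a set) \<subseteq> (\<lambda>f. \<Sum>i\<in>Basis. f i *\<^sub>R i) ` (Basis \<rightarrow>\<^sub>E \<rat>)"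
  proof
    fix a :: 'a assume "a \<in> rat_points"
    then have "restrict (\<lambda>i. a \<bullet> i) Basis \<in> Basis \<rightarrow>\<^sub>E \<rat>" by (auto simp: rat_points_def)
    moreover have "a = (\<Sum>i\<in>Basis. restrict (\<lambda>i. a \<bullet> i) Basis i *\<^sub>R i)"
      by (simp add: euclidean_representation)
    ultimately show "a \<in> (\<lambda>f. \<Sum>i\<in>Basis. f i *\<^sub>R i) ` (Basis \<rightarrow>\<^sub>E \<rat>)" by blast
  qed
  moreover have "countable (Basis \<rightarrow>\<^sub>E \<rat> :: ('a \<Rightarrow> real) set)"
    by (intro countable_PiE) (auto intro: countable_rat)
  ultimately show ?thesis by (meson countable_image countable_subset)
qed

lemma open_rat_box:
  fixes x :: "'a::euclidean_space"
  assumes "open M" "x \<in> M"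
  obtains a b where "a \<in> rat_points" "b \<in> rat_points" "x \<in> box a b" "box a b \<subseteq> M"
proof -
  have "x \<in> (\<Union>f\<in>{f \<in> Basis \<rightarrow>\<^sub>E \<rat> \<times> \<rat>. box (\<Sum>i\<in>Basis. fst (f i) *\<^sub>R i) (\<Sum>i\<in>Basis. snd (f i) *\<^sub>R i) \<subseteq> M}.
      box (\<Sum>i\<in>Basis. fst (f i) *\<^sub>R i) (\<Sum>i\<in>Basis. snd (f i) *\<^sub>R i))"
    using open_UNION_box[OF assms(1)] assms(2) by blast
  then obtain f :: "'a \<Rightarrow> real \<times> real" where f: "f \<in> Basis \<rightarrow>\<^sub>E \<rat> \<times> \<rat>"
    "box (\<Sum>i\<in>Basis. fst (f i) *\<^sub>R i) (\<Sum>i\<in>Basis. snd (f i) *\<^sub>R i) \<subseteq> M"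
    "x \<in> box (\<Sum>i\<in>Basis. fst (f i) *\<^sub>R i) (\<Sum>i\<in>Basis. snd (f i) *\<^sub>R i)" by blast
  show ?thesis
    by (rule that[OF _ _ f(3) f(2)]) (use f(1) in \<open>auto simp: rat_points_def PiE_iff mem_Times_iff\<close>)
qed

text \<open>Every open set is the union of the rational boxes inside it, and there are only
  countably many of them.\<close>

lemma borel_eq_rat_box:
  "sets borel = sigma_sets UNIV {box a b | a b :: 'a::euclidean_space. a \<in> rat_points \<and> b \<in> rat_points}"
    (is "_ = sigma_sets UNIV ?G")
proof
  have "U \<in> sigma_sets UNIV ?G" if "open U" for U
  proof -
    define D where "D = {(a, b). a \<in> rat_points \<and> b \<in> rat_points \<and> box a b \<subseteq> U}"
    have "countable D"
      by (rule countable_subset[of _ "rat_points \<times> rat_points"]) (auto simp: D_def countable_rat_points)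
    have U: "U = (\<Union>(a, b)\<in>D. box a b)"
    proof
      show "U \<subseteq> (\<Union>(a, b)\<in>D. box a b)"
      proof
        fix x assume "x \<in> U"
        from open_rat_box[OF that this] obtain a b where "a \<in> rat_points" "b \<in> rat_points" "x \<in> box a b" "box a b \<subseteq> U" .
        then show "x \<in> (\<Union>(a, b)\<in>D. box a b)" unfolding D_def by blast
      qed
    qed (auto simp: D_def)
    interpret sigma_algebra UNIV "sigma_sets UNIV ?G" by (rule sigma_algebra_sigma_sets) auto
    show ?thesis unfolding U using \<open>countable D\<close>
      by (intro countable_UN') (auto simp: D_def intro!: sigma_sets.Basic)
  qed
  then have "sigma_sets UNIV {S. open S} \<subseteq> sigma_sets UNIV ?G" by (intro sigma_sets_mono) auto
  then show "sets borel \<subseteq> sigma_sets UNIV ?G" by (simp add: borel_def)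
  show "sigma_sets UNIV ?G \<subseteq> sets borel"
    by (rule sets.sigma_sets_subset'[where M=borel, simplified]) auto
qed

lemma rat_points_max_min:
  assumes "a \<in> rat_points" "b \<in> rat_points"
  shows "(\<Sum>i\<in>Basis. max (a \<bullet> i) (b \<bullet> i) *\<^sub>R i) \<in> rat_points"
    "(\<Sum>i\<in>Basis. min (a \<bullet> i) (b \<bullet> i) *\<^sub>R i) \<in> rat_points"
  using assms by (auto simp: rat_points_def max_def min_def)

text \<open>A Dynkin class argument: rational boxes generate the Borel sets and are stable under
  intersection, while the sets over which \<open>f\<close> integrates to 0 are closed under disjoint
  countable unions and, because the total integral is 0, under complements. An integrable density
  with all set integrals 0 vanishes almost everywhere.\<close>

lemma box_integrals_zero_imp_AE:
  fixes f :: "'a::euclidean_space \<Rightarrow> real"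
  assumes f: "integrable lborel f" and zero: "(LINT x|lborel. f x) = 0"
    and box: "\<And>a b. a \<in> rat_points \<Longrightarrow> b \<in> rat_points \<Longrightarrow> (LINT x|lborel. indicator (box a b) x * f x) = 0"
  shows "AE x in lborel. f x = 0"
proof -
  let ?G = "{box a b | a b :: 'a. a \<in> rat_points \<and> b \<in> rat_points}"
  have int: "integrable lborel (\<lambda>x. indicator A x *\<^sub>R f x)" if "A \<in> sets borel" for A
    using f that by (intro integrable_mult_indicator) auto
  have z: "(LINT x|lborel. indicator A x *\<^sub>R f x) = 0" if A: "A \<in> sigma_sets UNIV ?G" for A
  proof (rule sigma_sets_induct_disjoint[OF _ _ A])
    show "Int_stable ?G"
      unfolding Int_stable_def
    proof (intro ballI)
      fix A B :: "'a set" assume "A \<in> ?G" "B \<in> ?G"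
      then obtain a b c d where "a \<in> rat_points" "b \<in> rat_points" "c \<in> rat_points" "d \<in> rat_points"
        "A = box a b" "B = box c d" by blast
      then show "A \<inter> B \<in> ?G" using rat_points_max_min box_Int_box[of a b c d] by blast
    qed
    show "(LINT x|lborel. indicator A x *\<^sub>R f x) = 0" if "A \<in> ?G" for A using box that by auto
    show "(LINT x|lborel. indicator (UNIV - A) x *\<^sub>R f x) = 0"
      if "A \<in> sigma_sets UNIV ?G" "(LINT x|lborel. indicator A x *\<^sub>R f x) = 0" for A
    proof -
      have A: "A \<in> sets borel" using that borel_eq_rat_box by blast
      have "(LINT x|lborel. indicator (UNIV - A) x *\<^sub>R f x) = (LINT x|lborel. f x - indicator A x *\<^sub>R f x)"
        by (intro Bochner_Integration.integral_cong) (auto split: split_indicator)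
      then show ?thesis using zero that(2) int[OF A] f by simp
    qed
    show "(LINT x|lborel. indicator (\<Union>i::nat. A i) x *\<^sub>R f x) = 0"
      if "disjoint_family A" "range A \<subseteq> sigma_sets UNIV ?G" "\<And>i. (LINT x|lborel. indicator (A i) x *\<^sub>R f x) = 0" for A
    proof -
      have "\<And>i. A i \<in> sets lborel" using that borel_eq_rat_box by auto
      moreover have "\<And>i j. i \<noteq> j \<Longrightarrow> A i \<inter> A j = {}" using that(1) by (auto simp: disjoint_family_on_def)
      moreover have "set_integrable lborel (\<Union>i. A i) f"
        unfolding set_integrable_def using calculation by (intro int) auto
      ultimately have "(LINT x:(\<Union>i. A i)|lborel. f x) = (\<Sum>i. (LINT x:(A i)|lborel. f x))"
        by (rule lebesgue_integral_countable_add)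
      then show ?thesis using that(3) by (simp add: set_lebesgue_integral_def)
    qed
  qed auto
  show ?thesis
    by (rule density_unique_real[OF f integrable_zero]) (use z borel_eq_rat_box in \<open>auto simp: set_lebesgue_integral_def\<close>)
qed

text \<open>A countable family of test functions lets exceptional null sets be collected over all of them.\<close>

definition rat_bumps :: "'a::euclidean_space set \<Rightarrow> ('a \<Rightarrow> real) set" where
  "rat_bumps S = {box_bump a b n | a b n. a \<in> rat_points \<and> b \<in> rat_points \<and> cbox a b \<subseteq> S}"

lemma rat_bumps_test_fun: "rat_bumps S \<subseteq> test_fun S"
  by (auto simp: rat_bumps_def box_bump_test_fun)

lemma countable_rat_bumps: "countable (rat_bumps S)"
proof -
  have "rat_bumps S \<subseteq> (\<lambda>(a, b, n). box_bump a b n) ` (rat_points \<times> rat_points \<times> UNIV)"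
    by (auto simp: rat_bumps_def image_iff) blast
  then show ?thesis by (rule countable_subset) (auto simp: countable_rat_points)
qed

lemma lebesgue_on_subset_integral:
  fixes f :: "'a::euclidean_space \<Rightarrow> real"
  assumes "S' \<subseteq> S" "S \<in> sets lebesgue" "S' \<in> sets lebesgue"
  shows "(LINT x|lebesgue_on S. indicator S' x * f x) = (LINT x|lebesgue_on S'. f x)"
    "integrable (lebesgue_on S) (\<lambda>x. indicator S' x * f x) \<longleftrightarrow> integrable (lebesgue_on S') f"
proof -
  have *: "indicator S x * (indicator S' x * f x) = indicator S' x * f x" for x
    using assms(1) by (auto split: split_indicator)
  have S: "S \<inter> space lebesgue \<in> sets lebesgue" "S' \<inter> space lebesgue \<in> sets lebesgue"
    using assms by simp_all
  show "(LINT x|lebesgue_on S. indicator S' x * f x) = (LINT x|lebesgue_on S'. f x)"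
    by (simp only: integral_restrict_space[OF S(1)] integral_restrict_space[OF S(2)] real_scaleR_def *)
  show "integrable (lebesgue_on S) (\<lambda>x. indicator S' x * f x) \<longleftrightarrow> integrable (lebesgue_on S') f"
    by (simp only: integrable_restrict_space[OF S(1)] integrable_restrict_space[OF S(2)] real_scaleR_def *)
qed

lemma integrable_lebesgue_on_subset:
  fixes f :: "'a::euclidean_space \<Rightarrow> real"
  assumes f: "integrable (lebesgue_on S) f" and S: "S' \<subseteq> S" "S \<in> sets lebesgue" "S' \<in> sets lebesgue"
  shows "integrable (lebesgue_on S') f"
proof -
  have "integrable (lebesgue_on S) (\<lambda>x. indicator S' x *\<^sub>R f x)"
    using f S by (intro integrable_mult_indicator) (auto simp: sets_restrict_space intro!: image_eqI[of _ _ S'])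
  then show ?thesis using lebesgue_on_subset_integral(2)[OF S] by simp
qed

text \<open>The bumps of a box converge boundedly to its indicator, so \<open>H\<close> integrates
  to 0 over every rational box whose closure lies in \<open>S\<close>. Inside each such box
  \<open>H\<close> vanishes almost everywhere by \<open>box_integrals_zero_imp_AE\<close>, and
  countably many of these boxes cover \<open>S\<close>.\<close>

lemma AE_zero_if_orthogonal_rat_bumps:
  fixes H :: "'a::euclidean_space \<Rightarrow> real"
  assumes S: "open S" and loc: "loc_integrable S H"
    and zero: "\<And>\<phi>. \<phi> \<in> rat_bumps S \<Longrightarrow> (LINT x|lebesgue_on S. H x * \<phi> x) = 0"
  shows "AE x in lebesgue_on S. H x = 0"
proof -
  have bz: "(LINT x|lebesgue_on (box a b). H x) = 0"
    if ab: "a \<in> rat_points" "b \<in> rat_points" "cbox a b \<subseteq> S" for a b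
  proof -
    have Sm: "S \<in> sets lebesgue" using S by (rule open_sets_lebesgue)
    have bS: "box a b \<subseteq> S" using ab(3) box_subset_cbox by blast
    have i: "integrable (lebesgue_on (cbox a b)) H" using loc ab by (auto simp: loc_integrable_def)
    then have i1: "integrable (lebesgue_on S) (\<lambda>x. indicator (cbox a b) x * H x)"
      using ab Sm by (subst lebesgue_on_subset_integral) auto
    then have "integrable (lebesgue_on S) (\<lambda>x. indicator (box a b) x *\<^sub>R (indicator (cbox a b) x * H x))"
      using bS by (intro integrable_mult_indicator) (auto simp: sets_restrict_space intro!: image_eqI[of _ _ "box a b"])
    moreover have "indicator (box a b) x *\<^sub>R (indicator (cbox a b) x * H x) = indicator (box a b) x * H x" for x
      using box_subset_cbox[of a b] by (auto split: split_indicator)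
    ultimately have i2: "integrable (lebesgue_on S) (\<lambda>x. indicator (box a b) x * H x)" by (simp only:)
    have bm: "(\<lambda>x. box_bump a b n x) \<in> borel_measurable (lebesgue_on S)" for n
    proof -
      have "continuous_on UNIV (box_bump a b n)" using Ck_box_bump[of 0] by simp
      then have "box_bump a b n \<in> borel_measurable borel" by (rule borel_measurable_continuous_onI)
      then show ?thesis by (intro measurable_restrict_space1 measurable_completion) simp
    qed
    \<comment> \<open>\<open>H\<close> is only locally integrable. Since the bump vanishes outside
      its box, the indicator of the box can be inserted for free, and it provides the integrable
      majorant for dominated convergence.\<close>
    have Hb: "box_bump a b n x * (indicator (box a b) x * H x) = H x * box_bump a b n x" for n x
      by (cases "x \<in> box a b") (auto simp: box_bump_outside)
    have "(\<lambda>n. (LINT x|lebesgue_on S. box_bump a b n x * (indicator (box a b) x * H x))) \<longlonglongrightarrow>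
        (LINT x|lebesgue_on S. indicator (box a b) x * (indicator (box a b) x * H x))"
    proof (rule integral_dominated_convergence[where w="\<lambda>x. norm (indicator (box a b) x * H x)"])
      show "integrable (lebesgue_on S) (\<lambda>x. norm (indicator (box a b) x * H x))" using i2 by simp
      show "AE x in lebesgue_on S. (\<lambda>n. box_bump a b n x * (indicator (box a b) x * H x)) \<longlonglongrightarrow>
          indicator (box a b) x * (indicator (box a b) x * H x)"
        by (intro AE_I2 tendsto_mult box_bump_limit tendsto_const)
      show "AE x in lebesgue_on S. norm (box_bump a b n x * (indicator (box a b) x * H x)) \<le> norm (indicator (box a b) x * H x)" for n
        using box_bump_bounds[of a b n] by (intro AE_I2) (simp add: abs_mult mult_left_le_one_le)
      have m2: "(\<lambda>x. indicator (box a b) x * H x) \<in> borel_measurable (lebesgue_on S)" using i2 by simp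
      show "(\<lambda>x. box_bump a b n x * (indicator (box a b) x * H x)) \<in> borel_measurable (lebesgue_on S)" for n
        using bm m2 by (rule borel_measurable_times)
      show "(\<lambda>x. indicator (box a b) x * (indicator (box a b) x * H x)) \<in> borel_measurable (lebesgue_on S)"
        by (rule borel_measurable_times[OF _ m2]) (intro measurable_restrict_space1 measurable_completion, simp)
    qed
    moreover have "(LINT x|lebesgue_on S. box_bump a b n x * (indicator (box a b) x * H x)) = 0" for n
      unfolding Hb using ab by (intro zero) (auto simp: rat_bumps_def)
    ultimately have "(LINT x|lebesgue_on S. indicator (box a b) x * (indicator (box a b) x * H x)) = 0"
      by (simp add: LIMSEQ_const_iff)
    moreover have "indicator (box a b) x * (indicator (box a b) x * H x) = indicator (box a b) x * H x" for x
      by (auto split: split_indicator)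
    ultimately show ?thesis using lebesgue_on_subset_integral(1)[OF bS Sm] by simp
  qed
  have AEbox: "AE x in lborel. x \<in> box a b \<longrightarrow> H x = 0"
    if ab: "a \<in> rat_points" "b \<in> rat_points" "cbox a b \<subseteq> S" for a b
  proof -
    have "integrable (lebesgue_on (cbox a b)) H" using loc ab by (auto simp: loc_integrable_def)
    then have "integrable (lebesgue_on (box a b)) H"
      by (rule integrable_lebesgue_on_subset) (auto simp: box_subset_cbox)
    then obtain f where f: "f \<in> borel_measurable borel" "integrable lborel f" "\<And>x. x \<notin> box a b \<Longrightarrow> f x = 0"
      "AE x in lborel. x \<in> box a b \<longrightarrow> f x = H x" "(LINT x|lebesgue_on (box a b). H x) = (LINT x|lborel. f x)"
      by (rule borel_representative) auto
    have "AE x in lborel. f x = 0"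
    proof (rule box_integrals_zero_imp_AE[OF f(2)])
      show "(LINT x|lborel. f x) = 0" using f(5) bz[OF ab] by simp
      fix c d :: 'a assume cd: "c \<in> rat_points" "d \<in> rat_points"
      let ?c = "\<Sum>i\<in>Basis. max (a \<bullet> i) (c \<bullet> i) *\<^sub>R i" and ?d = "\<Sum>i\<in>Basis. min (b \<bullet> i) (d \<bullet> i) *\<^sub>R i"
      \<comment> \<open>The box for which the integral is required meets \<open>box a b\<close> in a
        rational box that again has its closure in \<open>S\<close>, so \<open>bz\<close> covers
        it.\<close>
      have B: "box a b \<inter> box c d = box ?c ?d" by (rule box_Int_box)
      have "cbox ?c ?d \<subseteq> cbox a b" by (auto simp: mem_box)
      then have 0: "(LINT x|lebesgue_on (box ?c ?d). H x) = 0"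
        using ab cd by (intro bz rat_points_max_min) auto
      have "(LINT x|lebesgue_on (box ?c ?d). H x) = (LINT x|lebesgue. indicator (box ?c ?d) x *\<^sub>R H x)"
        by (intro integral_restrict_space) auto
      also have "\<dots> = (LINT x|lebesgue. indicator (box c d) x * f x)"
      proof (rule integral_cong_AE)
        show "AE x in lebesgue. indicator (box ?c ?d) x *\<^sub>R H x = indicator (box c d) x * f x"
          using AE_completion[OF f(4)] unfolding B[symmetric]
          by eventually_elim (use f(3) in \<open>auto split: split_indicator\<close>)
        have "integrable (lebesgue_on (box ?c ?d)) H"
        proof (rule integrable_lebesgue_on_subset)
          show "integrable (lebesgue_on (cbox ?c ?d)) H"
            using loc order_trans[OF \<open>cbox ?c ?d \<subseteq> cbox a b\<close> ab(3)] compact_cbox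
            unfolding loc_integrable_def by blast
        qed (simp_all add: box_subset_cbox)
        then show "(\<lambda>x. indicator (box ?c ?d) x *\<^sub>R H x) \<in> borel_measurable lebesgue"
          by (subst (asm) integrable_restrict_space) auto
        show "(\<lambda>x. indicator (box c d) x * f x) \<in> borel_measurable lebesgue"
          using f(1) by (intro measurable_completion) simp
      qed
      also have "\<dots> = (LINT x|lborel. indicator (box c d) x * f x)"
        using f(1) by (intro integral_completion) simp
      finally show "(LINT x|lborel. indicator (box c d) x * f x) = 0" using 0 by simp
    qed
    with f(4) show ?thesis by eventually_elim auto
  qed
  have "AE x in lborel. \<forall>(a,b)\<in>{(a,b). a \<in> rat_points \<and> b \<in> rat_points \<and> cbox a b \<subseteq> S}. x \<in> box a b \<longrightarrow> H x = 0"
  proof (subst AE_ball_countable)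
    show "countable {(a,b). a \<in> rat_points \<and> b \<in> rat_points \<and> cbox a b \<subseteq> S}"
      by (rule countable_subset[of _ "rat_points \<times> rat_points"]) (auto simp: countable_rat_points)
  qed (use AEbox in auto)
  then have "AE x in lborel. x \<in> S \<longrightarrow> H x = 0"
  proof (rule AE_mp, intro AE_I2 impI)
    fix x assume x: "\<forall>(a,b)\<in>{(a,b). a \<in> rat_points \<and> b \<in> rat_points \<and> cbox a b \<subseteq> S}. x \<in> box a b \<longrightarrow> H x = 0" "x \<in> S"
    obtain e where e: "e > 0" "cball x e \<subseteq> S" using S x(2) open_contains_cball by blast
    obtain a b where ab: "a \<in> rat_points" "b \<in> rat_points" "x \<in> box a b" "box a b \<subseteq> ball x e"
      using open_rat_box[of "ball x e" x] e(1) by auto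
    have "cbox a b = closure (box a b)" using ab(3) by (intro closure_box[symmetric]) auto
    also have "\<dots> \<subseteq> cball x e" using ab(4) by (intro closure_minimal) (auto simp: subset_iff less_imp_le)
    finally have "cbox a b \<subseteq> S" using e by auto
    with ab x show "H x = 0" by blast
  qed
  then show ?thesis using S by (simp add: lebesgue_on_AE_lborel)
qed

section \<open>Continuity of translations in L^1 and approximate identities\<close>

definition shift_cont :: "('a::euclidean_space \<Rightarrow> real) \<Rightarrow> bool" where
  "shift_cont f \<longleftrightarrow> (\<forall>z. z \<longlonglongrightarrow> 0 \<longrightarrow> (\<lambda>n. LINT x|lborel. \<bar>f (x + z n) - f x\<bar>) \<longlonglongrightarrow> 0)"

lemma lborel_integrable_shift:
  fixes f :: "'a::euclidean_space \<Rightarrow> real"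
  assumes "integrable lborel f" shows "integrable lborel (\<lambda>x. f (x + z))"
proof -
  have "integrable (distr lborel borel ((+) z)) f" using assms by (simp add: lborel_distr_plus)
  then show ?thesis by (subst (asm) integrable_distr_eq) (use assms in \<open>auto simp: add.commute\<close>)
qed

lemma lborel_integral_shift:
  fixes f :: "'a::euclidean_space \<Rightarrow> real"
  assumes "f \<in> borel_measurable borel" shows "(LINT x|lborel. f (x + z)) = (LINT x|lborel. f x)"
proof -
  have "(LINT x|lborel. f x) = (LINT x|distr lborel borel ((+) z). f x)" by (simp add: lborel_distr_plus)
  also have "\<dots> = (LINT x|lborel. f (z + x))" using assms by (subst integral_distr) auto
  finally show ?thesis by (simp add: add.commute)
qed

text \<open>A three-term estimate in which the errors of the approximation before and after the
  shift coincide by translation invariance, so the closeness is uniform in the shift.\<close>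

lemma shift_cont_approx:
  fixes f :: "'a::euclidean_space \<Rightarrow> real"
  assumes f: "integrable lborel f"
    and approx: "\<And>e. e > 0 \<Longrightarrow> \<exists>h. integrable lborel h \<and> shift_cont h \<and> (LINT x|lborel. \<bar>f x - h x\<bar>) < e"
  shows "shift_cont f"
  unfolding shift_cont_def
proof (intro allI impI)
  fix z :: "nat \<Rightarrow> 'a" assume z: "z \<longlonglongrightarrow> 0"
  show "(\<lambda>n. LINT x|lborel. \<bar>f (x + z n) - f x\<bar>) \<longlonglongrightarrow> 0"
  proof (rule LIMSEQ_I)
    fix r :: real assume r: "r > 0"
    then obtain h where h: "integrable lborel h" "shift_cont h" "(LINT x|lborel. \<bar>f x - h x\<bar>) < r / 3"
      using approx[of "r / 3"] by auto
    have "(\<lambda>n. LINT x|lborel. \<bar>h (x + z n) - h x\<bar>) \<longlonglongrightarrow> 0" using h(2) z by (simp add: shift_cont_def)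
    then have "\<forall>\<^sub>F n in sequentially. (LINT x|lborel. \<bar>h (x + z n) - h x\<bar>) < r / 3"
      using r by (intro order_tendstoD(2)) auto
    then obtain N where N: "\<And>n. n \<ge> N \<Longrightarrow> (LINT x|lborel. \<bar>h (x + z n) - h x\<bar>) < r / 3"
      unfolding eventually_sequentially by blast
    have "(LINT x|lborel. \<bar>f (x + z n) - f x\<bar>) < r" if "n \<ge> N" for n
    proof -
      note fz = lborel_integrable_shift[OF f, of "z n"] and hz = lborel_integrable_shift[OF h(1), of "z n"]
      have "(LINT x|lborel. \<bar>f (x + z n) - f x\<bar>) \<le>
        (LINT x|lborel. \<bar>f (x + z n) - h (x + z n)\<bar> + \<bar>h (x + z n) - h x\<bar> + \<bar>f x - h x\<bar>)"
        using fz hz f h(1) by (intro integral_mono) auto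
      also have "\<dots> = (LINT x|lborel. \<bar>f (x + z n) - h (x + z n)\<bar>) + (LINT x|lborel. \<bar>h (x + z n) - h x\<bar>) + (LINT x|lborel. \<bar>f x - h x\<bar>)"
        using fz hz f h(1) by simp
      also have "(LINT x|lborel. \<bar>f (x + z n) - h (x + z n)\<bar>) = (LINT x|lborel. \<bar>f x - h x\<bar>)"
        using f h(1) by (intro lborel_integral_shift[of "\<lambda>x. \<bar>f x - h x\<bar>"]) auto
      finally show ?thesis using h(3) N[OF that] by linarith
    qed
    then show "\<exists>N. \<forall>n\<ge>N. norm ((LINT x|lborel. \<bar>f (x + z n) - f x\<bar>) - 0) < r" by auto
  qed
qed

text \<open>At points of \<open>U\<close> the shifted indicator is eventually 1. At boundary points,
  which may have positive measure, nothing is known; the symmetric difference is therefore written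
  as twice the measure of \<open>U\<close> minus the overlap, which involves points of
  \<open>U\<close> only.\<close>

lemma shift_cont_open:
  fixes U :: "'a::euclidean_space set"
  assumes U: "open U" "emeasure lborel U < \<infinity>" shows "shift_cont (indicator U)"
  unfolding shift_cont_def
proof (intro allI impI)
  fix z :: "nat \<Rightarrow> 'a" assume z: "z \<longlonglongrightarrow> 0"
  have iU: "integrable lborel (indicator U :: 'a \<Rightarrow> real)" using U by simp
  have [measurable]: "U \<in> sets borel" using U by simp
  have eq: "(LINT x|lborel. \<bar>indicator U (x + z n) - indicator U x :: real\<bar>) =
     2 * (measure lborel U - (LINT x|lborel. indicator U x * indicator U (x + z n)))" for n
  proof -
    note s = lborel_integrable_shift[OF iU, of "z n"]
    have p: "integrable lborel (\<lambda>x. indicator U x * indicator U (x + z n) :: real)"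
      using U by (intro Bochner_Integration.integrable_bound[OF iU]) (auto split: split_indicator)
    have "\<bar>indicator U (x + z n) - indicator U x :: real\<bar> =
       indicator U (x + z n) + indicator U x - 2 * (indicator U x * indicator U (x + z n))" for x
      by (auto split: split_indicator)
    then have "(LINT x|lborel. \<bar>indicator U (x + z n) - indicator U x :: real\<bar>) =
       (LINT x|lborel. indicator U (x + z n)) + measure lborel U - 2 * (LINT x|lborel. indicator U x * indicator U (x + z n))"
      using s p iU by simp
    also have "(LINT x|lborel. indicator U (x + z n)) = measure lborel U"
      using lborel_integral_shift[of "indicator U :: 'a \<Rightarrow> real"] U by simp
    finally show ?thesis by simp
  qed
  have "(\<lambda>n. LINT x|lborel. indicator U x * indicator U (x + z n) :: real) \<longlonglongrightarrow> (LINT x|lborel. indicator U x)"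
  proof (rule integral_dominated_convergence[OF _ _ iU])
    show "AE x in lborel. (\<lambda>n. indicator U x * indicator U (x + z n) :: real) \<longlonglongrightarrow> indicator U x"
    proof (rule AE_I2)
      fix x
      show "(\<lambda>n. indicator U x * indicator U (x + z n) :: real) \<longlonglongrightarrow> indicator U x"
      proof (cases "x \<in> U")
        case True
        have "(\<lambda>n. x + z n) \<longlonglongrightarrow> x" using tendsto_add[OF tendsto_const z, of x] by simp
        then have "\<forall>\<^sub>F n in sequentially. x + z n \<in> U" using U(1) True by (rule topological_tendstoD)
        then have "\<forall>\<^sub>F n in sequentially. indicator U x * indicator U (x + z n) = (1::real)"
          by eventually_elim (use True in simp)
        then show ?thesis using True by (simp add: tendsto_eventually)
      qed simp
    qed
  qed (use U in \<open>auto split: split_indicator\<close>)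
  then have "(\<lambda>n. LINT x|lborel. indicator U x * indicator U (x + z n) :: real) \<longlonglongrightarrow> measure lborel U"
    using U by simp
  from tendsto_mult[OF tendsto_const[of 2] tendsto_diff[OF tendsto_const[of "measure lborel U"] this]]
  show "(\<lambda>n. LINT x|lborel. \<bar>indicator U (x + z n) - indicator U x :: real\<bar>) \<longlonglongrightarrow> 0"
    unfolding eq by simp
qed

text \<open>Outer regularity approximates the set in measure by an open set of finite
  measure.\<close>

lemma shift_cont_indicator:
  fixes A :: "'a::euclidean_space set"
  assumes A: "A \<in> sets borel" "emeasure lborel A < \<infinity>" shows "shift_cont (indicator A)"
proof (rule shift_cont_approx)
  show iA: "integrable lborel (indicator A :: 'a \<Rightarrow> real)" using A by simp
  fix e :: real assume e: "e > 0"
  obtain U where U: "open U" "A \<subseteq> U" "emeasure lborel (U - A) < ennreal e"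
    using outer_regular_lborel[OF A(1) e] by blast
  have Um: "U \<in> sets borel" using U by simp
  have "U = A \<union> (U - A)" using U by auto
  then have "emeasure lborel U \<le> emeasure lborel A + emeasure lborel (U - A)"
    using A Um by (metis emeasure_subadditive sets.Diff sets_lborel)
  also have "\<dots> < \<infinity>" using A(2) U(3) by (simp add: ennreal_add_less_top less_top[symmetric]) (metis ennreal_less_top order.strict_trans less_top)
  finally have fU: "emeasure lborel U < \<infinity>" .
  have "(LINT x|lborel. \<bar>indicator A x - indicator U x :: real\<bar>) = (LINT x|lborel. indicator (U - A) x)"
    using U(2) by (intro Bochner_Integration.integral_cong) (auto split: split_indicator)
  also have "\<dots> = measure lborel (U - A)" using A Um by simp
  also have "\<dots> < e"
    using U(3) e emeasure_eq_ennreal_measure[of lborel "U - A"]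
    by (metis ennreal_less_iff ennreal_less_top measure_nonneg order_less_le_trans order.strict_implies_not_eq order_less_trans top.not_eq_extremum)
  finally show "\<exists>h. integrable lborel h \<and> shift_cont h \<and> (LINT x|lborel. \<bar>indicator A x - h x :: real\<bar>) < e"
    using shift_cont_open[OF U(1) fU] U(1) fU by (intro exI[of _ "indicator U"]) auto
qed

lemma shift_cont_integrable:
  fixes f :: "'a::euclidean_space \<Rightarrow> real"
  assumes "integrable lborel f" shows "shift_cont f"
  using assms
proof (induction rule: integrable_induct)
  case (base A c)
  show ?case unfolding shift_cont_def
  proof (intro allI impI)
    fix z :: "nat \<Rightarrow> 'a" assume "z \<longlonglongrightarrow> 0"
    then have "(\<lambda>n. LINT x|lborel. \<bar>indicator A (x + z n) - indicator A x :: real\<bar>) \<longlonglongrightarrow> 0"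
      using shift_cont_indicator[of A] base by (simp add: shift_cont_def)
    from tendsto_mult[OF tendsto_const[of "\<bar>c\<bar>"] this]
    have "(\<lambda>n. \<bar>c\<bar> * (LINT x|lborel. \<bar>indicator A (x + z n) - indicator A x :: real\<bar>)) \<longlonglongrightarrow> 0" by simp
    moreover have "\<bar>indicator A (x + z n) *\<^sub>R c - indicator A x *\<^sub>R c\<bar> = \<bar>c\<bar> * \<bar>indicator A (x + z n) - indicator A x :: real\<bar>" for x n
      by (auto split: split_indicator)
    ultimately show "(\<lambda>n. LINT x|lborel. \<bar>indicator A (x + z n) *\<^sub>R c - indicator A x *\<^sub>R c\<bar>) \<longlonglongrightarrow> 0" by simp
  qed
next
  case (add f g)
  show ?case unfolding shift_cont_def
  proof (intro allI impI)
    fix z :: "nat \<Rightarrow> 'a" assume z: "z \<longlonglongrightarrow> 0"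
    have "(\<lambda>n. (LINT x|lborel. \<bar>f (x + z n) - f x\<bar>) + (LINT x|lborel. \<bar>g (x + z n) - g x\<bar>)) \<longlonglongrightarrow> 0 + 0"
      using add z by (intro tendsto_add) (auto simp: shift_cont_def)
    then show "(\<lambda>n. LINT x|lborel. \<bar>f (x + z n) + g (x + z n) - (f x + g x)\<bar>) \<longlonglongrightarrow> 0"
    proof (rule tendsto_sandwich[rotated 3, where f="\<lambda>_. 0", OF tendsto_eq_rhs])
      show "\<forall>\<^sub>F n in sequentially. (LINT x|lborel. \<bar>f (x + z n) + g (x + z n) - (f x + g x)\<bar>)
          \<le> (LINT x|lborel. \<bar>f (x + z n) - f x\<bar>) + (LINT x|lborel. \<bar>g (x + z n) - g x\<bar>)"
      proof (rule always_eventually, rule allI)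
        fix n
        note i = lborel_integrable_shift[OF add.hyps(1), of "z n"] lborel_integrable_shift[OF add.hyps(2), of "z n"] add.hyps(1,2)
        have "(LINT x|lborel. \<bar>f (x + z n) + g (x + z n) - (f x + g x)\<bar>) \<le>
          (LINT x|lborel. \<bar>f (x + z n) - f x\<bar> + \<bar>g (x + z n) - g x\<bar>)"
          using i by (intro integral_mono) auto
        then show "(LINT x|lborel. \<bar>f (x + z n) + g (x + z n) - (f x + g x)\<bar>)
          \<le> (LINT x|lborel. \<bar>f (x + z n) - f x\<bar>) + (LINT x|lborel. \<bar>g (x + z n) - g x\<bar>)"
          using i by simp
      qed
    qed auto
  qed
next
  case (lim f s)
  show ?case
  proof (rule shift_cont_approx[OF lim.hyps(4)])
    fix e :: real assume e: "e > 0"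
    have "(\<lambda>i. LINT x|lborel. \<bar>f x - s i x\<bar>) \<longlonglongrightarrow> (LINT x|(lborel::'a measure). 0)"
    proof (rule integral_dominated_convergence[where w="\<lambda>x. 3 * norm (f x)"])
      show "AE x in lborel. (\<lambda>i. \<bar>f x - s i x\<bar>) \<longlonglongrightarrow> 0"
      proof (rule AE_I2)
        fix x :: 'a
        have "(\<lambda>i. s i x) \<longlonglongrightarrow> f x" using lim.hyps(2) by simp
        from tendsto_rabs[OF tendsto_diff[OF tendsto_const[of "f x"] this]]
        show "(\<lambda>i. \<bar>f x - s i x\<bar>) \<longlonglongrightarrow> 0" by simp
      qed
      show "AE x in lborel. norm \<bar>f x - s i x\<bar> \<le> 3 * norm (f x)" for i
        using lim.hyps(3)[of _ i] by (intro AE_I2) (smt (verit) real_norm_def space_lborel UNIV_I)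
    qed (use lim in auto)
    then have "\<forall>\<^sub>F i in sequentially. (LINT x|lborel. \<bar>f x - s i x\<bar>) < e"
      using e by (intro order_tendstoD(2)) auto
    then obtain i where "(LINT x|lborel. \<bar>f x - s i x\<bar>) < e" by (meson eventually_sequentially order_refl)
    with lim show "\<exists>h. integrable lborel h \<and> shift_cont h \<and> (LINT x|lborel. \<bar>f x - h x\<bar>) < e" by blast
  qed
qed

text \<open>If no radius worked, shifts \<open>z n\<close> tending to 0 with error above
  \<open>e\<close> could be chosen, against the sequential statement
  \<open>shift_cont\<close>.\<close>

lemma L1_shift_uniform:
  fixes f :: "'a::euclidean_space \<Rightarrow> real"
  assumes f: "integrable lborel f" and e: "e > 0"
  obtains d where "d > 0" "\<And>z. norm z \<le> d \<Longrightarrow> (LINT x|lborel. \<bar>f (x - z) - f x\<bar>) \<le> e"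
proof (rule ccontr)
  assume "\<not> thesis"
  then have "\<forall>d>0. \<exists>z. norm z \<le> d \<and> (LINT x|lborel. \<bar>f (x - z) - f x\<bar>) > e" using that by (meson not_less)
  then have "\<forall>n. \<exists>z. norm z \<le> inverse (real (Suc n)) \<and> (LINT x|lborel. \<bar>f (x - z) - f x\<bar>) > e" by simp
  then obtain z where z: "\<And>n. norm (z n) \<le> inverse (real (Suc n))" "\<And>n. (LINT x|lborel. \<bar>f (x - z n) - f x\<bar>) > e"
    by metis
  have "(\<lambda>n. - z n) \<longlonglongrightarrow> 0"
    by (rule Lim_null_comparison[OF _ LIMSEQ_inverse_real_of_nat]) (use z(1) in auto)
  then have "(\<lambda>n. LINT x|lborel. \<bar>f (x + - z n) - f x\<bar>) \<longlonglongrightarrow> 0"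
    using shift_cont_integrable[OF f] unfolding shift_cont_def by blast
  then have "\<forall>\<^sub>F n in sequentially. (LINT x|lborel. \<bar>f (x + - z n) - f x\<bar>) < e"
    using e by (intro order_tendstoD(2)) auto
  then obtain n where "(LINT x|lborel. \<bar>f (x + - z n) - f x\<bar>) < e" by (meson eventually_sequentially order_refl)
  with z(2)[of n] show False by simp
qed

text \<open>The inner integral of the absolute value is a constant multiple of the absolute value of
  \<open>\<rho> z\<close>, again by translation invariance.\<close>

lemma convolution_integrable:
  fixes f \<rho> :: "'a::euclidean_space \<Rightarrow> real"
  assumes f: "integrable lborel f" and \<rho>: "integrable lborel \<rho>"
  shows "integrable (lborel \<Otimes>\<^sub>M lborel) (\<lambda>(z, y). \<rho> z * f (y - z))"
proof (rule lborel_pair.Fubini_integrable)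
  have fm: "f \<in> borel_measurable borel" "\<rho> \<in> borel_measurable borel" using f \<rho> by auto
  show "(\<lambda>(z, y). \<rho> z * f (y - z)) \<in> borel_measurable (lborel \<Otimes>\<^sub>M lborel)" using fm by measurable
  have fz: "integrable lborel (\<lambda>y. f (y - z))" for z
    using lborel_integrable_shift[OF f, of "-z"] by simp
  show "AE z in lborel. integrable lborel (\<lambda>y. case (z, y) of (z, y) \<Rightarrow> \<rho> z * f (y - z))"
    using fz by (intro AE_I2) simp
  have "(LINT y|lborel. norm (case (z, y) of (z, y) \<Rightarrow> \<rho> z * f (y - z))) = \<bar>\<rho> z\<bar> * (LINT y|lborel. \<bar>f y\<bar>)" for z
    using lborel_integral_shift[of "\<lambda>y. \<bar>f y\<bar>" "-z"] fm by (simp add: abs_mult)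
  then show "integrable lborel (\<lambda>z. LINT y|lborel. norm (case (z, y) of (z, y) \<Rightarrow> \<rho> z * f (y - z)))"
    using \<rho> by simp
qed

text \<open>Because \<rho> has mass 1, the error is an average over \<open>z\<close> of
  \<open>f (y - z) - f y\<close>. Exchanging the integrals leaves the average of the translation
  errors over the support of \<rho>. The kernel need not be continuous, so that the lemma serves the
  smooth mollifiers in space as well as the averages over time intervals.\<close>

lemma approx_identity:
  fixes f \<rho> :: "'a::euclidean_space \<Rightarrow> real"
  assumes f: "integrable lborel f" and \<rho>: "integrable lborel \<rho>" "\<And>z. 0 \<le> \<rho> z" "(LINT z|lborel. \<rho> z) = 1"
    and supp: "\<And>z. \<rho> z \<noteq> 0 \<Longrightarrow> norm z \<le> r"
    and e: "\<And>z. norm z \<le> r \<Longrightarrow> (LINT x|lborel. \<bar>f (x - z) - f x\<bar>) \<le> e"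
  shows "integrable lborel (\<lambda>y. LINT z|lborel. \<rho> z * f (y - z))"
    "(LINT y|lborel. \<bar>(LINT z|lborel. \<rho> z * f (y - z)) - f y\<bar>) \<le> e"
proof -
  have fm: "f \<in> borel_measurable borel" "\<rho> \<in> borel_measurable borel" using f \<rho> by auto
  note ci = convolution_integrable[OF f \<rho>(1)]
  show ic: "integrable lborel (\<lambda>y. LINT z|lborel. \<rho> z * f (y - z))"
    using lborel_pair.integrable_snd[OF ci] by simp
  have pi: "integrable (lborel \<Otimes>\<^sub>M lborel) (\<lambda>(z, y). \<rho> z * f y)"
  proof (rule lborel_pair.Fubini_integrable)
    show "integrable lborel (\<lambda>z. LINT y|lborel. norm (case (z, y) of (z, y) \<Rightarrow> \<rho> z * f y))"
      using \<rho> by (simp add: abs_mult)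
  qed (use f fm in auto)
  have gi: "integrable (lborel \<Otimes>\<^sub>M lborel) (\<lambda>(z, y). \<rho> z * \<bar>f (y - z) - f y\<bar>)"
  proof -
    have "integrable (lborel \<Otimes>\<^sub>M lborel) (\<lambda>x. \<bar>(\<lambda>(z, y). \<rho> z * f (y - z)) x - (\<lambda>(z, y). \<rho> z * f y) x\<bar>)"
      using ci pi by (intro integrable_abs Bochner_Integration.integrable_diff)
    moreover have "\<bar>(\<lambda>(z, y). \<rho> z * f (y - z)) x - (\<lambda>(z, y). \<rho> z * f y) x\<bar> = (\<lambda>(z, y). \<rho> z * \<bar>f (y - z) - f y\<bar>) x" for x
      using \<rho>(2) by (auto simp: right_diff_distrib[symmetric] abs_mult split: prod.split)
    ultimately show ?thesis by simp
  qed
  have "AE y in lborel. integrable lborel (\<lambda>z. \<rho> z * f (y - z))"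
    using lborel_pair.AE_integrable_snd[OF ci] by simp
  moreover have "AE y in lborel. integrable lborel (\<lambda>z. \<rho> z * \<bar>f (y - z) - f y\<bar>)"
    using lborel_pair.AE_integrable_snd[OF gi] by simp
  ultimately have ae: "AE y in lborel. \<bar>(LINT z|lborel. \<rho> z * f (y - z)) - f y\<bar> \<le> (LINT z|lborel. \<rho> z * \<bar>f (y - z) - f y\<bar>)"
  proof eventually_elim
    fix y assume i: "integrable lborel (\<lambda>z. \<rho> z * f (y - z))" "integrable lborel (\<lambda>z. \<rho> z * \<bar>f (y - z) - f y\<bar>)"
    have "f y = (LINT z|lborel. \<rho> z * f y)" using \<rho> by simp
    then have "(LINT z|lborel. \<rho> z * f (y - z)) - f y = (LINT z|lborel. \<rho> z * f (y - z) - \<rho> z * f y)"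
      using i \<rho> by simp
    then have "\<bar>(LINT z|lborel. \<rho> z * f (y - z)) - f y\<bar> \<le> (LINT z|lborel. \<bar>\<rho> z * f (y - z) - \<rho> z * f y\<bar>)"
      using integral_norm_bound[of lborel "\<lambda>z. \<rho> z * f (y - z) - \<rho> z * f y"] by simp
    also have "\<dots> = (LINT z|lborel. \<rho> z * \<bar>f (y - z) - f y\<bar>)"
      using \<rho>(2) by (simp add: right_diff_distrib[symmetric] abs_mult)
    finally show "\<bar>(LINT z|lborel. \<rho> z * f (y - z)) - f y\<bar> \<le> (LINT z|lborel. \<rho> z * \<bar>f (y - z) - f y\<bar>)" .
  qed
  have "(LINT y|lborel. \<bar>(LINT z|lborel. \<rho> z * f (y - z)) - f y\<bar>) \<le> (LINT y|lborel. LINT z|lborel. \<rho> z * \<bar>f (y - z) - f y\<bar>)"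
    using ae ic f lborel_pair.integrable_snd[OF gi] by (intro integral_mono_AE) auto
  also have "\<dots> = (LINT z|lborel. LINT y|lborel. \<rho> z * \<bar>f (y - z) - f y\<bar>)"
    using lborel_pair.Fubini_integral[OF gi] by simp
  also have "\<dots> \<le> (LINT z|lborel. \<rho> z * e)"
  proof (rule integral_mono)
    show "integrable lborel (\<lambda>z. LINT y|lborel. \<rho> z * \<bar>f (y - z) - f y\<bar>)"
      using lborel_pair.integrable_fst[OF gi] by simp
    show "(LINT y|lborel. \<rho> z * \<bar>f (y - z) - f y\<bar>) \<le> \<rho> z * e" for z
      using e[of z] supp[of z] \<rho>(2)[of z] by (cases "\<rho> z = 0") (auto intro!: mult_left_mono)
  qed (use \<rho> in simp)
  also have "\<dots> = e" using \<rho> by simp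
  finally show "(LINT y|lborel. \<bar>(LINT z|lborel. \<rho> z * f (y - z)) - f y\<bar>) \<le> e" .
qed

section \<open>Weak gradients\<close>

lemma compact_support_bounded:
  fixes h :: "'a::euclidean_space \<Rightarrow> real"
  assumes "continuous_on UNIV h" "compact K" "\<And>x. x \<notin> K \<Longrightarrow> h x = 0"
  obtains M where "M > 0" "\<And>x. \<bar>h x\<bar> \<le> M"
proof -
  have "compact (h ` K)" using assms by (intro compact_continuous_image continuous_on_subset[OF assms(1)]) auto
  then obtain B where B: "B > 0" "\<And>y. y \<in> h ` K \<Longrightarrow> norm y \<le> B" using bounded_pos compact_imp_bounded by metis
  have "\<bar>h x\<bar> \<le> B" for x using B assms(3)[of x] by (cases "x \<in> K") auto
  with B(1) show ?thesis using that by blast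
qed

lemma compact_support_integrable:
  fixes h :: "'a::euclidean_space \<Rightarrow> real"
  assumes h: "continuous_on UNIV h" "compact K" "\<And>x. x \<notin> K \<Longrightarrow> h x = 0"
  shows "integrable lborel h"
proof -
  obtain M where M: "M > 0" "\<And>x. \<bar>h x\<bar> \<le> M" using compact_support_bounded[OF h] by blast
  have "integrable lborel (\<lambda>x. M * indicator K x)"
    using h(2) emeasure_compact_finite[OF h(2)] compact_imp_closed[OF h(2)] by (intro integrable_mult_right) auto
  then show ?thesis
    by (rule Bochner_Integration.integrable_bound)
       (use M h borel_measurable_continuous_onI[OF h(1)] in \<open>auto simp: order_less_imp_le split: split_indicator\<close>)
qed

lemma continuous_measurable_lebesgue_on:
  fixes h :: "'a::euclidean_space \<Rightarrow> 'b::real_normed_vector"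
  assumes "continuous_on UNIV h" shows "h \<in> borel_measurable (lebesgue_on S)"
  using borel_measurable_continuous_onI[OF assms] by (intro measurable_restrict_space1 measurable_completion) simp

lemma loc_integrable_mult:
  fixes h :: "'a::euclidean_space \<Rightarrow> real"
  assumes S: "open S" and u: "loc_integrable S u"
    and h: "continuous_on UNIV h" "compact K" "\<And>x. x \<notin> K \<Longrightarrow> h x = 0" "K \<subseteq> S"
  shows "integrable (lebesgue_on S) (\<lambda>x. u x * h x)"
proof -
  obtain M where M: "M > 0" "\<And>x. \<bar>h x\<bar> \<le> M" using compact_support_bounded[OF h(1-3)] by blast
  have Sm: "S \<in> sets lebesgue" "K \<in> sets lebesgue"
    using S h(2) by (auto intro!: open_sets_lebesgue lmeasurable_compact fmeasurableD)
  have "integrable (lebesgue_on K) u" using u h by (simp add: loc_integrable_def)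
  then have i: "integrable (lebesgue_on S) (\<lambda>x. indicator K x * u x)"
    using lebesgue_on_subset_integral(2)[OF h(4) Sm] by simp
  then have m: "(\<lambda>x. indicator K x * u x) \<in> borel_measurable (lebesgue_on S)" by simp
  have e: "h x * (indicator K x * u x) = u x * h x" for x using h(3)[of x] by (cases "x \<in> K") auto
  have "integrable (lebesgue_on S) (\<lambda>x. h x * (indicator K x * u x))"
  proof (rule Bochner_Integration.integrable_bound)
    show "integrable (lebesgue_on S) (\<lambda>x. M * (indicator K x * u x))" using i by simp
    show "(\<lambda>x. h x * (indicator K x * u x)) \<in> borel_measurable (lebesgue_on S)"
      using borel_measurable_times[OF continuous_measurable_lebesgue_on[OF h(1)] m] .
    show "AE x in lebesgue_on S. norm (h x * (indicator K x * u x)) \<le> norm (M * (indicator K x * u x))"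
      using M by (intro AE_I2) (auto simp: abs_mult intro!: mult_right_mono)
  qed
  then show ?thesis by (simp only: e)
qed

text \<open>Difference quotients in direction \<open>j\<close> have integral 0 by translation
  invariance, and the mean value theorem gives the majorant for their limit. This avoids iterated
  integration along coordinate lines.\<close>

lemma integral_cgrad_zero:
  fixes \<xi> :: "'a::euclidean_space \<Rightarrow> real"
  assumes \<xi>: "Ck (Suc 0) \<xi>" "compact K" "\<And>x. x \<notin> K \<Longrightarrow> \<xi> x = 0" and j: "j \<in> Basis"
  shows "(LINT x|lborel. cgrad \<xi> x \<bullet> j) = 0"
proof -
  have cont: "continuous_on UNIV \<xi>" using Ck_SucD[OF \<xi>(1)] by simp
  have ig: "integrable lborel \<xi>" using compact_support_integrable[OF cont \<xi>(2,3)] by simp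
  note bm = borel_measurable_continuous_onI[OF cont]
  have contg: "continuous_on UNIV (\<lambda>x. cgrad \<xi> x \<bullet> j)" using Ck_cgrad[OF \<xi>(1) j] by simp
  obtain M where M: "M > 0" "\<And>x. \<bar>cgrad \<xi> x \<bullet> j\<bar> \<le> M"
  proof (rule compact_support_bounded[OF contg \<xi>(2)])
    show "cgrad \<xi> x \<bullet> j = 0" if "x \<notin> K" for x using cgrad_zero[OF \<xi>(2,3) that] by simp
  qed blast
  obtain R where R: "R > 0" "\<And>x. x \<in> K \<Longrightarrow> norm x \<le> R" using \<xi>(2) bounded_pos compact_imp_bounded by metis
  define h where "h n = inverse (real (Suc n))" for n
  have h: "h n > 0" "h n \<le> 1" for n by (auto simp: h_def field_simps)
  have der: "((\<lambda>s. \<xi> (x + s *\<^sub>R j)) has_real_derivative cgrad \<xi> (x + s *\<^sub>R j) \<bullet> j) (at s)" for x s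
  proof -
    have "(\<xi> has_derivative (\<lambda>v. v \<bullet> cgrad \<xi> (x + s *\<^sub>R j))) (at (x + s *\<^sub>R j))"
      using Ck_GDERIV[OF \<xi>(1)] by (simp add: gderiv_def)
    moreover have "((\<lambda>s. x + s *\<^sub>R j) has_derivative (\<lambda>t. t *\<^sub>R j)) (at s)" by (auto intro!: derivative_eq_intros)
    ultimately have "((\<lambda>s. \<xi> (x + s *\<^sub>R j)) has_derivative (\<lambda>t. (t *\<^sub>R j) \<bullet> cgrad \<xi> (x + s *\<^sub>R j))) (at s)"
      using has_derivative_compose by fastforce
    then show ?thesis by (simp add: has_field_derivative_def inner_commute mult_commute_abs)
  qed
  define D where "D n x = (\<xi> (x + h n *\<^sub>R j) - \<xi> x) / h n" for n x
  have Dm: "D n \<in> borel_measurable borel" for n unfolding D_def using bm by measurable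
  have D0: "(LINT x|lborel. D n x) = 0" for n
    using ig lborel_integrable_shift[OF ig] lborel_integral_shift[OF bm] by (simp add: D_def)
  \<comment> \<open>The ball of radius \<open>R + 1\<close> is enough for all \<open>n\<close>: the
    step \<open>h n\<close> is at most 1, so from a point outside this ball it cannot reach
    \<open>K\<close>.\<close>
  have "(\<lambda>n. LINT x|lborel. D n x) \<longlonglongrightarrow> (LINT x|lborel. cgrad \<xi> x \<bullet> j)"
  proof (rule integral_dominated_convergence[where w="\<lambda>x. M * indicator (cball 0 (R + 1)) x"])
    show "integrable lborel (\<lambda>x::'a. M * indicator (cball 0 (R + 1)) x)"
      using emeasure_compact_finite[of "cball 0 (R + 1) :: 'a set"] by (intro integrable_mult_right) auto
    show "AE x in lborel. (\<lambda>n. D n x) \<longlonglongrightarrow> cgrad \<xi> x \<bullet> j"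
    proof (rule AE_I2)
      fix x
      have "(\<lambda>s. (\<xi> (x + s *\<^sub>R j) - \<xi> x) / s) \<midarrow>0\<rightarrow> cgrad \<xi> x \<bullet> j"
        using der[of x 0] by (simp add: has_field_derivative_iff)
      moreover have "filterlim h (at 0) sequentially"
        unfolding filterlim_at
      proof
        show "h \<longlonglongrightarrow> 0" unfolding h_def by (rule LIMSEQ_inverse_real_of_nat)
        show "\<forall>\<^sub>F n in sequentially. h n \<in> UNIV \<and> h n \<noteq> 0" using h(1) by (simp add: less_imp_neq[symmetric])
      qed
      ultimately show "(\<lambda>n. D n x) \<longlonglongrightarrow> cgrad \<xi> x \<bullet> j"
        unfolding D_def by (rule filterlim_compose)
    qed
    show "AE x in lborel. norm (D n x) \<le> M * indicator (cball 0 (R + 1)) x" for n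
    proof (rule AE_I2)
      fix x
      show "norm (D n x) \<le> M * indicator (cball 0 (R + 1)) x"
      proof (cases "x \<in> cball 0 (R + 1)")
        case True
        have "\<exists>z>0. z < h n \<and> \<xi> (x + h n *\<^sub>R j) - \<xi> (x + 0 *\<^sub>R j) = (h n - 0) * (cgrad \<xi> (x + z *\<^sub>R j) \<bullet> j)"
          using h[of n] der by (intro MVT2) auto
        then obtain z where "\<xi> (x + h n *\<^sub>R j) - \<xi> x = h n * (cgrad \<xi> (x + z *\<^sub>R j) \<bullet> j)" by auto
        then have "D n x = cgrad \<xi> (x + z *\<^sub>R j) \<bullet> j" using h[of n] by (simp add: D_def)
        then show ?thesis using M(2) True by simp
      next
        case False
        then have "norm x > R + 1" by simp
        then have "norm (x + h n *\<^sub>R j) > R" using h[of n] j norm_triangle_ineq4[of "x + h n *\<^sub>R j" "h n *\<^sub>R j"] by simp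
        then have "x \<notin> K" "x + h n *\<^sub>R j \<notin> K" using R \<open>norm x > R + 1\<close> by fastforce+
        then show ?thesis using \<xi>(3) False by (simp add: D_def)
      qed
    qed
  qed (use Dm borel_measurable_continuous_onI[OF contg] in auto)
  then show ?thesis by (simp add: D0 LIMSEQ_const_iff)
qed

lemma lebesgue_on_integral_lborel:
  fixes f :: "'a::euclidean_space \<Rightarrow> real"
  assumes "S \<in> sets borel" "f \<in> borel_measurable borel" "\<And>x. x \<notin> S \<Longrightarrow> f x = 0"
  shows "(LINT x|lebesgue_on S. f x) = (LINT x|lborel. f x)"
proof -
  have "(LINT x|lebesgue_on S. f x) = (LINT x|lebesgue. indicator S x *\<^sub>R f x)"
    using assms by (intro integral_restrict_space) (auto simp: sets_completionI_sets)
  also have "(\<lambda>x. indicator S x *\<^sub>R f x) = f" using assms(3) by (auto split: split_indicator)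
  finally show ?thesis using assms(2) by (simp add: integral_completion)
qed

lemma test_fun_facts:
  assumes "\<phi> \<in> test_fun S"
  obtains K where "compact K" "K \<subseteq> S" "\<And>x. x \<notin> K \<Longrightarrow> \<phi> x = 0" "\<And>x. x \<notin> K \<Longrightarrow> cgrad \<phi> x = 0"
    "continuous_on UNIV \<phi>" "continuous_on UNIV (cgrad \<phi>)" "\<And>j. j \<in> Basis \<Longrightarrow> continuous_on UNIV (\<lambda>x. cgrad \<phi> x \<bullet> j)"
proof -
  obtain K where K: "compact K" "K \<subseteq> S" "\<And>x. x \<notin> K \<Longrightarrow> \<phi> x = 0" using assms by (rule test_funE) blast
  have "continuous_on UNIV (cgrad \<phi>)" using test_fun_Ck[OF assms] by (rule cgrad_continuous)
  with K show ?thesis using test_fun_Ck[OF assms, of 0] cgrad_zero[OF K(1,3)] test_fun_Ck[OF assms, of "Suc 0"]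
    by (intro that[of K]) (auto intro!: continuous_intros)
qed

lemma is_weak_grad_cgrad:
  "is_weak_grad S u z \<longleftrightarrow> loc_integrable S u \<and>
     (\<forall>j\<in>Basis. loc_integrable S (\<lambda>x. z x \<bullet> j) \<and>
        (\<forall>\<phi>\<in>test_fun S. - (LINT x|lebesgue_on S. u x * (cgrad \<phi> x \<bullet> j)) = (LINT x|lebesgue_on S. (z x \<bullet> j) * \<phi> x)))"
  unfolding is_weak_grad_def by (auto simp: cgrad_inner)

lemma continuous_loc_integrable: "continuous_on UNIV u \<Longrightarrow> loc_integrable S (u :: 'a::euclidean_space \<Rightarrow> real)"
  unfolding loc_integrable_def
proof (intro allI impI, elim conjE)
  fix K :: "'a set" assume u: "continuous_on UNIV u" and K: "compact K"
  obtain a b where ab: "K \<subseteq> cbox a b" using bounded_subset_cbox_symmetric[OF compact_imp_bounded[OF K]] by blast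
  have "integrable (lebesgue_on (cbox a b)) u"
    by (rule continuous_imp_integrable[OF continuous_on_subset[OF u subset_UNIV]])
  then show "integrable (lebesgue_on K) u"
    by (rule integrable_lebesgue_on_subset[OF _ ab]) (use K in \<open>auto intro!: lmeasurable_compact fmeasurableD\<close>)
qed

text \<open>Integration by parts is the statement that the gradient of the compactly supported
  product \<psi> \<phi> integrates to 0.\<close>

lemma is_weak_grad_smooth:
  assumes S: "open S" and \<psi>: "Ck (Suc 0) \<psi>"
  shows "is_weak_grad S \<psi> (cgrad \<psi>)"
  unfolding is_weak_grad_cgrad
proof (intro conjI ballI)
  have c: "continuous_on UNIV \<psi>" "\<And>j. j \<in> Basis \<Longrightarrow> continuous_on UNIV (\<lambda>x. cgrad \<psi> x \<bullet> j)"
    using Ck_SucD[OF \<psi>] Ck_cgrad[OF \<psi>] by auto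
  then show "loc_integrable S \<psi>" "\<And>j. j \<in> Basis \<Longrightarrow> loc_integrable S (\<lambda>x. cgrad \<psi> x \<bullet> j)"
    by (auto intro: continuous_loc_integrable)
  fix j :: 'a and \<phi> assume j: "j \<in> Basis" and \<phi>: "\<phi> \<in> test_fun S"
  obtain K where K: "compact K" "K \<subseteq> S" "\<And>x. x \<notin> K \<Longrightarrow> \<phi> x = 0" "\<And>x. x \<notin> K \<Longrightarrow> cgrad \<phi> x = 0"
    "continuous_on UNIV \<phi>" "continuous_on UNIV (\<lambda>x. cgrad \<phi> x \<bullet> j)"
    using test_fun_facts[OF \<phi>] j by metis
  have Sb: "S \<in> sets borel" using S by simp
  have f: "continuous_on UNIV (\<lambda>x. \<psi> x * (cgrad \<phi> x \<bullet> j))" "continuous_on UNIV (\<lambda>x. (cgrad \<psi> x \<bullet> j) * \<phi> x)"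
    using c j K by (auto intro!: continuous_on_mult)
  note fm = f[THEN borel_measurable_continuous_onI]
  have "(LINT x|lebesgue_on S. \<psi> x * (cgrad \<phi> x \<bullet> j)) + (LINT x|lebesgue_on S. (cgrad \<psi> x \<bullet> j) * \<phi> x) =
     (LINT x|lborel. \<psi> x * (cgrad \<phi> x \<bullet> j)) + (LINT x|lborel. (cgrad \<psi> x \<bullet> j) * \<phi> x)"
  proof (subst (1 2) lebesgue_on_integral_lborel[OF Sb])
    fix x assume "x \<notin> S"
    then have "x \<notin> K" using K(2) by blast
    then show "\<psi> x * (cgrad \<phi> x \<bullet> j) = 0" "(cgrad \<psi> x \<bullet> j) * \<phi> x = 0" using K(3,4)[of x] by auto
  qed (use fm in auto)
  also have "\<dots> = (LINT x|lborel. \<psi> x * (cgrad \<phi> x \<bullet> j) + (cgrad \<psi> x \<bullet> j) * \<phi> x)"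
    using compact_support_integrable[OF f(1) K(1)] compact_support_integrable[OF f(2) K(1)] K by simp
  also have "\<dots> = (LINT x|lborel. cgrad (\<lambda>x. \<psi> x * \<phi> x) x \<bullet> j)"
    using cgrad_mult[OF \<psi> test_fun_Ck[OF \<phi>]] by (simp add: inner_add_left mult.commute)
  also have "\<dots> = 0" by (rule integral_cgrad_zero[OF Ck_mult[OF \<psi> test_fun_Ck[OF \<phi>]] K(1) _ j]) (use K in auto)
  finally show "- (LINT x|lebesgue_on S. \<psi> x * (cgrad \<phi> x \<bullet> j)) = (LINT x|lebesgue_on S. (cgrad \<psi> x \<bullet> j) * \<phi> x)" by simp
qed

lemma loc_integrable_lincomb:
  "loc_integrable S u \<Longrightarrow> loc_integrable S v \<Longrightarrow> loc_integrable S (\<lambda>x. c * u x + d * v x)"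
  unfolding loc_integrable_def by auto

lemma is_weak_grad_lincomb:
  assumes S: "open S" and u: "is_weak_grad S u z" and v: "is_weak_grad S v y"
  shows "is_weak_grad S (\<lambda>x. c * u x + d * v x) (\<lambda>x. c *\<^sub>R z x + d *\<^sub>R y x)"
  unfolding is_weak_grad_cgrad
proof (intro conjI ballI)
  show "loc_integrable S (\<lambda>x. c * u x + d * v x)"
    using u v by (auto simp: is_weak_grad_def intro: loc_integrable_lincomb)
  fix j :: 'a assume j: "j \<in> Basis"
  then show "loc_integrable S (\<lambda>x. (c *\<^sub>R z x + d *\<^sub>R y x) \<bullet> j)"
    using u v by (auto simp: is_weak_grad_def inner_add_left intro: loc_integrable_lincomb)
  fix \<phi> assume \<phi>: "\<phi> \<in> test_fun S"
  obtain K where K: "compact K" "K \<subseteq> S" "\<And>x. x \<notin> K \<Longrightarrow> \<phi> x = 0" "\<And>x. x \<notin> K \<Longrightarrow> cgrad \<phi> x = 0"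
    "continuous_on UNIV \<phi>" "continuous_on UNIV (\<lambda>x. cgrad \<phi> x \<bullet> j)"
    using test_fun_facts[OF \<phi>] j by metis
  have l: "loc_integrable S u" "loc_integrable S v" "loc_integrable S (\<lambda>x. z x \<bullet> j)" "loc_integrable S (\<lambda>x. y x \<bullet> j)"
    using u v j by (auto simp: is_weak_grad_def)
  have i: "integrable (lebesgue_on S) (\<lambda>x. u x * (cgrad \<phi> x \<bullet> j))" "integrable (lebesgue_on S) (\<lambda>x. v x * (cgrad \<phi> x \<bullet> j))"
    "integrable (lebesgue_on S) (\<lambda>x. (z x \<bullet> j) * \<phi> x)" "integrable (lebesgue_on S) (\<lambda>x. (y x \<bullet> j) * \<phi> x)"
    using l K by (auto intro!: loc_integrable_mult[OF S])
  have "(LINT x|lebesgue_on S. (c * u x + d * v x) * (cgrad \<phi> x \<bullet> j)) =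
    (LINT x|lebesgue_on S. c * (u x * (cgrad \<phi> x \<bullet> j)) + d * (v x * (cgrad \<phi> x \<bullet> j)))"
    by (simp add: distrib_right mult.assoc)
  also have "\<dots> = c * (LINT x|lebesgue_on S. u x * (cgrad \<phi> x \<bullet> j)) + d * (LINT x|lebesgue_on S. v x * (cgrad \<phi> x \<bullet> j))"
    using i by simp
  finally have "- (LINT x|lebesgue_on S. (c * u x + d * v x) * (cgrad \<phi> x \<bullet> j)) =
      c * (- (LINT x|lebesgue_on S. u x * (cgrad \<phi> x \<bullet> j))) + d * (- (LINT x|lebesgue_on S. v x * (cgrad \<phi> x \<bullet> j)))"
    by simp
  also have "\<dots> = c * (LINT x|lebesgue_on S. (z x \<bullet> j) * \<phi> x) + d * (LINT x|lebesgue_on S. (y x \<bullet> j) * \<phi> x)"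
    using u v j \<phi> by (simp only: is_weak_grad_cgrad)
  also have "\<dots> = (LINT x|lebesgue_on S. c * ((z x \<bullet> j) * \<phi> x) + d * ((y x \<bullet> j) * \<phi> x))"
    using i by simp
  also have "\<dots> = (LINT x|lebesgue_on S. ((c *\<^sub>R z x + d *\<^sub>R y x) \<bullet> j) * \<phi> x)"
    by (simp add: distrib_right inner_add_left mult.assoc)
  finally show "- (LINT x|lebesgue_on S. (c * u x + d * v x) * (cgrad \<phi> x \<bullet> j)) =
     (LINT x|lebesgue_on S. ((c *\<^sub>R z x + d *\<^sub>R y x) \<bullet> j) * \<phi> x)" .
qed

lemma AE_euclidean_eqI:
  fixes z y :: "'b \<Rightarrow> 'a::euclidean_space"
  assumes "\<And>j. j \<in> Basis \<Longrightarrow> AE x in M. z x \<bullet> j = y x \<bullet> j"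
  shows "AE x in M. z x = y x"
proof -
  have "AE x in M. \<forall>j\<in>Basis. z x \<bullet> j = y x \<bullet> j" using assms by (subst AE_ball_countable) (auto intro: countable_finite)
  then show ?thesis by eventually_elim (auto intro: euclidean_eqI)
qed

lemma is_weak_grad_unique:
  assumes S: "open S" and u: "is_weak_grad S u z" "is_weak_grad S u y"
  shows "AE x in lebesgue_on S. z x = y x"
proof (rule AE_euclidean_eqI)
  fix j :: 'a assume j: "j \<in> Basis"
  have l: "loc_integrable S (\<lambda>x. z x \<bullet> j)" "loc_integrable S (\<lambda>x. y x \<bullet> j)"
    using u j by (auto simp: is_weak_grad_def)
  have "AE x in lebesgue_on S. 1 * (z x \<bullet> j) + (-1) * (y x \<bullet> j) = 0"
  proof (rule AE_zero_if_orthogonal_rat_bumps[OF S loc_integrable_lincomb[OF l]])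
    fix \<phi> assume "\<phi> \<in> rat_bumps S"
    then have \<phi>: "\<phi> \<in> test_fun S" using rat_bumps_test_fun by blast
    obtain K where K: "compact K" "K \<subseteq> S" "\<And>x. x \<notin> K \<Longrightarrow> \<phi> x = 0" "continuous_on UNIV \<phi>"
      using test_fun_facts[OF \<phi>] by metis
    have i: "integrable (lebesgue_on S) (\<lambda>x. (z x \<bullet> j) * \<phi> x)" "integrable (lebesgue_on S) (\<lambda>x. (y x \<bullet> j) * \<phi> x)"
      using l K by (auto intro!: loc_integrable_mult[OF S])
    have "(LINT x|lebesgue_on S. (z x \<bullet> j) * \<phi> x) = (LINT x|lebesgue_on S. (y x \<bullet> j) * \<phi> x)"
      using u j \<phi> by (auto simp: is_weak_grad_cgrad)
    then show "(LINT x|lebesgue_on S. (1 * (z x \<bullet> j) + (-1) * (y x \<bullet> j)) * \<phi> x) = 0"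
      using i by (simp add: left_diff_distrib)
  qed
  then show "AE x in lebesgue_on S. z x \<bullet> j = y x \<bullet> j" by simp
qed

lemma weak_grad:
  assumes "is_weak_grad S u z" shows "is_weak_grad S u (weak_grad S u)"
  unfolding weak_grad_def by (rule someI[of "is_weak_grad S u", OF assms])

lemma weak_grad_AE:
  assumes "open S" "is_weak_grad S u z" shows "AE x in lebesgue_on S. weak_grad S u x = z x"
  using is_weak_grad_unique[OF assms(1) weak_grad[OF assms(2)] assms(2)] .

lemma is_weak_grad_mono:
  assumes u: "is_weak_grad S u z" and S: "open S" "open S'" "S' \<subseteq> S"
  shows "is_weak_grad S' u z"
  unfolding is_weak_grad_cgrad
proof (intro conjI ballI)
  show "loc_integrable S' u" using u S by (auto simp: is_weak_grad_def loc_integrable_def)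
  fix j :: 'a assume j: "j \<in> Basis"
  show "loc_integrable S' (\<lambda>x. z x \<bullet> j)" using u S j by (auto simp: is_weak_grad_def loc_integrable_def)
  fix \<phi> assume \<phi>: "\<phi> \<in> test_fun S'"
  obtain K where K: "compact K" "K \<subseteq> S'" "\<And>x. x \<notin> K \<Longrightarrow> \<phi> x = 0" "\<And>x. x \<notin> K \<Longrightarrow> cgrad \<phi> x = 0"
    using test_fun_facts[OF \<phi>] by metis
  have I: "indicator S' x * (u x * (cgrad \<phi> x \<bullet> j)) = u x * (cgrad \<phi> x \<bullet> j)" "indicator S' x * ((z x \<bullet> j) * \<phi> x) = (z x \<bullet> j) * \<phi> x" for x
    using K(2) K(3,4)[of x] by (cases "x \<in> K"; auto split: split_indicator)+
  note L = lebesgue_on_subset_integral(1)[OF S(3) open_sets_lebesgue[OF S(1)] open_sets_lebesgue[OF S(2)]]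
  have "(LINT x|lebesgue_on S'. u x * (cgrad \<phi> x \<bullet> j)) = (LINT x|lebesgue_on S. u x * (cgrad \<phi> x \<bullet> j))"
    "(LINT x|lebesgue_on S'. (z x \<bullet> j) * \<phi> x) = (LINT x|lebesgue_on S. (z x \<bullet> j) * \<phi> x)"
    using L[of "\<lambda>x. u x * (cgrad \<phi> x \<bullet> j)"] L[of "\<lambda>x. (z x \<bullet> j) * \<phi> x"] by (simp_all only: I)
  moreover have "\<phi> \<in> test_fun S" using \<phi> S(3) test_fun_mono by blast
  ultimately show "- (LINT x|lebesgue_on S'. u x * (cgrad \<phi> x \<bullet> j)) = (LINT x|lebesgue_on S'. (z x \<bullet> j) * \<phi> x)"
    using u j by (auto simp: is_weak_grad_cgrad)
qed

text \<open>A dilated box bump, divided by its integral.\<close>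

lemma mollifier_exists:
  assumes r: "r > 0"
  obtains \<rho> :: "'a::euclidean_space \<Rightarrow> real" where "\<And>k. Ck k \<rho>" "\<And>z. 0 \<le> \<rho> z" "(LINT z|lborel. \<rho> z) = 1"
    "\<And>z. z \<notin> cball 0 r \<Longrightarrow> \<rho> z = 0" "integrable lborel \<rho>"
proof -
  define B :: "'a \<Rightarrow> real" where "B = box_bump (- One) One 0"
  obtain R where R: "R > 0" "\<And>x::'a. x \<in> cbox (-One) One \<Longrightarrow> norm x \<le> R"
    using bounded_pos[THEN iffD1, OF bounded_cbox] by metis
  \<comment> \<open>The ball of radius \<open>R\<close> contains the cube that carries
    \<open>B\<close>. Dilation by \<open>R / r\<close> maps the complement of the ball of radius
    \<open>r\<close> into the complement of that ball.\<close>
  define c where "c = R / r"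
  have c: "c > 0" using r R by (simp add: c_def)
  define \<beta> where "\<beta> z = B (c *\<^sub>R z + 0)" for z
  have C: "Ck k \<beta>" for k unfolding \<beta>_def B_def by (intro Ck_affine Ck_box_bump)
  have nn: "\<beta> z \<ge> 0" for z by (simp add: \<beta>_def B_def box_bump_bounds)
  have out: "\<beta> z = 0" if "z \<notin> cball 0 r" for z
  proof -
    have "norm (c *\<^sub>R z) > R" using that c r R by (simp add: c_def field_simps)
    then have "c *\<^sub>R z \<notin> box (-One) One" using R(2) box_subset_cbox by force
    then show ?thesis by (simp add: \<beta>_def B_def box_bump_outside)
  qed
  have cont: "continuous_on UNIV \<beta>" using C[of 0] by simp
  have int: "integrable lborel \<beta>" by (rule compact_support_integrable[OF cont compact_cball out])
  have "\<beta> 0 = 1" by (simp add: \<beta>_def B_def box_bump_def smooth_step)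
  \<comment> \<open>The bump is 1 at the origin, so by continuity it is positive on a nonempty open
    set, and such a set is not negligible.\<close>
  have "(LINT z|lborel. \<beta> z) \<noteq> 0"
  proof
    assume "(LINT z|lborel. \<beta> z) = 0"
    then have "AE z in lborel. \<beta> z = 0" using integral_nonneg_eq_0_iff_AE[OF int] nn by auto
    moreover have "open {z. \<beta> z > 0}" using cont by (intro open_Collect_less continuous_intros)
    moreover have "0 \<in> {z. \<beta> z > 0}" using \<open>\<beta> 0 = 1\<close> by simp
    ultimately show False
    proof -
      assume AE: "AE z in lborel. \<beta> z = 0" and o: "open {z. \<beta> z > 0}" and 0: "0 \<in> {z. \<beta> z > 0}"
      have "{z. \<beta> z \<noteq> 0} \<in> sets lborel"
        using borel_measurable_continuous_onI[OF cont] by measurable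
      then have N: "{z. \<beta> z \<noteq> 0} \<in> null_sets lborel" using AE by (subst (asm) AE_iff_null) auto
      then have "negligible {z. \<beta> z \<noteq> 0}" unfolding negligible_iff_null_sets by (rule null_sets_completionI)
      then have "negligible {z. \<beta> z > 0}" by (rule negligible_subset) auto
      then show False using open_not_negligible[OF o] 0 by blast
    qed
  qed
  then have I: "(LINT z|lborel. \<beta> z) > 0" using Bochner_Integration.integral_nonneg[of lborel \<beta>] nn by (simp add: order_less_le)
  show ?thesis
  proof
    show "Ck k (\<lambda>z. (1 / (LINT z|lborel. \<beta> z)) * \<beta> z)" for k by (intro Ck_mult Ck_const C)
  qed (use I nn out int in auto)
qed

lemma lborel_integral_reflect:
  fixes F :: "'a::euclidean_space \<Rightarrow> real"
  assumes "F \<in> borel_measurable borel"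
  shows "(LINT x|lborel. F (y - x)) = (LINT x|lborel. F x)"
proof -
  have "(LINT x|lborel. F x) = (LINT x|distr lborel borel (\<lambda>x. y - x). F x)"
    using lborel_affine[of "-1::real" y] by (simp add: density_1)
  also have "\<dots> = (LINT x|lborel. F (y - x))" using assms by (subst integral_distr) auto
  finally show ?thesis by simp
qed

lemma borel_measurable_lebesgue_on:
  "f \<in> borel_measurable borel \<Longrightarrow> f \<in> borel_measurable (lebesgue_on S)"
  by (intro measurable_restrict_space1 measurable_completion) simp

text \<open>The Leibniz rule for two functions that are only weakly differentiable: \<open>v\<close> is mollified, and
  the mollifier is moved to the smooth factor by testing the weak derivative of \<open>a\<close> with \<open>\<phi>\<close> times a translate of it.\<close>

lemma weak_product_identity:
  fixes S :: "'a::euclidean_space set"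
  assumes S: "open S" and v: "is_weak_grad S v z" and a: "is_weak_grad S a w"
    and am: "a \<in> borel_measurable (lebesgue_on S)" and ab: "AE x in lebesgue_on S. \<bar>a x\<bar> \<le> M"
    and wm: "(\<lambda>x. w x \<bullet> j) \<in> borel_measurable (lebesgue_on S)" and wb: "AE x in lebesgue_on S. \<bar>w x \<bullet> j\<bar> \<le> M"
    and j: "j \<in> Basis" and \<phi>: "\<phi> \<in> test_fun S"
  shows "(LINT x|lebesgue_on S. a x * (z x \<bullet> j) * \<phi> x + v x * (w x \<bullet> j) * \<phi> x + v x * a x * (cgrad \<phi> x \<bullet> j)) = 0"
proof -
  obtain K where K: "compact K" "K \<subseteq> S" "\<And>x. x \<notin> K \<Longrightarrow> \<phi> x = 0" "\<And>x. x \<notin> K \<Longrightarrow> cgrad \<phi> x = 0"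
    "continuous_on UNIV \<phi>" "continuous_on UNIV (\<lambda>x. cgrad \<phi> x \<bullet> j)"
    using test_fun_facts[OF \<phi>] j by metis
  obtain r0 where r0: "r0 > 0" "(\<Union>x\<in>K. cball x r0) \<subseteq> S"
    using compact_subset_open_imp_cball_epsilon_subset[OF K(1) S K(2)] by blast
  \<comment> \<open>Mollification with radius at most \<open>r0\<close> at a point of the support
    \<open>K\<close> of \<phi> sees values in \<open>K'\<close> only. On this compact subset of
    \<open>S\<close> both \<open>v\<close> and \<open>z\<close> are integrable.\<close>
  define K' where "K' = (\<Union>x\<in>K. cball x r0)"
  have K'c: "compact K'"
  proof -
    have "K' = (\<lambda>(x, y). x + y) ` (K \<times> cball 0 r0)"
      unfolding K'_def by (force simp: image_iff dist_norm norm_minus_commute intro: bexI[where x="_ - _"] exI)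
    then show ?thesis using K(1)
      by (auto intro!: compact_continuous_image compact_Times continuous_intros simp: split_def)
  qed
  have KK': "K \<subseteq> K'" using r0(1) by (force simp: K'_def)
  have sets: "S \<in> sets borel" "K \<in> sets borel" "K' \<in> sets borel"
    using S K(1) K'c by (auto simp: compact_imp_closed borel_closed)
  have sets': "S \<in> sets lebesgue" "K \<in> sets lebesgue" "K' \<in> sets lebesgue"
    using sets by (auto simp: sets_completionI_sets)
  have vz: "integrable (lebesgue_on K') v" "integrable (lebesgue_on K') (\<lambda>x. z x \<bullet> j)"
    using v j K'c r0(2) by (auto simp: is_weak_grad_def loc_integrable_def K'_def)
  obtain V where V: "V \<in> borel_measurable borel" "integrable lborel V" "\<And>x. x \<notin> K' \<Longrightarrow> V x = 0"
      "AE x in lborel. x \<in> K' \<longrightarrow> V x = v x"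
    by (rule borel_representative[OF vz(1) sets(3)]) (rule that)
  obtain Z where Z: "Z \<in> borel_measurable borel" "integrable lborel Z" "\<And>x. x \<notin> K' \<Longrightarrow> Z x = 0"
      "AE x in lborel. x \<in> K' \<longrightarrow> Z x = z x \<bullet> j"
    by (rule borel_representative[OF vz(2) sets(3)]) (rule that)
  have aw: "integrable (lebesgue_on K) a" "integrable (lebesgue_on K) (\<lambda>x. w x \<bullet> j)"
    using a j K(1,2) by (auto simp: is_weak_grad_def loc_integrable_def)
  obtain A0 where A0: "A0 \<in> borel_measurable borel" "\<And>x. x \<notin> K \<Longrightarrow> A0 x = 0"
      "AE x in lborel. x \<in> K \<longrightarrow> A0 x = a x"
    by (rule borel_representative[OF aw(1) sets(2)]) (rule that)
  obtain W0 where W0: "W0 \<in> borel_measurable borel" "\<And>x. x \<notin> K \<Longrightarrow> W0 x = 0"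
      "AE x in lborel. x \<in> K \<longrightarrow> W0 x = w x \<bullet> j"
    by (rule borel_representative[OF aw(2) sets(2)]) (rule that)
  have AS: "AE x in lborel. x \<in> S \<longrightarrow> \<bar>a x\<bar> \<le> M" "AE x in lborel. x \<in> S \<longrightarrow> \<bar>w x \<bullet> j\<bar> \<le> M"
    using ab wb sets by (auto simp: lebesgue_on_AE_lborel)
  \<comment> \<open>The Borel representatives agree with \<open>a\<close> and \<open>w\<close> only
    almost everywhere. Truncation keeps this and makes the bound hold at every point; the absolute
    value of \<open>M\<close> is used because the sign of \<open>M\<close> is unknown.\<close>
  define A where "A x = max (- \<bar>M\<bar>) (min \<bar>M\<bar> (A0 x))" for x
  define W where "W x = max (- \<bar>M\<bar>) (min \<bar>M\<bar> (W0 x))" for x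
  have A: "A \<in> borel_measurable borel" "\<And>x. x \<notin> K \<Longrightarrow> A x = 0" "\<And>x. \<bar>A x\<bar> \<le> \<bar>M\<bar>"
    "AE x in lborel. x \<in> K \<longrightarrow> A x = a x"
  proof -
    show "AE x in lborel. x \<in> K \<longrightarrow> A x = a x" using A0(3) AS(1)
      by eventually_elim (use K(2) in \<open>auto simp: A_def\<close>)
    show "A \<in> borel_measurable borel" unfolding A_def[abs_def] using A0(1) by measurable
  qed (use A0 in \<open>auto simp: A_def abs_le_iff\<close>)
  have W: "W \<in> borel_measurable borel" "\<And>x. x \<notin> K \<Longrightarrow> W x = 0" "\<And>x. \<bar>W x\<bar> \<le> \<bar>M\<bar>"
    "AE x in lborel. x \<in> K \<longrightarrow> W x = w x \<bullet> j"
  proof -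
    show "AE x in lborel. x \<in> K \<longrightarrow> W x = w x \<bullet> j" using W0(3) AS(2)
      by eventually_elim (use K(2) in \<open>auto simp: W_def\<close>)
    show "W \<in> borel_measurable borel" unfolding W_def[abs_def] using W0(1) by measurable
  qed (use W0 in \<open>auto simp: W_def abs_le_iff\<close>)
  \<comment> \<open>These are the bounded factors of the derivative of \<open>v\<close> and of
    \<open>v\<close> itself in the claim, which becomes that the integral of
    \<open>B1 Z + B2 V\<close> is 0.\<close>
  define B1 where "B1 x = A x * \<phi> x" for x
  define B2 where "B2 x = W x * \<phi> x + A x * (cgrad \<phi> x \<bullet> j)" for x
  obtain M1 where M1: "M1 > 0" "\<And>x. \<bar>\<phi> x\<bar> \<le> M1" using compact_support_bounded[OF K(5,1,3)] by blast
  obtain M2 where M2: "M2 > 0" "\<And>x. \<bar>cgrad \<phi> x \<bullet> j\<bar> \<le> M2"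
    using compact_support_bounded[OF K(6,1)] K(4) by (metis inner_zero_left)
  define MB where "MB = \<bar>M\<bar> * M1 + \<bar>M\<bar> * M2"
  have phm: "\<phi> \<in> borel_measurable borel" "(\<lambda>x. cgrad \<phi> x \<bullet> j) \<in> borel_measurable borel"
    using K(5,6) by (auto intro: borel_measurable_continuous_onI)
  have B1: "B1 \<in> borel_measurable borel" "\<bar>B1 x\<bar> \<le> MB" for x
  proof -
    have "\<bar>B1 x\<bar> \<le> \<bar>M\<bar> * M1" unfolding B1_def abs_mult using A(3) M1 by (intro mult_mono) auto
    then show "\<bar>B1 x\<bar> \<le> MB" using M2(1) unfolding MB_def by (smt (verit) mult_nonneg_nonneg abs_ge_zero)
    show "B1 \<in> borel_measurable borel" unfolding B1_def using A(1) phm by measurable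
  qed
  have B2: "B2 \<in> borel_measurable borel" "\<bar>B2 x\<bar> \<le> MB" for x
  proof -
    have "\<bar>W x * \<phi> x\<bar> \<le> \<bar>M\<bar> * M1" unfolding abs_mult using W(3) M1 by (intro mult_mono) auto
    moreover have "\<bar>A x * (cgrad \<phi> x \<bullet> j)\<bar> \<le> \<bar>M\<bar> * M2" unfolding abs_mult using A(3) M2 by (intro mult_mono) auto
    ultimately show "\<bar>B2 x\<bar> \<le> MB" unfolding MB_def B2_def by linarith
    show "B2 \<in> borel_measurable borel" unfolding B2_def using A(1) W(1) phm by measurable
  qed
  have MB0: "MB \<ge> 0" using M1(1) M2(1) by (simp add: MB_def)
  have bi: "integrable lborel (\<lambda>x. B x * F x)" if "integrable lborel F" "B \<in> borel_measurable borel" "\<And>x. \<bar>B x\<bar> \<le> MB" for B F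
  proof (rule Bochner_Integration.integrable_bound)
    show "integrable lborel (\<lambda>x. MB * F x)" using that by simp
    show "AE x in lborel. norm (B x * F x) \<le> norm (MB * F x)" using that(3) MB0
      by (intro AE_I2) (auto simp: abs_mult intro!: mult_right_mono)
  qed (use that in auto)
  \<comment> \<open>For mollified \<open>Z\<close> and \<open>V\<close> the identity is exact
    (\<open>key\<close>). Replacing them by \<open>Z\<close> and \<open>V\<close> costs at most
    \<open>MB * e\<close> in each of the two terms, with \<open>e\<close> as small as
    desired.\<close>
  have approx: "\<bar>(LINT y|lborel. B1 y * Z y) + (LINT y|lborel. B2 y * V y)\<bar> \<le> 2 * MB * e" if e: "e > 0" for e
  proof -
    obtain d1 where d1: "d1 > 0" "\<And>z. norm z \<le> d1 \<Longrightarrow> (LINT x|lborel. \<bar>V (x - z) - V x\<bar>) \<le> e" using L1_shift_uniform[OF V(2) e] by metis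
    obtain d2 where d2: "d2 > 0" "\<And>z. norm z \<le> d2 \<Longrightarrow> (LINT x|lborel. \<bar>Z (x - z) - Z x\<bar>) \<le> e" using L1_shift_uniform[OF Z(2) e] by metis
    define r where "r = min r0 (min d1 d2)"
    have r: "r > 0" "r \<le> r0" "r \<le> d1" "r \<le> d2" using r0(1) d1(1) d2(1) by (auto simp: r_def)
    obtain \<rho> :: "'a \<Rightarrow> real" where \<rho>: "\<And>k. Ck k \<rho>" "\<And>z. 0 \<le> \<rho> z" "(LINT z|lborel. \<rho> z) = 1"
      "\<And>z. z \<notin> cball 0 r \<Longrightarrow> \<rho> z = 0" "integrable lborel \<rho>" using mollifier_exists[OF r(1)] by blast
    have \<rho>supp: "norm z \<le> r" if "\<rho> z \<noteq> 0" for z using \<rho>(4)[of z] that by auto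
    define \<rho>' where "\<rho>' z = cgrad \<rho> z \<bullet> j" for z
    have \<rho>'0: "\<rho>' z = 0" if "z \<notin> cball 0 r" for z
      using cgrad_zero[OF compact_cball \<rho>(4) that] by (simp add: \<rho>'_def)
    have \<rho>c: "continuous_on UNIV \<rho>" "continuous_on UNIV \<rho>'"
      using \<rho>(1)[of 0] Ck_cgrad[OF \<rho>(1) j, of 0] by (auto simp: \<rho>'_def)
    have \<rho>m: "\<rho> \<in> borel_measurable borel" "\<rho>' \<in> borel_measurable borel"
      using \<rho>c by (auto intro: borel_measurable_continuous_onI)
    have \<rho>'i: "integrable lborel \<rho>'" by (rule compact_support_integrable[OF \<rho>c(2) compact_cball \<rho>'0])
    have gshift: "cgrad (\<lambda>x. \<rho> (c *\<^sub>R x + b)) x = c *\<^sub>R cgrad \<rho> (c *\<^sub>R x + b)" for c b x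
    proof (rule cgrad_eqI)
      have "((\<lambda>y. c *\<^sub>R y + b) has_derivative (\<lambda>h. c *\<^sub>R h)) (at x)" by (auto intro!: derivative_eq_intros)
      moreover have "(\<rho> has_derivative (\<lambda>h. h \<bullet> cgrad \<rho> (c *\<^sub>R x + b))) (at (c *\<^sub>R x + b))"
        using Ck_GDERIV[OF \<rho>(1)] by (simp add: gderiv_def)
      ultimately have "((\<lambda>y. \<rho> (c *\<^sub>R y + b)) has_derivative (\<lambda>h. c *\<^sub>R h \<bullet> cgrad \<rho> (c *\<^sub>R x + b))) (at x)"
        using has_derivative_compose by fastforce
      then show "GDERIV (\<lambda>y. \<rho> (c *\<^sub>R y + b)) x :> c *\<^sub>R cgrad \<rho> (c *\<^sub>R x + b)" by (simp add: gderiv_def)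
    qed
    have toV: "(LINT x|lebesgue_on S. v x * h x) = (LINT x|lborel. V x * h x)"
      "(LINT x|lebesgue_on S. (z x \<bullet> j) * h x) = (LINT x|lborel. Z x * h x)"
      if h: "h \<in> borel_measurable borel" "\<And>x. x \<notin> K' \<Longrightarrow> h x = 0" for h
    proof -
      have K'S: "K' \<subseteq> S" using r0(2) by (simp add: K'_def)
      have gen: "(LINT x|lebesgue_on S. q x * h x) = (LINT x|lborel. Q x * h x)"
        if q: "integrable (lebesgue_on K') q" and Q: "Q \<in> borel_measurable borel" "\<And>x. x \<notin> K' \<Longrightarrow> Q x = 0" "AE x in lborel. x \<in> K' \<longrightarrow> Q x = q x" for q Q
      proof -
        have "(LINT x|lebesgue_on S. q x * h x) = (LINT x|lebesgue_on S. indicator K' x * (q x * h x))"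
          using h(2) by (intro Bochner_Integration.integral_cong) (auto split: split_indicator)
        also have "\<dots> = (LINT x|lebesgue_on K'. q x * h x)"
          by (rule lebesgue_on_subset_integral(1)[OF K'S sets'(1,3)])
        also have "\<dots> = (LINT x|lebesgue_on K'. Q x * h x)"
        proof (rule integral_cong_AE)
          show "(\<lambda>x. q x * h x) \<in> borel_measurable (lebesgue_on K')" "(\<lambda>x. Q x * h x) \<in> borel_measurable (lebesgue_on K')"
            using borel_measurable_times[OF borel_measurable_integrable[OF q] borel_measurable_lebesgue_on[OF h(1)]]
              borel_measurable_times[OF borel_measurable_lebesgue_on[OF Q(1)] borel_measurable_lebesgue_on[OF h(1)]] by auto
          show "AE x in lebesgue_on K'. q x * h x = Q x * h x"
            using Q(3) unfolding lebesgue_on_AE_lborel[OF sets(3)] by eventually_elim simp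
        qed
        also have "\<dots> = (LINT x|lborel. Q x * h x)"
          by (rule lebesgue_on_integral_lborel[OF sets(3)]) (use Q h in auto)
        finally show ?thesis .
      qed
      show "(LINT x|lebesgue_on S. v x * h x) = (LINT x|lborel. V x * h x)"
        "(LINT x|lebesgue_on S. (z x \<bullet> j) * h x) = (LINT x|lborel. Z x * h x)"
        using v j K'c r0(2) V Z by (auto intro!: gen simp: is_weak_grad_def loc_integrable_def K'_def)
    qed
    have toA: "(LINT x|lebesgue_on S. a x * h x) = (LINT x|lborel. A x * h x)"
      "(LINT x|lebesgue_on S. (w x \<bullet> j) * h x) = (LINT x|lborel. W x * h x)"
      if h: "h \<in> borel_measurable borel" "\<And>x. x \<notin> K \<Longrightarrow> h x = 0" for h
    proof -
      have gen: "(LINT x|lebesgue_on S. q x * h x) = (LINT x|lborel. Q x * h x)"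
        if q: "integrable (lebesgue_on K) q" and Q: "Q \<in> borel_measurable borel" "\<And>x. x \<notin> K \<Longrightarrow> Q x = 0" "AE x in lborel. x \<in> K \<longrightarrow> Q x = q x" for q Q
      proof -
        have "(LINT x|lebesgue_on S. q x * h x) = (LINT x|lebesgue_on S. indicator K x * (q x * h x))"
          using h(2) by (intro Bochner_Integration.integral_cong) (auto split: split_indicator)
        also have "\<dots> = (LINT x|lebesgue_on K. q x * h x)"
          by (rule lebesgue_on_subset_integral(1)[OF K(2) sets'(1,2)])
        also have "\<dots> = (LINT x|lebesgue_on K. Q x * h x)"
        proof (rule integral_cong_AE)
          show "(\<lambda>x. q x * h x) \<in> borel_measurable (lebesgue_on K)" "(\<lambda>x. Q x * h x) \<in> borel_measurable (lebesgue_on K)"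
            using borel_measurable_times[OF borel_measurable_integrable[OF q] borel_measurable_lebesgue_on[OF h(1)]]
              borel_measurable_times[OF borel_measurable_lebesgue_on[OF Q(1)] borel_measurable_lebesgue_on[OF h(1)]] by auto
          show "AE x in lebesgue_on K. q x * h x = Q x * h x"
            using Q(3) unfolding lebesgue_on_AE_lborel[OF sets(2)] by eventually_elim simp
        qed
        also have "\<dots> = (LINT x|lborel. Q x * h x)"
          by (rule lebesgue_on_integral_lborel[OF sets(2)]) (use Q h in auto)
        finally show ?thesis .
      qed
      show "(LINT x|lebesgue_on S. a x * h x) = (LINT x|lborel. A x * h x)"
        "(LINT x|lebesgue_on S. (w x \<bullet> j) * h x) = (LINT x|lborel. W x * h x)"
        using a j K(1,2) A W by (auto intro!: gen simp: is_weak_grad_def loc_integrable_def)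
    qed
    \<comment> \<open>The weak derivative of \<open>v\<close> is tested with \<open>x\<close> mapped
      to \<open>\<rho> (y - x)\<close>; the reflection contributes the sign that cancels the one in
      the definition. For \<open>y\<close> in \<open>K\<close> this is a test function on
      \<open>S\<close>.\<close>
    have idA: "(LINT x|lborel. V x * \<rho>' (y - x)) = (LINT x|lborel. Z x * \<rho> (y - x))" if y: "y \<in> K" for y
    proof -
      define \<psi> where "\<psi> x = \<rho> ((-1) *\<^sub>R x + y)" for x
      have out: "\<psi> x = 0" if "x \<notin> cball y r" for x
      proof -
        have "y - x \<notin> cball 0 r" using that by (simp add: dist_norm norm_minus_commute)
        from \<rho>(4)[OF this] show ?thesis by (simp add: \<psi>_def)
      qed
      have sub: "cball y r \<subseteq> K'" using y r by (auto simp: K'_def)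
      have "\<psi> \<in> test_fun S"
      proof (rule test_funI[of _ "cball y r"])
        show "Ck k \<psi>" for k unfolding \<psi>_def[abs_def] by (rule Ck_affine[OF \<rho>(1)])
        show "cball y r \<subseteq> S" using sub r0(2) unfolding K'_def[symmetric] by blast
      qed (use out in auto)
      then have "- (LINT x|lebesgue_on S. v x * (cgrad \<psi> x \<bullet> j)) = (LINT x|lebesgue_on S. (z x \<bullet> j) * \<psi> x)"
        using v j by (auto simp: is_weak_grad_cgrad)
      moreover have "cgrad \<psi> x \<bullet> j = - \<rho>' (y - x)" for x
        using gshift[of "-1" y x] by (simp add: \<psi>_def[abs_def] \<rho>'_def)
      ultimately have "(LINT x|lebesgue_on S. v x * \<rho>' (y - x)) = (LINT x|lebesgue_on S. (z x \<bullet> j) * \<rho> (y - x))"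
        by (simp add: \<psi>_def)
      moreover have "\<rho>' (y - x) = 0" "\<rho> (y - x) = 0" if "x \<notin> K'" for x
      proof -
        have "x \<notin> cball y r" using sub that by blast
        then have "y - x \<notin> cball 0 r" by (simp add: dist_norm norm_minus_commute)
        then show "\<rho>' (y - x) = 0" "\<rho> (y - x) = 0" using \<rho>'0 \<rho>(4) by auto
      qed
      ultimately show ?thesis using \<rho>m by (simp add: toV)
    qed
    \<comment> \<open>Here \<open>a\<close> is tested with \<phi> times a translate of \<rho>. The
      factor \<phi> alone keeps the support inside \<open>S\<close>, so \<open>x\<close> is
      arbitrary, as the use under the integral over all \<open>x\<close> demands.\<close>
    have idB: "(LINT y|lborel. B1 y * \<rho>' (y - x)) = - (LINT y|lborel. B2 y * \<rho> (y - x))" for x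
    proof -
      define \<psi> where "\<psi> y = \<phi> y * \<rho> (1 *\<^sub>R y + (- x))" for y
      have C: "Ck k (\<lambda>y. \<rho> (1 *\<^sub>R y + (- x)))" for k by (intro Ck_affine \<rho>(1))
      have \<psi>t: "\<psi> \<in> test_fun S" unfolding \<psi>_def by (rule test_fun_mult_Ck[OF \<phi> C])
      have g: "cgrad \<psi> y \<bullet> j = \<phi> y * \<rho>' (y - x) + \<rho> (y - x) * (cgrad \<phi> y \<bullet> j)" for y
        unfolding \<psi>_def[abs_def] using cgrad_mult[OF test_fun_Ck[OF \<phi>] C, of y] gshift[of 1 "-x" y]
        by (simp add: inner_add_left \<rho>'_def)
      have "- (LINT y|lebesgue_on S. a y * (cgrad \<psi> y \<bullet> j)) = (LINT y|lebesgue_on S. (w y \<bullet> j) * \<psi> y)"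
        using a j \<psi>t by (auto simp: is_weak_grad_cgrad)
      then have e1: "- (LINT y|lborel. A y * (\<phi> y * \<rho>' (y - x) + \<rho> (y - x) * (cgrad \<phi> y \<bullet> j))) = (LINT y|lborel. W y * (\<phi> y * \<rho> (y - x)))"
      proof -
        have "(LINT y|lebesgue_on S. a y * (\<phi> y * \<rho>' (y - x) + \<rho> (y - x) * (cgrad \<phi> y \<bullet> j))) =
            (LINT y|lborel. A y * (\<phi> y * \<rho>' (y - x) + \<rho> (y - x) * (cgrad \<phi> y \<bullet> j)))"
        proof (rule toA(1))
          show "(\<lambda>y. \<phi> y * \<rho>' (y - x) + \<rho> (y - x) * (cgrad \<phi> y \<bullet> j)) \<in> borel_measurable borel"
            using phm \<rho>m by measurable
        qed (use K(3,4) in auto)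
        moreover have "(LINT y|lebesgue_on S. (w y \<bullet> j) * (\<phi> y * \<rho> (y - x))) = (LINT y|lborel. W y * (\<phi> y * \<rho> (y - x)))"
        proof (rule toA(2))
          show "(\<lambda>y. \<phi> y * \<rho> (y - x)) \<in> borel_measurable borel" using phm \<rho>m by measurable
        qed (use K(3) in auto)
        moreover assume "- (LINT y|lebesgue_on S. a y * (cgrad \<psi> y \<bullet> j)) = (LINT y|lebesgue_on S. (w y \<bullet> j) * \<psi> y)"
        ultimately show ?thesis by (simp add: g \<psi>_def)
      qed
      have sh: "integrable lborel (\<lambda>y. \<rho>' (y - x))" "integrable lborel (\<lambda>y. \<rho> (y - x))"
        using lborel_integrable_shift[OF \<rho>'i, of "-x"] lborel_integrable_shift[OF \<rho>(5), of "-x"] by auto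
      have i1: "integrable lborel (\<lambda>y. B1 y * \<rho>' (y - x))" by (rule bi[OF sh(1) B1])
      have i2: "integrable lborel (\<lambda>y. B2 y * \<rho> (y - x))" by (rule bi[OF sh(2) B2])
      have "\<bar>W y * \<phi> y\<bar> \<le> MB" for y
      proof -
        have "\<bar>W y * \<phi> y\<bar> \<le> \<bar>M\<bar> * M1" unfolding abs_mult using W(3) M1 by (intro mult_mono) auto
        then show ?thesis using M2(1) unfolding MB_def by (smt (verit) mult_nonneg_nonneg abs_ge_zero)
      qed
      then have i3: "integrable lborel (\<lambda>y. (W y * \<phi> y) * \<rho> (y - x))"
        using W(1) phm by (intro bi[OF sh(2)]) auto
      have "A y * (\<phi> y * \<rho>' (y - x) + \<rho> (y - x) * (cgrad \<phi> y \<bullet> j)) = B1 y * \<rho>' (y - x) + (B2 y * \<rho> (y - x) - (W y * \<phi> y) * \<rho> (y - x))" for y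
        by (simp add: B1_def B2_def algebra_simps)
      then have "(LINT y|lborel. A y * (\<phi> y * \<rho>' (y - x) + \<rho> (y - x) * (cgrad \<phi> y \<bullet> j))) =
        (LINT y|lborel. B1 y * \<rho>' (y - x)) + ((LINT y|lborel. B2 y * \<rho> (y - x)) - (LINT y|lborel. (W y * \<phi> y) * \<rho> (y - x)))"
        using i1 i2 i3 by simp
      then show ?thesis using e1 by (simp add: mult.assoc)
    qed
    have fub: "integrable (lborel \<Otimes>\<^sub>M lborel) (\<lambda>(x, y). V x * (B y * \<kappa> (y - x)))"
      "(LINT y|lborel. B y * (LINT x|lborel. V x * \<kappa> (y - x))) = (LINT x|lborel. V x * (LINT y|lborel. B y * \<kappa> (y - x)))"
      if V: "integrable lborel V" and \<kappa>: "integrable lborel \<kappa>" and B: "B \<in> borel_measurable borel" "\<And>x. \<bar>B x\<bar> \<le> MB" for V \<kappa> B :: "'a \<Rightarrow> real"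
    proof -
      have ci: "integrable (lborel \<Otimes>\<^sub>M lborel) (\<lambda>(x, y). V x * \<kappa> (y - x))"
        by (rule convolution_integrable[OF \<kappa> V])
      have m: "V \<in> borel_measurable borel" "\<kappa> \<in> borel_measurable borel" using V \<kappa> by auto
      show i: "integrable (lborel \<Otimes>\<^sub>M lborel) (\<lambda>(x, y). V x * (B y * \<kappa> (y - x)))"
      proof (rule Bochner_Integration.integrable_bound)
        show "integrable (lborel \<Otimes>\<^sub>M lborel) (\<lambda>p. MB * (\<lambda>(x, y). V x * \<kappa> (y - x)) p)" using ci by (rule integrable_mult_right)
        show "(\<lambda>(x, y). V x * (B y * \<kappa> (y - x))) \<in> borel_measurable (lborel \<Otimes>\<^sub>M lborel)" using m B(1) by measurable
        have "\<bar>V x * (B y * \<kappa> (y - x))\<bar> \<le> \<bar>MB * (V x * \<kappa> (y - x))\<bar>" for x y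
        proof -
          have "\<bar>V x * (B y * \<kappa> (y - x))\<bar> = \<bar>B y\<bar> * \<bar>V x * \<kappa> (y - x)\<bar>" by (simp add: abs_mult)
          also have "\<dots> \<le> \<bar>MB\<bar> * \<bar>V x * \<kappa> (y - x)\<bar>" using B(2)[of y] by (intro mult_right_mono) auto
          finally show ?thesis by (simp add: abs_mult)
        qed
        then show "AE p in lborel \<Otimes>\<^sub>M lborel. norm (case p of (x, y) \<Rightarrow> V x * (B y * \<kappa> (y - x))) \<le> norm (MB * (case p of (x, y) \<Rightarrow> V x * \<kappa> (y - x)))"
          by (intro AE_I2) (auto split: prod.split)
      qed
      have "(LINT y|lborel. B y * (LINT x|lborel. V x * \<kappa> (y - x))) = (LINT y|lborel. LINT x|lborel. V x * (B y * \<kappa> (y - x)))"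
        by (simp flip: integral_mult_right_zero add: mult.left_commute)
      also have "\<dots> = (LINT x|lborel. LINT y|lborel. V x * (B y * \<kappa> (y - x)))"
        using lborel_pair.Fubini_integral[OF i] by simp
      also have "\<dots> = (LINT x|lborel. V x * (LINT y|lborel. B y * \<kappa> (y - x)))" by simp
      finally show "(LINT y|lborel. B y * (LINT x|lborel. V x * \<kappa> (y - x))) = (LINT x|lborel. V x * (LINT y|lborel. B y * \<kappa> (y - x)))" .
    qed
    have conv: "(LINT x|lborel. F x * \<rho> (y - x)) = (LINT t|lborel. \<rho> t * F (y - t))" if "F \<in> borel_measurable borel" for F y
      using lborel_integral_reflect[of "\<lambda>t. \<rho> t * F (y - t)" y] that \<rho>m by (simp add: mult.commute)
    \<comment> \<open>\<open>idA\<close> turns the mollified \<open>Z\<close> into \<open>V\<close>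
      convolved with the derivative of the mollifier, Fubini moves this derivative to
      \<open>B1\<close>, and \<open>idB\<close> exchanges it for \<open>- B2\<close> with the
      mollifier itself. Points outside \<open>K\<close> do not matter since \<open>B1\<close>
      vanishes there.\<close>
    have "(LINT y|lborel. B1 y * (LINT x|lborel. Z x * \<rho> (y - x))) = (LINT y|lborel. B1 y * (LINT x|lborel. V x * \<rho>' (y - x)))"
    proof (rule Bochner_Integration.integral_cong)
      fix y show "B1 y * (LINT x|lborel. Z x * \<rho> (y - x)) = B1 y * (LINT x|lborel. V x * \<rho>' (y - x))"
        using idA[of y] A(2)[of y] by (cases "y \<in> K") (auto simp: B1_def)
    qed simp
    also have "\<dots> = (LINT x|lborel. V x * (LINT y|lborel. B1 y * \<rho>' (y - x)))" by (rule fub(2)[OF V(2) \<rho>'i B1])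
    also have "\<dots> = - (LINT x|lborel. V x * (LINT y|lborel. B2 y * \<rho> (y - x)))" by (simp add: idB)
    also have "(LINT x|lborel. V x * (LINT y|lborel. B2 y * \<rho> (y - x))) = (LINT y|lborel. B2 y * (LINT x|lborel. V x * \<rho> (y - x)))"
      by (rule fub(2)[OF V(2) \<rho>(5) B2, symmetric])
    finally have key: "(LINT y|lborel. B1 y * (LINT t|lborel. \<rho> t * Z (y - t))) + (LINT y|lborel. B2 y * (LINT t|lborel. \<rho> t * V (y - t))) = 0"
      using V(1) Z(1) by (simp add: conv)
    have close: "\<bar>(LINT y|lborel. B y * (LINT t|lborel. \<rho> t * F (y - t))) - (LINT y|lborel. B y * F y)\<bar> \<le> MB * e"
      if B: "B \<in> borel_measurable borel" "\<And>x. \<bar>B x\<bar> \<le> MB" and F: "integrable lborel F" "\<And>z. norm z \<le> r \<Longrightarrow> (LINT x|lborel. \<bar>F (x - z) - F x\<bar>) \<le> e" for B F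
    proof -
      note ai = approx_identity[OF F(1) \<rho>(5,2,3) \<rho>supp F(2)]
      have "(LINT y|lborel. B y * (LINT t|lborel. \<rho> t * F (y - t))) - (LINT y|lborel. B y * F y) =
        (LINT y|lborel. B y * ((LINT t|lborel. \<rho> t * F (y - t)) - F y))"
        using bi[OF ai(1) B] bi[OF F(1) B] by (simp add: right_diff_distrib)
      also have "\<bar>\<dots>\<bar> \<le> (LINT y|lborel. \<bar>B y * ((LINT t|lborel. \<rho> t * F (y - t)) - F y)\<bar>)"
        using integral_norm_bound[of lborel "\<lambda>y. B y * ((LINT t|lborel. \<rho> t * F (y - t)) - F y)"] by simp
      also have "\<dots> \<le> (LINT y|lborel. MB * \<bar>(LINT t|lborel. \<rho> t * F (y - t)) - F y\<bar>)"
      proof (rule integral_mono)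
        show "integrable lborel (\<lambda>y. \<bar>B y * ((LINT t|lborel. \<rho> t * F (y - t)) - F y)\<bar>)"
          using bi[OF _ B, of "\<lambda>y. (LINT t|lborel. \<rho> t * F (y - t)) - F y"] ai(1) F(1) by simp
        show "integrable lborel (\<lambda>y. MB * \<bar>(LINT t|lborel. \<rho> t * F (y - t)) - F y\<bar>)" using ai(1) F(1) by simp
        show "\<bar>B y * ((LINT t|lborel. \<rho> t * F (y - t)) - F y)\<bar> \<le> MB * \<bar>(LINT t|lborel. \<rho> t * F (y - t)) - F y\<bar>" for y
          unfolding abs_mult using B(2) by (intro mult_right_mono) auto
      qed
      also have "\<dots> \<le> MB * e" using ai(2) MB0 by (simp add: mult_left_mono)
      finally show ?thesis .
    qed
    have "\<bar>(LINT y|lborel. B1 y * (LINT t|lborel. \<rho> t * Z (y - t))) - (LINT y|lborel. B1 y * Z y)\<bar> \<le> MB * e"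
      by (rule close[OF B1 Z(2)]) (use d2 r in auto)
    moreover have "\<bar>(LINT y|lborel. B2 y * (LINT t|lborel. \<rho> t * V (y - t))) - (LINT y|lborel. B2 y * V y)\<bar> \<le> MB * e"
      by (rule close[OF B2 V(2)]) (use d1 r in auto)
    ultimately show ?thesis using key by linarith
  qed
  have "(LINT y|lborel. B1 y * Z y) + (LINT y|lborel. B2 y * V y) = 0"
  proof (rule ccontr)
    define X where "X = \<bar>(LINT y|lborel. B1 y * Z y) + (LINT y|lborel. B2 y * V y)\<bar>"
    assume "(LINT y|lborel. B1 y * Z y) + (LINT y|lborel. B2 y * V y) \<noteq> 0"
    then have "X > 0" by (simp add: X_def)
    \<comment> \<open>The choice of \<open>e\<close> makes the bound from \<open>approx\<close>
      smaller than \<open>X\<close>; adding 1 to \<open>MB\<close> guards against division by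
      0.\<close>
    have "X \<le> 2 * MB * (X / (4 * (MB + 1)))" unfolding X_def[symmetric] using \<open>X > 0\<close> MB0 approx[of "X / (4 * (MB + 1))"]
      unfolding X_def by simp
    also have "\<dots> < X"
    proof -
      have "2 * MB * X < 4 * (MB + 1) * X" using \<open>X > 0\<close> MB0 by (intro mult_strict_right_mono) auto
      then have "2 * MB * X / (4 * (MB + 1)) < X" using MB0 by (subst divide_less_eq) (auto simp: mult.commute)
      then show ?thesis by simp
    qed
    finally show False by simp
  qed
  moreover have "(LINT x|lebesgue_on S. a x * (z x \<bullet> j) * \<phi> x + v x * (w x \<bullet> j) * \<phi> x + v x * a x * (cgrad \<phi> x \<bullet> j)) =
     (LINT y|lborel. B1 y * Z y + B2 y * V y)"
  proof -
    have "(LINT x|lebesgue_on S. a x * (z x \<bullet> j) * \<phi> x + v x * (w x \<bullet> j) * \<phi> x + v x * a x * (cgrad \<phi> x \<bullet> j)) =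
      (LINT y|lebesgue_on S. B1 y * Z y + B2 y * V y)"
    proof (rule integral_cong_AE)
      show "AE x in lebesgue_on S. a x * (z x \<bullet> j) * \<phi> x + v x * (w x \<bullet> j) * \<phi> x + v x * a x * (cgrad \<phi> x \<bullet> j) = B1 x * Z x + B2 x * V x"
        unfolding lebesgue_on_AE_lborel[OF sets(1)] using V(4) Z(4) A(4) W(4)
      proof eventually_elim
        case (elim x)
        then show ?case using K(3,4)[of x] KK' by (cases "x \<in> K") (auto simp: B1_def B2_def algebra_simps)
      qed
      show "(\<lambda>x. B1 x * Z x + B2 x * V x) \<in> borel_measurable (lebesgue_on S)"
        using B1(1) B2(1) V(1) Z(1) by (intro borel_measurable_lebesgue_on) simp
      have i: "integrable (lebesgue_on S) (\<lambda>x. (z x \<bullet> j) * \<phi> x)" "integrable (lebesgue_on S) (\<lambda>x. v x * \<phi> x)" "integrable (lebesgue_on S) (\<lambda>x. v x * (cgrad \<phi> x \<bullet> j))"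
        using v j K by (auto intro!: loc_integrable_mult[OF S] simp: is_weak_grad_def)
      then have "(\<lambda>x. a x * ((z x \<bullet> j) * \<phi> x) + (w x \<bullet> j) * (v x * \<phi> x) + a x * (v x * (cgrad \<phi> x \<bullet> j))) \<in> borel_measurable (lebesgue_on S)"
        by (intro borel_measurable_add borel_measurable_times[OF am borel_measurable_integrable[OF i(1)]]
          borel_measurable_times[OF wm borel_measurable_integrable[OF i(2)]]
          borel_measurable_times[OF am borel_measurable_integrable[OF i(3)]])
      then show "(\<lambda>x. a x * (z x \<bullet> j) * \<phi> x + v x * (w x \<bullet> j) * \<phi> x + v x * a x * (cgrad \<phi> x \<bullet> j)) \<in> borel_measurable (lebesgue_on S)"
        by (simp add: mult_ac)
    qed
    also have "\<dots> = (LINT y|lborel. B1 y * Z y + B2 y * V y)"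
    proof (rule lebesgue_on_integral_lborel[OF sets(1)])
      fix x assume "x \<notin> S"
      then have "x \<notin> K" using K(2) by blast
      then show "B1 x * Z x + B2 x * V x = 0" using K(3,4)[of x] by (simp add: B1_def B2_def)
    qed (use B1 B2 V Z in auto)
    finally show ?thesis .
  qed
  moreover have "integrable lborel (\<lambda>y. B1 y * Z y)" "integrable lborel (\<lambda>y. B2 y * V y)"
    using bi[OF Z(2) B1] bi[OF V(2) B2] .
  ultimately show ?thesis by simp
qed

section \<open>Lebesgue and weighted Sobolev spaces\<close>

text \<open>This is completeness of Lebesgue measure. It provides measurability for functions that
  are known only up to a null set, such as chosen gradients and limits almost everywhere.\<close>

lemma measurable_lebesgue_on_AE:
  fixes f g :: "'a::euclidean_space \<Rightarrow> real"
  assumes f: "f \<in> borel_measurable (lebesgue_on S)" and S: "S \<in> sets lebesgue" and ae: "AE x in lebesgue_on S. f x = g x"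
  shows "g \<in> borel_measurable (lebesgue_on S)"
proof -
  have "(\<lambda>x. if x \<in> S then f x else 0) \<in> borel_measurable lebesgue" using f S by (rule borel_measurable_if_I)
  moreover have "AE x in lebesgue. (if x \<in> S then f x else 0) = (if x \<in> S then g x else 0)"
    using ae S by (subst (asm) AE_restrict_space_iff) (auto elim!: eventually_mono)
  ultimately have "(\<lambda>x. if x \<in> S then g x else 0) \<in> borel_measurable lebesgue" by (rule borel_measurable_AE)
  then show ?thesis by (rule borel_measurable_if_D)
qed

lemma powr_norm_add_le:
  fixes x y :: "'a::real_normed_vector"
  assumes "p \<ge> 0" shows "norm (x + y) powr p \<le> 2 powr p * (norm x powr p + norm y powr p)"
proof -
  have "norm (x + y) powr p \<le> (2 * max (norm x) (norm y)) powr p"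
    using assms norm_triangle_ineq[of x y] by (intro powr_mono2) auto
  also have "\<dots> = 2 powr p * max (norm x) (norm y) powr p" by (simp add: powr_mult)
  also have "max (norm x) (norm y) powr p \<le> norm x powr p + norm y powr p" by (simp add: max_def)
  finally show ?thesis by (simp add: mult_left_mono)
qed

lemma powr_le_one_plus:
  fixes x :: real
  assumes "0 \<le> q" "q \<le> p" "0 \<le> x" shows "x powr q \<le> 1 + x powr p"
proof (cases "x \<le> 1")
  case True
  then show ?thesis using powr_le1[of q x] assms by (smt (verit) powr_ge_zero)
next
  case False
  then have "x powr q \<le> x powr p" using assms by (intro powr_mono) auto
  then show ?thesis by linarith
qed

lemma powr_abs_power2: "\<bar>x\<bar> powr 2 = (x::real)\<^sup>2"
  by (cases "x = 0") (simp_all add: powr_numeral)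

lemma abs_mult_le_squares: "\<bar>x * y\<bar> \<le> x\<^sup>2 + (y::real)\<^sup>2"
proof -
  have "0 \<le> (\<bar>x\<bar> - \<bar>y\<bar>)\<^sup>2" by simp
  then have "2 * \<bar>x * y\<bar> \<le> x\<^sup>2 + y\<^sup>2" by (simp add: power2_diff abs_mult)
  then show ?thesis by (smt (verit) abs_ge_zero)
qed

definition finite_domain :: "'a::euclidean_space set \<Rightarrow> bool" where
  "finite_domain S \<longleftrightarrow> open S \<and> bounded S"

lemma finite_domain_measure:
  assumes "finite_domain S"
  shows "finite_measure (lebesgue_on S)" "integrable (lebesgue_on S) (\<lambda>x. c :: real)" "S \<in> sets lebesgue"
proof -
  have l: "S \<in> lmeasurable" using assms lmeasurable_open by (auto simp: finite_domain_def)
  then show m: "S \<in> sets lebesgue" by (rule fmeasurableD)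
  have "emeasure (lebesgue_on S) (space (lebesgue_on S)) \<noteq> \<infinity>"
    using l m by (simp add: emeasure_restrict_space fmeasurable_def less_top)
  then show f: "finite_measure (lebesgue_on S)" by (rule finite_measureI)
  then show "integrable (lebesgue_on S) (\<lambda>x. c :: real)" by (rule finite_measure.integrable_const)
qed

lemma Lp_lincomb:
  assumes u: "u \<in> Lp_space S w p" and v: "v \<in> Lp_space S w p" and w: "w \<in> borel_measurable (lebesgue_on S)"
    "AE x in lebesgue_on S. 0 \<le> w x" and p: "p > 0"
  shows "(\<lambda>x. c * u x + d * v x) \<in> Lp_space S w p"
proof -
  have m: "u \<in> borel_measurable (lebesgue_on S)" "v \<in> borel_measurable (lebesgue_on S)" using u v by (auto simp: Lp_space_def)
  have i: "integrable (lebesgue_on S) (\<lambda>x. 2 powr p * (\<bar>c\<bar> powr p * (w x * \<bar>u x\<bar> powr p) + \<bar>d\<bar> powr p * (w x * \<bar>v x\<bar> powr p)))"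
    using u v by (auto simp: Lp_space_def)
  have "integrable (lebesgue_on S) (\<lambda>x. w x * \<bar>c * u x + d * v x\<bar> powr p)"
  proof (rule Bochner_Integration.integrable_bound[OF i])
    show "(\<lambda>x. w x * \<bar>c * u x + d * v x\<bar> powr p) \<in> borel_measurable (lebesgue_on S)" using m w(1) by measurable
    show "AE x in lebesgue_on S. norm (w x * \<bar>c * u x + d * v x\<bar> powr p) \<le>
        norm (2 powr p * (\<bar>c\<bar> powr p * (w x * \<bar>u x\<bar> powr p) + \<bar>d\<bar> powr p * (w x * \<bar>v x\<bar> powr p)))"
      using w(2)
    proof eventually_elim
      case (elim x)
      have "\<bar>c * u x + d * v x\<bar> powr p \<le> 2 powr p * (\<bar>c * u x\<bar> powr p + \<bar>d * v x\<bar> powr p)"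
        using powr_norm_add_le[of p "c * u x" "d * v x"] p by simp
      also have "\<dots> = 2 powr p * (\<bar>c\<bar> powr p * \<bar>u x\<bar> powr p + \<bar>d\<bar> powr p * \<bar>v x\<bar> powr p)"
        by (simp add: abs_mult powr_mult)
      finally have "w x * \<bar>c * u x + d * v x\<bar> powr p \<le> w x * (2 powr p * (\<bar>c\<bar> powr p * \<bar>u x\<bar> powr p + \<bar>d\<bar> powr p * \<bar>v x\<bar> powr p))"
        using elim by (rule mult_left_mono)
      also have "\<dots> = 2 powr p * (\<bar>c\<bar> powr p * (w x * \<bar>u x\<bar> powr p) + \<bar>d\<bar> powr p * (w x * \<bar>v x\<bar> powr p))"
        by (simp add: algebra_simps)
      finally show ?case using elim by simp
    qed
  qed
  then show ?thesis using m by (simp add: Lp_space_def)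
qed

lemma Lp_bounded_weight:
  assumes u: "u \<in> Lp_space S (\<lambda>_. 1) p" and w: "w \<in> borel_measurable (lebesgue_on S)" "AE x in lebesgue_on S. \<bar>w x\<bar> \<le> M"
  shows "u \<in> Lp_space S w p"
proof -
  have m: "u \<in> borel_measurable (lebesgue_on S)" using u by (auto simp: Lp_space_def)
  have i: "integrable (lebesgue_on S) (\<lambda>x. M * \<bar>u x\<bar> powr p)" using u by (auto simp: Lp_space_def)
  have "integrable (lebesgue_on S) (\<lambda>x. w x * \<bar>u x\<bar> powr p)"
  proof (rule Bochner_Integration.integrable_bound[OF i])
    show "(\<lambda>x. w x * \<bar>u x\<bar> powr p) \<in> borel_measurable (lebesgue_on S)" using m w(1) by measurable
    show "AE x in lebesgue_on S. norm (w x * \<bar>u x\<bar> powr p) \<le> norm (M * \<bar>u x\<bar> powr p)"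
      using w(2) by eventually_elim (auto simp: abs_mult intro!: mult_right_mono)
  qed
  then show ?thesis using m by (simp add: Lp_space_def)
qed

lemma Lp_unweight:
  assumes u: "u \<in> Lp_space S w p" and c: "c > 0" "AE x in lebesgue_on S. c \<le> w x"
  shows "u \<in> Lp_space S (\<lambda>_. 1) p"
proof -
  have m: "u \<in> borel_measurable (lebesgue_on S)" using u by (auto simp: Lp_space_def)
  have i: "integrable (lebesgue_on S) (\<lambda>x. (1 / c) * (w x * \<bar>u x\<bar> powr p))" using u by (auto simp: Lp_space_def)
  have "integrable (lebesgue_on S) (\<lambda>x. 1 * \<bar>u x\<bar> powr p)"
  proof (rule Bochner_Integration.integrable_bound[OF i])
    show "(\<lambda>x. 1 * \<bar>u x\<bar> powr p) \<in> borel_measurable (lebesgue_on S)" using m by measurable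
    show "AE x in lebesgue_on S. norm (1 * \<bar>u x\<bar> powr p) \<le> norm ((1 / c) * (w x * \<bar>u x\<bar> powr p))"
      using c(2)
    proof eventually_elim
      case (elim x)
      have "c * \<bar>u x\<bar> powr p \<le> w x * \<bar>u x\<bar> powr p" using elim by (rule mult_right_mono) simp
      then have "\<bar>u x\<bar> powr p \<le> (1 / c) * (w x * \<bar>u x\<bar> powr p)" using c(1) by (simp add: field_simps)
      also have "\<dots> \<le> norm ((1 / c) * (w x * \<bar>u x\<bar> powr p))" unfolding real_norm_def by (rule abs_ge_self)
      finally show ?case by simp
    qed
  qed
  then show ?thesis using m by (simp add: Lp_space_def)
qed

lemma Lp_bounded_mult:
  assumes u: "u \<in> Lp_space S (\<lambda>_. 1) p" and w: "w \<in> borel_measurable (lebesgue_on S)" "AE x in lebesgue_on S. \<bar>w x\<bar> \<le> M"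
    and p: "p > 0"
  shows "(\<lambda>x. w x * u x) \<in> Lp_space S (\<lambda>_. 1) p"
proof -
  have m: "u \<in> borel_measurable (lebesgue_on S)" using u by (auto simp: Lp_space_def)
  have i: "integrable (lebesgue_on S) (\<lambda>x. \<bar>M\<bar> powr p * (1 * \<bar>u x\<bar> powr p))" using u by (auto simp: Lp_space_def)
  have "integrable (lebesgue_on S) (\<lambda>x. 1 * \<bar>w x * u x\<bar> powr p)"
  proof (rule Bochner_Integration.integrable_bound[OF i])
    show "(\<lambda>x. 1 * \<bar>w x * u x\<bar> powr p) \<in> borel_measurable (lebesgue_on S)" using m w(1) by measurable
    show "AE x in lebesgue_on S. norm (1 * \<bar>w x * u x\<bar> powr p) \<le> norm (\<bar>M\<bar> powr p * (1 * \<bar>u x\<bar> powr p))"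
      using w(2)
    proof eventually_elim
      case (elim x)
      then have "\<bar>w x\<bar> powr p \<le> \<bar>M\<bar> powr p" using p by (intro powr_mono2) auto
      then show ?case by (simp add: abs_mult powr_mult mult_right_mono)
    qed
  qed
  then show ?thesis using m w(1) by (simp add: Lp_space_def)
qed

lemma Lp_subset:
  assumes S: "finite_domain S" and u: "u \<in> Lp_space S (\<lambda>_. 1) p" and q: "0 \<le> q" "q \<le> p"
  shows "u \<in> Lp_space S (\<lambda>_. 1) q"
proof -
  have m: "u \<in> borel_measurable (lebesgue_on S)" using u by (auto simp: Lp_space_def)
  have i: "integrable (lebesgue_on S) (\<lambda>x. 1 + 1 * \<bar>u x\<bar> powr p)"
    using u finite_domain_measure[OF S] by (auto simp: Lp_space_def)
  have "integrable (lebesgue_on S) (\<lambda>x. 1 * \<bar>u x\<bar> powr q)"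
  proof (rule Bochner_Integration.integrable_bound[OF i])
    show "(\<lambda>x. 1 * \<bar>u x\<bar> powr q) \<in> borel_measurable (lebesgue_on S)" using m by measurable
    show "AE x in lebesgue_on S. norm (1 * \<bar>u x\<bar> powr q) \<le> norm (1 + 1 * \<bar>u x\<bar> powr p)"
      using powr_le_one_plus[OF q] by (intro AE_I2) (simp add: abs_of_nonneg)
  qed
  then show ?thesis using m by (simp add: Lp_space_def)
qed

lemma L2_mult_integrable:
  assumes u: "u \<in> Lp_space S (\<lambda>_. 1) 2" and v: "v \<in> Lp_space S (\<lambda>_. 1) 2"
  shows "integrable (lebesgue_on S) (\<lambda>x. u x * v x)"
proof -
  have m: "u \<in> borel_measurable (lebesgue_on S)" "v \<in> borel_measurable (lebesgue_on S)" using u v by (auto simp: Lp_space_def)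
  have i: "integrable (lebesgue_on S) (\<lambda>x. (u x)\<^sup>2 + (v x)\<^sup>2)"
    using u v by (auto simp: Lp_space_def powr_abs_power2)
  show ?thesis
    by (rule Bochner_Integration.integrable_bound[OF i]) (use m abs_mult_le_squares in \<open>auto simp: abs_of_nonneg\<close>)
qed

lemma Lp_mult_integrable:
  assumes S: "finite_domain S" and p: "p \<ge> 2" and u: "u \<in> Lp_space S (\<lambda>_. 1) p" and v: "v \<in> Lp_space S (\<lambda>_. 1) p"
  shows "integrable (lebesgue_on S) (\<lambda>x. u x * v x)"
  using Lp_subset[OF S u, of 2] Lp_subset[OF S v, of 2] p by (intro L2_mult_integrable) auto

lemma Lp_const: "finite_domain S \<Longrightarrow> (\<lambda>x. c) \<in> Lp_space S (\<lambda>_. 1) p"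
  by (simp add: Lp_space_def finite_domain_measure)

lemma Lp_integrable:
  assumes S: "finite_domain S" and p: "p \<ge> 1" and u: "u \<in> Lp_space S (\<lambda>_. 1) p"
  shows "integrable (lebesgue_on S) u"
proof -
  have 1: "u \<in> Lp_space S (\<lambda>_. 1) 1" using Lp_subset[OF S u, of 1] p by simp
  then have "integrable (lebesgue_on S) (\<lambda>x. \<bar>u x\<bar>)" by (simp add: Lp_space_def)
  then show ?thesis using 1 by (subst integrable_abs_iff[symmetric]) (simp_all add: Lp_space_def)
qed

lemma integrable_loc_integrable:
  fixes u :: "'a::euclidean_space \<Rightarrow> real"
  assumes S: "S \<in> sets lebesgue" and u: "integrable (lebesgue_on S) u"
  shows "loc_integrable S u"
  unfolding loc_integrable_def
proof (intro allI impI, elim conjE)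
  fix K assume "compact K" "K \<subseteq> S"
  then show "integrable (lebesgue_on K) u"
    by (intro integrable_lebesgue_on_subset[OF u _ S] fmeasurableD lmeasurable_compact)
qed

lemma Lp_measurable: "u \<in> Lp_space S w p \<Longrightarrow> u \<in> borel_measurable (lebesgue_on S)"
  by (simp add: Lp_space_def)

lemma Lp_cong_AE:
  assumes u: "u \<in> Lp_space S w p" and w: "w \<in> borel_measurable (lebesgue_on S)" and S: "S \<in> sets lebesgue" and ae: "AE x in lebesgue_on S. u x = v x"
  shows "v \<in> Lp_space S w p"
proof -
  have m: "v \<in> borel_measurable (lebesgue_on S)" by (rule measurable_lebesgue_on_AE[OF Lp_measurable[OF u] S ae])
  have "integrable (lebesgue_on S) (\<lambda>x. w x * \<bar>v x\<bar> powr p)"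
  proof (rule integrable_cong_AE[THEN iffD1])
    show "integrable (lebesgue_on S) (\<lambda>x. w x * \<bar>u x\<bar> powr p)" using u by (simp add: Lp_space_def)
    show "AE x in lebesgue_on S. w x * \<bar>u x\<bar> powr p = w x * \<bar>v x\<bar> powr p" using ae by eventually_elim simp
    show "(\<lambda>x. w x * \<bar>u x\<bar> powr p) \<in> borel_measurable (lebesgue_on S)"
      "(\<lambda>x. w x * \<bar>v x\<bar> powr p) \<in> borel_measurable (lebesgue_on S)" using Lp_measurable[OF u] m w by measurable
  qed
  then show ?thesis using m by (simp add: Lp_space_def)
qed

lemma Lp_vec_measurable: "z \<in> Lp_vec S w p \<Longrightarrow> z \<in> borel_measurable (lebesgue_on S)"
  by (subst borel_measurable_euclidean_space) (auto simp: Lp_vec_def Lp_space_def)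

lemma Lp_vec_cong_AE:
  assumes u: "z \<in> Lp_vec S w p" and w: "w \<in> borel_measurable (lebesgue_on S)" and S: "S \<in> sets lebesgue" and ae: "AE x in lebesgue_on S. z x = y x"
  shows "y \<in> Lp_vec S w p"
  unfolding Lp_vec_def
proof (clarify)
  fix j :: 'a assume j: "j \<in> Basis"
  have ae': "AE x in lebesgue_on S. z x \<bullet> j = y x \<bullet> j" using ae by eventually_elim simp
  have "(\<lambda>x. z x \<bullet> j) \<in> Lp_space S w p" using u j by (simp add: Lp_vec_def)
  then show "(\<lambda>x. y x \<bullet> j) \<in> Lp_space S w p" by (rule Lp_cong_AE[OF _ w S ae'])
qed

lemma Lp_vec_lincomb:
  assumes u: "z \<in> Lp_vec S w p" and v: "y \<in> Lp_vec S w p" and w: "w \<in> borel_measurable (lebesgue_on S)"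
    "AE x in lebesgue_on S. 0 \<le> w x" and p: "p > 0"
  shows "(\<lambda>x. c *\<^sub>R z x + d *\<^sub>R y x) \<in> Lp_vec S w p"
  unfolding Lp_vec_def
proof clarify
  fix j :: 'a assume "j \<in> Basis"
  then have "(\<lambda>x. c * (z x \<bullet> j) + d * (y x \<bullet> j)) \<in> Lp_space S w p"
    using u v by (intro Lp_lincomb[OF _ _ w p]) (auto simp: Lp_vec_def)
  then show "(\<lambda>x. (c *\<^sub>R z x + d *\<^sub>R y x) \<bullet> j) \<in> Lp_space S w p" by (simp add: inner_add_left)
qed

lemma powr_norm_le_components:
  fixes z :: "'a::euclidean_space"
  assumes p: "p > 0"
  shows "norm z powr p \<le> real DIM('a) powr p * (\<Sum>j\<in>Basis. \<bar>z \<bullet> j\<bar> powr p)"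
proof -
  define m where "m = Max ((\<lambda>j. \<bar>z \<bullet> j\<bar>) ` Basis)"
  have m: "\<And>j. j \<in> Basis \<Longrightarrow> \<bar>z \<bullet> j\<bar> \<le> m" unfolding m_def by simp
  have "m \<in> (\<lambda>j. \<bar>z \<bullet> j\<bar>) ` Basis" unfolding m_def by (rule Max_in) auto
  then obtain k where k: "k \<in> Basis" "m = \<bar>z \<bullet> k\<bar>" by blast
  have "norm z \<le> (\<Sum>j\<in>Basis. \<bar>z \<bullet> j\<bar>)" by (rule norm_le_l1)
  also have "\<dots> \<le> (\<Sum>j\<in>(Basis::'a set). m)" using m by (intro sum_mono) auto
  finally have "norm z powr p \<le> (real DIM('a) * m) powr p" using p by (intro powr_mono2) auto
  also have "\<dots> = real DIM('a) powr p * m powr p" using k by (simp add: powr_mult)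
  also have "m powr p \<le> (\<Sum>j\<in>Basis. \<bar>z \<bullet> j\<bar> powr p)"
    unfolding k(2) by (rule member_le_sum[OF k(1)]) auto
  finally show ?thesis by (simp add: mult_left_mono)
qed

lemma Lp_vec_norm_integrable:
  assumes z: "z \<in> Lp_vec S w p" and w: "w \<in> borel_measurable (lebesgue_on S)" "AE x in lebesgue_on S. 0 \<le> w x" and p: "p > 0"
  shows "integrable (lebesgue_on S) (\<lambda>x. w x * norm (z x) powr p)"
proof (rule Bochner_Integration.integrable_bound)
  show "integrable (lebesgue_on S) (\<lambda>x. real DIM('a) powr p * (\<Sum>j\<in>Basis. w x * \<bar>z x \<bullet> j\<bar> powr p))"
    using z by (intro integrable_mult_right Bochner_Integration.integrable_sum) (auto simp: Lp_vec_def Lp_space_def)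
  show "(\<lambda>x. w x * norm (z x) powr p) \<in> borel_measurable (lebesgue_on S)"
    using w(1) Lp_vec_measurable[OF z] by measurable
  show "AE x in lebesgue_on S. norm (w x * norm (z x) powr p) \<le> norm (real DIM('a) powr p * (\<Sum>j\<in>Basis. w x * \<bar>z x \<bullet> j\<bar> powr p))"
    using w(2)
  proof eventually_elim
    case (elim x)
    have "w x * norm (z x) powr p \<le> w x * (real DIM('a) powr p * (\<Sum>j\<in>Basis. \<bar>z x \<bullet> j\<bar> powr p))"
      using powr_norm_le_components[OF p, of "z x"] elim by (rule mult_left_mono)
    also have "\<dots> = real DIM('a) powr p * (\<Sum>j\<in>Basis. w x * \<bar>z x \<bullet> j\<bar> powr p)"
      by (simp add: sum_distrib_left mult_ac)
    finally show ?case using elim by simp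
  qed
qed

text \<open>A pointwise substitute for Hoelder's inequality with a square integrable factor:
  \<open>\<bar>f h\<bar>\<close> is bounded by \<open>e * f^2 + e\<close> plus a large multiple of
  \<open>\<bar>h\<bar> powr p\<close>. The first two terms are small because the domain has finite
  measure, the last one by hypothesis.\<close>

lemma Lp_null_sequence:
  assumes S: "finite_domain S" and p: "p \<ge> 2" and f: "f \<in> Lp_space S (\<lambda>_. 1) 2" and h: "\<And>n. h n \<in> Lp_space S (\<lambda>_. 1) p"
    and lim: "(\<lambda>n. LINT x|lebesgue_on S. \<bar>h n x\<bar> powr p) \<longlonglongrightarrow> 0"
  shows "(\<lambda>n. LINT x|lebesgue_on S. f x * h n x) \<longlonglongrightarrow> 0"
proof (rule LIMSEQ_I)
  fix r :: real assume r: "r > 0"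
  define F where "F = (LINT x|lebesgue_on S. (f x)\<^sup>2)"
  define m where "m = (LINT x|lebesgue_on S. (1::real))"
  have F0: "F \<ge> 0" "m \<ge> 0" unfolding F_def m_def by (auto intro!: Bochner_Integration.integral_nonneg)
  \<comment> \<open>Chosen so that the part that does not tend to 0, \<open>e * (F + m)\<close>,
    stays below \<open>r\<close>. The summand 1 keeps the denominator positive.\<close>
  define e where "e = r / (2 * (F + m + 1))"
  have e: "e > 0" "e * (F + m) < r"
  proof -
    show "e > 0" using r F0 by (simp add: e_def)
    then have "e * (F + m) \<le> e * (F + m + 1)" by simp
    also have "\<dots> = r / 2"
    proof -
      have "F + m + 1 \<noteq> 0" using F0 by linarith
      then show ?thesis unfolding e_def by (simp only: nonzero_divide_mult_cancel_right times_divide_eq_left) (simp add: divide_simps)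
    qed
    finally show "e * (F + m) < r" using r by simp
  qed
  \<comment> \<open>Where \<open>h\<close> exceeds \<open>e\<close> in absolute value, the exponent
    \<open>2 - p \<le> 0\<close> gives \<open>\<bar>h\<bar> powr (2 - p) \<le> C\<close>, hence
    \<open>h^2 \<le> C * \<bar>h\<bar> powr p\<close>; elsewhere
    \<open>h^2 \<le> e^2\<close>.\<close>
  define C where "C = e powr (2 - p)"
  have pw: "\<bar>f x * h n x\<bar> \<le> e * (f x)\<^sup>2 + (e + (C / e) * \<bar>h n x\<bar> powr p)" for x n
  proof -
    have "0 \<le> (e * \<bar>f x\<bar> - \<bar>h n x\<bar>)\<^sup>2" by simp
    then have "2 * (e * \<bar>f x * h n x\<bar>) \<le> e\<^sup>2 * (f x)\<^sup>2 + (h n x)\<^sup>2"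
      by (simp add: power2_diff abs_mult power_mult_distrib mult_ac)
    then have "e * \<bar>f x * h n x\<bar> \<le> e\<^sup>2 * (f x)\<^sup>2 + (h n x)\<^sup>2" using e(1) by (smt (verit) mult_nonneg_nonneg abs_ge_zero)
    moreover have "(h n x)\<^sup>2 \<le> e\<^sup>2 + C * \<bar>h n x\<bar> powr p"
    proof (cases "\<bar>h n x\<bar> \<le> e")
      case True
      then have "(h n x)\<^sup>2 \<le> e\<^sup>2" using e(1) by (simp add: abs_le_square_iff[symmetric])
      moreover have "0 \<le> C * \<bar>h n x\<bar> powr p" by (simp add: C_def)
      ultimately show ?thesis by linarith
    next
      case False
      then have "\<bar>h n x\<bar> powr (2 - p) \<le> C" unfolding C_def using p e by (intro powr_mono2') auto
      then have "\<bar>h n x\<bar> powr (2 - p) * \<bar>h n x\<bar> powr p \<le> C * \<bar>h n x\<bar> powr p" by (rule mult_right_mono) simp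
      moreover have "\<bar>h n x\<bar> powr (2 - p) * \<bar>h n x\<bar> powr p = (h n x)\<^sup>2"
        by (simp add: powr_add[symmetric] powr_abs_power2)
      ultimately show ?thesis by (smt (verit) zero_le_power2)
    qed
    ultimately have "e * \<bar>f x * h n x\<bar> \<le> e * (e * (f x)\<^sup>2 + (e + (C / e) * \<bar>h n x\<bar> powr p))"
      using e(1) by (simp add: algebra_simps power2_eq_square)
    then show ?thesis using e(1) by simp
  qed
  have if2: "integrable (lebesgue_on S) (\<lambda>x. (f x)\<^sup>2)" using f by (simp add: Lp_space_def powr_abs_power2)
  have ih: "integrable (lebesgue_on S) (\<lambda>x. \<bar>h n x\<bar> powr p)" for n using h[of n] by (simp add: Lp_space_def)
  have ic: "integrable (lebesgue_on S) (\<lambda>x. e)" by (rule finite_domain_measure(2)[OF S])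
  have ifh: "integrable (lebesgue_on S) (\<lambda>x. f x * h n x)" for n
    using Lp_subset[OF S h[of n], of 2] p f by (intro L2_mult_integrable) auto
  have bound: "\<bar>LINT x|lebesgue_on S. f x * h n x\<bar> \<le> e * (F + m) + (C / e) * (LINT x|lebesgue_on S. \<bar>h n x\<bar> powr p)" for n
  proof -
    have "\<bar>LINT x|lebesgue_on S. f x * h n x\<bar> \<le> (LINT x|lebesgue_on S. \<bar>f x * h n x\<bar>)"
      using integral_norm_bound[of "lebesgue_on S" "\<lambda>x. f x * h n x"] by simp
    also have "\<dots> \<le> (LINT x|lebesgue_on S. e * (f x)\<^sup>2 + (e + (C / e) * \<bar>h n x\<bar> powr p))"
      using if2 ih[of n] ic ifh[of n] pw by (intro integral_mono) auto
    also have "\<dots> = e * F + ((LINT x|lebesgue_on S. e) + (C / e) * (LINT x|lebesgue_on S. \<bar>h n x\<bar> powr p))"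
      using if2 ih[of n] ic by (simp add: F_def)
    also have "(LINT x|lebesgue_on S. e) = e * m"
      unfolding m_def using integral_mult_right_zero[of "lebesgue_on S" e "\<lambda>_. 1"] by simp
    finally show ?thesis by (simp add: algebra_simps)
  qed
  have "(\<lambda>n. e * (F + m) + (C / e) * (LINT x|lebesgue_on S. \<bar>h n x\<bar> powr p)) \<longlonglongrightarrow> e * (F + m) + (C / e) * 0"
    by (intro tendsto_intros lim)
  then have "\<forall>\<^sub>F n in sequentially. e * (F + m) + (C / e) * (LINT x|lebesgue_on S. \<bar>h n x\<bar> powr p) < r"
    using e(2) by (intro order_tendstoD(2)) auto
  then obtain N where "\<And>n. n \<ge> N \<Longrightarrow> e * (F + m) + (C / e) * (LINT x|lebesgue_on S. \<bar>h n x\<bar> powr p) < r"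
    unfolding eventually_sequentially by blast
  then show "\<exists>N. \<forall>n\<ge>N. norm ((LINT x|lebesgue_on S. f x * h n x) - 0) < r"
    using bound by (intro exI[of _ N]) (auto intro: order_le_less_trans)
qed

lemma Lp_norm_powr:
  assumes "AE x in lebesgue_on S. 0 \<le> w x" "p > 0"
  shows "Lp_norm S w p u powr p = (LINT x|lebesgue_on S. w x * norm (u x) powr p)"
proof -
  have "0 \<le> (LINT x|lebesgue_on S. w x * norm (u x) powr p)"
    using assms(1) by (intro integral_nonneg_AE) (auto elim!: eventually_mono)
  then show ?thesis using assms(2) by (simp add: Lp_norm_def powr_powr)
qed

lemma finite_domainD: "finite_domain S \<Longrightarrow> open S" "finite_domain S \<Longrightarrow> S \<in> sets lebesgue"
  by (auto simp: finite_domain_def intro: open_sets_lebesgue)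

lemma compact_support_Lp:
  fixes h :: "'a::euclidean_space \<Rightarrow> real"
  assumes S: "finite_domain S" and p: "p > 0" and h: "continuous_on UNIV h" "compact K" "\<And>x. x \<notin> K \<Longrightarrow> h x = 0"
  shows "h \<in> Lp_space S (\<lambda>_. 1) p"
proof -
  obtain M where M: "M > 0" "\<And>x. \<bar>h x\<bar> \<le> M" using compact_support_bounded[OF h] by blast
  have "(\<lambda>x. h x * 1) \<in> Lp_space S (\<lambda>_. 1) p"
    by (rule Lp_bounded_mult[OF Lp_const[OF S] continuous_measurable_lebesgue_on[OF h(1)] _ p]) (use M in auto)
  then show ?thesis by simp
qed

lemma test_fun_W1p:
  assumes S: "finite_domain S" and p: "p > 0" and \<phi>: "\<phi> \<in> test_fun S"
  shows "\<phi> \<in> W1p S p" "is_weak_grad S \<phi> (cgrad \<phi>)" "cgrad \<phi> \<in> Lp_vec S (\<lambda>_. 1) p" "\<phi> \<in> Lp_space S (\<lambda>_. 1) p"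
proof -
  obtain K where K: "compact K" "\<And>x. x \<notin> K \<Longrightarrow> \<phi> x = 0" "\<And>x. x \<notin> K \<Longrightarrow> cgrad \<phi> x = 0"
    "continuous_on UNIV \<phi>" "\<And>j. j \<in> Basis \<Longrightarrow> continuous_on UNIV (\<lambda>x. cgrad \<phi> x \<bullet> j)"
    by (rule test_fun_facts[OF \<phi>]) (rule that)
  show 1: "\<phi> \<in> Lp_space S (\<lambda>_. 1) p" by (rule compact_support_Lp[OF S p K(4,1,2)])
  show 2: "cgrad \<phi> \<in> Lp_vec S (\<lambda>_. 1) p"
    unfolding Lp_vec_def
  proof clarify
    fix j :: 'a assume "j \<in> Basis"
    then show "(\<lambda>x. cgrad \<phi> x \<bullet> j) \<in> Lp_space S (\<lambda>_. 1) p"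
      using K(3) by (intro compact_support_Lp[OF S p K(5) K(1)]) auto
  qed
  show 3: "is_weak_grad S \<phi> (cgrad \<phi>)"
    by (rule is_weak_grad_smooth[OF finite_domainD(1)[OF S] test_fun_Ck[OF \<phi>]])
  show "\<phi> \<in> W1p S p" using 1 2 3 by (auto simp: W1p_def)
qed

lemma W1pD:
  assumes S: "finite_domain S" and v: "v \<in> W1p S p"
  shows "v \<in> Lp_space S (\<lambda>_. 1) p" "is_weak_grad S v (weak_grad S v)" "weak_grad S v \<in> Lp_vec S (\<lambda>_. 1) p"
proof -
  from v obtain z where z: "v \<in> Lp_space S (\<lambda>_. 1) p" "z \<in> Lp_vec S (\<lambda>_. 1) p" "is_weak_grad S v z" by (auto simp: W1p_def)
  then show "v \<in> Lp_space S (\<lambda>_. 1) p" "is_weak_grad S v (weak_grad S v)" by (auto intro: weak_grad)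
  have "AE x in lebesgue_on S. z x = weak_grad S v x"
    using weak_grad_AE[OF finite_domainD(1)[OF S] z(3)] by eventually_elim simp
  then show "weak_grad S v \<in> Lp_vec S (\<lambda>_. 1) p"
    by (intro Lp_vec_cong_AE[OF z(2) _ finite_domainD(2)[OF S]]) auto
qed

lemma W1p_lincomb:
  assumes S: "finite_domain S" and p: "p > 0" and u: "u \<in> W1p S p" and v: "v \<in> W1p S p"
  shows "(\<lambda>x. c * u x + d * v x) \<in> W1p S p"
    "AE x in lebesgue_on S. weak_grad S (\<lambda>x. c * u x + d * v x) x = c *\<^sub>R weak_grad S u x + d *\<^sub>R weak_grad S v x"
proof -
  note U = W1pD[OF S u] and V = W1pD[OF S v]
  note w = is_weak_grad_lincomb[OF finite_domainD(1)[OF S] U(2) V(2), of c d]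
  have "(\<lambda>x. c * u x + d * v x) \<in> Lp_space S (\<lambda>_. 1) p" using U V p by (intro Lp_lincomb) auto
  moreover have "(\<lambda>x. c *\<^sub>R weak_grad S u x + d *\<^sub>R weak_grad S v x) \<in> Lp_vec S (\<lambda>_. 1) p" using U V p by (intro Lp_vec_lincomb) auto
  ultimately show "(\<lambda>x. c * u x + d * v x) \<in> W1p S p" using w by (auto simp: W1p_def)
  show "AE x in lebesgue_on S. weak_grad S (\<lambda>x. c * u x + d * v x) x = c *\<^sub>R weak_grad S u x + d *\<^sub>R weak_grad S v x"
    by (rule weak_grad_AE[OF finite_domainD(1)[OF S] w])
qed

lemma W1p_norm_powr:
  assumes p: "p > 0"
  shows "W1p_norm S p u powr p = (LINT x|lebesgue_on S. norm (weak_grad S u x) powr p) + (LINT x|lebesgue_on S. \<bar>u x\<bar> powr p)"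
proof -
  have "W1p_norm S p u powr p = Lp_norm S (\<lambda>_. 1) p (weak_grad S u) powr p + Lp_norm S (\<lambda>_. 1) p u powr p"
    using p by (simp add: W1p_norm_def powr_powr)
  also have "\<dots> = (LINT x|lebesgue_on S. norm (weak_grad S u x) powr p) + (LINT x|lebesgue_on S. \<bar>u x\<bar> powr p)"
    using p by (simp add: Lp_norm_powr)
  finally show ?thesis .
qed

lemma W1p_norm_null:
  assumes S: "finite_domain S" and p: "p > 0" and h: "\<And>n. h n \<in> W1p S p" and lim: "(\<lambda>n. W1p_norm S p (h n)) \<longlonglongrightarrow> 0" and j: "j \<in> Basis"
  shows "(\<lambda>n. LINT x|lebesgue_on S. \<bar>h n x\<bar> powr p) \<longlonglongrightarrow> 0"
    "(\<lambda>n. LINT x|lebesgue_on S. \<bar>weak_grad S (h n) x \<bullet> j\<bar> powr p) \<longlonglongrightarrow> 0"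
proof -
  have "(\<lambda>n. W1p_norm S p (h n) powr p) \<longlonglongrightarrow> 0 powr p"
    by (rule tendsto_powr'[OF lim tendsto_const]) (use p in \<open>simp add: W1p_norm_def\<close>)
  then have l: "(\<lambda>n. W1p_norm S p (h n) powr p) \<longlonglongrightarrow> 0" using p by simp
  have nn: "0 \<le> (LINT x|lebesgue_on S. norm (weak_grad S (h n) x) powr p)" "0 \<le> (LINT x|lebesgue_on S. \<bar>h n x\<bar> powr p)" for n
    by (auto intro!: Bochner_Integration.integral_nonneg)
  show "(\<lambda>n. LINT x|lebesgue_on S. \<bar>h n x\<bar> powr p) \<longlonglongrightarrow> 0"
    by (rule tendsto_sandwich[OF _ _ tendsto_const l]) (use nn in \<open>auto simp: W1p_norm_powr[OF p]\<close>)
  have "(LINT x|lebesgue_on S. \<bar>weak_grad S (h n) x \<bullet> j\<bar> powr p) \<le> W1p_norm S p (h n) powr p" for n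
  proof -
    note W = W1pD[OF S h[of n]]
    have "(LINT x|lebesgue_on S. \<bar>weak_grad S (h n) x \<bullet> j\<bar> powr p) \<le> (LINT x|lebesgue_on S. norm (weak_grad S (h n) x) powr p)"
    proof (rule integral_mono)
      show "integrable (lebesgue_on S) (\<lambda>x. \<bar>weak_grad S (h n) x \<bullet> j\<bar> powr p)" using W(3) j by (simp add: Lp_vec_def Lp_space_def)
      show "integrable (lebesgue_on S) (\<lambda>x. norm (weak_grad S (h n) x) powr p)" using Lp_vec_norm_integrable[OF W(3) _ _ p] by simp
      show "\<bar>weak_grad S (h n) x \<bullet> j\<bar> powr p \<le> norm (weak_grad S (h n) x) powr p" for x
        using p Basis_le_norm[OF j] by (intro powr_mono2) auto
    qed
    also have "\<dots> \<le> W1p_norm S p (h n) powr p" by (simp add: W1p_norm_powr[OF p])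
    finally show ?thesis .
  qed
  then show "(\<lambda>n. LINT x|lebesgue_on S. \<bar>weak_grad S (h n) x \<bullet> j\<bar> powr p) \<longlonglongrightarrow> 0"
    by (intro tendsto_sandwich[OF _ _ tendsto_const l]) (auto intro!: Bochner_Integration.integral_nonneg)
qed

lemma W1p_norm_zero:
  assumes S: "finite_domain S" and p: "p > 0" shows "W1p_norm S p (\<lambda>x. 0) = 0"
proof -
  have "is_weak_grad S (\<lambda>x::'a. 0) (\<lambda>x. 0)" by (simp add: is_weak_grad_def loc_integrable_def)
  then have "AE x in lebesgue_on S. weak_grad S (\<lambda>x. 0) x = 0" by (rule weak_grad_AE[OF finite_domainD(1)[OF S]])
  then have "(LINT x|lebesgue_on S. norm (weak_grad S (\<lambda>x. 0) x) powr p) = 0"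
    by (intro integral_eq_zero_AE) (auto elim!: eventually_mono simp: p)
  then have "W1p_norm S p (\<lambda>x. 0) powr p = 0" by (simp add: W1p_norm_powr[OF p])
  then show ?thesis by simp
qed

lemma test_fun_W1p_zero:
  assumes S: "finite_domain S" and p: "p > 0" and \<phi>: "\<phi> \<in> test_fun S" shows "\<phi> \<in> W1p_zero S p"
  using test_fun_W1p[OF S p \<phi>] W1p_norm_zero[OF S p] \<phi> by (auto simp: W1p_zero_def intro!: exI[of _ "\<lambda>_. \<phi>"])

lemma W1p_mono:
  assumes S: "finite_domain S" "finite_domain S'" "S' \<subseteq> S" and v: "v \<in> W1p S p"
  shows "v \<in> W1p S' p" "AE x in lebesgue_on S'. weak_grad S' v x = weak_grad S v x"
proof -
  note V = W1pD[OF S(1) v]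
  have w: "is_weak_grad S' v (weak_grad S v)"
    by (rule is_weak_grad_mono[OF V(2) finite_domainD(1)[OF S(1)] finite_domainD(1)[OF S(2)] S(3)])
  have L: "u \<in> Lp_space S' (\<lambda>_. 1) p" if "u \<in> Lp_space S (\<lambda>_. 1) p" for u
  proof -
    have "u \<in> borel_measurable (restrict_space (lebesgue_on S) S')" by (rule measurable_restrict_space1[OF Lp_measurable[OF that]])
    then have "u \<in> borel_measurable (lebesgue_on S')" using S by (simp add: restrict_restrict_space finite_domainD Int_absorb1)
    moreover have "integrable (lebesgue_on S') (\<lambda>x. 1 * \<bar>u x\<bar> powr p)"
      using that S by (intro integrable_lebesgue_on_subset[OF _ S(3)]) (auto simp: Lp_space_def finite_domainD)
    ultimately show ?thesis by (simp add: Lp_space_def)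
  qed
  show "v \<in> W1p S' p" using V w L by (auto simp: W1p_def Lp_vec_def)
  show "AE x in lebesgue_on S'. weak_grad S' v x = weak_grad S v x"
    by (rule weak_grad_AE[OF finite_domainD(1)[OF S(2)] w])
qed

section \<open>The weighted space of a single subdomain\<close>

locale weighted_domain =
  fixes S :: "'a::euclidean_space set" and a b :: "'a \<Rightarrow> real" and p cb :: real
  assumes dom: "finite_domain S" and p2: "p \<ge> 2" and aW: "a \<in> W1inf S" and apos: "AE x in lebesgue_on S. a x > 0"
    and bL: "b \<in> Linf_space S" and cb: "cb > 0" "AE x in lebesgue_on S. b x \<ge> cb"
begin

lemma oS: "open S" and mS: "S \<in> sets lebesgue" using finite_domainD[OF dom] by auto

lemma p0: "p > 0" using p2 by simp

lemma am: "a \<in> borel_measurable (lebesgue_on S)" and bm: "b \<in> borel_measurable (lebesgue_on S)"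
  using aW bL by (auto simp: W1inf_def Linf_space_def)

lemma a_ge: "AE x in lebesgue_on S. 0 \<le> a x" using apos by eventually_elim simp
lemma b_ge: "AE x in lebesgue_on S. 0 \<le> b x" using cb(2) by eventually_elim (use cb(1) in simp)

definition Ma where "Ma = (SOME M. AE x in lebesgue_on S. \<bar>a x\<bar> \<le> M)"
lemma Ma: "AE x in lebesgue_on S. \<bar>a x\<bar> \<le> Ma"
proof -
  have "\<exists>M. AE x in lebesgue_on S. \<bar>a x\<bar> \<le> M" using aW by (auto simp: W1inf_def Linf_space_def)
  then show ?thesis unfolding Ma_def by (rule someI_ex)
qed

definition Mb where "Mb = (SOME M. AE x in lebesgue_on S. \<bar>b x\<bar> \<le> M)"
lemma Mb: "AE x in lebesgue_on S. \<bar>b x\<bar> \<le> Mb"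
proof -
  have "\<exists>M. AE x in lebesgue_on S. \<bar>b x\<bar> \<le> M" using bL by (auto simp: Linf_space_def)
  then show ?thesis unfolding Mb_def by (rule someI_ex)
qed

definition da where "da = (SOME z. (\<forall>j\<in>Basis. (\<lambda>x. z x \<bullet> j) \<in> Linf_space S) \<and> is_weak_grad S a z)"
lemma da: "is_weak_grad S a da" "j \<in> Basis \<Longrightarrow> (\<lambda>x. da x \<bullet> j) \<in> Linf_space S"
proof -
  have "\<exists>z. (\<forall>j\<in>Basis. (\<lambda>x. z x \<bullet> j) \<in> Linf_space S) \<and> is_weak_grad S a z" using aW by (auto simp: W1inf_def)
  from someI_ex[OF this] show "is_weak_grad S a da" "j \<in> Basis \<Longrightarrow> (\<lambda>x. da x \<bullet> j) \<in> Linf_space S"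
    unfolding da_def by auto
qed

lemma da_bound:
  assumes "j \<in> Basis"
  obtains M where "(\<lambda>x. da x \<bullet> j) \<in> borel_measurable (lebesgue_on S)" "AE x in lebesgue_on S. \<bar>da x \<bullet> j\<bar> \<le> M"
    "AE x in lebesgue_on S. \<bar>a x\<bar> \<le> M"
proof -
  from da(2)[OF assms] obtain K where K: "(\<lambda>x. da x \<bullet> j) \<in> borel_measurable (lebesgue_on S)" "AE x in lebesgue_on S. \<bar>da x \<bullet> j\<bar> \<le> K"
    by (auto simp: Linf_space_def)
  have "AE x in lebesgue_on S. \<bar>da x \<bullet> j\<bar> \<le> max K Ma" using K(2) by eventually_elim simp
  moreover have "AE x in lebesgue_on S. \<bar>a x\<bar> \<le> max K Ma" using Ma by eventually_elim simp
  ultimately show ?thesis by (rule that[OF K(1)])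
qed

lemma product_grad_Lp:
  assumes v: "v \<in> Lp_space S (\<lambda>_. 1) p" and z: "z \<in> Lp_vec S (\<lambda>_. 1) p"
  shows "(\<lambda>x. a x *\<^sub>R z x + v x *\<^sub>R da x) \<in> Lp_vec S (\<lambda>_. 1) p"
  unfolding Lp_vec_def
proof clarify
  fix j :: 'a assume j: "j \<in> Basis"
  obtain M where M: "(\<lambda>x. da x \<bullet> j) \<in> borel_measurable (lebesgue_on S)" "AE x in lebesgue_on S. \<bar>da x \<bullet> j\<bar> \<le> M"
    using da_bound[OF j] by blast
  have "(\<lambda>x. a x * (z x \<bullet> j)) \<in> Lp_space S (\<lambda>_. 1) p"
    using z j by (intro Lp_bounded_mult[OF _ am Ma p0]) (simp add: Lp_vec_def)
  moreover have "(\<lambda>x. (da x \<bullet> j) * v x) \<in> Lp_space S (\<lambda>_. 1) p" by (rule Lp_bounded_mult[OF v M p0])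
  ultimately have "(\<lambda>x. 1 * (a x * (z x \<bullet> j)) + 1 * ((da x \<bullet> j) * v x)) \<in> Lp_space S (\<lambda>_. 1) p"
    by (rule Lp_lincomb) (use p0 in auto)
  then show "(\<lambda>x. (a x *\<^sub>R z x + v x *\<^sub>R da x) \<bullet> j) \<in> Lp_space S (\<lambda>_. 1) p"
    by (simp add: inner_add_left mult.commute)
qed

text \<open>Makes explicit the \<open>weak_grad\<close> of \<open>a v\<close> that occurs in
  \<open>is_wgrad\<close> only as a choice.\<close>

lemma product_weak_grad:
  assumes v: "v \<in> W1p S p"
  shows "is_weak_grad S (\<lambda>x. a x * v x) (\<lambda>x. a x *\<^sub>R weak_grad S v x + v x *\<^sub>R da x)"
  unfolding is_weak_grad_cgrad
proof (intro conjI ballI)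
  note V = W1pD[OF dom v]
  note pg = product_grad_Lp[OF V(1,3)]
  have av: "(\<lambda>x. a x * v x) \<in> Lp_space S (\<lambda>_. 1) p" by (rule Lp_bounded_mult[OF V(1) am Ma p0])
  have p1: "p \<ge> 1" using p2 by simp
  show "loc_integrable S (\<lambda>x. a x * v x)" by (rule integrable_loc_integrable[OF mS Lp_integrable[OF dom p1 av]])
  fix j :: 'a assume j: "j \<in> Basis"
  have pgj: "(\<lambda>x. (a x *\<^sub>R weak_grad S v x + v x *\<^sub>R da x) \<bullet> j) \<in> Lp_space S (\<lambda>_. 1) p" using pg j by (simp add: Lp_vec_def)
  show "loc_integrable S (\<lambda>x. (a x *\<^sub>R weak_grad S v x + v x *\<^sub>R da x) \<bullet> j)"
    by (rule integrable_loc_integrable[OF mS Lp_integrable[OF dom p1 pgj]])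
  fix \<phi> assume \<phi>: "\<phi> \<in> test_fun S"
  note T = test_fun_W1p[OF dom p0 \<phi>]
  have Tj: "(\<lambda>x. cgrad \<phi> x \<bullet> j) \<in> Lp_space S (\<lambda>_. 1) p" using T(3) j by (simp add: Lp_vec_def)
  obtain M where M: "(\<lambda>x. da x \<bullet> j) \<in> borel_measurable (lebesgue_on S)" "AE x in lebesgue_on S. \<bar>da x \<bullet> j\<bar> \<le> M" "AE x in lebesgue_on S. \<bar>a x\<bar> \<le> M"
    using da_bound[OF j] by blast
  have 0: "(LINT x|lebesgue_on S. a x * (weak_grad S v x \<bullet> j) * \<phi> x + v x * (da x \<bullet> j) * \<phi> x + v x * a x * (cgrad \<phi> x \<bullet> j)) = 0"
    by (rule weak_product_identity[OF oS V(2) da(1) am M(3,1,2) j \<phi>])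
  have i1: "integrable (lebesgue_on S) (\<lambda>x. ((a x *\<^sub>R weak_grad S v x + v x *\<^sub>R da x) \<bullet> j) * \<phi> x)"
    by (rule Lp_mult_integrable[OF dom p2 pgj T(4)])
  have i2: "integrable (lebesgue_on S) (\<lambda>x. (a x * v x) * (cgrad \<phi> x \<bullet> j))"
    by (rule Lp_mult_integrable[OF dom p2 av Tj])
  have "(LINT x|lebesgue_on S. ((a x *\<^sub>R weak_grad S v x + v x *\<^sub>R da x) \<bullet> j) * \<phi> x) + (LINT x|lebesgue_on S. (a x * v x) * (cgrad \<phi> x \<bullet> j)) =
    (LINT x|lebesgue_on S. ((a x *\<^sub>R weak_grad S v x + v x *\<^sub>R da x) \<bullet> j) * \<phi> x + (a x * v x) * (cgrad \<phi> x \<bullet> j))"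
    using i1 i2 by simp
  also have "\<dots> = (LINT x|lebesgue_on S. a x * (weak_grad S v x \<bullet> j) * \<phi> x + v x * (da x \<bullet> j) * \<phi> x + v x * a x * (cgrad \<phi> x \<bullet> j))"
    by (intro Bochner_Integration.integral_cong) (auto simp: inner_add_left algebra_simps)
  finally show "- (LINT x|lebesgue_on S. (a x * v x) * (cgrad \<phi> x \<bullet> j)) =
    (LINT x|lebesgue_on S. ((a x *\<^sub>R weak_grad S v x + v x *\<^sub>R da x) \<bullet> j) * \<phi> x)" using 0 by simp
qed

lemma product_grad_AE:
  assumes v: "v \<in> W1p S p"
  shows "AE x in lebesgue_on S. weak_grad S (\<lambda>x. a x * v x) x = a x *\<^sub>R weak_grad S v x + v x *\<^sub>R da x"
  by (rule weak_grad_AE[OF oS product_weak_grad[OF v]])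

lemma product_grad_component_Lp:
  assumes v: "v \<in> W1p S p" and j: "j \<in> Basis"
  shows "(\<lambda>x. weak_grad S (\<lambda>x. a x * v x) x \<bullet> j) \<in> Lp_space S (\<lambda>_. 1) p"
proof -
  have "AE x in lebesgue_on S. a x *\<^sub>R weak_grad S v x + v x *\<^sub>R da x = weak_grad S (\<lambda>x. a x * v x) x"
    using product_grad_AE[OF v] by eventually_elim simp
  from Lp_vec_cong_AE[OF product_grad_Lp[OF W1pD(1,3)[OF dom v]] _ mS this]
  show ?thesis using j by (simp add: Lp_vec_def)
qed

text \<open>The weight may degenerate, so \<open>z\<close> itself need not be integrable. The bound
  \<open>\<bar>z v\<bar> \<le> 1 + \<bar>z\<bar> powr p + \<bar>v\<bar> powr 2\<close> is therefore
  multiplied by \<open>a\<close> before integrating; it uses \<open>p \<ge> 2\<close>.\<close>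

lemma weighted_mult_integrable:
  assumes z: "z \<in> Lp_space S a p" and v: "v \<in> Lp_space S (\<lambda>_. 1) 2"
  shows "integrable (lebesgue_on S) (\<lambda>x. a x * z x * v x)"
proof (rule Bochner_Integration.integrable_bound)
  have m: "z \<in> borel_measurable (lebesgue_on S)" "v \<in> borel_measurable (lebesgue_on S)" using z v by (auto simp: Lp_space_def)
  have "integrable (lebesgue_on S) a" using Lp_integrable[OF dom _ Lp_bounded_mult[OF Lp_const[OF dom, of 1 1] am Ma]] by simp
  moreover have "v \<in> Lp_space S a 2" by (rule Lp_bounded_weight[OF v am Ma])
  ultimately show "integrable (lebesgue_on S) (\<lambda>x. a x + a x * \<bar>z x\<bar> powr p + a x * \<bar>v x\<bar> powr 2)"
    using z by (auto simp: Lp_space_def)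
  show "(\<lambda>x. a x * z x * v x) \<in> borel_measurable (lebesgue_on S)" using m am by measurable
  show "AE x in lebesgue_on S. norm (a x * z x * v x) \<le> norm (a x + a x * \<bar>z x\<bar> powr p + a x * \<bar>v x\<bar> powr 2)"
    using a_ge
  proof eventually_elim
    case (elim x)
    have "\<bar>z x * v x\<bar> \<le> (z x)\<^sup>2 + (v x)\<^sup>2" by (rule abs_mult_le_squares)
    also have "\<dots> \<le> 1 + \<bar>z x\<bar> powr p + \<bar>v x\<bar> powr 2"
      using powr_le_one_plus[of 2 p "\<bar>z x\<bar>"] p2 by (simp add: powr_abs_power2)
    finally have "a x * \<bar>z x * v x\<bar> \<le> a x * (1 + \<bar>z x\<bar> powr p + \<bar>v x\<bar> powr 2)" using elim by (rule mult_left_mono)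
    also have "\<dots> = a x + a x * \<bar>z x\<bar> powr p + a x * \<bar>v x\<bar> powr 2" by (simp add: algebra_simps)
    also have "\<dots> \<le> norm \<dots>" by simp
    finally show ?case using elim by (simp add: abs_mult mult.assoc)
  qed
qed

lemma W1p_zero_W1p: "v \<in> W1p_zero S p \<Longrightarrow> v \<in> W1p S p" by (simp add: W1p_zero_def)

lemma W1p_L2: "v \<in> W1p S p \<Longrightarrow> v \<in> Lp_space S (\<lambda>_. 1) 2"
  using Lp_subset[OF dom W1pD(1)[OF dom], of v p 2] p2 by simp

lemma is_wgrad_lincomb:
  assumes u: "u \<in> Lp_space S (\<lambda>_. 1) p" "is_wgrad S a p u z" and v: "v \<in> Lp_space S (\<lambda>_. 1) p" "is_wgrad S a p v y"
  shows "is_wgrad S a p (\<lambda>x. c * u x + d * v x) (\<lambda>x. c *\<^sub>R z x + d *\<^sub>R y x)"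
  unfolding is_wgrad_def
proof (intro conjI ballI)
  show "(\<lambda>x. c *\<^sub>R z x + d *\<^sub>R y x) \<in> Lp_vec S a p"
    using u v by (intro Lp_vec_lincomb[OF _ _ am a_ge p0]) (auto simp: is_wgrad_def)
  fix j :: 'a and w assume j: "j \<in> Basis" and w: "w \<in> W1p_zero S p"
  note W = W1p_zero_W1p[OF w]
  note g = product_grad_component_Lp[OF W j]
  let ?g = "\<lambda>x. weak_grad S (\<lambda>y. a y * w y) x \<bullet> j"
  have i: "integrable (lebesgue_on S) (\<lambda>x. u x * ?g x)" "integrable (lebesgue_on S) (\<lambda>x. v x * ?g x)"
    using Lp_mult_integrable[OF dom p2 u(1) g] Lp_mult_integrable[OF dom p2 v(1) g] .
  have k: "integrable (lebesgue_on S) (\<lambda>x. a x * (z x \<bullet> j) * w x)" "integrable (lebesgue_on S) (\<lambda>x. a x * (y x \<bullet> j) * w x)"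
    using u(2) v(2) j by (auto intro!: weighted_mult_integrable[OF _ W1p_L2[OF W]] simp: is_wgrad_def Lp_vec_def)
  have "- (LINT x|lebesgue_on S. (c * u x + d * v x) * ?g x) = - (LINT x|lebesgue_on S. c * (u x * ?g x) + d * (v x * ?g x))"
    by (simp add: distrib_right mult.assoc)
  also have "\<dots> = c * (- (LINT x|lebesgue_on S. u x * ?g x)) + d * (- (LINT x|lebesgue_on S. v x * ?g x))"
    using i by simp
  also have "\<dots> = c * (LINT x|lebesgue_on S. a x * (z x \<bullet> j) * w x) + d * (LINT x|lebesgue_on S. a x * (y x \<bullet> j) * w x)"
    using u(2) v(2) j w by (simp only: is_wgrad_def)
  also have "\<dots> = (LINT x|lebesgue_on S. c * (a x * (z x \<bullet> j) * w x) + d * (a x * (y x \<bullet> j) * w x))"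
    using k by simp
  also have "\<dots> = (LINT x|lebesgue_on S. a x * ((c *\<^sub>R z x + d *\<^sub>R y x) \<bullet> j) * w x)"
    by (intro Bochner_Integration.integral_cong) (auto simp: inner_add_left algebra_simps)
  finally show "- (LINT x|lebesgue_on S. (c * u x + d * v x) * ?g x) = (LINT x|lebesgue_on S. a x * ((c *\<^sub>R z x + d *\<^sub>R y x) \<bullet> j) * w x)" .
qed

text \<open>Testing determines only \<open>a z\<close>; positivity of \<open>a\<close> almost
  everywhere allows the division.\<close>

lemma is_wgrad_unique:
  assumes u: "is_wgrad S a p u z" "is_wgrad S a p u y"
  shows "AE x in lebesgue_on S. z x = y x"
proof (rule AE_euclidean_eqI)
  fix j :: 'a assume j: "j \<in> Basis"
  have zy: "(\<lambda>x. z x \<bullet> j) \<in> Lp_space S a p" "(\<lambda>x. y x \<bullet> j) \<in> Lp_space S a p" using u j by (auto simp: is_wgrad_def Lp_vec_def)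
  have i: "integrable (lebesgue_on S) (\<lambda>x. a x * (z x \<bullet> j))" "integrable (lebesgue_on S) (\<lambda>x. a x * (y x \<bullet> j))"
    using weighted_mult_integrable[OF zy(1) Lp_const[OF dom, of 1]] weighted_mult_integrable[OF zy(2) Lp_const[OF dom, of 1]] by auto
  have "AE x in lebesgue_on S. a x * (z x \<bullet> j) - a x * (y x \<bullet> j) = 0"
  proof (rule AE_zero_if_orthogonal_rat_bumps[OF oS])
    show "loc_integrable S (\<lambda>x. a x * (z x \<bullet> j) - a x * (y x \<bullet> j))"
      using i by (intro integrable_loc_integrable[OF mS]) auto
    fix \<phi> assume "\<phi> \<in> rat_bumps S"
    then have \<phi>: "\<phi> \<in> test_fun S" using rat_bumps_test_fun by blast
    note W = test_fun_W1p_zero[OF dom p0 \<phi>]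
    have k: "integrable (lebesgue_on S) (\<lambda>x. a x * (z x \<bullet> j) * \<phi> x)" "integrable (lebesgue_on S) (\<lambda>x. a x * (y x \<bullet> j) * \<phi> x)"
      using zy by (auto intro!: weighted_mult_integrable[OF _ W1p_L2[OF W1p_zero_W1p[OF W]]])
    have "(LINT x|lebesgue_on S. a x * (z x \<bullet> j) * \<phi> x) = (LINT x|lebesgue_on S. a x * (y x \<bullet> j) * \<phi> x)"
    proof -
      have "- (LINT x|lebesgue_on S. u x * (weak_grad S (\<lambda>y. a y * \<phi> y) x \<bullet> j)) = (LINT x|lebesgue_on S. a x * (z x \<bullet> j) * \<phi> x)"
        "- (LINT x|lebesgue_on S. u x * (weak_grad S (\<lambda>y. a y * \<phi> y) x \<bullet> j)) = (LINT x|lebesgue_on S. a x * (y x \<bullet> j) * \<phi> x)"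
        using u j W unfolding is_wgrad_def by blast+
      then show ?thesis by (rule subst)
    qed
    then show "(LINT x|lebesgue_on S. (a x * (z x \<bullet> j) - a x * (y x \<bullet> j)) * \<phi> x) = 0"
      using k by (simp add: left_diff_distrib)
  qed
  then show "AE x in lebesgue_on S. z x \<bullet> j = y x \<bullet> j"
    using apos by eventually_elim (simp add: right_diff_distrib[symmetric])
qed

lemma wgrad: "is_wgrad S a p u z \<Longrightarrow> is_wgrad S a p u (wgrad S a p u)"
  unfolding wgrad_def by (rule someI[of "is_wgrad S a p u"])

lemma wgrad_AE: "is_wgrad S a p u z \<Longrightarrow> AE x in lebesgue_on S. wgrad S a p u x = z x"
  using is_wgrad_unique wgrad by blast

lemma VwD:
  assumes "u \<in> Vw S a b p"
  shows "u \<in> Lp_space S b p" "u \<in> Lp_space S (\<lambda>_. 1) p" "is_wgrad S a p u (wgrad S a p u)" "wgrad S a p u \<in> Lp_vec S a p"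
    "u \<in> Lp_space S (\<lambda>_. 1) 2"
proof -
  show 1: "u \<in> Lp_space S b p" and 3: "is_wgrad S a p u (wgrad S a p u)" using assms wgrad by (auto simp: Vw_def)
  show 2: "u \<in> Lp_space S (\<lambda>_. 1) p" by (rule Lp_unweight[OF 1 cb])
  show "wgrad S a p u \<in> Lp_vec S a p" using 3 by (simp add: is_wgrad_def)
  show "u \<in> Lp_space S (\<lambda>_. 1) 2" using Lp_subset[OF dom 2, of 2] p2 by simp
qed

lemma Vw_lincomb:
  assumes u: "u \<in> Vw S a b p" and v: "v \<in> Vw S a b p"
  shows "(\<lambda>x. c * u x + d * v x) \<in> Vw S a b p"
    "AE x in lebesgue_on S. wgrad S a p (\<lambda>x. c * u x + d * v x) x = c *\<^sub>R wgrad S a p u x + d *\<^sub>R wgrad S a p v x"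
proof -
  note U = VwD[OF u] and V = VwD[OF v]
  note w = is_wgrad_lincomb[OF U(2,3) V(2,3), of c d]
  show "(\<lambda>x. c * u x + d * v x) \<in> Vw S a b p"
    using w Lp_lincomb[OF U(1) V(1) bm b_ge p0] by (auto simp: Vw_def)
  show "AE x in lebesgue_on S. wgrad S a p (\<lambda>x. c * u x + d * v x) x = c *\<^sub>R wgrad S a p u x + d *\<^sub>R wgrad S a p v x"
    by (rule wgrad_AE[OF w])
qed

text \<open>When \<open>w\<close> is a test function, the identity rearranges the Leibniz rule for
  \<open>a v\<close>. A general \<open>w\<close> is approximated by test functions in the norm of
  \<open>W1p\<close>, and \<open>Lp_null_sequence\<close> carries the two integrals, in which the
  remaining factors are fixed, to the limit.\<close>

lemma is_wgrad_W1p: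
  assumes v: "v \<in> W1p S p"
  shows "is_wgrad S a p v (weak_grad S v)"
  unfolding is_wgrad_def
proof (intro conjI ballI)
  note V = W1pD[OF dom v]
  show "weak_grad S v \<in> Lp_vec S a p" using V(3) by (auto simp: Lp_vec_def intro: Lp_bounded_weight[OF _ am Ma])
  fix j :: 'a and w assume j: "j \<in> Basis" and w: "w \<in> W1p_zero S p"
  note W = W1pD[OF dom W1p_zero_W1p[OF w]]
  have Vj: "(\<lambda>x. weak_grad S v x \<bullet> j) \<in> Lp_space S (\<lambda>_. 1) p" and Wj: "(\<lambda>x. weak_grad S w x \<bullet> j) \<in> Lp_space S (\<lambda>_. 1) p"
    using V(3) W(3) j by (auto simp: Lp_vec_def)
  obtain \<phi> where \<phi>: "\<And>n. \<phi> n \<in> test_fun S" and lim: "(\<lambda>n. W1p_norm S p (\<lambda>x. \<phi> n x - w x)) \<longlonglongrightarrow> 0"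
    using w by (auto simp: W1p_zero_def)
  note T = test_fun_W1p[OF dom p0 \<phi>]
  have h: "(\<lambda>x. \<phi> n x - w x) \<in> W1p S p" for n
    using W1p_lincomb(1)[OF dom p0 T(1)[of n] W1p_zero_W1p[OF w], of 1 "-1"] by simp
  note hW = W1pD[OF dom h]
  have hg: "AE x in lebesgue_on S. weak_grad S (\<lambda>x. \<phi> n x - w x) x = cgrad (\<phi> n) x - weak_grad S w x" for n
    using W1p_lincomb(2)[OF dom p0 T(1)[of n] W1p_zero_W1p[OF w], of 1 "-1"] weak_grad_AE[OF oS T(2)[of n]]
    by (simp, eventually_elim) simp
  have hj: "(\<lambda>x. weak_grad S (\<lambda>x. \<phi> n x - w x) x \<bullet> j) \<in> Lp_space S (\<lambda>_. 1) p" for n using hW(3)[of n] j by (simp add: Lp_vec_def)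
  have av: "(\<lambda>x. a x * v x) \<in> Lp_space S (\<lambda>_. 1) p" by (rule Lp_bounded_mult[OF V(1) am Ma p0])
  \<comment> \<open>\<open>P\<close> is the \<open>j\<close>-th component of the weak gradient of
    \<open>a v\<close>.\<close>
  define P where "P x = (a x *\<^sub>R weak_grad S v x + v x *\<^sub>R da x) \<bullet> j" for x
  have P: "P \<in> Lp_space S (\<lambda>_. 1) p" using product_grad_Lp[OF V(1,3)] j by (simp add: Lp_vec_def P_def[abs_def])
  have sub2: "f \<in> Lp_space S (\<lambda>_. 1) 2" if "f \<in> Lp_space S (\<lambda>_. 1) p" for f using Lp_subset[OF dom that, of 2] p2 by simp
  have l1: "(\<lambda>n. LINT x|lebesgue_on S. P x * (\<phi> n x - w x)) \<longlonglongrightarrow> 0"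
    by (rule Lp_null_sequence[OF dom p2 sub2[OF P] hW(1) W1p_norm_null(1)[OF dom p0 h lim j]])
  have l2: "(\<lambda>n. LINT x|lebesgue_on S. (a x * v x) * (weak_grad S (\<lambda>x. \<phi> n x - w x) x \<bullet> j)) \<longlonglongrightarrow> 0"
    by (rule Lp_null_sequence[OF dom p2 sub2[OF av] hj W1p_norm_null(2)[OF dom p0 h lim j]])
  have Tj: "(\<lambda>x. cgrad (\<phi> n) x \<bullet> j) \<in> Lp_space S (\<lambda>_. 1) p" for n using T(3)[of n] j by (simp add: Lp_vec_def)
  note I = Lp_mult_integrable[OF dom p2]
  have eq: "(LINT x|lebesgue_on S. (a x * v x) * (weak_grad S (\<lambda>x. \<phi> n x - w x) x \<bullet> j)) =
     - (LINT x|lebesgue_on S. P x * \<phi> n x) - (LINT x|lebesgue_on S. (a x * v x) * (weak_grad S w x \<bullet> j))" for n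
  proof -
    have "(LINT x|lebesgue_on S. (a x * v x) * (weak_grad S (\<lambda>x. \<phi> n x - w x) x \<bullet> j)) =
      (LINT x|lebesgue_on S. (a x * v x) * (cgrad (\<phi> n) x \<bullet> j) - (a x * v x) * (weak_grad S w x \<bullet> j))"
    proof (rule integral_cong_AE)
      show "AE x in lebesgue_on S. (a x * v x) * (weak_grad S (\<lambda>x. \<phi> n x - w x) x \<bullet> j) = (a x * v x) * (cgrad (\<phi> n) x \<bullet> j) - (a x * v x) * (weak_grad S w x \<bullet> j)"
        using hg[of n] by eventually_elim (simp add: inner_diff_left right_diff_distrib)
    qed (use I[OF av hj[of n]] I[OF av Tj[of n]] I[OF av Wj] in auto)
    also have "\<dots> = (LINT x|lebesgue_on S. (a x * v x) * (cgrad (\<phi> n) x \<bullet> j)) - (LINT x|lebesgue_on S. (a x * v x) * (weak_grad S w x \<bullet> j))"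
      using I[OF av Tj[of n]] I[OF av Wj] by simp
    also have "(LINT x|lebesgue_on S. (a x * v x) * (cgrad (\<phi> n) x \<bullet> j)) = - (LINT x|lebesgue_on S. P x * \<phi> n x)"
    proof -
      have "- (LINT x|lebesgue_on S. (a x * v x) * (cgrad (\<phi> n) x \<bullet> j)) = (LINT x|lebesgue_on S. P x * \<phi> n x)"
        using product_weak_grad[OF v] j \<phi>[of n] unfolding is_weak_grad_cgrad P_def by blast
      then show ?thesis by linarith
    qed
    finally show ?thesis .
  qed
  have eq1: "(LINT x|lebesgue_on S. P x * (\<phi> n x - w x)) = (LINT x|lebesgue_on S. P x * \<phi> n x) - (LINT x|lebesgue_on S. P x * w x)" for n
    using I[OF P T(4)[of n]] I[OF P W(1)] by (simp add: right_diff_distrib)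
  \<comment> \<open>In the sum the integrals that contain \<open>\<phi> n\<close> cancel by the
    definition of the weak gradient of \<open>a v\<close>. What remains does not depend on
    \<open>n\<close> and must equal its limit 0.\<close>
  have "(\<lambda>n. (LINT x|lebesgue_on S. (a x * v x) * (weak_grad S (\<lambda>x. \<phi> n x - w x) x \<bullet> j)) + (LINT x|lebesgue_on S. P x * (\<phi> n x - w x))) \<longlonglongrightarrow> 0 + 0"
    by (intro tendsto_add l1 l2)
  then have "- (LINT x|lebesgue_on S. (a x * v x) * (weak_grad S w x \<bullet> j)) - (LINT x|lebesgue_on S. P x * w x) = 0"
    unfolding eq eq1 by (simp add: LIMSEQ_const_iff)
  then have fin: "(LINT x|lebesgue_on S. (a x * v x) * (weak_grad S w x \<bullet> j)) + (LINT x|lebesgue_on S. P x * w x) = 0" by simp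
  note pr = product_grad_component_Lp[OF W1p_zero_W1p[OF w] j]
  have azw: "integrable (lebesgue_on S) (\<lambda>x. a x * (weak_grad S v x \<bullet> j) * w x)"
    using I[OF Lp_bounded_mult[OF Vj am Ma p0] W(1)] .
  have "(LINT x|lebesgue_on S. v x * (weak_grad S (\<lambda>y. a y * w y) x \<bullet> j)) =
     (LINT x|lebesgue_on S. (a x * v x) * (weak_grad S w x \<bullet> j) + (P x * w x - a x * (weak_grad S v x \<bullet> j) * w x))"
  proof (rule integral_cong_AE)
    show "AE x in lebesgue_on S. v x * (weak_grad S (\<lambda>y. a y * w y) x \<bullet> j) = (a x * v x) * (weak_grad S w x \<bullet> j) + (P x * w x - a x * (weak_grad S v x \<bullet> j) * w x)"
      using product_grad_AE[OF W1p_zero_W1p[OF w]] by eventually_elim (simp add: P_def inner_add_left algebra_simps)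
  qed (use I[OF V(1) pr] I[OF av Wj] I[OF P W(1)] azw in auto)
  also have "\<dots> = (LINT x|lebesgue_on S. (a x * v x) * (weak_grad S w x \<bullet> j)) + ((LINT x|lebesgue_on S. P x * w x) - (LINT x|lebesgue_on S. a x * (weak_grad S v x \<bullet> j) * w x))"
    using I[OF av Wj] I[OF P W(1)] azw by simp
  finally show "- (LINT x|lebesgue_on S. v x * (weak_grad S (\<lambda>y. a y * w y) x \<bullet> j)) = (LINT x|lebesgue_on S. a x * (weak_grad S v x \<bullet> j) * w x)"
    using fin by simp
qed

lemma W1p_Vw:
  assumes "v \<in> W1p S p"
  shows "v \<in> Vw S a b p" "AE x in lebesgue_on S. wgrad S a p v x = weak_grad S v x"
  using is_wgrad_W1p[OF assms] Lp_bounded_weight[OF W1pD(1)[OF dom assms] bm Mb] wgrad_AE by (auto simp: Vw_def)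

end

text \<open>Functions produced by \<open>restr_time\<close> are undefined outside \<open>S\<close>.
  This and the following congruence rules show that gradient, membership and norms see only the
  values on \<open>S\<close>.\<close>

lemma is_wgrad_cong:
  assumes "\<And>x. x \<in> S \<Longrightarrow> u x = v x" shows "is_wgrad S a p u = is_wgrad S a p v"
proof (rule ext)
  fix z
  have "(LINT x|lebesgue_on S. u x * g x) = (LINT x|lebesgue_on S. v x * g x)" for g
    using assms by (intro Bochner_Integration.integral_cong) auto
  then show "is_wgrad S a p u z = is_wgrad S a p v z" by (simp add: is_wgrad_def)
qed

lemma wgrad_cong: "(\<And>x. x \<in> S \<Longrightarrow> u x = v x) \<Longrightarrow> wgrad S a p u = wgrad S a p v"
  unfolding wgrad_def by (simp add: is_wgrad_cong[of S u v])

lemma Lp_space_cong: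
  assumes "\<And>x. x \<in> S \<Longrightarrow> u x = v x" shows "u \<in> Lp_space S w p \<longleftrightarrow> v \<in> Lp_space S w p"
proof -
  have "u \<in> borel_measurable (lebesgue_on S) \<longleftrightarrow> v \<in> borel_measurable (lebesgue_on S)"
    using assms by (intro measurable_cong) auto
  moreover have "integrable (lebesgue_on S) (\<lambda>x. w x * \<bar>u x\<bar> powr p) \<longleftrightarrow> integrable (lebesgue_on S) (\<lambda>x. w x * \<bar>v x\<bar> powr p)"
    using assms by (intro Bochner_Integration.integrable_cong) auto
  ultimately show ?thesis by (simp add: Lp_space_def)
qed

lemma Vw_cong:
  assumes "\<And>x. x \<in> S \<Longrightarrow> u x = v x" shows "u \<in> Vw S a b p \<longleftrightarrow> v \<in> Vw S a b p"
  using Lp_space_cong[of S u v] is_wgrad_cong[of S u v] assms by (simp add: Vw_def)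

lemma Lp_norm_cong:
  assumes "\<And>x. x \<in> S \<Longrightarrow> u x = v x" shows "Lp_norm S w p u = Lp_norm S w p v"
proof -
  have "(LINT x|lebesgue_on S. w x * norm (u x) powr p) = (LINT x|lebesgue_on S. w x * norm (v x) powr p)"
    using assms by (intro Bochner_Integration.integral_cong) auto
  then show ?thesis by (simp add: Lp_norm_def)
qed

lemma Vw_norm_cong: "(\<And>x. x \<in> S \<Longrightarrow> u x = v x) \<Longrightarrow> Vw_norm S a b p u = Vw_norm S a b p v"
  unfolding Vw_norm_def using wgrad_cong[of S u v] Lp_norm_cong[of S u v] by simp

section \<open>Bochner spaces and the time derivative\<close>

abbreviation I0 :: "real \<Rightarrow> real measure" where "I0 T \<equiv> lebesgue_on {0<..<T}"

lemma I0_sets: "{0<..<T::real} \<in> sets lebesgue" by (rule open_sets_lebesgue) simp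

lemma finite_domain_interval: "finite_domain {0<..<T::real}"
  by (simp add: finite_domain_def bounded_Ioo)

text \<open>The part of \<open>bochner_simple\<close> that does not mention the space. It can be
  applied to values that combine elements of different spaces, such as a functional evaluated at a
  vector.\<close>

definition fin_meas :: "real \<Rightarrow> (real \<Rightarrow> 'y) \<Rightarrow> bool" where
  "fin_meas T s \<longleftrightarrow> finite (s ` {0<..<T}) \<and> (\<forall>x. {t \<in> {0<..<T}. s t = x} \<in> sets lebesgue)"

lemma bochner_simple_fin_meas: "bochner_simple T X s \<longleftrightarrow> fin_meas T s \<and> s ` {0<..<T} \<subseteq> X"
  by (auto simp: bochner_simple_def fin_meas_def)

lemma fin_meas_pred:
  assumes "fin_meas T s" shows "{t \<in> {0<..<T}. P (s t)} \<in> sets lebesgue"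
proof -
  have "{t \<in> {0<..<T}. P (s t)} = (\<Union>x\<in>{x \<in> s ` {0<..<T}. P x}. {t \<in> {0<..<T}. s t = x})" by auto
  also have "\<dots> \<in> sets lebesgue" using assms by (intro sets.finite_UN) (auto simp: fin_meas_def)
  finally show ?thesis .
qed

lemma fin_meas_measurable:
  fixes G :: "'y \<Rightarrow> 'b::topological_space"
  assumes "fin_meas T s" shows "(\<lambda>t. G (s t)) \<in> measurable (I0 T) borel"
proof (rule measurableI)
  fix A assume "A \<in> sets (borel :: 'b measure)"
  have "(\<lambda>t. G (s t)) -` A \<inter> space (I0 T) = {t \<in> {0<..<T}. G (s t) \<in> A}" by auto
  also have "\<dots> \<in> sets (I0 T)"
    using fin_meas_pred[OF assms, of "\<lambda>x. G x \<in> A"] by (auto simp: sets_restrict_space intro!: image_eqI[where x="{t \<in> {0<..<T}. G (s t) \<in> A}"])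
  finally show "(\<lambda>t. G (s t)) -` A \<inter> space (I0 T) \<in> sets (I0 T)" .
qed simp

lemma fin_meas_comp2:
  assumes "fin_meas T s" "fin_meas T r" shows "fin_meas T (\<lambda>t. F (s t) (r t))"
proof -
  have "(\<lambda>t. F (s t) (r t)) ` {0<..<T} \<subseteq> (\<lambda>(x, y). F x y) ` (s ` {0<..<T} \<times> r ` {0<..<T})" by auto
  moreover have "finite ((\<lambda>(x, y). F x y) ` (s ` {0<..<T} \<times> r ` {0<..<T}))"
  proof -
    have "finite (s ` {0<..<T})" "finite (r ` {0<..<T})" using assms by (simp_all add: fin_meas_def)
    then show ?thesis by (rule finite_imageI[OF finite_cartesian_product])
  qed
  moreover have "{t \<in> {0<..<T}. F (s t) (r t) = z} \<in> sets lebesgue" for z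
  proof -
    have "{t \<in> {0<..<T}. F (s t) (r t) = z} = (\<Union>x\<in>s ` {0<..<T}. {t \<in> {0<..<T}. s t = x} \<inter> {t \<in> {0<..<T}. F x (r t) = z})" by auto
    also have "\<dots> \<in> sets lebesgue"
    proof (intro sets.finite_UN sets.Int)
      show "finite (s ` {0<..<T})" using assms(1) by (simp add: fin_meas_def)
      show "{t \<in> {0<..<T}. s t = x} \<in> sets lebesgue" for x using assms(1) unfolding fin_meas_def by blast
      show "{t \<in> {0<..<T}. F x (r t) = z} \<in> sets lebesgue" for x by (rule fin_meas_pred[OF assms(2)])
    qed
    finally show ?thesis .
  qed
  ultimately show ?thesis unfolding fin_meas_def by (blast intro: finite_subset)
qed

lemma fin_meas_const: "fin_meas T (\<lambda>t. c)"
proof -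
  have "{t \<in> {0<..<T}. c = x} = (if c = x then {0<..<T} else {})" for x by auto
  then have "{t \<in> {0<..<T}. c = x} \<in> sets lebesgue" for x using I0_sets[of T] by simp
  moreover have "finite ((\<lambda>t. c) ` {0<..<T})" by (rule finite_subset[of _ "{c}"]) auto
  ultimately show ?thesis by (simp add: fin_meas_def)
qed

lemma fin_meas_indicator:
  assumes "E \<in> sets lebesgue" shows "fin_meas T (\<lambda>t. if t \<in> E then x else y)"
proof -
  have "(\<lambda>t. if t \<in> E then x else y) ` {0<..<T} \<subseteq> {x, y}" by auto
  moreover have "{t \<in> {0<..<T}. (if t \<in> E then x else y) = z} \<in> sets lebesgue" for z
  proof -
    have eq: "{t \<in> {0<..<T}. (if t \<in> E then x else y) = z} =
      (if x = z then {0<..<T} \<inter> E else {}) \<union> (if y = z then {0<..<T} - E else {})"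
      by (rule set_eqI) (simp split: if_splits, blast?)
    have "{0<..<T} \<inter> E \<in> sets lebesgue" "{0<..<T} - E \<in> sets lebesgue" using assms I0_sets[of T] by blast+
    then show ?thesis unfolding eq by (intro sets.Un) simp_all
  qed
  ultimately show ?thesis unfolding fin_meas_def by (blast intro: finite_subset)
qed

lemma AE_limit_measurable:
  fixes f :: "nat \<Rightarrow> real \<Rightarrow> real"
  assumes f: "\<And>n. f n \<in> borel_measurable (I0 T)" and lim: "AE t in I0 T. (\<lambda>n. f n t) \<longlonglongrightarrow> g t"
  shows "g \<in> borel_measurable (I0 T)"
proof -
  have "(\<lambda>t. lim (\<lambda>n. f n t)) \<in> borel_measurable (I0 T)" using f by (rule borel_measurable_lim_metric)
  moreover have "AE t in I0 T. lim (\<lambda>n. f n t) = g t" using lim by eventually_elim (rule limI)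
  ultimately show ?thesis by (rule measurable_lebesgue_on_AE[OF _ I0_sets])
qed

lemma AE_I0: "AE t in I0 T. t \<in> {0<..<T}"
  by (rule AE_I2) simp

locale seminormed =
  fixes X :: "('y \<Rightarrow> real) set" and N :: "('y \<Rightarrow> real) \<Rightarrow> real"
  assumes zero_mem: "(\<lambda>y. 0) \<in> X"
    and lin: "u \<in> X \<Longrightarrow> v \<in> X \<Longrightarrow> (\<lambda>y. c * u y + d * v y) \<in> X"
    and tri: "u \<in> X \<Longrightarrow> v \<in> X \<Longrightarrow> N (\<lambda>y. u y + v y) \<le> N u + N v"
    and hom: "u \<in> X \<Longrightarrow> N (\<lambda>y. c * u y) = \<bar>c\<bar> * N u"
begin

lemma scale_mem: "u \<in> X \<Longrightarrow> (\<lambda>y. c * u y) \<in> X" using lin[of u u c 0] by simp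
lemma diff_mem: "u \<in> X \<Longrightarrow> v \<in> X \<Longrightarrow> (\<lambda>y. u y - v y) \<in> X" using lin[of u v 1 "-1"] by simp

lemma N_zero: "N (\<lambda>y. 0) = 0" using hom[OF zero_mem, of 0] by simp

lemma N_neg: "u \<in> X \<Longrightarrow> N (\<lambda>y. - u y) = N u" using hom[of u "-1"] by simp

lemma N_nonneg: "u \<in> X \<Longrightarrow> 0 \<le> N u"
  using tri[of u "\<lambda>y. -1 * u y"] scale_mem[of u "-1"] hom[of u "-1"] N_zero by simp

lemma N_lin: "u \<in> X \<Longrightarrow> v \<in> X \<Longrightarrow> N (\<lambda>y. c * u y + d * v y) \<le> \<bar>c\<bar> * N u + \<bar>d\<bar> * N v"
  using tri[of "\<lambda>y. c * u y" "\<lambda>y. d * v y"] scale_mem hom by simp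

lemma N_diff_le: "u \<in> X \<Longrightarrow> v \<in> X \<Longrightarrow> N (\<lambda>y. u y - v y) \<le> N u + N v"
  using N_lin[of u v 1 "-1"] by simp

lemma N_diff_commute: "u \<in> X \<Longrightarrow> v \<in> X \<Longrightarrow> N (\<lambda>y. u y - v y) = N (\<lambda>y. v y - u y)"
  using N_neg[OF diff_mem[of u v]] by simp

lemma N_abs_diff: assumes "u \<in> X" "v \<in> X" shows "\<bar>N u - N v\<bar> \<le> N (\<lambda>y. u y - v y)"
proof -
  have "N u \<le> N (\<lambda>y. u y - v y) + N v" "N v \<le> N (\<lambda>y. v y - u y) + N u"
    using tri[OF diff_mem[OF assms] assms(2)] tri[OF diff_mem[OF assms(2,1)] assms(1)] by simp_all
  then show ?thesis using N_diff_commute[OF assms] by simp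
qed

lemma simple_mem: "bochner_simple T X s \<Longrightarrow> t \<in> {0<..<T} \<Longrightarrow> s t \<in> X" by (auto simp: bochner_simple_def)

lemma simple_lin:
  assumes "bochner_simple T X s" "bochner_simple T X r" shows "bochner_simple T X (\<lambda>t y. c * s t y + d * r t y)"
  unfolding bochner_simple_fin_meas
proof
  show "fin_meas T (\<lambda>t y. c * s t y + d * r t y)"
    using assms fin_meas_comp2[of T s r "\<lambda>u v y. c * u y + d * v y"] by (simp add: bochner_simple_fin_meas)
  show "(\<lambda>t y. c * s t y + d * r t y) ` {0<..<T} \<subseteq> X"
    by (rule image_subsetI, rule lin) (use assms simple_mem in blast)+
qed

lemma bochner_measurableE:
  assumes "bochner_measurable T X N u"
  obtains s where "\<And>n::nat. bochner_simple T X (s n)" "AE t in I0 T. u t \<in> X \<and> (\<forall>n. s n t \<in> X) \<and> (\<lambda>n. N (\<lambda>y. s n t y - u t y)) \<longlonglongrightarrow> 0"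
proof -
  from assms obtain s where s: "\<And>n::nat. bochner_simple T X (s n)" "AE t in I0 T. u t \<in> X" "AE t in I0 T. (\<lambda>n. N (\<lambda>y. s n t y - u t y)) \<longlonglongrightarrow> 0"
    by (auto simp: bochner_measurable_def)
  have "AE t in I0 T. u t \<in> X \<and> (\<forall>n. s n t \<in> X) \<and> (\<lambda>n. N (\<lambda>y. s n t y - u t y)) \<longlonglongrightarrow> 0"
    using s(2,3) AE_I0[of T] by eventually_elim (use s(1) simple_mem in blast)
  with s(1) show ?thesis by (rule that)
qed

lemma bochner_measurable_lin:
  assumes u: "bochner_measurable T X N u" and v: "bochner_measurable T X N v"
  shows "bochner_measurable T X N (\<lambda>t y. c * u t y + d * v t y)"
proof -
  obtain s where s: "\<And>n::nat. bochner_simple T X (s n)" "AE t in I0 T. u t \<in> X \<and> (\<forall>n. s n t \<in> X) \<and> (\<lambda>n. N (\<lambda>y. s n t y - u t y)) \<longlonglongrightarrow> 0"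
    using u by (rule bochner_measurableE) (rule that)
  obtain r where r: "\<And>n::nat. bochner_simple T X (r n)" "AE t in I0 T. v t \<in> X \<and> (\<forall>n. r n t \<in> X) \<and> (\<lambda>n. N (\<lambda>y. r n t y - v t y)) \<longlonglongrightarrow> 0"
    using v by (rule bochner_measurableE) (rule that)
  have "AE t in I0 T. (\<lambda>n. N (\<lambda>y. (c * s n t y + d * r n t y) - (c * u t y + d * v t y))) \<longlonglongrightarrow> 0"
    using s(2) r(2)
  proof eventually_elim
    case (elim t)
    have l: "(\<lambda>n. \<bar>c\<bar> * N (\<lambda>y. s n t y - u t y) + \<bar>d\<bar> * N (\<lambda>y. r n t y - v t y)) \<longlonglongrightarrow> 0"
      using elim by (intro tendsto_eq_intros) auto
    have "N (\<lambda>y. (c * s n t y + d * r n t y) - (c * u t y + d * v t y)) \<le> \<bar>c\<bar> * N (\<lambda>y. s n t y - u t y) + \<bar>d\<bar> * N (\<lambda>y. r n t y - v t y)" for n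
      using N_lin[of "\<lambda>y. s n t y - u t y" "\<lambda>y. r n t y - v t y" c d] elim diff_mem by (simp add: algebra_simps)
    moreover have "0 \<le> N (\<lambda>y. (c * s n t y + d * r n t y) - (c * u t y + d * v t y))" for n
      using elim by (intro N_nonneg diff_mem lin) auto
    ultimately show ?case by (intro tendsto_sandwich[OF _ _ tendsto_const l]) auto
  qed
  moreover have "AE t in I0 T. (\<lambda>y. c * u t y + d * v t y) \<in> X" using s(2) r(2) by eventually_elim (use lin in blast)
  moreover have "bochner_simple T X (\<lambda>t y. c * s n t y + d * r n t y)" for n by (rule simple_lin[OF s(1) r(1)])
  ultimately show ?thesis unfolding bochner_measurable_def
    by (intro conjI exI[of _ "\<lambda>n t y. c * s n t y + d * r n t y"]) auto
qed

lemma bochner_norm_measurable: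
  assumes u: "bochner_measurable T X N u" shows "(\<lambda>t. N (u t)) \<in> borel_measurable (I0 T)"
proof -
  obtain s where s: "\<And>n::nat. bochner_simple T X (s n)" "AE t in I0 T. u t \<in> X \<and> (\<forall>n. s n t \<in> X) \<and> (\<lambda>n. N (\<lambda>y. s n t y - u t y)) \<longlonglongrightarrow> 0"
    using u by (rule bochner_measurableE) (rule that)
  show ?thesis
  proof (rule AE_limit_measurable)
    show "(\<lambda>t. N (s n t)) \<in> borel_measurable (I0 T)" for n
      using s(1)[of n] by (intro fin_meas_measurable[where s="s n"]) (simp add: bochner_simple_fin_meas)
    show "AE t in I0 T. (\<lambda>n. N (s n t)) \<longlonglongrightarrow> N (u t)"
      using s(2)
    proof eventually_elim
      case (elim t)
      have "norm (N (s n t) - N (u t)) \<le> N (\<lambda>y. s n t y - u t y)" for n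
        unfolding real_norm_def by (rule N_abs_diff) (use elim in simp_all)
      moreover have "(\<lambda>n. N (\<lambda>y. s n t y - u t y)) \<longlonglongrightarrow> 0" using elim by (elim conjE)
      ultimately have "(\<lambda>n. N (s n t) - N (u t)) \<longlonglongrightarrow> 0"
        by (rule Lim_null_comparison[OF always_eventually[OF allI]])
      then show ?case by (rule LIM_zero_cancel)
    qed
  qed
qed

lemma bochner_Lp_lin:
  assumes u: "u \<in> bochner_Lp T X N r" and v: "v \<in> bochner_Lp T X N r" and r: "r > 0"
  shows "(\<lambda>t y. c * u t y + d * v t y) \<in> bochner_Lp T X N r"
proof -
  have m: "bochner_measurable T X N u" "bochner_measurable T X N v" using u v by (auto simp: bochner_Lp_def)
  note m3 = bochner_measurable_lin[OF m, of c d]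
  have "integrable (I0 T) (\<lambda>t. N (\<lambda>y. c * u t y + d * v t y) powr r)"
  proof (rule Bochner_Integration.integrable_bound)
    show "integrable (I0 T) (\<lambda>t. 2 powr r * (\<bar>c\<bar> powr r * N (u t) powr r + \<bar>d\<bar> powr r * N (v t) powr r))"
      using u v by (auto simp: bochner_Lp_def)
    show "(\<lambda>t. N (\<lambda>y. c * u t y + d * v t y) powr r) \<in> borel_measurable (I0 T)"
      using bochner_norm_measurable[OF m3] by measurable
    have "AE t in I0 T. u t \<in> X" "AE t in I0 T. v t \<in> X" using m by (auto simp: bochner_measurable_def)
    then show "AE t in I0 T. norm (N (\<lambda>y. c * u t y + d * v t y) powr r) \<le> norm (2 powr r * (\<bar>c\<bar> powr r * N (u t) powr r + \<bar>d\<bar> powr r * N (v t) powr r))"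
    proof eventually_elim
      case (elim t)
      have "N (\<lambda>y. c * u t y + d * v t y) powr r \<le> (\<bar>c\<bar> * N (u t) + \<bar>d\<bar> * N (v t)) powr r"
        using elim r by (intro powr_mono2 N_lin N_nonneg lin) auto
      also have "\<dots> \<le> 2 powr r * ((\<bar>c\<bar> * N (u t)) powr r + (\<bar>d\<bar> * N (v t)) powr r)"
        using powr_norm_add_le[of r "\<bar>c\<bar> * N (u t)" "\<bar>d\<bar> * N (v t)"] r N_nonneg elim by (simp add: abs_of_nonneg)
      also have "\<dots> = 2 powr r * (\<bar>c\<bar> powr r * N (u t) powr r + \<bar>d\<bar> powr r * N (v t) powr r)"
        using N_nonneg elim by (simp add: powr_mult)
      finally show ?case by simp
    qed
  qed
  with m3 show ?thesis by (simp add: bochner_Lp_def)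
qed

lemma bochner_Lp_simple:
  assumes s: "bochner_simple T X s" shows "s \<in> bochner_Lp T X N r"
proof -
  have f: "fin_meas T s" using s by (simp add: bochner_simple_fin_meas)
  have "bochner_measurable T X N s"
    unfolding bochner_measurable_def
  proof (intro conjI exI[of _ "\<lambda>n. s"])
    show "AE t in I0 T. s t \<in> X" using simple_mem[OF s] by (intro AE_I2) simp
    show "AE t in I0 T. (\<lambda>n::nat. N (\<lambda>y. s t y - s t y)) \<longlonglongrightarrow> 0" by (simp add: N_zero)
  qed (use s in auto)
  moreover have "integrable (I0 T) (\<lambda>t. N (s t) powr r)"
  proof -
    have fin: "finite ((\<lambda>t. N (s t) powr r) ` {0<..<T})" 
    proof -
      have "finite (s ` {0<..<T})" using f by (simp add: fin_meas_def)
      from finite_imageI[OF this, of "\<lambda>x. N x powr r"] show ?thesis by (simp add: image_image)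
    qed
    obtain B where "\<forall>x\<in>(\<lambda>t. N (s t) powr r) ` {0<..<T}. \<bar>x\<bar> \<le> B"
      using finite_imp_bounded[OF fin] unfolding bounded_real by blast
    then have B: "N (s t) powr r \<le> B" if "t \<in> {0<..<T}" for t using that by (auto simp: abs_le_iff)
    show ?thesis
    proof (rule Bochner_Integration.integrable_bound)
      show "integrable (I0 T) (\<lambda>t. B)" by (rule finite_domain_measure(2)[OF finite_domain_interval])
      show "(\<lambda>t. N (s t) powr r) \<in> borel_measurable (I0 T)" by (rule fin_meas_measurable[OF f])
      show "AE t in I0 T. norm (N (s t) powr r) \<le> norm B"
      proof (rule AE_I2)
        fix t assume "t \<in> space (I0 T)"
        then have "N (s t) powr r \<le> B" using B by simp
        then show "norm (N (s t) powr r) \<le> norm B" using powr_ge_zero[of "N (s t)" r] by simp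
      qed
    qed
  qed
  ultimately show ?thesis by (simp add: bochner_Lp_def)
qed

text \<open>Supplies test functions that localise an identity integrated over time to an arbitrary
  measurable set of times.\<close>

lemma simple_indicator:
  assumes "E \<in> sets lebesgue" "v \<in> X" shows "bochner_simple T X (\<lambda>t y. indicator E t * v y)"
proof -
  have "fin_meas T (\<lambda>t. if t \<in> E then v else (\<lambda>y. 0))" by (rule fin_meas_indicator[OF assms(1)])
  then have 1: "bochner_simple T X (\<lambda>t. if t \<in> E then v else (\<lambda>y. 0))"
    using assms(2) zero_mem by (simp add: bochner_simple_fin_meas image_subset_iff)
  have "(\<lambda>t. if t \<in> E then v else (\<lambda>y. 0)) = (\<lambda>t y. indicator E t * v y)"
  proof
    fix t show "(if t \<in> E then v else (\<lambda>y. 0)) = (\<lambda>y. indicator E t * v y)" by (cases "t \<in> E") simp_all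
  qed
  with 1 show ?thesis by simp
qed

lemma bochner_Lp_const: "v \<in> X \<Longrightarrow> (\<lambda>t. v) \<in> bochner_Lp T X N r"
  by (rule bochner_Lp_simple) (simp add: bochner_simple_fin_meas fin_meas_const image_subset_iff)

text \<open>Pointwise approximants from the definition of measurability need not converge in the
  integral norm. They are set to 0 wherever their norm exceeds \<open>N (w t) + 1\<close>, which
  gives the integrable majorant \<open>4 powr r * (1 + N (w t) powr r)\<close>.\<close>

lemma bochner_simple_approx:
  assumes w: "w \<in> bochner_Lp T X N r" and r: "r > 0"
  obtains \<sigma> where "\<And>k::nat. bochner_simple T X (\<sigma> k)" "\<And>k. integrable (I0 T) (\<lambda>t. N (\<lambda>y. w t y - \<sigma> k t y) powr r)"
    "(\<lambda>k. LINT t|I0 T. N (\<lambda>y. w t y - \<sigma> k t y) powr r) \<longlonglongrightarrow> 0"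
    "AE t in I0 T. (\<lambda>k. N (\<lambda>y. w t y - \<sigma> k t y)) \<longlonglongrightarrow> 0"
proof -
  have wm: "bochner_measurable T X N w" using w by (simp add: bochner_Lp_def)
  obtain s where s: "\<And>n::nat. bochner_simple T X (s n)" "AE t in I0 T. w t \<in> X \<and> (\<forall>n. s n t \<in> X) \<and> (\<lambda>n. N (\<lambda>y. s n t y - w t y)) \<longlonglongrightarrow> 0"
    using wm by (rule bochner_measurableE) (rule that)
  define E where "E n = {t \<in> {0<..<T}. N (s n t) \<le> N (w t) + 1}" for n
  have E: "E n \<in> sets lebesgue" for n
  proof -
    have "(\<lambda>t. N (s n t)) \<in> borel_measurable (I0 T)" using s(1)[of n] by (intro fin_meas_measurable[where s="s n"]) (simp add: bochner_simple_fin_meas)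
    then have "{t \<in> space (I0 T). N (s n t) \<le> N (w t) + 1} \<in> sets (I0 T)"
      using bochner_norm_measurable[OF wm] by measurable
    then have "E n \<in> sets (I0 T)" by (simp add: E_def)
    moreover have "{0<..<T} \<inter> space lebesgue \<in> sets lebesgue" using I0_sets[of T] by simp
    ultimately show ?thesis using sets_restrict_space_iff by blast
  qed
  define \<sigma> where "\<sigma> n t = (if t \<in> E n then s n t else (\<lambda>y. 0))" for n t
  have \<sigma>: "bochner_simple T X (\<sigma> n)" for n
  proof -
    have "fin_meas T (\<lambda>t. (\<lambda>b u. if b then u else (\<lambda>y. 0)) (if t \<in> E n then True else False) (s n t))"
      using s(1)[of n] by (intro fin_meas_comp2[where F="\<lambda>b u. if b then u else (\<lambda>y. 0)" and r="s n"] fin_meas_indicator E) (simp add: bochner_simple_fin_meas)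
    moreover have "(\<lambda>t. (\<lambda>b u. if b then u else (\<lambda>y. 0)) (if t \<in> E n then True else False) (s n t)) = \<sigma> n"
      by (rule ext) (simp add: \<sigma>_def)
    ultimately have "fin_meas T (\<sigma> n)" by (simp only:)
    then show ?thesis using simple_mem[OF s(1)] zero_mem by (auto simp: bochner_simple_fin_meas \<sigma>_def)
  qed
  have iw: "(\<lambda>t y. w t y - \<sigma> k t y) \<in> bochner_Lp T X N r" for k
    using bochner_Lp_lin[OF w bochner_Lp_simple[OF \<sigma>[of k]] r, of 1 "-1"] by simp
  have conv: "AE t in I0 T. (\<lambda>k. N (\<lambda>y. w t y - \<sigma> k t y)) \<longlonglongrightarrow> 0"
    using s(2) AE_I0[of T]
  proof eventually_elim
    case (elim t)
    \<comment> \<open>As soon as the approximation error is below 1, the truncation is inactive at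
      \<open>t\<close>; hence the truncated sequence has the same limit.\<close>
    have l: "(\<lambda>n. N (\<lambda>y. s n t y - w t y)) \<longlonglongrightarrow> 0" using elim by blast
    then have "\<forall>\<^sub>F n in sequentially. N (\<lambda>y. s n t y - w t y) < 1" by (rule order_tendstoD) simp
    then have "\<forall>\<^sub>F n in sequentially. N (\<lambda>y. s n t y - w t y) = N (\<lambda>y. w t y - \<sigma> n t y)"
    proof eventually_elim
      case (elim n)
      then have "N (s n t) \<le> N (w t) + 1" using N_abs_diff[of "s n t" "w t"] \<open>w t \<in> X \<and> _\<close> by auto
      then have "\<sigma> n t = s n t" using \<open>t \<in> {0<..<T}\<close> by (simp add: \<sigma>_def E_def)
      then show ?case using N_diff_commute[of "s n t" "w t"] \<open>w t \<in> X \<and> _\<close> by auto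
    qed
    with l show ?case by (rule Lim_transform_eventually)
  qed
  have bd: "AE t in I0 T. N (\<lambda>y. w t y - \<sigma> k t y) powr r \<le> 4 powr r * (1 + N (w t) powr r)" for k
    using s(2) AE_I0[of T]
  proof eventually_elim
    case (elim t)
    have nn: "0 \<le> N (w t)" using elim N_nonneg by blast
    have \<sigma>X: "\<sigma> k t \<in> X" using elim zero_mem by (simp add: \<sigma>_def)
    have "N (\<sigma> k t) \<le> N (w t) + 1" using nn by (simp add: \<sigma>_def E_def N_zero)
    then have "N (\<lambda>y. w t y - \<sigma> k t y) \<le> 2 * (N (w t) + 1)" using N_diff_le[of "w t" "\<sigma> k t"] \<sigma>X elim nn by auto
    moreover have "0 \<le> N (\<lambda>y. w t y - \<sigma> k t y)" using \<sigma>X elim by (intro N_nonneg diff_mem) auto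
    ultimately have "N (\<lambda>y. w t y - \<sigma> k t y) powr r \<le> (2 * (N (w t) + 1)) powr r" using r by (intro powr_mono2) auto
    also have "\<dots> = 2 powr r * (N (w t) + 1) powr r" by (rule powr_mult)
    also have "\<dots> \<le> 2 powr r * (2 powr r * (N (w t) powr r + 1))"
      using powr_norm_add_le[of r "N (w t)" 1] r nn by (intro mult_left_mono) (simp_all add: abs_of_nonneg)
    also have "\<dots> = (2 * 2) powr r * (1 + N (w t) powr r)" by (simp only: powr_mult) (simp add: mult.assoc add.commute)
    finally show ?case by simp
  qed
  have "(\<lambda>k. LINT t|I0 T. N (\<lambda>y. w t y - \<sigma> k t y) powr r) \<longlonglongrightarrow> (LINT t|I0 T. 0)"
  proof (rule integral_dominated_convergence)
    show "integrable (I0 T) (\<lambda>t. 4 powr r * (1 + N (w t) powr r))"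
      using w finite_domain_measure(2)[OF finite_domain_interval] by (auto simp: bochner_Lp_def)
    show "AE t in I0 T. norm (N (\<lambda>y. w t y - \<sigma> k t y) powr r) \<le> 4 powr r * (1 + N (w t) powr r)" for k using bd[of k] by eventually_elim simp
    show "AE t in I0 T. (\<lambda>k. N (\<lambda>y. w t y - \<sigma> k t y) powr r) \<longlonglongrightarrow> 0"
      using conv s(2) AE_I0[of T]
    proof eventually_elim
      case (elim t)
      have "0 \<le> N (\<lambda>y. w t y - \<sigma> k t y)" for k
        using elim zero_mem by (intro N_nonneg diff_mem) (auto simp: \<sigma>_def)
      then have "(\<lambda>k. N (\<lambda>y. w t y - \<sigma> k t y) powr r) \<longlonglongrightarrow> 0 powr r"
        using elim r by (intro tendsto_powr'[OF _ tendsto_const]) auto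
      then show ?case using r by simp
    qed
    show "(\<lambda>t. N (\<lambda>y. w t y - \<sigma> k t y) powr r) \<in> borel_measurable (I0 T)" for k
      using iw[of k] by (auto simp: bochner_Lp_def)
  qed simp
  then have "(\<lambda>k. LINT t|I0 T. N (\<lambda>y. w t y - \<sigma> k t y) powr r) \<longlonglongrightarrow> 0" by simp
  moreover have "integrable (I0 T) (\<lambda>t. N (\<lambda>y. w t y - \<sigma> k t y) powr r)" for k using iw[of k] by (auto simp: bochner_Lp_def)
  ultimately show ?thesis using \<sigma> conv that by blast
qed

section \<open>Dual spaces and the duality pairing\<close>

lemma dual_bdd:
  assumes "\<psi> \<in> dual_space X N" shows "bdd_above ((\<lambda>u. \<bar>\<psi> u\<bar>) ` {u \<in> X. N u \<le> 1})"
proof -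
  from assms obtain K where "\<forall>u\<in>X. \<bar>\<psi> u\<bar> \<le> K * N u" by (auto simp: dual_space_def)
  then have K: "\<And>u. u \<in> X \<Longrightarrow> \<bar>\<psi> u\<bar> \<le> K * N u" by blast
  have "\<bar>\<psi> u\<bar> \<le> \<bar>K\<bar>" if "u \<in> X" "N u \<le> 1" for u
  proof -
    have "\<bar>\<psi> u\<bar> \<le> \<bar>K\<bar> * N u" using K[OF that(1)] N_nonneg[OF that(1)] by (smt (verit) mult_right_mono)
    also have "\<dots> \<le> \<bar>K\<bar> * 1" using that by (intro mult_left_mono) auto
    finally show ?thesis by simp
  qed
  then show ?thesis by (auto intro!: bdd_aboveI)
qed

lemma dual_linear:
  assumes "\<psi> \<in> dual_space X N" "u \<in> X" "v \<in> X"
  shows "\<psi> (\<lambda>y. c * u y + d * v y) = c * \<psi> u + d * \<psi> v" "\<psi> (\<lambda>y. u y - v y) = \<psi> u - \<psi> v"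
    "\<psi> (\<lambda>y. u y + v y) = \<psi> u + \<psi> v" "\<psi> (\<lambda>y. c * u y) = c * \<psi> u"
proof -
  have a: "\<And>u v. u \<in> X \<Longrightarrow> v \<in> X \<Longrightarrow> \<psi> (\<lambda>y. u y + v y) = \<psi> u + \<psi> v" and s: "\<And>k u. u \<in> X \<Longrightarrow> \<psi> (\<lambda>y. k * u y) = k * \<psi> u"
    using assms(1) by (auto simp: dual_space_def)
  show 1: "\<psi> (\<lambda>y. c * u y + d * v y) = c * \<psi> u + d * \<psi> v" for c d
    using a[OF scale_mem[OF assms(2)] scale_mem[OF assms(3)]] s assms by simp
  show "\<psi> (\<lambda>y. u y - v y) = \<psi> u - \<psi> v" using 1[of 1 "-1"] by simp
  show "\<psi> (\<lambda>y. u y + v y) = \<psi> u + \<psi> v" "\<psi> (\<lambda>y. c * u y) = c * \<psi> u" using a s assms by auto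
qed

text \<open>Normalising \<open>u\<close> fails when its seminorm is 0. In that case the bound in the
  definition of the dual space forces the functional to vanish at \<open>u\<close>.\<close>

lemma dual_bound:
  assumes \<psi>: "\<psi> \<in> dual_space X N" and u: "u \<in> X" shows "\<bar>\<psi> u\<bar> \<le> dual_norm X N \<psi> * N u"
proof (cases "N u = 0")
  case True
  from \<psi> obtain K where "\<bar>\<psi> u\<bar> \<le> K * N u" using u by (auto simp: dual_space_def)
  then show ?thesis using True by simp
next
  case False
  then have pos: "N u > 0" using N_nonneg[OF u] by simp
  have "N (\<lambda>y. (1 / N u) * u y) = \<bar>1 / N u\<bar> * N u" by (rule hom[OF u])
  then have "N (\<lambda>y. (1 / N u) * u y) \<le> 1" using pos by (simp only:) simp
  then have "(\<lambda>y. (1 / N u) * u y) \<in> {u \<in> X. N u \<le> 1}" using scale_mem[OF u, of "1 / N u"] by blast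
  then have "\<bar>\<psi> (\<lambda>y. (1 / N u) * u y)\<bar> \<le> dual_norm X N \<psi>"
    unfolding dual_norm_def by (rule cSUP_upper[OF _ dual_bdd[OF \<psi>]])
  moreover have "\<psi> (\<lambda>y. (1 / N u) * u y) = (1 / N u) * \<psi> u" by (rule dual_linear(4)[OF \<psi> u u])
  ultimately have "\<bar>(1 / N u) * \<psi> u\<bar> \<le> dual_norm X N \<psi>" by (simp only:)
  then have "\<bar>\<psi> u\<bar> / N u \<le> dual_norm X N \<psi>" using pos by (simp add: abs_mult)
  then show ?thesis using pos by (simp add: pos_divide_le_eq)
qed

lemma unit_ball_zero: "(\<lambda>y. 0) \<in> {u \<in> X. N u \<le> 1}" using zero_mem N_zero by simp

lemma dual_norm_leI:
  assumes "\<And>u. u \<in> X \<Longrightarrow> N u \<le> 1 \<Longrightarrow> \<bar>\<psi> u\<bar> \<le> K" shows "dual_norm X N \<psi> \<le> K"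
  unfolding dual_norm_def using unit_ball_zero assms by (intro cSUP_least) auto

lemma dual_norm_nonneg: assumes "\<psi> \<in> dual_space X N" shows "0 \<le> dual_norm X N \<psi>"
proof -
  have "\<bar>\<psi> (\<lambda>y. 0)\<bar> \<le> dual_norm X N \<psi>" unfolding dual_norm_def by (rule cSUP_upper[OF unit_ball_zero dual_bdd[OF assms]])
  then show ?thesis by linarith
qed

lemma dual_space_lin:
  assumes \<psi>: "\<psi> \<in> dual_space X N" and \<chi>': "\<xi> \<in> dual_space X N" shows "(\<lambda>u. c * \<psi> u + d * \<xi> u) \<in> dual_space X N"
proof -
  have "\<bar>c * \<psi> u + d * \<xi> u\<bar> \<le> (\<bar>c\<bar> * dual_norm X N \<psi> + \<bar>d\<bar> * dual_norm X N \<xi>) * N u" if u: "u \<in> X" for u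
  proof -
    have "\<bar>c * \<psi> u + d * \<xi> u\<bar> \<le> \<bar>c\<bar> * \<bar>\<psi> u\<bar> + \<bar>d\<bar> * \<bar>\<xi> u\<bar>" using abs_triangle_ineq[of "c * \<psi> u" "d * \<xi> u"] by (simp add: abs_mult)
    also have "\<dots> \<le> \<bar>c\<bar> * (dual_norm X N \<psi> * N u) + \<bar>d\<bar> * (dual_norm X N \<xi> * N u)"
      using dual_bound[OF \<psi> u] dual_bound[OF \<chi>' u] by (intro add_mono mult_left_mono) auto
    finally show ?thesis by (simp add: algebra_simps)
  qed
  then have "\<exists>K. \<forall>u\<in>X. \<bar>c * \<psi> u + d * \<xi> u\<bar> \<le> K * N u" by blast
  then show ?thesis using dual_linear(3,4)[OF \<psi>] dual_linear(3,4)[OF \<chi>'] unfolding dual_space_def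
    by (simp add: algebra_simps)
qed

text \<open>Makes the results on Bochner spaces available for functions of time with values in the
  dual.\<close>

lemma dual_seminormed: "seminormed (dual_space X N) (dual_norm X N)"
proof
  show "(\<lambda>u. 0) \<in> dual_space X N" by (auto simp: dual_space_def intro: exI[of _ 0])
  show "(\<lambda>y. c * u y + d * v y) \<in> dual_space X N" if "u \<in> dual_space X N" "v \<in> dual_space X N" for u v c d
    using dual_space_lin that .
  fix \<psi> assume \<psi>: "\<psi> \<in> dual_space X N"
  show "dual_norm X N (\<lambda>y. \<psi> y + \<xi> y) \<le> dual_norm X N \<psi> + dual_norm X N \<xi>" if \<xi>: "\<xi> \<in> dual_space X N" for \<xi>
  proof (rule dual_norm_leI)
    fix u assume u: "u \<in> X" "N u \<le> 1"
    have "\<bar>\<psi> u\<bar> \<le> dual_norm X N \<psi>" "\<bar>\<xi> u\<bar> \<le> dual_norm X N \<xi>"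
      unfolding dual_norm_def using u by (auto intro!: cSUP_upper dual_bdd \<psi> \<xi>)
    then show "\<bar>\<psi> u + \<xi> u\<bar> \<le> dual_norm X N \<psi> + dual_norm X N \<xi>" by linarith
  qed
  have le: "dual_norm X N (\<lambda>y. c * \<psi> y) \<le> \<bar>c\<bar> * dual_norm X N \<psi>" if \<psi>: "\<psi> \<in> dual_space X N" for c \<psi>
  proof (rule dual_norm_leI)
    fix u assume u: "u \<in> X" "N u \<le> 1"
    have "\<bar>\<psi> u\<bar> \<le> dual_norm X N \<psi>" unfolding dual_norm_def using u by (auto intro!: cSUP_upper dual_bdd \<psi>)
    then show "\<bar>c * \<psi> u\<bar> \<le> \<bar>c\<bar> * dual_norm X N \<psi>" by (simp add: abs_mult mult_left_mono)
  qed
  show "dual_norm X N (\<lambda>y. c * \<psi> y) = \<bar>c\<bar> * dual_norm X N \<psi>" for c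
  proof (cases "c = 0")
    case True
    have "dual_norm X N (\<lambda>y. c * \<psi> y) \<le> \<bar>c\<bar> * dual_norm X N \<psi>" by (rule le[OF \<psi>])
    moreover have "0 \<le> dual_norm X N (\<lambda>y. c * \<psi> y)" using dual_space_lin[OF \<psi> \<psi>, of c 0] by (intro dual_norm_nonneg) simp
    ultimately show ?thesis using True by simp
  next
    case False
    have c\<psi>: "(\<lambda>y. c * \<psi> y) \<in> dual_space X N" using dual_space_lin[OF \<psi> \<psi>, of c 0] by simp
    have "dual_norm X N \<psi> = dual_norm X N (\<lambda>y. (1 / c) * (c * \<psi> y))" using False by simp
    also have "\<dots> \<le> \<bar>1 / c\<bar> * dual_norm X N (\<lambda>y. c * \<psi> y)" by (rule le[OF c\<psi>])
    finally have "\<bar>c\<bar> * dual_norm X N \<psi> \<le> dual_norm X N (\<lambda>y. c * \<psi> y)" using False by (simp add: field_simps)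
    then show ?thesis using le[OF \<psi>, of c] by linarith
  qed
qed

text \<open>The pairing of two simple functions takes finitely many values on measurable sets, and
  the pairing is continuous in both arguments at almost every time.\<close>

lemma pairing_measurable:
  assumes f: "bochner_measurable T (dual_space X N) (dual_norm X N) f" and w: "bochner_measurable T X N w"
  shows "(\<lambda>t. f t (w t)) \<in> borel_measurable (I0 T)"
proof -
  interpret D: seminormed "dual_space X N" "dual_norm X N" by (rule dual_seminormed)
  obtain s where s: "\<And>n::nat. bochner_simple T (dual_space X N) (s n)" "AE t in I0 T. f t \<in> dual_space X N \<and> (\<forall>n. s n t \<in> dual_space X N) \<and> (\<lambda>n. dual_norm X N (\<lambda>y. s n t y - f t y)) \<longlonglongrightarrow> 0"
    using f by (rule D.bochner_measurableE) (rule that)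
  obtain r where r: "\<And>n::nat. bochner_simple T X (r n)" "AE t in I0 T. w t \<in> X \<and> (\<forall>n. r n t \<in> X) \<and> (\<lambda>n. N (\<lambda>y. r n t y - w t y)) \<longlonglongrightarrow> 0"
    using w by (rule bochner_measurableE) (rule that)
  show ?thesis
  proof (rule AE_limit_measurable)
    have "fin_meas T (\<lambda>t. (s n t) (r n t))" for n
      using s(1)[of n] r(1)[of n] by (intro fin_meas_comp2[of T "s n" "r n" "\<lambda>x y. x y"]) (auto simp: bochner_simple_fin_meas)
    then show "(\<lambda>t. s n t (r n t)) \<in> borel_measurable (I0 T)" for n
      using fin_meas_measurable[of T "\<lambda>t. s n t (r n t)" "\<lambda>x. x"] by simp
    show "AE t in I0 T. (\<lambda>n. s n t (r n t)) \<longlonglongrightarrow> f t (w t)"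
      using s(2) r(2)
    proof eventually_elim
      case (elim t)
      have e: "\<bar>s n t (r n t) - f t (w t)\<bar> \<le> dual_norm X N (\<lambda>y. s n t y - f t y) * (N (\<lambda>y. r n t y - w t y) + N (w t)) + dual_norm X N (f t) * N (\<lambda>y. r n t y - w t y)" for n
      proof -
        have ft: "f t \<in> dual_space X N" and st: "s n t \<in> dual_space X N" and wt: "w t \<in> X" and rt: "r n t \<in> X" using elim by auto
        have "s n t (r n t) - f t (w t) = (\<lambda>y. s n t y - f t y) (r n t) + f t (\<lambda>y. r n t y - w t y)"
          using dual_linear(2)[OF ft rt wt] by simp
        also have "\<bar>\<dots>\<bar> \<le> \<bar>(\<lambda>y. s n t y - f t y) (r n t)\<bar> + \<bar>f t (\<lambda>y. r n t y - w t y)\<bar>" by (rule abs_triangle_ineq)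
        also have "\<dots> \<le> dual_norm X N (\<lambda>y. s n t y - f t y) * N (r n t) + dual_norm X N (f t) * N (\<lambda>y. r n t y - w t y)"
          by (intro add_mono dual_bound D.diff_mem diff_mem ft st wt rt)
        also have "\<dots> \<le> dual_norm X N (\<lambda>y. s n t y - f t y) * (N (\<lambda>y. r n t y - w t y) + N (w t)) + dual_norm X N (f t) * N (\<lambda>y. r n t y - w t y)"
          using tri[OF diff_mem[OF rt wt] wt] dual_norm_nonneg[OF D.diff_mem[OF st ft]] by (intro add_right_mono mult_left_mono) auto
        finally show ?thesis .
      qed
      have l: "(\<lambda>n. dual_norm X N (\<lambda>y. s n t y - f t y) * (N (\<lambda>y. r n t y - w t y) + N (w t)) + dual_norm X N (f t) * N (\<lambda>y. r n t y - w t y)) \<longlonglongrightarrow> 0 * (0 + N (w t)) + dual_norm X N (f t) * 0"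
        using elim by (intro tendsto_intros) auto
      show ?case by (rule LIM_zero_cancel, rule Lim_null_comparison[OF _ l[simplified]]) (use e in auto)
    qed
  qed
qed

lemma conjugate_exponent: assumes "p > (1::real)" shows "p / (p - 1) > 1" "1 / p + 1 / (p / (p - 1)) = 1"
  using assms by (auto simp: field_simps)

lemma pairing_integrable:
  assumes f: "f \<in> bochner_dual T X N (p / (p - 1))" and w: "w \<in> bochner_Lp T X N p" and p: "p > 1"
  shows "integrable (I0 T) (\<lambda>t. f t (w t))"
proof (rule Bochner_Integration.integrable_bound)
  let ?q = "p / (p - 1)"
  show "integrable (I0 T) (\<lambda>t. dual_norm X N (f t) powr ?q + N (w t) powr p)"
    using f w by (auto simp: bochner_Lp_def bochner_dual_def)
  show "(\<lambda>t. f t (w t)) \<in> borel_measurable (I0 T)"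
    using f w by (intro pairing_measurable) (auto simp: bochner_Lp_def bochner_dual_def)
  have "AE t in I0 T. f t \<in> dual_space X N" "AE t in I0 T. w t \<in> X"
    using f w by (auto simp: bochner_Lp_def bochner_dual_def bochner_measurable_def)
  then show "AE t in I0 T. norm (f t (w t)) \<le> norm (dual_norm X N (f t) powr ?q + N (w t) powr p)"
  proof eventually_elim
    case (elim t)
    have nn: "0 \<le> dual_norm X N (f t)" "0 \<le> N (w t)" using elim dual_norm_nonneg N_nonneg by auto
    note q = conjugate_exponent[OF p]
    have "\<bar>f t (w t)\<bar> \<le> N (w t) * dual_norm X N (f t)" using dual_bound[OF elim] by (simp add: mult.commute)
    also have "\<dots> \<le> N (w t) powr p / p + dual_norm X N (f t) powr ?q / ?q"
      by (rule Youngs_inequality[OF p q nn(2,1)])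
    also have "\<dots> \<le> N (w t) powr p / 1 + dual_norm X N (f t) powr ?q / 1"
      using p q(1) by (intro add_mono divide_left_mono) auto
    finally show ?case by simp
  qed
qed

end

section \<open>Recovering a continuous function from its weak time derivative\<close>

definition step_deriv :: "real \<Rightarrow> real" where "step_deriv x = deriv smooth_step x"

lemma step_deriv: "DERIV smooth_step x :> step_deriv x" "continuous_on UNIV step_deriv"
proof -
  obtain h where h: "\<forall>x. DERIV smooth_step x :> h x" "Ck 0 h" using smooth_step(1)[of "Suc 0"] unfolding Ck_Suc_real_iff by blast
  then have "step_deriv = h" by (auto simp: step_deriv_def fun_eq_iff intro: DERIV_imp_deriv)
  with h show "DERIV smooth_step x :> step_deriv x" "continuous_on UNIV step_deriv" by auto
qed

lemma step_deriv_outside: "x \<notin> {0..1} \<Longrightarrow> step_deriv x = 0"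
proof -
  assume x: "x \<notin> {0..1}"
  have "(smooth_step has_real_derivative 0) (at x)"
  proof (cases "x < 0")
    case True
    have "((\<lambda>x. 0) has_real_derivative 0) (at x) \<longleftrightarrow> (smooth_step has_real_derivative 0) (at x)"
      using True smooth_step(2) by (intro DERIV_cong_ev) (auto simp: eventually_nhds intro!: exI[of _ "{..<0}"])
    then show ?thesis by simp
  next
    case False
    then have "x > 1" using x by auto
    then have "((\<lambda>x. 1) has_real_derivative 0) (at x) \<longleftrightarrow> (smooth_step has_real_derivative 0) (at x)"
      using smooth_step(3) by (intro DERIV_cong_ev) (auto simp: eventually_nhds intro!: exI[of _ "{1<..}"])
    then show ?thesis by simp
  qed
  then show ?thesis using DERIV_unique step_deriv(1) by blast
qed

lemma step_deriv_integral: "integrable lborel step_deriv" "(LINT x|lborel. step_deriv x) = 1"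
proof -
  have "has_bochner_integral lborel (\<lambda>x. step_deriv x * indicator {0..1} x) (smooth_step 1 - smooth_step 0)"
    using step_deriv by (intro has_bochner_integral_FTC_Icc_real) (auto simp: continuous_on_eq_continuous_at)
  moreover have "step_deriv x * indicator {0..1} x = step_deriv x" for x using step_deriv_outside[of x] by (auto split: split_indicator)
  ultimately have "has_bochner_integral lborel step_deriv 1" by (simp add: smooth_step)
  then show "integrable lborel step_deriv" "(LINT x|lborel. step_deriv x) = 1" by (auto simp: has_bochner_integral_iff)
qed

text \<open>The substitution \<open>y = Suc n * (\<tau> - r)\<close> turns the integral into the
  mean of \<open>k\<close> at \<open>r + y / Suc n\<close> with respect to the density
  \<open>step_deriv\<close>, whose mass is 1.\<close>

lemma step_deriv_concentrates:
  fixes k :: "real \<Rightarrow> real"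
  assumes k: "continuous_on {0..T} k" and r: "0 < r" "r < T"
  shows "(\<lambda>n. LINT \<tau>|I0 T. (real (Suc n) * step_deriv (real (Suc n) * (\<tau> - r))) * k \<tau>) \<longlonglongrightarrow> k r"
proof -
  \<comment> \<open>Extension by 0 makes the integrand meaningful for all \<open>y\<close>.
    Continuity at \<open>r\<close> survives because \<open>r\<close> is an interior point of the
    interval.\<close>
  define k0 where "k0 \<tau> = indicator {0<..<T} \<tau> * k \<tau>" for \<tau>
  have k0m: "k0 \<in> borel_measurable borel"
    using borel_measurable_continuous_on_indicator[of "{0<..<T}" k] continuous_on_subset[OF k greaterThanLessThan_subseteq_atLeastAtMost_iff[THEN iffD2]]
    by (simp add: k0_def[abs_def])
  have "compact (k ` {0..T})" using k by (intro compact_continuous_image) auto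
  then obtain M where M: "\<And>y. y \<in> k ` {0..T} \<Longrightarrow> norm y \<le> M" "M > 0" using compact_imp_bounded bounded_pos by metis
  have k0b: "\<bar>k0 \<tau>\<bar> \<le> M" for \<tau> using M by (auto simp: k0_def split: split_indicator)
  have sm: "step_deriv \<in> borel_measurable borel" by (rule borel_measurable_continuous_onI[OF step_deriv(2)])
  have eq: "(LINT \<tau>|I0 T. (real (Suc n) * step_deriv (real (Suc n) * (\<tau> - r))) * k \<tau>) = (LINT y|lborel. step_deriv y * k0 (r + y / real (Suc n)))" for n
  proof -
    let ?c = "real (Suc n)"
    have "(LINT \<tau>|I0 T. (?c * step_deriv (?c * (\<tau> - r))) * k \<tau>) = (LINT \<tau>|I0 T. (?c * step_deriv (?c * (\<tau> - r))) * k0 \<tau>)"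
      by (intro Bochner_Integration.integral_cong) (auto simp: k0_def)
    also have "\<dots> = (LINT \<tau>|lborel. (?c * step_deriv (?c * (\<tau> - r))) * k0 \<tau>)"
    proof (rule lebesgue_on_integral_lborel)
      show "(\<lambda>\<tau>. (?c * step_deriv (?c * (\<tau> - r))) * k0 \<tau>) \<in> borel_measurable borel" using sm k0m by measurable
    qed (auto simp: k0_def)
    also have "\<dots> = \<bar>1 / ?c\<bar> *\<^sub>R (LINT y|lborel. (?c * step_deriv (?c * ((r + (1 / ?c) * y) - r))) * k0 (r + (1 / ?c) * y))"
      by (rule lborel_integral_real_affine) simp
    also have "\<dots> = (LINT y|lborel. step_deriv y * k0 (r + y / ?c))"
      by (simp add: mult.assoc del: of_nat_Suc)
    finally show ?thesis .
  qed
  have "(\<lambda>n. LINT y|lborel. step_deriv y * k0 (r + y / real (Suc n))) \<longlonglongrightarrow> (LINT y|lborel. step_deriv y * k r)"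
  proof (rule integral_dominated_convergence)
    show "integrable lborel (\<lambda>y. M * \<bar>step_deriv y\<bar>)" using step_deriv_integral(1) by simp
    show "AE y in lborel. norm (step_deriv y * k0 (r + y / real (Suc n))) \<le> M * \<bar>step_deriv y\<bar>" for n
      using k0b by (intro AE_I2) (auto simp: abs_mult mult.commute[of M] intro!: mult_left_mono)
    show "AE y in lborel. (\<lambda>n. step_deriv y * k0 (r + y / real (Suc n))) \<longlonglongrightarrow> step_deriv y * k r"
    proof (intro AE_I2 tendsto_mult tendsto_const)
      fix y :: real
      have l: "(\<lambda>n. r + y / real (Suc n)) \<longlonglongrightarrow> r"
        using tendsto_add[OF tendsto_const[of r] tendsto_mult[OF tendsto_const[of y] LIMSEQ_inverse_real_of_nat]] by (simp add: divide_inverse)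
      have "isCont k0 r"
      proof -
        have "isCont k r" using continuous_on_interior[OF k, of r] r by simp
        moreover have "\<forall>\<^sub>F x in nhds r. k x = k0 x" using r by (auto simp: eventually_nhds k0_def intro!: exI[of _ "{0<..<T}"])
        ultimately show ?thesis using isCont_cong by blast
      qed
      from isCont_tendsto_compose[OF this l] show "(\<lambda>n. k0 (r + y / real (Suc n))) \<longlonglongrightarrow> k r" using r by (simp add: k0_def)
    qed
  qed (use sm k0m in auto)
  then show ?thesis unfolding eq using step_deriv_integral by simp
qed

text \<open>The difference of two steps that rise at \<open>s\<close> and at \<open>t\<close> is an
  admissible test function and tends to the indicator of the interval from \<open>s\<close> to
  \<open>t\<close>, while its derivative concentrates at the end points. Letting \<open>s\<close>
  tend to 0 brings in the initial value.\<close>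

lemma weak_derivative_imp_integral:
  fixes k f :: "real \<Rightarrow> real"
  assumes k: "continuous_on {0..T} k" and k0: "k 0 = 0" and f: "integrable (I0 T) f"
    and weak: "\<And>\<phi>. \<phi> \<in> test_fun {0<..<T} \<Longrightarrow> - (LINT \<tau>|I0 T. deriv \<phi> \<tau> * k \<tau>) = (LINT \<tau>|I0 T. \<phi> \<tau> * f \<tau>)"
    and t: "0 < t" "t < T"
  shows "k t = (LINT \<tau>|I0 T. indicator {0<..t} \<tau> * f \<tau>)"
proof -
  have st: "k t - k s = (LINT \<tau>|I0 T. indicator {s<..t} \<tau> * f \<tau>)" if s: "0 < s" "s < t" for s
  proof -
    define \<phi> where "\<phi> n \<tau> = smooth_step (real (Suc n) * (\<tau> - s)) - smooth_step (real (Suc n) * (\<tau> - t))" for n \<tau>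
    define \<phi>' where "\<phi>' n \<tau> = real (Suc n) * step_deriv (real (Suc n) * (\<tau> - s)) - real (Suc n) * step_deriv (real (Suc n) * (\<tau> - t))" for n \<tau>
    have der: "DERIV (\<phi> n) \<tau> :> \<phi>' n \<tau>" for n \<tau>
    proof -
      have d: "((\<lambda>\<tau>. smooth_step (real (Suc n) * (\<tau> - r))) has_real_derivative step_deriv (real (Suc n) * (\<tau> - r)) * real (Suc n)) (at \<tau>)" for r
        by (rule DERIV_chain2[OF step_deriv(1)]) (auto intro!: derivative_eq_intros)
      show ?thesis unfolding \<phi>_def[abs_def] \<phi>'_def using DERIV_diff[OF d[of s] d[of t]] by (simp add: mult.commute)
    qed
    \<comment> \<open>The step at \<open>t\<close> is completed only at
      \<open>t + 1 / Suc n\<close>, so the support lies inside the time interval for large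
      \<open>n\<close> only.\<close>
    have "(\<lambda>n. 1 / real (Suc n)) \<longlonglongrightarrow> 0" using LIMSEQ_inverse_real_of_nat by (simp add: divide_inverse)
    then have "\<forall>\<^sub>F n in sequentially. 1 / real (Suc n) < T - t" using t by (intro order_tendstoD) auto
    then obtain n0 where n0: "\<And>n. n \<ge> n0 \<Longrightarrow> 1 / real (Suc n) < T - t" unfolding eventually_sequentially by blast
    have test: "\<phi> n \<in> test_fun {0<..<T}" if "n \<ge> n0" for n
    proof (rule test_funI[of _ "{s..t + 1 / real (Suc n)}"])
      have "Ck k (\<lambda>\<tau>. smooth_step (real (Suc n) *\<^sub>R \<tau> + (- real (Suc n) * s)) + (-1) * smooth_step (real (Suc n) *\<^sub>R \<tau> + (- real (Suc n) * t)))" for k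
        by (intro Ck_add Ck_mult Ck_const Ck_affine smooth_step(1))
      then show "Ck k (\<phi> n)" for k by (simp add: \<phi>_def[abs_def] algebra_simps)
      show "{s..t + 1 / real (Suc n)} \<subseteq> {0<..<T}" using s n0[OF that] by (auto simp: less_diff_eq add.commute)
      fix \<tau> assume "\<tau> \<notin> {s..t + 1 / real (Suc n)}"
      then consider "\<tau> < s" | "\<tau> > t + 1 / real (Suc n)" by fastforce
      then show "\<phi> n \<tau> = 0"
      proof cases
        case 1
        then have "real (Suc n) * (\<tau> - s) \<le> 0" "real (Suc n) * (\<tau> - t) \<le> 0" using s by (auto intro!: mult_nonneg_nonpos)
        then show ?thesis by (simp add: \<phi>_def smooth_step)
      next
        case 2
        then have "1 / real (Suc n) \<le> \<tau> - t" "1 / real (Suc n) \<le> \<tau> - s" using s by auto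
        then have "1 \<le> real (Suc n) * (\<tau> - t)" "1 \<le> real (Suc n) * (\<tau> - s)" by (simp_all only: pos_divide_le_eq of_nat_0_less_iff zero_less_Suc mult.commute)
        then show ?thesis by (simp add: \<phi>_def smooth_step)
      qed
    qed simp
    have bm: "f \<in> borel_measurable (I0 T)" using f by simp
    have mm: "g \<in> borel_measurable (I0 T)" if "continuous_on UNIV g" for g :: "real \<Rightarrow> real" using continuous_measurable_lebesgue_on that by blast
    have phc: "continuous_on UNIV (\<phi> n)" for n using DERIV_isCont[OF der] by (simp add: continuous_on_eq_continuous_at)
    have kI: "integrable (I0 T) (\<lambda>\<tau>. g \<tau> * k \<tau>)" if g: "continuous_on UNIV g" for g
    proof -
      have "integrable (lebesgue_on {0..T}) (\<lambda>\<tau>. g \<tau> * k \<tau>)"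
        by (intro continuous_imp_integrable_real continuous_on_mult continuous_on_subset[OF g] k) simp
      then show ?thesis by (rule integrable_lebesgue_on_subset) (auto simp: I0_sets)
    qed
    have sc: "continuous_on UNIV (\<lambda>\<tau>. real (Suc n) * step_deriv (real (Suc n) * (\<tau> - r)))" for n r
      by (intro continuous_on_mult continuous_intros continuous_on_compose2[OF step_deriv(2)]) auto
    have "(LINT \<tau>|I0 T. deriv (\<phi> n) \<tau> * k \<tau>) =
        (LINT \<tau>|I0 T. (real (Suc n) * step_deriv (real (Suc n) * (\<tau> - s))) * k \<tau>) - (LINT \<tau>|I0 T. (real (Suc n) * step_deriv (real (Suc n) * (\<tau> - t))) * k \<tau>)" for n
      using kI[OF sc[of n s]] kI[OF sc[of n t]] DERIV_imp_deriv[OF der] by (simp add: \<phi>'_def left_diff_distrib)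
    then have "(\<lambda>n. - (LINT \<tau>|I0 T. deriv (\<phi> n) \<tau> * k \<tau>)) \<longlonglongrightarrow> - (k s - k t)"
      using s t by (auto intro!: tendsto_minus tendsto_diff step_deriv_concentrates[OF k] simp del: of_nat_Suc)
    moreover have "\<forall>\<^sub>F n in sequentially. - (LINT \<tau>|I0 T. deriv (\<phi> n) \<tau> * k \<tau>) = (LINT \<tau>|I0 T. \<phi> n \<tau> * f \<tau>)"
      unfolding eventually_sequentially using weak[OF test] by blast
    ultimately have l1: "(\<lambda>n. LINT \<tau>|I0 T. \<phi> n \<tau> * f \<tau>) \<longlonglongrightarrow> k t - k s"
      using Lim_transform_eventually by fastforce
    have "(\<lambda>n. LINT \<tau>|I0 T. \<phi> n \<tau> * f \<tau>) \<longlonglongrightarrow> (LINT \<tau>|I0 T. indicator {s<..t} \<tau> * f \<tau>)"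
    proof (rule integral_dominated_convergence)
      show "integrable (I0 T) (\<lambda>\<tau>. norm (f \<tau>))" using f by simp
      show "AE \<tau> in I0 T. norm (\<phi> n \<tau> * f \<tau>) \<le> norm (f \<tau>)" for n
      proof (rule AE_I2)
        fix \<tau>
        have "\<bar>\<phi> n \<tau>\<bar> \<le> 1" using smooth_step_bounds[of "real (Suc n) * (\<tau> - s)"] smooth_step_bounds[of "real (Suc n) * (\<tau> - t)"] unfolding \<phi>_def by linarith
        then show "norm (\<phi> n \<tau> * f \<tau>) \<le> norm (f \<tau>)" by (simp add: abs_mult mult_left_le_one_le)
      qed
      show "AE \<tau> in I0 T. (\<lambda>n. \<phi> n \<tau> * f \<tau>) \<longlonglongrightarrow> indicator {s<..t} \<tau> * f \<tau>"
      proof (intro AE_I2 tendsto_mult tendsto_const)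
        fix \<tau>
        have "(\<lambda>n. \<phi> n \<tau>) \<longlonglongrightarrow> (if 0 < \<tau> - s then 1 else 0) - (if 0 < \<tau> - t then 1 else 0)"
          unfolding \<phi>_def by (intro tendsto_diff smooth_step_scaled_limit)
        also have "(if 0 < \<tau> - s then 1 else 0) - (if 0 < \<tau> - t then 1 else 0) = (indicator {s<..t} \<tau> :: real)"
          using s by (auto split: split_indicator)
        finally show "(\<lambda>n. \<phi> n \<tau>) \<longlonglongrightarrow> indicator {s<..t} \<tau>" .
      qed
      show "(\<lambda>\<tau>. \<phi> n \<tau> * f \<tau>) \<in> borel_measurable (I0 T)" for n using borel_measurable_times[OF mm[OF phc] bm] .
      show "(\<lambda>\<tau>. indicator {s<..t} \<tau> * f \<tau>) \<in> borel_measurable (I0 T)"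
        by (rule borel_measurable_times[OF borel_measurable_lebesgue_on bm]) simp
    qed
    with l1 show ?thesis using LIMSEQ_unique by blast
  qed
  \<comment> \<open>The shift by 2 keeps \<open>s m\<close> strictly below \<open>t\<close> also for
    \<open>m = 0\<close>.\<close>
  define s where "s m = t / real (m + 2)" for m
  have s: "0 < s m" "s m < t" for m
  proof -
    show "0 < s m" using t by (simp add: s_def)
    have "t * 1 < t * real (m + 2)" using t by (intro mult_strict_left_mono) auto
    then show "s m < t" by (simp add: s_def divide_less_eq)
  qed
  have sl: "s \<longlonglongrightarrow> 0"
  proof -
    have "(\<lambda>m. t * inverse (real (Suc (Suc m)))) \<longlonglongrightarrow> t * 0"
      by (intro tendsto_mult tendsto_const LIMSEQ_Suc[OF LIMSEQ_inverse_real_of_nat])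
    then show ?thesis by (simp add: s_def[abs_def] divide_inverse add.commute)
  qed
  have "(\<lambda>m. k (s m)) \<longlonglongrightarrow> k 0"
    by (rule continuous_on_tendsto_compose[OF k sl]) (use s t in \<open>auto intro!: always_eventually less_imp_le less_trans[OF s(2)] simp: less_imp_le order.strict_trans[OF s(2)]\<close>)
  then have 1: "(\<lambda>m. k t - k (s m)) \<longlonglongrightarrow> k t - 0" unfolding k0 by (intro tendsto_diff tendsto_const)
  have bm: "f \<in> borel_measurable (I0 T)" using f by simp
  have "(\<lambda>m. LINT \<tau>|I0 T. indicator {s m<..t} \<tau> * f \<tau>) \<longlonglongrightarrow> (LINT \<tau>|I0 T. indicator {0<..t} \<tau> * f \<tau>)"
  proof (rule integral_dominated_convergence)
    show "integrable (I0 T) (\<lambda>\<tau>. norm (f \<tau>))" using f by simp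
    show "AE \<tau> in I0 T. norm (indicator {s m<..t} \<tau> * f \<tau>) \<le> norm (f \<tau>)" for m by (auto split: split_indicator)
    show "AE \<tau> in I0 T. (\<lambda>m. indicator {s m<..t} \<tau> * f \<tau>) \<longlonglongrightarrow> indicator {0<..t} \<tau> * f \<tau>"
    proof (intro AE_I2 tendsto_mult tendsto_const)
      fix \<tau> assume "\<tau> \<in> space (I0 T)"
      then have "\<tau> > 0" by simp
      then have "\<forall>\<^sub>F m in sequentially. s m < \<tau>" using sl by (intro order_tendstoD) auto
      then have "\<forall>\<^sub>F m in sequentially. indicator {s m<..t} \<tau> = (indicator {0<..t} \<tau> :: real)"
        by eventually_elim (use \<open>\<tau> > 0\<close> in \<open>auto split: split_indicator\<close>)
      then show "(\<lambda>m. indicator {s m<..t} \<tau>) \<longlonglongrightarrow> (indicator {0<..t} \<tau> :: real)" by (rule tendsto_eventually)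
    qed
    show "(\<lambda>\<tau>. indicator {s m<..t} \<tau> * f \<tau>) \<in> borel_measurable (I0 T)" for m
      by (rule borel_measurable_times[OF borel_measurable_lebesgue_on bm]) simp
    show "(\<lambda>\<tau>. indicator {0<..t} \<tau> * f \<tau>) \<in> borel_measurable (I0 T)"
      by (rule borel_measurable_times[OF borel_measurable_lebesgue_on bm]) simp
  qed
  then have "(\<lambda>m. k t - k (s m)) \<longlonglongrightarrow> (LINT \<tau>|I0 T. indicator {0<..t} \<tau> * f \<tau>)" using st[OF s] by simp
  with 1 show ?thesis using LIMSEQ_unique by fastforce
qed

text \<open>The backward Steklov average. As the integral runs over the time interval only,
  \<open>F\<close> counts as 0 at negative times.\<close>

definition avg :: "real \<Rightarrow> real \<Rightarrow> (real \<Rightarrow> real) \<Rightarrow> real \<Rightarrow> real" where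
  "avg T h F t = (1 / h) * (LINT \<tau>|I0 T. indicator {t - h<..t} \<tau> * F \<tau>)"

lemma avg_kernel:
  assumes h: "h > 0"
  shows "integrable lborel (\<lambda>z. (1 / h) * indicator {0..<h} z :: real)" "(LINT z|lborel. (1 / h) * indicator {0..<h} z :: real) = 1"
  using h by auto

text \<open>Exhibits the average as a convolution with a kernel of mass 1 supported in an interval
  of length \<open>h\<close>, so that \<open>approx_identity\<close> yields convergence in
  L^1.\<close>

lemma avg_conv:
  assumes F: "integrable (I0 T) F"
  obtains F' where "integrable lborel F'" "AE t in I0 T. F' t = F t" "\<And>t. t \<notin> {0<..<T} \<Longrightarrow> F' t = 0"
    "\<And>h t. h > 0 \<Longrightarrow> avg T h F t = (LINT z|lborel. ((1 / h) * indicator {0..<h} z) * F' (t - z))"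
proof -
  obtain F' where F': "F' \<in> borel_measurable borel" "integrable lborel F'" "\<And>x. x \<notin> {0<..<T} \<Longrightarrow> F' x = 0" "AE x in I0 T. F' x = F x"
    by (rule borel_representative[OF F]) (auto intro: that)
  have "avg T h F t = (LINT z|lborel. ((1 / h) * indicator {0..<h} z) * F' (t - z))" if h: "h > 0" for h t
  proof -
    have "(LINT \<tau>|I0 T. indicator {t - h<..t} \<tau> * F \<tau>) = (LINT \<tau>|I0 T. indicator {t - h<..t} \<tau> * F' \<tau>)"
    proof (rule integral_cong_AE)
      have im: "(indicator {t - h<..t} :: real \<Rightarrow> real) \<in> borel_measurable (I0 T)" by (rule borel_measurable_lebesgue_on) simp
      show "(\<lambda>\<tau>. indicator {t - h<..t} \<tau> * F \<tau>) \<in> borel_measurable (I0 T)"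
        by (rule borel_measurable_times[OF im borel_measurable_integrable[OF F]])
      show "(\<lambda>\<tau>. indicator {t - h<..t} \<tau> * F' \<tau>) \<in> borel_measurable (I0 T)"
        by (rule borel_measurable_times[OF im borel_measurable_lebesgue_on[OF F'(1)]])
      show "AE \<tau> in I0 T. indicator {t - h<..t} \<tau> * F \<tau> = indicator {t - h<..t} \<tau> * F' \<tau>" using F'(4) by eventually_elim simp
    qed
    also have "\<dots> = (LINT \<tau>|lborel. indicator {t - h<..t} \<tau> * F' \<tau>)"
      using F' by (intro lebesgue_on_integral_lborel) auto
    also have "\<dots> = (LINT z|lborel. indicator {t - h<..t} (t - z) * F' (t - z))"
      using F'(1) by (intro lborel_integral_reflect[of "\<lambda>\<tau>. indicator {t - h<..t} \<tau> * F' \<tau>", symmetric]) simp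
    also have "\<dots> = (LINT z|lborel. indicator {0..<h} z * F' (t - z))"
      by (intro Bochner_Integration.integral_cong) (auto split: split_indicator)
    finally have "avg T h F t = (1 / h) * (LINT z|lborel. indicator {0..<h} z * F' (t - z))" by (simp add: avg_def)
    also have "\<dots> = (LINT z|lborel. (1 / h) * (indicator {0..<h} z * F' (t - z)))" by (rule integral_mult_right_zero[symmetric])
    finally show ?thesis by (simp only: mult.assoc)
  qed
  with F' show ?thesis using that by blast
qed

lemma avg_integrable:
  assumes F: "integrable (I0 T) F" and h: "h > 0" shows "integrable (I0 T) (avg T h F)"
proof -
  obtain F' where F': "integrable lborel F'"
    "\<And>h t. h > 0 \<Longrightarrow> avg T h F t = (LINT z|lborel. ((1 / h) * indicator {0..<h} z) * F' (t - z))"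
    by (rule avg_conv[OF F]) (auto intro: that)
  have "integrable (lborel \<Otimes>\<^sub>M lborel) (\<lambda>(z, y). ((1 / h) * indicator {0..<h} z) * F' (y - z))"
    by (rule convolution_integrable[OF F'(1) avg_kernel(1)[OF h]])
  from lborel_pair.integrable_snd[OF this] have "integrable lborel (avg T h F)" by (simp add: F'(2)[OF h, abs_def])
  then have "integrable (lebesgue_on UNIV) (avg T h F)" by (simp add: integrable_completion lebesgue_on_UNIV_eq)
  then show ?thesis by (rule integrable_lebesgue_on_subset) (auto simp: I0_sets)
qed

lemma avg_tendsto:
  assumes F: "integrable (I0 T) F"
  shows "((\<lambda>h. LINT t|I0 T. \<bar>avg T h F t - F t\<bar>) \<longlongrightarrow> 0) (at_right 0)"
proof (rule tendstoI)
  fix e :: real assume e: "e > 0"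
  obtain F' where F': "integrable lborel F'" "AE t in I0 T. F' t = F t" "\<And>t. t \<notin> {0<..<T} \<Longrightarrow> F' t = 0"
    "\<And>h t. h > 0 \<Longrightarrow> avg T h F t = (LINT z|lborel. ((1 / h) * indicator {0..<h} z) * F' (t - z))"
    by (rule avg_conv[OF F]) (auto intro: that)
  obtain d where d: "d > 0" "\<And>z. norm z \<le> d \<Longrightarrow> (LINT x|lborel. \<bar>F' (x - z) - F' x\<bar>) \<le> e / 2"
    using L1_shift_uniform[OF F'(1), of "e / 2"] e by auto
  have "(LINT t|I0 T. \<bar>avg T h F t - F t\<bar>) \<le> e / 2" if h: "0 < h" "h < d" for h
  proof -
    note ai = approx_identity[OF F'(1) avg_kernel(1)[OF h(1)] _ avg_kernel(2)[OF h(1)], where r=d and e="e / 2"]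
    have supp: "norm z \<le> d" if "(1 / h) * indicator {0..<h} z \<noteq> (0::real)" for z using that h by (auto split: split_indicator_asm)
    have nn: "0 \<le> (1 / h) * indicator {0..<h} z" for z :: real using h by simp
    have a: "integrable lborel (\<lambda>y. LINT z|lborel. ((1 / h) * indicator {0..<h} z) * F' (y - z))"
      "(LINT y|lborel. \<bar>(LINT z|lborel. ((1 / h) * indicator {0..<h} z) * F' (y - z)) - F' y\<bar>) \<le> e / 2"
      using ai[OF nn supp d(2)] by blast+
    then have a': "integrable lborel (avg T h F)" "(LINT y|lborel. \<bar>avg T h F y - F' y\<bar>) \<le> e / 2"
      by (simp_all only: F'(4)[OF h(1), abs_def, symmetric] F'(4)[OF h(1), symmetric])
    have m: "avg T h F \<in> borel_measurable borel" "F' \<in> borel_measurable borel" using a' F' by auto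
    have "(LINT t|I0 T. \<bar>avg T h F t - F t\<bar>) = (LINT t|I0 T. \<bar>avg T h F t - F' t\<bar>)"
    proof (rule integral_cong_AE)
      show "AE t in I0 T. \<bar>avg T h F t - F t\<bar> = \<bar>avg T h F t - F' t\<bar>" using F'(2) by eventually_elim simp
      show "(\<lambda>t. \<bar>avg T h F t - F t\<bar>) \<in> borel_measurable (I0 T)"
        using borel_measurable_lebesgue_on[OF m(1)] borel_measurable_integrable[OF F] by measurable
      show "(\<lambda>t. \<bar>avg T h F t - F' t\<bar>) \<in> borel_measurable (I0 T)"
        by (rule borel_measurable_lebesgue_on) (use m in measurable)
    qed
    also have "\<dots> = (LINT t|I0 T. indicator {0<..<T} t * \<bar>avg T h F t - F' t\<bar>)"
      by (intro Bochner_Integration.integral_cong) auto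
    also have "\<dots> = (LINT t|lborel. indicator {0<..<T} t * \<bar>avg T h F t - F' t\<bar>)"
      by (rule lebesgue_on_integral_lborel) (use m in auto)
    also have "\<dots> \<le> (LINT t|lborel. \<bar>avg T h F t - F' t\<bar>)"
    proof (rule integral_mono)
      show "integrable lborel (\<lambda>t. indicator {0<..<T} t * \<bar>avg T h F t - F' t\<bar>)"
        using integrable_mult_indicator[of "{0<..<T}" lborel "\<lambda>t. \<bar>avg T h F t - F' t\<bar>"] a' F' by simp
    qed (use a' F' in \<open>auto split: split_indicator\<close>)
    finally show ?thesis using a'(2) by linarith
  qed
  moreover have "0 \<le> (LINT t|I0 T. \<bar>avg T h F t - F t\<bar>)" for h by (rule Bochner_Integration.integral_nonneg) simp
  ultimately have "\<forall>h>0. h < d \<longrightarrow> dist (LINT t|I0 T. \<bar>avg T h F t - F t\<bar>) 0 < e" using e by (fastforce simp: dist_real_def)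
  then show "\<forall>\<^sub>F h in at_right 0. dist (LINT t|I0 T. \<bar>avg T h F t - F t\<bar>) 0 < e"
    unfolding eventually_at_right_field using d(1) by (intro exI[of _ d]) auto
qed

lemma AE_lborel_shift:
  fixes h :: real
  assumes "AE t in lborel. P t" shows "AE t in lborel. P (t - h)"
proof -
  obtain N where N: "N \<in> null_sets lborel" "{t. \<not> P t} \<subseteq> N" using assms by (auto simp: eventually_ae_filter)
  have "AE t in lborel. t \<notin> N" using N(1) by (rule AE_not_in)
  then have "AE t in distr lborel borel ((+) (-h)). t \<notin> N" by (simp only: lborel_distr_plus)
  then have "AE t in lborel. (-h) + t \<notin> N" using N(1) by (subst (asm) AE_distr_iff) (auto simp: null_sets_def)
  then show ?thesis by eventually_elim (use N(2) in auto)
qed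

lemma AE_I0_lborel: "(AE t in I0 T. P t) \<longleftrightarrow> (AE t in lborel. t \<in> {0<..<T} \<longrightarrow> P t)"
  by (rule lebesgue_on_AE_lborel) simp

lemma avg_integrand_integrable:
  fixes F :: "real \<Rightarrow> real"
  assumes F: "integrable (I0 T) F" shows "integrable (I0 T) (\<lambda>\<tau>. indicator {r<..s} \<tau> * F \<tau>)"
proof (rule Bochner_Integration.integrable_bound[OF F])
  have "(indicator {r<..s} :: real \<Rightarrow> real) \<in> borel_measurable (I0 T)" by (rule borel_measurable_lebesgue_on) simp
  then show "(\<lambda>\<tau>. indicator {r<..s} \<tau> * F \<tau>) \<in> borel_measurable (I0 T)"
    using F by (intro borel_measurable_times) auto
qed (auto split: split_indicator)

lemma avg_bound:
  assumes F: "integrable (I0 T) F" "integrable (I0 T) G" and h: "h > 0" and le: "AE t in I0 T. \<bar>F t\<bar> \<le> G t"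
  shows "\<bar>avg T h F t\<bar> \<le> avg T h G t"
proof -
  note i = avg_integrand_integrable[where r="t - h" and s=t]
  have "\<bar>LINT \<tau>|I0 T. indicator {t - h<..t} \<tau> * F \<tau>\<bar> \<le> (LINT \<tau>|I0 T. \<bar>indicator {t - h<..t} \<tau> * F \<tau>\<bar>)"
    using integral_norm_bound[of "I0 T" "\<lambda>\<tau>. indicator {t - h<..t} \<tau> * F \<tau>"] by simp
  also have "\<dots> \<le> (LINT \<tau>|I0 T. indicator {t - h<..t} \<tau> * G \<tau>)"
  proof (rule integral_mono_AE)
    show "AE \<tau> in I0 T. \<bar>indicator {t - h<..t} \<tau> * F \<tau>\<bar> \<le> indicator {t - h<..t} \<tau> * G \<tau>"
      using le by eventually_elim (auto split: split_indicator)
  qed (use i[OF F(1)] i[OF F(2)] in auto)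
  finally show ?thesis using h by (simp add: avg_def abs_mult divide_right_mono)
qed

text \<open>Equality fails for \<open>t < h\<close>, where part of the averaging window lies at
  negative times and contributes nothing.\<close>

lemma avg_const_le:
  assumes h: "h > 0" and c: "c \<ge> 0" shows "avg T h (\<lambda>t. c) t \<le> c"
proof -
  have "(LINT \<tau>|I0 T. indicator {t - h<..t} \<tau> * c) = (LINT \<tau>|I0 T. indicator {0<..<T} \<tau> * (indicator {t - h<..t} \<tau> * c))"
    by (intro Bochner_Integration.integral_cong) auto
  also have "\<dots> = (LINT \<tau>|lborel. indicator {0<..<T} \<tau> * (indicator {t - h<..t} \<tau> * c))"
    by (rule lebesgue_on_integral_lborel) auto
  also have "\<dots> \<le> (LINT \<tau>|lborel. indicator {t - h<..t} \<tau> * c)"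
  proof (rule integral_mono)
    have i: "integrable lborel (\<lambda>\<tau>. indicator {t - h<..t} \<tau> * c)" using h by simp
    then show "integrable lborel (\<lambda>\<tau>. indicator {t - h<..t} \<tau> * c)" .
    show "integrable lborel (\<lambda>\<tau>. indicator {0<..<T} \<tau> * (indicator {t - h<..t} \<tau> * c))"
      using integrable_mult_indicator[OF _ i, of "{0<..<T}"] by simp
  qed (use c in \<open>auto split: split_indicator\<close>)
  also have "\<dots> = h * c" using h by simp
  finally show ?thesis using h by (simp add: avg_def divide_le_eq mult.commute)
qed

lemma avg_lincomb:
  assumes F: "integrable (I0 T) F" "integrable (I0 T) G"
  shows "avg T h (\<lambda>t. c * F t + d * G t) t = c * avg T h F t + d * avg T h G t"
proof -
  note i = avg_integrand_integrable[where r="t - h" and s=t]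
  have "(LINT \<tau>|I0 T. indicator {t - h<..t} \<tau> * (c * F \<tau> + d * G \<tau>)) = (LINT \<tau>|I0 T. c * (indicator {t - h<..t} \<tau> * F \<tau>) + d * (indicator {t - h<..t} \<tau> * G \<tau>))"
    by (intro Bochner_Integration.integral_cong) (auto simp: algebra_simps)
  also have "\<dots> = c * (LINT \<tau>|I0 T. indicator {t - h<..t} \<tau> * F \<tau>) + d * (LINT \<tau>|I0 T. indicator {t - h<..t} \<tau> * G \<tau>)"
    using i[OF F(1)] i[OF F(2)] by simp
  finally show ?thesis by (simp add: avg_def algebra_simps)
qed

text \<open>The parameter \<open>l\<close> decides which factor gets the small coefficient. A small
  \<open>l\<close> tames a dual norm that is merely bounded, at the price of a large coefficient for
  a factor that can itself be made small.\<close>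

lemma Young_scaled:
  fixes x y :: real
  assumes p: "p > 1" and l: "l > 0" and nn: "x \<ge> 0" "y \<ge> 0"
  shows "x * y \<le> l powr (p / (p - 1)) * x powr (p / (p - 1)) + l powr (- p) * y powr p"
proof -
  let ?q = "p / (p - 1)"
  have q: "?q > 1" "1 / ?q + 1 / p = 1" using p by (auto simp: field_simps)
  have "x * y = (l * x) * (y / l)" using l by simp
  also have "\<dots> \<le> (l * x) powr ?q / ?q + (y / l) powr p / p"
    using q p l nn by (intro Youngs_inequality) auto
  also have "\<dots> \<le> (l * x) powr ?q / 1 + (y / l) powr p / 1"
    using q(1) p by (intro add_mono divide_left_mono) auto
  also have "\<dots> = l powr ?q * x powr ?q + l powr (- p) * y powr p"
    using l nn by (simp add: powr_mult powr_divide powr_minus_divide)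
  finally show ?thesis .
qed

lemma simple_section_measurable:
  fixes K :: "real \<Rightarrow> 'y \<Rightarrow> real"
  assumes s: "fin_meas T s" and K: "\<And>x. x \<in> s ` {0<..<T} \<Longrightarrow> (\<lambda>t. K t x) \<in> borel_measurable (I0 T)"
  shows "(\<lambda>t. K t (s t)) \<in> borel_measurable (I0 T)"
proof -
  have fin: "finite (s ` {0<..<T})" using s by (simp add: fin_meas_def)
  have "(\<lambda>t. \<Sum>x\<in>s ` {0<..<T}. (if s t = x then 1 else 0) * K t x) \<in> borel_measurable (I0 T)"
  proof (rule borel_measurable_sum)
    fix x assume "x \<in> s ` {0<..<T}"
    then show "(\<lambda>t. (if s t = x then 1 else 0) * K t x) \<in> borel_measurable (I0 T)"
      using fin_meas_measurable[OF s, of "\<lambda>y. if y = x then 1 else (0::real)"] K by (intro borel_measurable_times) auto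
  qed
  moreover have "(\<Sum>x\<in>s ` {0<..<T}. (if s t = x then 1 else 0) * K t x) = K t (s t)" if "t \<in> {0<..<T}" for t
  proof -
    have "(\<Sum>x\<in>s ` {0<..<T}. (if s t = x then 1 else 0) * K t x) = (\<Sum>x\<in>s ` {0<..<T}. if x = s t then K t x else 0)"
      by (intro sum.cong) auto
    then show ?thesis using fin that by (simp add: sum.delta)
  qed
  moreover have "(\<lambda>t. \<Sum>x\<in>s ` {0<..<T}. (if s t = x then 1 else 0) * K t x) \<in> borel_measurable (I0 T) \<longleftrightarrow> (\<lambda>t. K t (s t)) \<in> borel_measurable (I0 T)"
    by (rule measurable_cong) (use calculation(2) in simp)
  ultimately show ?thesis by blast
qed

text \<open>Turns convergence in L^1 for each fixed \<open>x\<close> into convergence along a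
  function of time with finitely many values.\<close>

lemma simple_section_integral_bound:
  fixes K :: "real \<Rightarrow> 'y \<Rightarrow> real"
  assumes s: "fin_meas T s" and K: "\<And>x. x \<in> s ` {0<..<T} \<Longrightarrow> integrable (I0 T) (\<lambda>t. K t x)"
  shows "integrable (I0 T) (\<lambda>t. K t (s t))" "\<bar>LINT t|I0 T. K t (s t)\<bar> \<le> (\<Sum>x\<in>s ` {0<..<T}. (LINT t|I0 T. \<bar>K t x\<bar>))"
proof -
  have fin: "finite (s ` {0<..<T})" using s by (simp add: fin_meas_def)
  have m: "(\<lambda>t. K t (s t)) \<in> borel_measurable (I0 T)" using K by (intro simple_section_measurable[OF s, where K=K]) auto
  have si: "integrable (I0 T) (\<lambda>t. \<Sum>x\<in>s ` {0<..<T}. \<bar>K t x\<bar>)" using K by (intro Bochner_Integration.integrable_sum) auto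
  have b: "\<bar>K t (s t)\<bar> \<le> (\<Sum>x\<in>s ` {0<..<T}. \<bar>K t x\<bar>)" if "t \<in> {0<..<T}" for t
    using fin that by (intro member_le_sum[of "s t" _ "\<lambda>x. \<bar>K t x\<bar>"]) auto
  show i: "integrable (I0 T) (\<lambda>t. K t (s t))"
  proof (rule Bochner_Integration.integrable_bound[OF si m], rule AE_I2)
    fix t assume "t \<in> space (I0 T)"
    then have "\<bar>K t (s t)\<bar> \<le> (\<Sum>x\<in>s ` {0<..<T}. \<bar>K t x\<bar>)" using b by simp
    then show "norm (K t (s t)) \<le> norm (\<Sum>x\<in>s ` {0<..<T}. \<bar>K t x\<bar>)" by simp
  qed
  have "\<bar>LINT t|I0 T. K t (s t)\<bar> \<le> (LINT t|I0 T. \<bar>K t (s t)\<bar>)" using integral_norm_bound[of "I0 T" "\<lambda>t. K t (s t)"] by simp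
  also have "\<dots> \<le> (LINT t|I0 T. (\<Sum>x\<in>s ` {0<..<T}. \<bar>K t x\<bar>))" using i si b by (intro integral_mono) auto
  also have "\<dots> = (\<Sum>x\<in>s ` {0<..<T}. (LINT t|I0 T. \<bar>K t x\<bar>))" using K by (intro Bochner_Integration.integral_sum) auto
  finally show "\<bar>LINT t|I0 T. K t (s t)\<bar> \<le> (\<Sum>x\<in>s ` {0<..<T}. (LINT t|I0 T. \<bar>K t x\<bar>))" .
qed

context seminormed
begin

lemma dual_pairing_integrable_const:
  assumes g: "g \<in> bochner_dual T X N (p / (p - 1))" and p: "p > 1" and v: "v \<in> X"
  shows "integrable (I0 T) (\<lambda>t. g t v)"
  using pairing_integrable[OF g bochner_Lp_const[OF v] p] .

text \<open>The extension by zero to negative times is legitimate because \<open>U(0) = 0\<close>.\<close>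

lemma backward_difference:
  assumes p: "p > 1"
    and M: "Mw \<in> bochner_dual T X N (p / (p - 1))" and g: "is_ddt T X N (p / (p - 1)) Mw g"
    and U: "AE t in I0 T. \<forall>v\<in>X. U t v = Mw t v" "\<forall>t\<in>{0..T}. U t \<in> dual_space X N"
      "\<forall>t\<in>{0..T}. ((\<lambda>s. dual_norm X N (\<lambda>v. U s v - U t v)) \<longlongrightarrow> 0) (at t within {0..T})" "\<forall>v\<in>X. U 0 v = 0"
    and v: "v \<in> X" and t: "t \<in> {0<..<T}" and h: "h > 0"
  shows "(1 / h) * (U t v - (if t > h then U (t - h) v else 0)) = avg T h (\<lambda>s. g s v) t"
proof -
  interpret D: seminormed "dual_space X N" "dual_norm X N" by (rule dual_seminormed)
  have gd: "g \<in> bochner_dual T X N (p / (p - 1))" using g by (simp add: is_ddt_def)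
  have gi: "integrable (I0 T) (\<lambda>t. g t v)" by (rule dual_pairing_integrable_const[OF gd p v])
  have Mi: "integrable (I0 T) (\<lambda>t. Mw t v)" by (rule dual_pairing_integrable_const[OF M p v])
  \<comment> \<open>Continuity in the dual norm passes to the values at the fixed \<open>v\<close>,
    which reduces the claim to a scalar function of time.\<close>
  have k: "continuous_on {0..T} (\<lambda>t. U t v)"
    unfolding continuous_on_def
  proof
    fix t assume t: "t \<in> {0..T}"
    have "((\<lambda>s. U s v - U t v) \<longlongrightarrow> 0) (at t within {0..T})"
    proof (rule Lim_null_comparison)
      show "\<forall>\<^sub>F s in at t within {0..T}. norm (U s v - U t v) \<le> dual_norm X N (\<lambda>v. U s v - U t v) * N v"
        unfolding eventually_at_filter
      proof (intro always_eventually allI impI)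
        fix s assume "s \<noteq> t" "s \<in> {0..T}"
        then have "(\<lambda>v. U s v - U t v) \<in> dual_space X N" using U(2) t by (intro D.diff_mem) auto
        from dual_bound[OF this v] show "norm (U s v - U t v) \<le> dual_norm X N (\<lambda>v. U s v - U t v) * N v" by simp
      qed
      show "((\<lambda>s. dual_norm X N (\<lambda>v. U s v - U t v) * N v) \<longlongrightarrow> 0) (at t within {0..T})"
        using tendsto_mult[OF bspec[OF U(3) t] tendsto_const[of "N v"]] by simp
    qed
    then show "((\<lambda>t. U t v) \<longlongrightarrow> U t v) (at t within {0..T})" by (rule LIM_zero_cancel)
  qed
  have weak: "- (LINT \<tau>|I0 T. deriv \<phi> \<tau> * U \<tau> v) = (LINT \<tau>|I0 T. \<phi> \<tau> * g \<tau> v)" if \<phi>: "\<phi> \<in> test_fun {0<..<T}" for \<phi>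
  proof -
    obtain d where d: "\<forall>x. DERIV \<phi> x :> d x" "Ck 0 d" using test_fun_Ck[OF \<phi>, of "Suc 0"] unfolding Ck_Suc_real_iff by blast
    then have "deriv \<phi> = d" by (auto intro: DERIV_imp_deriv)
    then have dm: "deriv \<phi> \<in> borel_measurable (I0 T)" using d(2) continuous_measurable_lebesgue_on by auto
    have ae: "AE \<tau> in I0 T. deriv \<phi> \<tau> * Mw \<tau> v = deriv \<phi> \<tau> * U \<tau> v" using U(1) by eventually_elim (use v in simp)
    have m1: "(\<lambda>\<tau>. deriv \<phi> \<tau> * Mw \<tau> v) \<in> borel_measurable (I0 T)" using dm Mi by (intro borel_measurable_times) auto
    have "(LINT \<tau>|I0 T. deriv \<phi> \<tau> * Mw \<tau> v) = (LINT \<tau>|I0 T. deriv \<phi> \<tau> * U \<tau> v)"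
      by (rule integral_cong_AE[OF m1 measurable_lebesgue_on_AE[OF m1 I0_sets ae] ae])
    moreover have "- (LINT \<tau>|I0 T. deriv \<phi> \<tau> * Mw \<tau> v) = (LINT \<tau>|I0 T. \<phi> \<tau> * g \<tau> v)"
      using g \<phi> v unfolding is_ddt_def by blast
    ultimately show ?thesis by (simp only:)
  qed
  have rep: "U s v = (LINT \<tau>|I0 T. indicator {0<..s} \<tau> * g \<tau> v)" if "0 < s" "s < T" for s
    by (rule weak_derivative_imp_integral[OF k _ gi weak that]) (use U(4) v in auto)
  note i = avg_integrand_integrable[OF gi]
  \<comment> \<open>For \<open>t \<le> h\<close> the window reaches below 0, where the integral has
    no mass and the extension of \<open>U\<close> is 0, so both cases agree with the
    average.\<close>
  have "U t v - (if t > h then U (t - h) v else 0) = (LINT \<tau>|I0 T. indicator {t - h<..t} \<tau> * g \<tau> v)"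
  proof (cases "t > h")
    case True
    have "U t v - U (t - h) v = (LINT \<tau>|I0 T. indicator {0<..t} \<tau> * g \<tau> v) - (LINT \<tau>|I0 T. indicator {0<..t - h} \<tau> * g \<tau> v)"
      using rep[of t] rep[of "t - h"] t h True by simp
    also have "\<dots> = (LINT \<tau>|I0 T. indicator {0<..t} \<tau> * g \<tau> v - indicator {0<..t - h} \<tau> * g \<tau> v)" using i by simp
    also have "\<dots> = (LINT \<tau>|I0 T. indicator {t - h<..t} \<tau> * g \<tau> v)"
      using True h by (intro Bochner_Integration.integral_cong) (auto split: split_indicator)
    finally show ?thesis using True by simp
  next
    case False
    have "(LINT \<tau>|I0 T. indicator {0<..t} \<tau> * g \<tau> v) = (LINT \<tau>|I0 T. indicator {t - h<..t} \<tau> * g \<tau> v)"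
      using False by (intro Bochner_Integration.integral_cong) (auto split: split_indicator)
    then show ?thesis using rep[of t] t False by simp
  qed
  then show ?thesis by (simp add: avg_def)
qed

text \<open>\<open>B\<close> may be degenerate, so \<open>Mw\<close> carries no norm of
  \<open>w\<close>. The form enters through the inequality for \<open>2 * B v u\<close> and
  nonnegativity of \<open>B u u\<close>, applied to difference quotients, and the limit is taken in
  the pairing of these quotients with \<open>w\<close>.\<close>

theorem ddt_pairing_nonneg:
  assumes p: "p > 1" and w: "w \<in> bochner_Lp T X N p"
    and B: "\<And>u v. u \<in> X \<Longrightarrow> v \<in> X \<Longrightarrow> 2 * B v u \<le> B u u + B v v" "\<And>u. u \<in> X \<Longrightarrow> 0 \<le> (B u u :: real)"
    and M: "Mw \<in> bochner_dual T X N (p / (p - 1))" and g: "is_ddt T X N (p / (p - 1)) Mw g"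
    and init: "zero_initial T X N Mw" and MB: "AE t in I0 T. \<forall>v\<in>X. Mw t v = B (w t) v"
  shows "0 \<le> (LINT t|I0 T. g t (w t))"
proof -
  let ?q = "p / (p - 1)"
  interpret D: seminormed "dual_space X N" "dual_norm X N" by (rule dual_seminormed)
  have p0: "p > 0" using p by simp
  obtain U where U: "AE t in I0 T. \<forall>v\<in>X. U t v = Mw t v" "\<forall>t\<in>{0..T}. U t \<in> dual_space X N"
      "\<forall>t\<in>{0..T}. ((\<lambda>s. dual_norm X N (\<lambda>v. U s v - U t v)) \<longlongrightarrow> 0) (at t within {0..T})" "\<forall>v\<in>X. U 0 v = 0"
    using init by (auto simp: zero_initial_def)
  define Dq where "Dq h t v = (1 / h) * (U t v - (if t > h then U (t - h) v else 0))" for h t and v :: "'y \<Rightarrow> real"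
  have Dq_avg: "Dq h t v = avg T h (\<lambda>s. g s v) t" if "v \<in> X" "t \<in> {0<..<T}" "h > 0" for h t v
    unfolding Dq_def by (rule backward_difference[OF p M g U that])
  have Dq_dual: "Dq h t \<in> dual_space X N" if "t \<in> {0<..<T}" "h > 0" for h t
  proof -
    have "U t \<in> dual_space X N" "t > h \<Longrightarrow> U (t - h) \<in> dual_space X N" using U(2) that by auto
    then show ?thesis
      using D.scale_mem[OF D.diff_mem[of "U t" "U (t - h)"], of "1 / h"] D.scale_mem[of "U t" "1 / h"]
      unfolding Dq_def[abs_def] by (cases "t > h") auto
  qed
  have gd: "g \<in> bochner_dual T X N ?q" using g by (simp add: is_ddt_def)
  have gX: "AE t in I0 T. g t \<in> dual_space X N" using gd by (simp add: bochner_dual_def bochner_Lp_def bochner_measurable_def)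
  have wX: "AE t in I0 T. w t \<in> X" using w by (simp add: bochner_Lp_def bochner_measurable_def)
  define Gq where "Gq t = dual_norm X N (g t) powr ?q" for t
  have Gq: "integrable (I0 T) Gq" unfolding Gq_def using gd by (simp add: bochner_dual_def bochner_Lp_def)
  have gi: "integrable (I0 T) (\<lambda>t. g t v)" if "v \<in> X" for v by (rule dual_pairing_integrable_const[OF gd p that])
  have const_i: "integrable (I0 T) (\<lambda>t. c :: real)" for c by (rule finite_domain_measure(2)[OF finite_domain_interval])
  have g_bound: "\<bar>g t e\<bar> \<le> l powr ?q * Gq t + l powr (- p) * N e powr p" if "g t \<in> dual_space X N" "e \<in> X" "l > 0" for t e l
  proof -
    have "\<bar>g t e\<bar> \<le> dual_norm X N (g t) * N e" by (rule dual_bound[OF that(1,2)])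
    also have "\<dots> \<le> l powr ?q * Gq t + l powr (- p) * N e powr p"
      unfolding Gq_def using that by (intro Young_scaled[OF p] dual_norm_nonneg N_nonneg)
    finally show ?thesis .
  qed
  \<comment> \<open>Bounded pointwise by Young's inequality under the average; the constants do not
    depend on \<open>h\<close>, which permits the later choice of \<open>l\<close> before
    \<open>h\<close>.\<close>
  have Dq_bound: "\<bar>Dq h t e\<bar> \<le> l powr ?q * avg T h Gq t + l powr (- p) * N e powr p"
    if e: "e \<in> X" and t: "t \<in> {0<..<T}" and h: "h > 0" and l: "l > 0" for h t e l
  proof -
    have "\<bar>Dq h t e\<bar> = \<bar>avg T h (\<lambda>s. g s e) t\<bar>" using Dq_avg[OF e t h] by simp
    also have "\<dots> \<le> avg T h (\<lambda>s. l powr ?q * Gq s + 1 * (l powr (- p) * N e powr p)) t"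
    proof (rule avg_bound[OF gi[OF e] _ h])
      show "integrable (I0 T) (\<lambda>s. l powr ?q * Gq s + 1 * (l powr (- p) * N e powr p))"
        using Gq const_i by (intro Bochner_Integration.integrable_add integrable_mult_right) auto
      show "AE s in I0 T. \<bar>g s e\<bar> \<le> l powr ?q * Gq s + 1 * (l powr (- p) * N e powr p)"
        using gX by eventually_elim (use g_bound e l in simp)
    qed
    also have "\<dots> = l powr ?q * avg T h Gq t + 1 * avg T h (\<lambda>s. l powr (- p) * N e powr p) t"
      by (rule avg_lincomb[OF Gq const_i])
    also have "\<dots> \<le> l powr ?q * avg T h Gq t + 1 * (l powr (- p) * N e powr p)"
      by (intro add_left_mono mult_left_mono avg_const_le h) auto
    finally show ?thesis by simp
  qed
  \<comment> \<open>Bochner measurability of the quotients is not established, as \<open>U\<close>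
    agrees with \<open>Mw\<close> only almost everywhere. For fixed arguments the quotient is an
    average, hence measurable, and simple approximations of \<open>y\<close> do the rest.\<close>
  have Dq_meas: "(\<lambda>t. Dq h t (y t)) \<in> borel_measurable (I0 T)" if h: "h > 0" and y: "y \<in> bochner_Lp T X N p" for h y
  proof -
    obtain s where s: "\<And>k::nat. bochner_simple T X (s k)" "AE t in I0 T. (\<lambda>k. N (\<lambda>x. y t x - s k t x)) \<longlonglongrightarrow> 0"
      by (rule bochner_simple_approx[OF y p0]) (rule that)
    have yX: "AE t in I0 T. y t \<in> X" using y by (simp add: bochner_Lp_def bochner_measurable_def)
    show ?thesis
    proof (rule AE_limit_measurable)
      show "(\<lambda>t. Dq h t (s k t)) \<in> borel_measurable (I0 T)" for k
      proof (rule simple_section_measurable[where K="Dq h" and s="s k"])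
        show "fin_meas T (s k)" using s(1)[of k] by (simp add: bochner_simple_fin_meas)
        fix x assume "x \<in> s k ` {0<..<T}"
        then have x: "x \<in> X" using simple_mem[OF s(1)] by auto
        have "avg T h (\<lambda>s. g s x) \<in> borel_measurable (I0 T)" using avg_integrable[OF gi[OF x] h] by simp
        then show "(\<lambda>t. Dq h t x) \<in> borel_measurable (I0 T)"
          by (subst measurable_cong[where g="avg T h (\<lambda>s. g s x)"]) (use Dq_avg[OF x _ h] in auto)
      qed
      show "AE t in I0 T. (\<lambda>k. Dq h t (s k t)) \<longlonglongrightarrow> Dq h t (y t)"
        using s(2) yX AE_I0[of T]
      proof eventually_elim
        case (elim t)
        have sX: "s k t \<in> X" for k using simple_mem[OF s(1)] elim by blast
        have b: "\<bar>Dq h t (y t) - Dq h t (s k t)\<bar> \<le> dual_norm X N (Dq h t) * N (\<lambda>x. y t x - s k t x)" for k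
          using dual_bound[OF Dq_dual[OF elim(3) h] diff_mem[OF elim(2) sX]] dual_linear(2)[OF Dq_dual[OF elim(3) h] elim(2) sX] by simp
        have "(\<lambda>k. dual_norm X N (Dq h t) * N (\<lambda>x. y t x - s k t x)) \<longlonglongrightarrow> dual_norm X N (Dq h t) * 0"
          by (intro tendsto_mult tendsto_const elim(1))
        then have "(\<lambda>k. dual_norm X N (Dq h t) * N (\<lambda>x. y t x - s k t x)) \<longlonglongrightarrow> 0" by simp
        then have "(\<lambda>k. Dq h t (y t) - Dq h t (s k t)) \<longlonglongrightarrow> 0"
          by (rule Lim_null_comparison[rotated]) (use b in auto)
        then have "(\<lambda>k. Dq h t (y t) - (Dq h t (y t) - Dq h t (s k t))) \<longlonglongrightarrow> Dq h t (y t) - 0"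
          by (intro tendsto_diff tendsto_const)
        then show ?case by simp
      qed
    qed
  qed
  have Dq_int: "integrable (I0 T) (\<lambda>t. Dq h t (y t))"
    "\<bar>LINT t|I0 T. Dq h t (y t)\<bar> \<le> l powr ?q * (LINT t|I0 T. avg T h Gq t) + l powr (- p) * (LINT t|I0 T. N (y t) powr p)"
    if h: "h > 0" and y: "y \<in> bochner_Lp T X N p" and l: "l > 0" for h y l
  proof -
    have yX: "AE t in I0 T. y t \<in> X" using y by (simp add: bochner_Lp_def bochner_measurable_def)
    have yi: "integrable (I0 T) (\<lambda>t. N (y t) powr p)" using y by (simp add: bochner_Lp_def)
    have b: "AE t in I0 T. \<bar>Dq h t (y t)\<bar> \<le> l powr ?q * avg T h Gq t + l powr (- p) * N (y t) powr p"
      using yX AE_I0[of T] by eventually_elim (rule Dq_bound[OF _ _ h l])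
    have ri: "integrable (I0 T) (\<lambda>t. l powr ?q * avg T h Gq t + l powr (- p) * N (y t) powr p)"
      using avg_integrable[OF Gq h] yi by simp
    show i: "integrable (I0 T) (\<lambda>t. Dq h t (y t))"
      by (rule Bochner_Integration.integrable_bound[OF ri Dq_meas[OF h y]]) (use b in \<open>eventually_elim, simp\<close>)
    have "\<bar>LINT t|I0 T. Dq h t (y t)\<bar> \<le> (LINT t|I0 T. \<bar>Dq h t (y t)\<bar>)"
      using integral_norm_bound[of "I0 T" "\<lambda>t. Dq h t (y t)"] by simp
    also have "\<dots> \<le> (LINT t|I0 T. l powr ?q * avg T h Gq t + l powr (- p) * N (y t) powr p)"
      by (rule integral_mono_AE) (use i ri b in auto)
    also have "\<dots> = l powr ?q * (LINT t|I0 T. avg T h Gq t) + l powr (- p) * (LINT t|I0 T. N (y t) powr p)"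
      using avg_integrable[OF Gq h] yi by simp
    finally show "\<bar>LINT t|I0 T. Dq h t (y t)\<bar> \<le> l powr ?q * (LINT t|I0 T. avg T h Gq t) + l powr (- p) * (LINT t|I0 T. N (y t) powr p)" .
  qed
  \<comment> \<open>\<open>w\<close> is split into a simple function \<sigma> and a remainder
    \<open>E\<close>. On \<sigma> the quotients converge because each of its finitely many values is
    fixed; on \<open>E\<close> both pairings are small, uniformly for small
    \<open>h\<close>.\<close>
  have lim: "((\<lambda>h. LINT t|I0 T. Dq h t (w t)) \<longlongrightarrow> (LINT t|I0 T. g t (w t))) (at_right 0)"
  proof (rule tendstoI)
    fix e :: real assume e: "e > 0"
    define C where "C = (LINT t|I0 T. Gq t) + 1"
    have C: "C \<ge> 1" unfolding C_def Gq_def by (simp add: Bochner_Integration.integral_nonneg)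
    \<comment> \<open>\<open>C\<close> bounds the integral of \<open>Gq\<close> and, once
      \<open>h\<close> is small, also that of its averages. The exponent is chosen to give
      \<open>l powr ?q * C = e / 8\<close>.\<close>
    define l where "l = (e / (8 * C)) powr (1 / ?q)"
    have l0: "l > 0" using e C by (simp add: l_def)
    have lq: "l powr ?q = e / (8 * C)" using e C p by (simp add: l_def powr_powr)
    have lC: "l powr ?q * C = e / 8" using C by (simp add: lq)
    obtain s where s: "\<And>k::nat. bochner_simple T X (s k)" "\<And>k. integrable (I0 T) (\<lambda>t. N (\<lambda>y. w t y - s k t y) powr p)"
      "(\<lambda>k. LINT t|I0 T. N (\<lambda>y. w t y - s k t y) powr p) \<longlonglongrightarrow> 0"
      by (rule bochner_simple_approx[OF w p0]) (rule that)
    have "\<forall>\<^sub>F k in sequentially. (LINT t|I0 T. N (\<lambda>y. w t y - s k t y) powr p) < e / 8 * l powr p"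
      using s(3) e l0 by (intro order_tendstoD(2)) auto
    \<comment> \<open>With \<open>l\<close> fixed, the approximation is taken so fine that the term
      with the large coefficient \<open>l powr (- p)\<close> is below \<open>e / 8\<close> as
      well.\<close>
    then obtain k where k: "(LINT t|I0 T. N (\<lambda>y. w t y - s k t y) powr p) < e / 8 * l powr p"
      by (meson eventually_sequentially order_refl)
    define \<sigma> where "\<sigma> = s k"
    define E where "E t = (\<lambda>y. w t y - \<sigma> t y)" for t
    have \<sigma>s: "bochner_simple T X \<sigma>" using s(1) by (simp add: \<sigma>_def)
    note \<sigma>L = bochner_Lp_simple[OF \<sigma>s, of p]
    have EL: "E \<in> bochner_Lp T X N p" unfolding E_def[abs_def] using bochner_Lp_lin[OF w \<sigma>L p0, of 1 "-1"] by simp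
    have Ei: "integrable (I0 T) (\<lambda>t. N (E t) powr p)" using s(2)[of k] by (simp add: E_def \<sigma>_def)
    have Eb: "l powr (- p) * (LINT t|I0 T. N (E t) powr p) < e / 8"
    proof -
      have "l powr (- p) * (LINT t|I0 T. N (E t) powr p) < l powr (- p) * (e / 8 * l powr p)"
        using k l0 by (intro mult_strict_left_mono) (auto simp: E_def \<sigma>_def)
      also have "\<dots> = e / 8 * (l powr (- p) * l powr p)" by simp
      also have "l powr (- p) * l powr p = 1" using l0 by (simp add: powr_add[symmetric])
      finally show ?thesis by simp
    qed
    have gE: "\<bar>LINT t|I0 T. g t (E t)\<bar> \<le> e / 4"
    proof -
      have i: "integrable (I0 T) (\<lambda>t. g t (E t))" by (rule pairing_integrable[OF gd EL p])
      have EX: "AE t in I0 T. E t \<in> X" using EL by (simp add: bochner_Lp_def bochner_measurable_def)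
      have "\<bar>LINT t|I0 T. g t (E t)\<bar> \<le> (LINT t|I0 T. \<bar>g t (E t)\<bar>)" using integral_norm_bound[of "I0 T" "\<lambda>t. g t (E t)"] by simp
      also have "\<dots> \<le> (LINT t|I0 T. l powr ?q * Gq t + l powr (- p) * N (E t) powr p)"
      proof (rule integral_mono_AE)
        show "AE t in I0 T. \<bar>g t (E t)\<bar> \<le> l powr ?q * Gq t + l powr (- p) * N (E t) powr p"
          using EX gX by eventually_elim (rule g_bound[OF _ _ l0])
      qed (use i Gq Ei in auto)
      also have "\<dots> = l powr ?q * (LINT t|I0 T. Gq t) + l powr (- p) * (LINT t|I0 T. N (E t) powr p)" using Gq Ei by simp
      also have "\<dots> \<le> l powr ?q * C + e / 8" using Eb by (intro add_mono mult_left_mono) (auto simp: C_def)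
      finally show ?thesis using lC by simp
    qed
    have range: "x \<in> X" if "x \<in> \<sigma> ` {0<..<T}" for x using simple_mem[OF \<sigma>s] that by auto
    have fs: "fin_meas T \<sigma>" using \<sigma>s by (simp add: bochner_simple_fin_meas)
    have "((\<lambda>h. \<Sum>x\<in>\<sigma> ` {0<..<T}. (LINT t|I0 T. \<bar>avg T h (\<lambda>s. g s x) t - g t x\<bar>)) \<longlongrightarrow> (\<Sum>x\<in>\<sigma> ` {0<..<T}. 0)) (at_right 0)"
      by (intro tendsto_sum avg_tendsto gi range)
    then have ev1: "\<forall>\<^sub>F h in at_right 0. (\<Sum>x\<in>\<sigma> ` {0<..<T}. (LINT t|I0 T. \<bar>avg T h (\<lambda>s. g s x) t - g t x\<bar>)) < e / 4"
      using e by (intro order_tendstoD(2)) auto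
    have ev2: "\<forall>\<^sub>F h in at_right 0. (LINT t|I0 T. \<bar>avg T h Gq t - Gq t\<bar>) < 1"
      using avg_tendsto[OF Gq] by (rule order_tendstoD(2)) simp
    have ev3: "\<forall>\<^sub>F h in at_right (0::real). h > 0" by (rule eventually_at_right_less)
    from ev1 ev2 ev3 show "\<forall>\<^sub>F h in at_right 0. dist (LINT t|I0 T. Dq h t (w t)) (LINT t|I0 T. g t (w t)) < e"
    proof eventually_elim
      case (elim h)
      have "(LINT t|I0 T. avg T h Gq t) - (LINT t|I0 T. Gq t) = (LINT t|I0 T. avg T h Gq t - Gq t)"
        using avg_integrable[OF Gq elim(3)] Gq by simp
      also have "\<dots> \<le> (LINT t|I0 T. \<bar>avg T h Gq t - Gq t\<bar>)"
        using avg_integrable[OF Gq elim(3)] Gq by (intro integral_mono) auto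
      finally have avgC: "(LINT t|I0 T. avg T h Gq t) \<le> C" using elim(2) by (simp add: C_def)
      have "\<bar>LINT t|I0 T. Dq h t (E t)\<bar> \<le> l powr ?q * (LINT t|I0 T. avg T h Gq t) + l powr (- p) * (LINT t|I0 T. N (E t) powr p)"
        by (rule Dq_int(2)[OF elim(3) EL l0])
      also have "\<dots> \<le> l powr ?q * C + e / 8" using Eb avgC by (intro add_mono mult_left_mono) auto
      finally have DE: "\<bar>LINT t|I0 T. Dq h t (E t)\<bar> \<le> e / 4" using lC by simp
      have "\<bar>LINT t|I0 T. Dq h t (\<sigma> t) - g t (\<sigma> t)\<bar> = \<bar>LINT t|I0 T. (\<lambda>t x. avg T h (\<lambda>s. g s x) t - g t x) t (\<sigma> t)\<bar>"
        using Dq_avg[OF simple_mem[OF \<sigma>s] _ elim(3)] by (intro arg_cong[where f=abs] Bochner_Integration.integral_cong) auto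
      also have "\<dots> \<le> (\<Sum>x\<in>\<sigma> ` {0<..<T}. (LINT t|I0 T. \<bar>avg T h (\<lambda>s. g s x) t - g t x\<bar>))"
        by (rule simple_section_integral_bound(2)[OF fs, where K="\<lambda>t x. avg T h (\<lambda>s. g s x) t - g t x"]) (use avg_integrable[OF gi elim(3)] gi range in auto)
      finally have D\<sigma>: "\<bar>LINT t|I0 T. Dq h t (\<sigma> t) - g t (\<sigma> t)\<bar> \<le> e / 4" using elim(1) by linarith
      have i: "integrable (I0 T) (\<lambda>t. Dq h t (E t))" "integrable (I0 T) (\<lambda>t. Dq h t (\<sigma> t))" "integrable (I0 T) (\<lambda>t. g t (E t))" "integrable (I0 T) (\<lambda>t. g t (\<sigma> t))"
        using Dq_int(1)[OF elim(3) EL l0] Dq_int(1)[OF elim(3) \<sigma>L l0] pairing_integrable[OF gd EL p] pairing_integrable[OF gd \<sigma>L p] by auto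
      have iw: "integrable (I0 T) (\<lambda>t. Dq h t (w t))" "integrable (I0 T) (\<lambda>t. g t (w t))"
        using Dq_int(1)[OF elim(3) w l0] pairing_integrable[OF gd w p] by auto
      have split: "(LINT t|I0 T. Dq h t (w t)) = (LINT t|I0 T. Dq h t (E t) + Dq h t (\<sigma> t))" "(LINT t|I0 T. g t (w t)) = (LINT t|I0 T. g t (E t) + g t (\<sigma> t))"
      proof -
        show "(LINT t|I0 T. Dq h t (w t)) = (LINT t|I0 T. Dq h t (E t) + Dq h t (\<sigma> t))"
        proof (rule integral_cong_AE)
          show "AE t in I0 T. Dq h t (w t) = Dq h t (E t) + Dq h t (\<sigma> t)"
            using wX AE_I0[of T]
          proof eventually_elim
            case (elim t)
            from dual_linear(2)[OF Dq_dual[OF elim(2) \<open>h > 0\<close>] elim(1) simple_mem[OF \<sigma>s elim(2)]] show ?case by (simp add: E_def)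
          qed
        qed (use iw i in auto)
        show "(LINT t|I0 T. g t (w t)) = (LINT t|I0 T. g t (E t) + g t (\<sigma> t))"
        proof (rule integral_cong_AE)
          show "AE t in I0 T. g t (w t) = g t (E t) + g t (\<sigma> t)"
            using wX gX AE_I0[of T]
          proof eventually_elim
            case (elim t)
            from dual_linear(2)[OF elim(2) elim(1) simple_mem[OF \<sigma>s elim(3)]] show ?case by (simp add: E_def)
          qed
        qed (use iw i in auto)
      qed
      \<comment> \<open>Each of the three terms is at most \<open>e / 4\<close>, which leaves room
        for the strict inequality.\<close>
      have "(LINT t|I0 T. Dq h t (w t)) - (LINT t|I0 T. g t (w t)) = (LINT t|I0 T. Dq h t (E t)) + (LINT t|I0 T. Dq h t (\<sigma> t) - g t (\<sigma> t)) - (LINT t|I0 T. g t (E t))"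
        unfolding split using i by simp
      then show ?case using DE D\<sigma> gE e unfolding dist_real_def by linarith
    qed
  qed
  \<comment> \<open>For almost every time this is the quadratic form \<open>B (w t) (w t)\<close>.
    Its Borel version \<open>Q0\<close> vanishes outside the time interval, which encodes the
    extension of \<open>w\<close> by 0.\<close>
  define Q where "Q t = Mw t (w t)" for t
  have Qi: "integrable (I0 T) Q" unfolding Q_def using pairing_integrable[OF M w p] .
  obtain Q0 where Q0: "Q0 \<in> borel_measurable borel" "integrable lborel Q0" "\<And>x. x \<notin> {0<..<T} \<Longrightarrow> Q0 x = 0"
    "AE x in I0 T. Q0 x = Q x" "(LINT x|I0 T. Q x) = (LINT x|lborel. Q0 x)"
    by (rule borel_representative[OF Qi]) (auto intro: that)
  have nonneg: "0 \<le> (LINT t|I0 T. Dq h t (w t))" if h: "h > 0" for h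
  proof -
    have good: "AE t in lborel. t \<in> {0<..<T} \<longrightarrow> ((\<forall>v\<in>X. U t v = B (w t) v) \<and> w t \<in> X \<and> Q0 t = Q t \<and> Q t = B (w t) (w t))"
      unfolding AE_I0_lborel[symmetric] using U(1) wX Q0(4) MB by eventually_elim (auto simp: Q_def)
    have Q0nn: "AE t in lborel. 0 \<le> Q0 t"
      using good
    proof eventually_elim
      case (elim t)
      then show ?case using Q0(3)[of t] B(2)[of "w t"] by (cases "t \<in> {0<..<T}") auto
    qed
    have low: "AE t in I0 T. (1 / h) * ((1 / 2) * (Q0 t - Q0 (t - h))) \<le> Dq h t (w t)"
      unfolding AE_I0_lborel using good AE_lborel_shift[OF good, of h]
    proof eventually_elim
      case (elim t)
      show ?case
      proof
        assume t: "t \<in> {0<..<T}"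
        then have a: "U t (w t) = Q t" "w t \<in> X" "Q0 t = Q t" "Q t = B (w t) (w t)" using elim(1) by auto
        \<comment> \<open>For \<open>t > h\<close> this is
          \<open>2 B v u \<le> B u u + B v v\<close> with \<open>v\<close> the value of
          \<open>w\<close> at the earlier time. For smaller \<open>t\<close> the shifted terms are 0
          and nonnegativity of \<open>Q t\<close> suffices.\<close>
        have "(1 / 2) * (Q0 t - Q0 (t - h)) \<le> U t (w t) - (if t > h then U (t - h) (w t) else 0)"
        proof (cases "t > h")
          case True
          then have th: "t - h \<in> {0<..<T}" using t h by auto
          then have "U (t - h) (w t) = B (w (t - h)) (w t)" "w (t - h) \<in> X" "Q0 (t - h) = Q (t - h)" "Q (t - h) = B (w (t - h)) (w (t - h))" using elim(2) a(2) by auto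
          moreover have "2 * B (w (t - h)) (w t) \<le> Q t + Q (t - h)" using B(1)[OF a(2), of "w (t - h)"] calculation a(4) by simp
          ultimately show ?thesis using a True by simp
        next
          case False
          then have "Q0 (t - h) = 0" by (intro Q0(3)) auto
          moreover have "0 \<le> Q t" using B(2)[OF a(2)] a(4) by simp
          ultimately show ?thesis using a False by simp
        qed
        then show "(1 / h) * ((1 / 2) * (Q0 t - Q0 (t - h))) \<le> Dq h t (w t)"
          unfolding Dq_def using h by (intro mult_left_mono) auto
      qed
    qed
    have sh: "integrable lborel (\<lambda>t. Q0 (t - h))" using lborel_integrable_shift[OF Q0(2), of "-h"] by simp
    have Lr: "integrable (I0 T) f" if "integrable lborel f" for f :: "real \<Rightarrow> real"
    proof -
      have "integrable (lebesgue_on UNIV) f" using that by (simp add: integrable_completion lebesgue_on_UNIV_eq)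
      then show ?thesis by (rule integrable_lebesgue_on_subset) (auto simp: I0_sets)
    qed
    have 1: "(LINT t|I0 T. Q0 t) = (LINT t|lborel. Q0 t)" by (rule lebesgue_on_integral_lborel) (use Q0 in auto)
    \<comment> \<open>Shifting to the right pushes part of the nonnegative mass of \<open>Q0\<close>
      beyond \<open>T\<close> and brings in none from negative times. This is the
      telescoping.\<close>
    have 2: "(LINT t|I0 T. Q0 (t - h)) \<le> (LINT t|lborel. Q0 t)"
    proof -
      have "(LINT t|I0 T. Q0 (t - h)) = (LINT t|I0 T. indicator {0<..<T} t * Q0 (t - h))"
        by (intro Bochner_Integration.integral_cong) auto
      also have "\<dots> = (LINT t|lborel. indicator {0<..<T} t * Q0 (t - h))"
        using Q0(1) by (intro lebesgue_on_integral_lborel) auto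
      also have "\<dots> \<le> (LINT t|lborel. Q0 (t - h))"
      proof (rule integral_mono_AE)
        show "integrable lborel (\<lambda>t. indicator {0<..<T} t * Q0 (t - h))"
          using integrable_mult_indicator[OF _ sh, of "{0<..<T}"] by simp
        show "AE t in lborel. indicator {0<..<T} t * Q0 (t - h) \<le> Q0 (t - h)"
          using AE_lborel_shift[OF Q0nn, of h] by eventually_elim (auto split: split_indicator)
      qed (rule sh)
      also have "\<dots> = (LINT t|lborel. Q0 t)" using lborel_integral_shift[OF Q0(1), of "-h"] by simp
      finally show ?thesis .
    qed
    have "0 \<le> (1 / h) * ((1 / 2) * ((LINT t|I0 T. Q0 t) - (LINT t|I0 T. Q0 (t - h))))" using 1 2 h by simp
    also have "\<dots> = (LINT t|I0 T. (1 / h) * ((1 / 2) * (Q0 t - Q0 (t - h))))"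
      using Lr[OF Q0(2)] Lr[OF sh] by simp
    also have "\<dots> \<le> (LINT t|I0 T. Dq h t (w t))"
      using low Lr[OF Q0(2)] Lr[OF sh] Dq_int(1)[OF h w, of 1] by (intro integral_mono_AE) auto
    finally show ?thesis .
  qed
  have "\<forall>\<^sub>F h in at_right 0. 0 \<le> (LINT t|I0 T. Dq h t (w t))"
    using eventually_at_right_less[of "0::real"] by eventually_elim (rule nonneg)
  then show ?thesis by (rule tendsto_lowerbound[OF lim]) simp
qed

end

section \<open>Seminorms and the space-time inner product\<close>

text \<open>Convexity of the power applied to \<open>x / l\<close> and \<open>y / (1 - l)\<close>
  with weights \<open>l\<close> and \<open>1 - l\<close>. Unlike the norm inequality itself, this
  bound is linear in the powers and can be integrated.\<close>

lemma powr_split_convex: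
  fixes x y p l :: real
  assumes p: "p \<ge> 1" and l: "0 < l" "l < 1" and nn: "0 \<le> x" "0 \<le> y"
  shows "(x + y) powr p \<le> l powr (1 - p) * x powr p + (1 - l) powr (1 - p) * y powr p"
proof -
  have one: "1 \<le> r powr (1 - p)" if "0 < r" "r < 1" for r
    using powr_mono'[of "1 - p" 0 r] p that by simp
  consider "x = 0" | "y = 0" | "x > 0" "y > 0" using nn by linarith
  then show ?thesis
  proof cases
    case 1
    have "1 * y powr p \<le> (1 - l) powr (1 - p) * y powr p" using one[of "1 - l"] l by (intro mult_right_mono) auto
    then show ?thesis using 1 p by simp
  next
    case 2
    have "1 * x powr p \<le> l powr (1 - p) * x powr p" using one[of l] l by (intro mult_right_mono) auto
    then show ?thesis using 2 p by simp
  next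
    case 3
    have "(l *\<^sub>R (x / l) + (1 - l) *\<^sub>R (y / (1 - l))) powr p \<le> l * (x / l) powr p + (1 - l) * (y / (1 - l)) powr p"
      using convex_onD[OF powr_convex[OF p], of "1 - l" "x / l" "y / (1 - l)"] 3 l by simp
    also have "l *\<^sub>R (x / l) + (1 - l) *\<^sub>R (y / (1 - l)) = x + y" using l by simp
    also have "l * (x / l) powr p + (1 - l) * (y / (1 - l)) powr p = l powr (1 - p) * x powr p + (1 - l) powr (1 - p) * y powr p"
      using l 3 by (simp add: powr_divide powr_diff)
    finally show ?thesis .
  qed
qed

lemma norm_powr_split_convex:
  fixes x y :: "'a::real_normed_vector" and p l :: real
  assumes p: "p \<ge> 1" and l: "0 < l" "l < 1"
  shows "norm (x + y) powr p \<le> l powr (1 - p) * norm x powr p + (1 - l) powr (1 - p) * norm y powr p"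
proof -
  have "norm (x + y) powr p \<le> (norm x + norm y) powr p" using p norm_triangle_ineq by (intro powr_mono2) auto
  also have "\<dots> \<le> l powr (1 - p) * norm x powr p + (1 - l) powr (1 - p) * norm y powr p"
    by (rule powr_split_convex[OF p l]) auto
  finally show ?thesis .
qed

text \<open>Minkowski's inequality: the optimal \<open>l\<close> is \<open>Ju\<^sup>1\<^sup>/\<^sup>p / (Ju\<^sup>1\<^sup>/\<^sup>p + Jv\<^sup>1\<^sup>/\<^sup>p)\<close>.\<close>

lemma root_subadditive:
  fixes Ju Jv Juv p :: real
  assumes p: "p \<ge> 1" and nn: "0 \<le> Ju" "0 \<le> Jv" "0 \<le> Juv"
    and split: "\<And>l. 0 < l \<Longrightarrow> l < 1 \<Longrightarrow> Juv \<le> l powr (1 - p) * Ju + (1 - l) powr (1 - p) * Jv"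
  shows "Juv powr (1 / p) \<le> Ju powr (1 / p) + Jv powr (1 / p)"
proof (rule field_le_epsilon)
  fix e :: real assume e: "e > 0"
  \<comment> \<open>The two roots are enlarged by \<open>e / 2\<close> so that the ratio defining
    \<open>l\<close> lies strictly between 0 and 1 even if \<open>Ju\<close> or \<open>Jv\<close>
    vanishes.\<close>
  define A where "A = Ju powr (1 / p) + e / 2"
  define B where "B = Jv powr (1 / p) + e / 2"
  have AB: "A > 0" "B > 0" using e by (auto simp: A_def B_def add_nonneg_pos)
  have Ju: "Ju \<le> A powr p"
  proof -
    have "Ju = (Ju powr (1 / p)) powr p" using p nn by (simp add: powr_powr)
    also have "\<dots> \<le> A powr p" using p e by (intro powr_mono2) (auto simp: A_def)
    finally show ?thesis .
  qed
  have Jv: "Jv \<le> B powr p"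
  proof -
    have "Jv = (Jv powr (1 / p)) powr p" using p nn by (simp add: powr_powr)
    also have "\<dots> \<le> B powr p" using p e by (intro powr_mono2) (auto simp: B_def)
    finally show ?thesis .
  qed
  define l where "l = A / (A + B)"
  have l: "0 < l" "l < 1" "1 - l = B / (A + B)" using AB by (auto simp: l_def field_simps)
  have tm: "(C / (A + B)) powr (1 - p) * C powr p = C * (A + B) powr (p - 1)" if "C > 0" for C
  proof -
    have "(C / (A + B)) powr (1 - p) * C powr p = (C powr (1 - p) * C powr p) / (A + B) powr (1 - p)"
      using that AB by (simp add: powr_divide)
    also have "C powr (1 - p) * C powr p = C" using that by (simp add: powr_add[symmetric])
    also have "C / (A + B) powr (1 - p) = C * (A + B) powr (p - 1)"
      using powr_minus_divide[of "A + B" "1 - p"] by simp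
    finally show ?thesis .
  qed
  have "Juv \<le> l powr (1 - p) * Ju + (1 - l) powr (1 - p) * Jv" by (rule split[OF l(1,2)])
  also have "\<dots> \<le> l powr (1 - p) * A powr p + (1 - l) powr (1 - p) * B powr p"
    using Ju Jv by (intro add_mono mult_left_mono) auto
  also have "\<dots> = (A + B) * (A + B) powr (p - 1)"
    using tm[OF AB(1)] tm[OF AB(2)] unfolding l(3) by (simp add: l_def distrib_right)
  also have "\<dots> = (A + B) powr p" using AB by (simp add: powr_mult_base)
  finally have "Juv powr (1 / p) \<le> ((A + B) powr p) powr (1 / p)" using p nn by (intro powr_mono2) auto
  also have "\<dots> = A + B" using p AB by (simp add: powr_powr)
  finally show "Juv powr (1 / p) \<le> Ju powr (1 / p) + Jv powr (1 / p) + e" by (simp add: A_def B_def)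
qed

text \<open>One proof for the weighted spaces, for \<open>W1p\<close> and, with gradient 0, for L^2.
  Linearity of \<open>D\<close> is asked for only almost everywhere because gradients are
  choices.\<close>

lemma grad_space_seminormed:
  fixes S :: "'a::euclidean_space set" and D :: "('a \<Rightarrow> real) \<Rightarrow> 'a \<Rightarrow> 'a"
  assumes p: "p \<ge> 1" and a: "a \<in> borel_measurable (lebesgue_on S)" "AE x in lebesgue_on S. 0 \<le> a x"
    and b: "b \<in> borel_measurable (lebesgue_on S)" "AE x in lebesgue_on S. 0 \<le> b x"
    and zero: "(\<lambda>x. 0) \<in> X" and lin: "\<And>u v c d. u \<in> X \<Longrightarrow> v \<in> X \<Longrightarrow> (\<lambda>x. c * u x + d * v x) \<in> X"
    and D: "\<And>u v c d. u \<in> X \<Longrightarrow> v \<in> X \<Longrightarrow> AE x in lebesgue_on S. D (\<lambda>x. c * u x + d * v x) x = c *\<^sub>R D u x + d *\<^sub>R D v x"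
    and XD: "\<And>u. u \<in> X \<Longrightarrow> D u \<in> Lp_vec S a p" and Xb: "\<And>u. u \<in> X \<Longrightarrow> u \<in> Lp_space S b p"
  shows "seminormed X (\<lambda>u. (Lp_norm S a p (D u) powr p + Lp_norm S b p u powr p) powr (1 / p))"
proof -
  define N where "N u = (Lp_norm S a p (D u) powr p + Lp_norm S b p u powr p) powr (1 / p)" for u
  define J1 where "J1 u = (LINT x|lebesgue_on S. a x * norm (D u x) powr p)" for u
  define J2 where "J2 u = (LINT x|lebesgue_on S. b x * \<bar>u x\<bar> powr p)" for u
  have p0: "p > 0" using p by simp
  have N: "N u = (J1 u + J2 u) powr (1 / p)" for u
    using a(2) b(2) p0 by (simp add: N_def J1_def J2_def Lp_norm_powr)
  have Jnn: "0 \<le> J1 u" "0 \<le> J2 u" for u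
  proof -
    have "AE x in lebesgue_on S. 0 \<le> a x * norm (D u x) powr p" using a(2) by eventually_elim simp
    then show "0 \<le> J1 u" unfolding J1_def by (rule integral_nonneg_AE)
    have "AE x in lebesgue_on S. 0 \<le> b x * \<bar>u x\<bar> powr p" using b(2) by eventually_elim simp
    then show "0 \<le> J2 u" unfolding J2_def by (rule integral_nonneg_AE)
  qed
  have i1: "integrable (lebesgue_on S) (\<lambda>x. a x * norm (D u x) powr p)" if "u \<in> X" for u
    by (rule Lp_vec_norm_integrable[OF XD[OF that] a p0])
  have i2: "integrable (lebesgue_on S) (\<lambda>x. b x * \<bar>u x\<bar> powr p)" if "u \<in> X" for u
    using Xb[OF that] by (simp add: Lp_space_def)
  have "seminormed X N"
  proof
    show "(\<lambda>y. 0) \<in> X" by (rule zero)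
    show "(\<lambda>y. c * u y + d * v y) \<in> X" if "u \<in> X" "v \<in> X" for u v c d by (rule lin[OF that])
    show "N (\<lambda>y. u y + v y) \<le> N u + N v" if u: "u \<in> X" and v: "v \<in> X" for u v
      unfolding N
    proof (rule root_subadditive[OF p])
      have uv: "(\<lambda>y. u y + v y) \<in> X" using lin[OF u v, of 1 1] by simp
      have Duv: "AE x in lebesgue_on S. D (\<lambda>y. u y + v y) x = D u x + D v x" using D[OF u v, of 1 1] by simp
      fix l :: real assume l: "0 < l" "l < 1"
      have "J1 (\<lambda>y. u y + v y) \<le> (LINT x|lebesgue_on S. l powr (1 - p) * (a x * norm (D u x) powr p) + (1 - l) powr (1 - p) * (a x * norm (D v x) powr p))"
        unfolding J1_def
      proof (rule integral_mono_AE)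
        show "AE x in lebesgue_on S. a x * norm (D (\<lambda>y. u y + v y) x) powr p \<le> l powr (1 - p) * (a x * norm (D u x) powr p) + (1 - l) powr (1 - p) * (a x * norm (D v x) powr p)"
          using a(2) Duv
        proof eventually_elim
          case (elim x)
          have "a x * norm (D u x + D v x) powr p \<le> a x * (l powr (1 - p) * norm (D u x) powr p + (1 - l) powr (1 - p) * norm (D v x) powr p)"
            using norm_powr_split_convex[OF p l] elim(1) by (rule mult_left_mono)
          then show ?case by (simp add: elim(2) algebra_simps)
        qed
      qed (use i1[OF uv] i1[OF u] i1[OF v] in auto)
      also have "\<dots> = l powr (1 - p) * J1 u + (1 - l) powr (1 - p) * J1 v" using i1[OF u] i1[OF v] by (simp add: J1_def)
      finally have 1: "J1 (\<lambda>y. u y + v y) \<le> l powr (1 - p) * J1 u + (1 - l) powr (1 - p) * J1 v" .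
      have "J2 (\<lambda>y. u y + v y) \<le> (LINT x|lebesgue_on S. l powr (1 - p) * (b x * \<bar>u x\<bar> powr p) + (1 - l) powr (1 - p) * (b x * \<bar>v x\<bar> powr p))"
        unfolding J2_def
      proof (rule integral_mono_AE)
        show "AE x in lebesgue_on S. b x * \<bar>u x + v x\<bar> powr p \<le> l powr (1 - p) * (b x * \<bar>u x\<bar> powr p) + (1 - l) powr (1 - p) * (b x * \<bar>v x\<bar> powr p)"
          using b(2)
        proof eventually_elim
          case (elim x)
          have "b x * \<bar>u x + v x\<bar> powr p \<le> b x * (l powr (1 - p) * \<bar>u x\<bar> powr p + (1 - l) powr (1 - p) * \<bar>v x\<bar> powr p)"
            using norm_powr_split_convex[OF p l, of "u x" "v x"] elim(1) by (intro mult_left_mono) auto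
          then show ?case by (simp add: algebra_simps)
        qed
      qed (use i2[OF uv] i2[OF u] i2[OF v] in auto)
      also have "\<dots> = l powr (1 - p) * J2 u + (1 - l) powr (1 - p) * J2 v" using i2[OF u] i2[OF v] by (simp add: J2_def)
      finally show "J1 (\<lambda>y. u y + v y) + J2 (\<lambda>y. u y + v y) \<le> l powr (1 - p) * (J1 u + J2 u) + (1 - l) powr (1 - p) * (J1 v + J2 v)"
        using 1 by (simp add: algebra_simps)
    qed (use Jnn in auto)
    show "N (\<lambda>y. c * u y) = \<bar>c\<bar> * N u" if u: "u \<in> X" for u c
    proof -
      have Dc: "AE x in lebesgue_on S. D (\<lambda>y. c * u y) x = c *\<^sub>R D u x" using D[OF u u, of c 0] by simp
      have cu: "(\<lambda>y. c * u y) \<in> X" using lin[OF u u, of c 0] by simp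
      have "J1 (\<lambda>y. c * u y) = (LINT x|lebesgue_on S. \<bar>c\<bar> powr p * (a x * norm (D u x) powr p))"
        unfolding J1_def
      proof (rule integral_cong_AE)
        show "AE x in lebesgue_on S. a x * norm (D (\<lambda>y. c * u y) x) powr p = \<bar>c\<bar> powr p * (a x * norm (D u x) powr p)"
          using Dc by eventually_elim (simp add: powr_mult)
      qed (use i1[OF cu] i1[OF u] in auto)
      then have 1: "J1 (\<lambda>y. c * u y) = \<bar>c\<bar> powr p * J1 u" by (simp add: J1_def)
      have "b x * \<bar>c * u x\<bar> powr p = \<bar>c\<bar> powr p * (b x * \<bar>u x\<bar> powr p)" for x by (simp add: abs_mult powr_mult)
      then have 2: "J2 (\<lambda>y. c * u y) = \<bar>c\<bar> powr p * J2 u" by (simp only: J2_def integral_mult_right_zero)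
      have "N (\<lambda>y. c * u y) = (\<bar>c\<bar> powr p * (J1 u + J2 u)) powr (1 / p)" unfolding N 1 2 by (simp add: distrib_left)
      also have "\<dots> = (\<bar>c\<bar> powr p) powr (1 / p) * N u" unfolding N by (rule powr_mult)
      also have "(\<bar>c\<bar> powr p) powr (1 / p) = \<bar>c\<bar>" using p0 by (simp add: powr_powr)
      finally show ?thesis .
    qed
  qed
  then show ?thesis by (simp add: N_def[abs_def])
qed

lemma Lp_zero_mem: "(\<lambda>x. 0) \<in> Lp_space S w p" if "p > 0"
  using that by (simp add: Lp_space_def)

lemma (in weighted_domain) Vw_zero_mem: "(\<lambda>x. 0) \<in> Vw S a b p"
  using p0 by (auto simp: Vw_def is_wgrad_def Lp_vec_def Lp_space_def intro!: exI[of _ "\<lambda>x. 0"])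

lemma (in weighted_domain) Vw_seminormed: "seminormed (Vw S a b p) (Vw_norm S a b p)"
proof -
  have "p \<ge> 1" using p2 by simp
  then show ?thesis
    unfolding Vw_norm_def[abs_def]
    by (rule grad_space_seminormed[OF _ am a_ge bm b_ge Vw_zero_mem Vw_lincomb(1) Vw_lincomb(2) VwD(4) VwD(1)])
qed

lemma W1p_seminormed:
  assumes S: "finite_domain S" and p: "p \<ge> 1"
  shows "seminormed (W1p S p) (W1p_norm S p)"
proof -
  have p0: "p > 0" using p by simp
  have z: "(\<lambda>x. 0) \<in> W1p S p"
    unfolding W1p_def
  proof (intro CollectI conjI bexI)
    show "is_weak_grad S (\<lambda>x. 0) (\<lambda>x. 0)" by (simp add: is_weak_grad_def loc_integrable_def)
    show "(\<lambda>x. 0) \<in> Lp_vec S (\<lambda>_. 1) p" using p0 by (simp add: Lp_vec_def Lp_zero_mem)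
  qed (use p0 in \<open>simp add: Lp_zero_mem\<close>)
  show ?thesis
    unfolding W1p_norm_def[abs_def]
    by (rule grad_space_seminormed[OF p _ _ _ _ z W1p_lincomb(1)[OF S p0] W1p_lincomb(2)[OF S p0] W1pD(3)[OF S] W1pD(1)[OF S]]) auto
qed

lemma L2_seminormed: "seminormed (Lp_space S (\<lambda>_. 1) 2) (Lp_norm S (\<lambda>_. 1) 2)"
proof -
  have "seminormed (Lp_space S (\<lambda>_. 1) 2) (\<lambda>u. (Lp_norm S (\<lambda>_. 1) 2 ((\<lambda>u x. 0) u :: 'a \<Rightarrow> 'a) powr 2 + Lp_norm S (\<lambda>_. 1) 2 u powr 2) powr (1 / 2))"
  proof (rule grad_space_seminormed)
    show "(\<lambda>x. c * u x + d * v x) \<in> Lp_space S (\<lambda>_. 1) 2" if "u \<in> Lp_space S (\<lambda>_. 1) 2" "v \<in> Lp_space S (\<lambda>_. 1) 2" for u v c d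
      using that by (intro Lp_lincomb) auto
  qed (auto simp: Lp_vec_def Lp_zero_mem)
  moreover have "(Lp_norm S (\<lambda>_. 1) 2 ((\<lambda>u x. 0) u :: 'a \<Rightarrow> 'a) powr 2 + Lp_norm S (\<lambda>_. 1) 2 u powr 2) powr (1 / 2) = Lp_norm S (\<lambda>_. 1) 2 u" for u :: "'a \<Rightarrow> real"
  proof -
    have "Lp_norm S (\<lambda>_. 1) 2 ((\<lambda>u x. 0) u :: 'a \<Rightarrow> 'a) = 0" by (simp add: Lp_norm_def)
    moreover have "0 \<le> Lp_norm S (\<lambda>_. 1) 2 u" by (simp add: Lp_norm_def)
    ultimately show ?thesis by (simp add: powr_powr)
  qed
  ultimately show ?thesis by simp
qed

lemma L2_norm_sq: "Lp_norm S (\<lambda>_. 1) 2 u powr 2 = (LINT x|lebesgue_on S. (u x)\<^sup>2)"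
  by (subst Lp_norm_powr) (auto simp: powr_abs_power2)

lemma L2_time_lin:
  assumes "u \<in> L2_time T S" "v \<in> L2_time T S" shows "(\<lambda>t x. c * u t x + d * v t x) \<in> L2_time T S"
proof -
  interpret seminormed "Lp_space S (\<lambda>_. 1) 2" "Lp_norm S (\<lambda>_. 1) 2" by (rule L2_seminormed)
  show ?thesis using assms unfolding L2_time_def by (rule bochner_Lp_lin) simp
qed

lemma L2_time_mem: "u \<in> L2_time T S \<Longrightarrow> AE t in I0 T. u t \<in> Lp_space S (\<lambda>_. 1) 2"
  by (simp add: L2_time_def bochner_Lp_def bochner_measurable_def)

lemma L2_time_sq_integrable:
  assumes "u \<in> L2_time T S" shows "integrable (I0 T) (\<lambda>t. LINT x|lebesgue_on S. (u t x)\<^sup>2)"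
  using assms by (simp add: L2_time_def bochner_Lp_def L2_norm_sq)

text \<open>Polarisation: measurability in time is known for squared norms, and the product is a
  quarter of the difference of those of the sum and the difference.\<close>

lemma L2_time_mult_integrable:
  assumes u: "u \<in> L2_time T S" and v: "v \<in> L2_time T S"
  shows "integrable (I0 T) (\<lambda>t. LINT x|lebesgue_on S. u t x * v t x)"
proof -
  have i: "integrable (I0 T) (\<lambda>t. (1 / 4) * ((LINT x|lebesgue_on S. (1 * u t x + 1 * v t x)\<^sup>2) - (LINT x|lebesgue_on S. (1 * u t x + (-1) * v t x)\<^sup>2)))"
    using L2_time_sq_integrable[OF L2_time_lin[OF u v, of 1 1]] L2_time_sq_integrable[OF L2_time_lin[OF u v, of 1 "-1"]] by simp
  have ae: "AE t in I0 T. (1 / 4) * ((LINT x|lebesgue_on S. (1 * u t x + 1 * v t x)\<^sup>2) - (LINT x|lebesgue_on S. (1 * u t x + (-1) * v t x)\<^sup>2)) = (LINT x|lebesgue_on S. u t x * v t x)"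
    using L2_time_mem[OF u] L2_time_mem[OF v]
  proof eventually_elim
    case (elim t)
    have uv: "integrable (lebesgue_on S) (\<lambda>x. u t x * v t x)" by (rule L2_mult_integrable[OF elim])
    have uu: "integrable (lebesgue_on S) (\<lambda>x. (u t x)\<^sup>2)" "integrable (lebesgue_on S) (\<lambda>x. (v t x)\<^sup>2)"
      using L2_mult_integrable[OF elim(1,1)] L2_mult_integrable[OF elim(2,2)] by (auto simp: power2_eq_square)
    have e: "(1 * u t x + 1 * v t x)\<^sup>2 = (u t x)\<^sup>2 + 2 * (u t x * v t x) + (v t x)\<^sup>2" "(1 * u t x + (-1) * v t x)\<^sup>2 = (u t x)\<^sup>2 - 2 * (u t x * v t x) + (v t x)\<^sup>2" for x
      by (auto simp: power2_eq_square algebra_simps)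
    have 1: "(LINT x|lebesgue_on S. (1 * u t x + 1 * v t x)\<^sup>2) = (LINT x|lebesgue_on S. (u t x)\<^sup>2) + 2 * (LINT x|lebesgue_on S. u t x * v t x) + (LINT x|lebesgue_on S. (v t x)\<^sup>2)"
      unfolding e using uv uu by simp
    have 2: "(LINT x|lebesgue_on S. (1 * u t x + (-1) * v t x)\<^sup>2) = (LINT x|lebesgue_on S. (u t x)\<^sup>2) - 2 * (LINT x|lebesgue_on S. u t x * v t x) + (LINT x|lebesgue_on S. (v t x)\<^sup>2)"
      unfolding e using uv uu by simp
    show ?case unfolding 1 2 by simp
  qed
  have m: "(\<lambda>t. LINT x|lebesgue_on S. u t x * v t x) \<in> borel_measurable (I0 T)"
    by (rule measurable_lebesgue_on_AE[OF borel_measurable_integrable[OF i] I0_sets ae])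
  show ?thesis by (rule integrable_cong_AE[THEN iffD1, OF _ m ae i]) (use i in auto)
qed

definition ip :: "real \<Rightarrow> 'a::euclidean_space set \<Rightarrow> (real \<Rightarrow> 'a \<Rightarrow> real) \<Rightarrow> (real \<Rightarrow> 'a \<Rightarrow> real) \<Rightarrow> real" where
  "ip T S u v = (LINT t|I0 T. LINT x|lebesgue_on S. u t x * v t x)"

lemma ip_commute: "ip T S u v = ip T S v u"
  by (simp add: ip_def mult.commute)

lemma ip_lin_left:
  assumes u: "u \<in> L2_time T S" and v: "v \<in> L2_time T S" and w: "w \<in> L2_time T S"
  shows "ip T S (\<lambda>t x. c * u t x + d * v t x) w = c * ip T S u w + d * ip T S v w"
proof -
  note i = L2_time_mult_integrable
  have "ip T S (\<lambda>t x. c * u t x + d * v t x) w = (LINT t|I0 T. c * (LINT x|lebesgue_on S. u t x * w t x) + d * (LINT x|lebesgue_on S. v t x * w t x))"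
    unfolding ip_def
  proof (rule integral_cong_AE)
    show "AE t in I0 T. (LINT x|lebesgue_on S. (c * u t x + d * v t x) * w t x) = c * (LINT x|lebesgue_on S. u t x * w t x) + d * (LINT x|lebesgue_on S. v t x * w t x)"
      using L2_time_mem[OF u] L2_time_mem[OF v] L2_time_mem[OF w]
    proof eventually_elim
      case (elim t)
      have "(LINT x|lebesgue_on S. (c * u t x + d * v t x) * w t x) = (LINT x|lebesgue_on S. c * (u t x * w t x) + d * (v t x * w t x))"
        by (intro Bochner_Integration.integral_cong) (auto simp: algebra_simps)
      then show ?case using L2_mult_integrable[OF elim(1,3)] L2_mult_integrable[OF elim(2,3)] by simp
    qed
  qed (use i[OF L2_time_lin[OF u v] w] i[OF u w] i[OF v w] in auto)
  also have "\<dots> = c * ip T S u w + d * ip T S v w" unfolding ip_def using i[OF u w] i[OF v w] by simp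
  finally show ?thesis .
qed

lemma ip_self_nonneg: "0 \<le> ip T S u u"
  unfolding ip_def by (intro Bochner_Integration.integral_nonneg) simp

lemma ip_sq_lin:
  assumes u: "u \<in> L2_time T S" and v: "v \<in> L2_time T S"
  shows "ip T S (\<lambda>t x. c * u t x + d * v t x) (\<lambda>t x. c * u t x + d * v t x) = c\<^sup>2 * ip T S u u + 2 * c * d * ip T S u v + d\<^sup>2 * ip T S v v"
proof -
  note w = L2_time_lin[OF u v, of c d]
  have "ip T S (\<lambda>t x. c * u t x + d * v t x) (\<lambda>t x. c * u t x + d * v t x) = c * ip T S (\<lambda>t x. c * u t x + d * v t x) u + d * ip T S (\<lambda>t x. c * u t x + d * v t x) v"
    using ip_lin_left[OF u v w, of c d] by (simp add: ip_commute)
  also have "\<dots> = c * (c * ip T S u u + d * ip T S v u) + d * (c * ip T S u v + d * ip T S v v)"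
    by (simp add: ip_lin_left[OF u v u] ip_lin_left[OF u v v])
  finally show ?thesis by (simp add: ip_commute[of T S v u] power2_eq_square algebra_simps)
qed

lemma ip_cong:
  assumes u: "u \<in> L2_time T S" "u' \<in> L2_time T S" "eq_L2 T S u u'" and v: "v \<in> L2_time T S" "v' \<in> L2_time T S" "eq_L2 T S v v'"
  shows "ip T S u v = ip T S u' v'"
  unfolding ip_def
proof (rule integral_cong_AE)
  show "AE t in I0 T. (LINT x|lebesgue_on S. u t x * v t x) = (LINT x|lebesgue_on S. u' t x * v' t x)"
    using u(3)[unfolded eq_L2_def] v(3)[unfolded eq_L2_def] L2_time_mem[OF u(1)] L2_time_mem[OF u(2)] L2_time_mem[OF v(1)] L2_time_mem[OF v(2)]
  proof eventually_elim
    case (elim t)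
    show ?case
    proof (rule integral_cong_AE)
      show "AE x in lebesgue_on S. u t x * v t x = u' t x * v' t x" using elim(1,2) by eventually_elim simp
    qed (use L2_mult_integrable[OF elim(3,5)] L2_mult_integrable[OF elim(4,6)] in auto)
  qed
qed (use L2_time_mult_integrable[OF u(1) v(1)] L2_time_mult_integrable[OF u(2) v(2)] in auto)

lemma bochner_simple_map:
  assumes "bochner_simple T X s" "F ` X \<subseteq> Y" shows "bochner_simple T Y (\<lambda>t. F (s t))"
  using assms fin_meas_comp2[of T s "\<lambda>t. ()" "\<lambda>x y. F x"] fin_meas_const[of T "()"]
  unfolding bochner_simple_fin_meas by fastforce

lemma ext_zero_Lp:
  fixes S :: "'a::euclidean_space set"
  assumes S: "S \<subseteq> \<Omega>" "S \<in> sets lebesgue" "\<Omega> \<in> sets lebesgue"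
  shows "h \<in> Lp_space S (\<lambda>_. 1) 2 \<Longrightarrow> ext_zero S h \<in> Lp_space \<Omega> (\<lambda>_. 1) 2"
    "Lp_norm \<Omega> (\<lambda>_. 1) 2 (ext_zero S h) = Lp_norm S (\<lambda>_. 1) 2 h"
    "(LINT x|lebesgue_on \<Omega>. ext_zero S h x * k x) = (LINT x|lebesgue_on S. h x * k x)"
proof -
  have e: "ext_zero S h = (\<lambda>x. if x \<in> S then h x else 0)" by (simp add: ext_zero_def)
  have sq: "(ext_zero S h x)\<^sup>2 = indicator S x * (h x)\<^sup>2" for x by (simp add: ext_zero_def)
  have pr: "ext_zero S h x * k x = indicator S x * (h x * k x)" for x by (simp add: ext_zero_def)
  show "(LINT x|lebesgue_on \<Omega>. ext_zero S h x * k x) = (LINT x|lebesgue_on S. h x * k x)"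
    unfolding pr by (rule lebesgue_on_subset_integral(1)[OF S(1,3,2)])
  have "(LINT x|lebesgue_on \<Omega>. (ext_zero S h x)\<^sup>2) = (LINT x|lebesgue_on S. (h x)\<^sup>2)"
    unfolding sq by (rule lebesgue_on_subset_integral(1)[OF S(1,3,2)])
  then show "Lp_norm \<Omega> (\<lambda>_. 1) 2 (ext_zero S h) = Lp_norm S (\<lambda>_. 1) 2 h"
    by (simp add: Lp_norm_def powr_abs_power2)
  assume h: "h \<in> Lp_space S (\<lambda>_. 1) 2"
  then have "h \<in> borel_measurable (lebesgue_on S)" by (rule Lp_measurable)
  then have "ext_zero S h \<in> borel_measurable (lebesgue_on \<Omega>)"
    unfolding e using borel_measurable_if_lebesgue_on[OF S(2,3,1)] by blast
  moreover have "integrable (lebesgue_on \<Omega>) (\<lambda>x. (ext_zero S h x)\<^sup>2)"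
    unfolding sq using h by (subst lebesgue_on_subset_integral(2)[OF S(1,3,2)]) (simp add: Lp_space_def powr_abs_power2)
  ultimately show "ext_zero S h \<in> Lp_space \<Omega> (\<lambda>_. 1) 2" by (simp add: Lp_space_def powr_abs_power2)
qed

lemma ext_zero_L2_time:
  assumes S: "S \<subseteq> \<Omega>" "S \<in> sets lebesgue" "\<Omega> \<in> sets lebesgue" and h: "h \<in> L2_time T S"
  shows "(\<lambda>t. ext_zero S (h t)) \<in> L2_time T \<Omega>"
proof -
  note E = ext_zero_Lp[OF S]
  interpret L: seminormed "Lp_space S (\<lambda>_. 1) 2" "Lp_norm S (\<lambda>_. 1) 2" by (rule L2_seminormed)
  have hm: "bochner_measurable T (Lp_space S (\<lambda>_. 1) 2) (Lp_norm S (\<lambda>_. 1) 2) h" using h by (simp add: L2_time_def bochner_Lp_def)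
  obtain s where s: "\<And>n::nat. bochner_simple T (Lp_space S (\<lambda>_. 1) 2) (s n)" "AE t in I0 T. h t \<in> Lp_space S (\<lambda>_. 1) 2 \<and> (\<forall>n. s n t \<in> Lp_space S (\<lambda>_. 1) 2) \<and> (\<lambda>n. Lp_norm S (\<lambda>_. 1) 2 (\<lambda>y. s n t y - h t y)) \<longlonglongrightarrow> 0"
    using hm by (rule L.bochner_measurableE) (rule that)
  have d: "(\<lambda>y. ext_zero S u y - ext_zero S v y) = ext_zero S (\<lambda>y. u y - v y)" for u v by (auto simp: ext_zero_def)
  have "bochner_measurable T (Lp_space \<Omega> (\<lambda>_. 1) 2) (Lp_norm \<Omega> (\<lambda>_. 1) 2) (\<lambda>t. ext_zero S (h t))"
    unfolding bochner_measurable_def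
  proof (intro conjI exI[of _ "\<lambda>n t. ext_zero S (s n t)"] allI)
    show "AE t in I0 T. ext_zero S (h t) \<in> Lp_space \<Omega> (\<lambda>_. 1) 2" using s(2) by eventually_elim (use E(1) in blast)
    show "bochner_simple T (Lp_space \<Omega> (\<lambda>_. 1) 2) (\<lambda>t. ext_zero S (s n t))" for n
      by (rule bochner_simple_map[OF s(1)]) (use E(1) in auto)
    show "AE t in I0 T. (\<lambda>n. Lp_norm \<Omega> (\<lambda>_. 1) 2 (\<lambda>y. ext_zero S (s n t) y - ext_zero S (h t) y)) \<longlonglongrightarrow> 0"
      unfolding d E(2) using s(2) by eventually_elim blast
  qed
  moreover have "integrable (I0 T) (\<lambda>t. Lp_norm \<Omega> (\<lambda>_. 1) 2 (ext_zero S (h t)) powr 2)"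
    unfolding E(2) using h by (simp add: L2_time_def bochner_Lp_def)
  ultimately show ?thesis by (simp add: L2_time_def bochner_Lp_def)
qed

lemma test_fun_times_integrable:
  assumes \<phi>: "\<phi> \<in> test_fun {0<..<T}" and k: "integrable (I0 T) k"
  shows "integrable (I0 T) (\<lambda>t. \<phi> t * k t)" "integrable (I0 T) (\<lambda>t. deriv \<phi> t * k t)"
proof -
  obtain K where K: "compact K" "K \<subseteq> {0<..<T}" "\<And>x. x \<notin> K \<Longrightarrow> \<phi> x = 0" "\<And>x. x \<notin> K \<Longrightarrow> cgrad \<phi> x = 0"
    "continuous_on UNIV \<phi>" "continuous_on UNIV (cgrad \<phi>)"
    by (rule test_fun_facts[OF \<phi>]) (rule that)
  have d: "deriv \<phi> = cgrad \<phi>"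
  proof
    fix x
    have "GDERIV \<phi> x :> cgrad \<phi> x" using test_fun_Ck[OF \<phi>] by (rule Ck_GDERIV)
    then show "deriv \<phi> x = cgrad \<phi> x" by (simp add: DERIV_imp_deriv)
  qed
  have loc: "loc_integrable {0<..<T} k" by (rule integrable_loc_integrable[OF I0_sets k])
  show "integrable (I0 T) (\<lambda>t. \<phi> t * k t)" "integrable (I0 T) (\<lambda>t. deriv \<phi> t * k t)"
    unfolding d using loc_integrable_mult[OF _ loc K(6,1,4,2)] loc_integrable_mult[OF _ loc K(5,1,3,2)] by (simp_all add: mult.commute)
qed

context seminormed
begin

text \<open>\<open>ddt\<close> is a choice and thus not additive by itself. The difference of two
  chosen derivatives is shown to be a derivative of the difference, and
  \<open>ddt_pairing_nonneg\<close> accepts any derivative.\<close>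

lemma is_ddt_diff:
  assumes p: "p > 1" and u: "Mu \<in> bochner_dual T X N (p / (p - 1))" "is_ddt T X N (p / (p - 1)) Mu g"
    and v: "Mv \<in> bochner_dual T X N (p / (p - 1))" "is_ddt T X N (p / (p - 1)) Mv k"
  shows "(\<lambda>t x. Mu t x - Mv t x) \<in> bochner_dual T X N (p / (p - 1))"
    "is_ddt T X N (p / (p - 1)) (\<lambda>t x. Mu t x - Mv t x) (\<lambda>t x. g t x - k t x)"
proof -
  interpret D: seminormed "dual_space X N" "dual_norm X N" by (rule dual_seminormed)
  have q: "p / (p - 1) > 0" using p by simp
  have dif: "(\<lambda>t x. f t x - h t x) \<in> bochner_dual T X N (p / (p - 1))"
    if "f \<in> bochner_dual T X N (p / (p - 1))" "h \<in> bochner_dual T X N (p / (p - 1))" for f h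
    using D.bochner_Lp_lin[OF that[unfolded bochner_dual_def] q, of 1 "-1"] by (simp add: bochner_dual_def)
  show "(\<lambda>t x. Mu t x - Mv t x) \<in> bochner_dual T X N (p / (p - 1))" by (rule dif[OF u(1) v(1)])
  have gk: "g \<in> bochner_dual T X N (p / (p - 1))" "k \<in> bochner_dual T X N (p / (p - 1))" using u v by (auto simp: is_ddt_def)
  show "is_ddt T X N (p / (p - 1)) (\<lambda>t x. Mu t x - Mv t x) (\<lambda>t x. g t x - k t x)"
    unfolding is_ddt_def
  proof (intro conjI ballI)
    show "(\<lambda>t x. g t x - k t x) \<in> bochner_dual T X N (p / (p - 1))" by (rule dif[OF gk])
    fix \<phi> y assume \<phi>: "\<phi> \<in> test_fun {0<..<T}" and y: "y \<in> X"
    have I: "integrable (I0 T) (\<lambda>t. deriv \<phi> t * f t y)" "integrable (I0 T) (\<lambda>t. \<phi> t * f t y)"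
      if "f \<in> bochner_dual T X N (p / (p - 1))" for f
      using test_fun_times_integrable[OF \<phi> dual_pairing_integrable_const[OF that p y]] by simp_all
    have "- (LINT t|I0 T. deriv \<phi> t * (Mu t y - Mv t y)) = - (LINT t|I0 T. deriv \<phi> t * Mu t y) - (- (LINT t|I0 T. deriv \<phi> t * Mv t y))"
      using I(1)[OF u(1)] I(1)[OF v(1)] by (simp add: right_diff_distrib)
    also have "\<dots> = (LINT t|I0 T. \<phi> t * g t y) - (LINT t|I0 T. \<phi> t * k t y)"
      using u(2) v(2) \<phi> y unfolding is_ddt_def by simp
    also have "\<dots> = (LINT t|I0 T. \<phi> t * (g t y - k t y))"
      using I(2)[OF gk(1)] I(2)[OF gk(2)] by (simp add: right_diff_distrib)
    finally show "- (LINT t|I0 T. deriv \<phi> t * (Mu t y - Mv t y)) = (LINT t|I0 T. \<phi> t * (g t y - k t y))" .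
  qed
qed

lemma zero_initial_diff:
  assumes u: "zero_initial T X N Mu" and v: "zero_initial T X N Mv"
  shows "zero_initial T X N (\<lambda>t x. Mu t x - Mv t x)"
proof -
  interpret D: seminormed "dual_space X N" "dual_norm X N" by (rule dual_seminormed)
  obtain U where U: "AE t in I0 T. \<forall>v\<in>X. U t v = Mu t v" "\<forall>t\<in>{0..T}. U t \<in> dual_space X N"
      "\<forall>t\<in>{0..T}. ((\<lambda>s. dual_norm X N (\<lambda>v. U s v - U t v)) \<longlongrightarrow> 0) (at t within {0..T})" "\<forall>v\<in>X. U 0 v = 0"
    using u by (auto simp: zero_initial_def)
  obtain V where V: "AE t in I0 T. \<forall>v\<in>X. V t v = Mv t v" "\<forall>t\<in>{0..T}. V t \<in> dual_space X N"
      "\<forall>t\<in>{0..T}. ((\<lambda>s. dual_norm X N (\<lambda>v. V s v - V t v)) \<longlongrightarrow> 0) (at t within {0..T})" "\<forall>v\<in>X. V 0 v = 0"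
    using v by (auto simp: zero_initial_def)
  show ?thesis
    unfolding zero_initial_def
  proof (intro exI[of _ "\<lambda>t x. U t x - V t x"] conjI ballI)
    show "AE t in I0 T. \<forall>v\<in>X. U t v - V t v = Mu t v - Mv t v" using U(1) V(1) by eventually_elim simp
    show "(\<lambda>x. U t x - V t x) \<in> dual_space X N" if "t \<in> {0..T}" for t using U(2) V(2) that by (intro D.diff_mem) auto
    show "U 0 v - V 0 v = 0" if "v \<in> X" for v using U(4) V(4) that by simp
    fix t assume t: "t \<in> {0..T}"
    show "((\<lambda>s. dual_norm X N (\<lambda>v. U s v - V s v - (U t v - V t v))) \<longlongrightarrow> 0) (at t within {0..T})"
    proof (rule Lim_null_comparison)
      show "((\<lambda>s. dual_norm X N (\<lambda>v. U s v - U t v) + dual_norm X N (\<lambda>v. V s v - V t v)) \<longlongrightarrow> 0) (at t within {0..T})"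
        using tendsto_add[OF bspec[OF U(3) t] bspec[OF V(3) t]] by simp
      show "\<forall>\<^sub>F s in at t within {0..T}. norm (dual_norm X N (\<lambda>v. U s v - V s v - (U t v - V t v))) \<le> dual_norm X N (\<lambda>v. U s v - U t v) + dual_norm X N (\<lambda>v. V s v - V t v)"
        unfolding eventually_at_filter
      proof (intro always_eventually allI impI)
        fix s assume s: "s \<noteq> t" "s \<in> {0..T}"
        have a: "(\<lambda>v. U s v - U t v) \<in> dual_space X N" "(\<lambda>v. V s v - V t v) \<in> dual_space X N"
          using U(2) V(2) s t by (auto intro!: D.diff_mem)
        have e: "(\<lambda>v. U s v - V s v - (U t v - V t v)) = (\<lambda>v. (U s v - U t v) - (V s v - V t v))" by (auto simp: algebra_simps)
        show "norm (dual_norm X N (\<lambda>v. U s v - V s v - (U t v - V t v))) \<le> dual_norm X N (\<lambda>v. U s v - U t v) + dual_norm X N (\<lambda>v. V s v - V t v)"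
          unfolding e using D.N_diff_le[OF a] D.N_nonneg[OF D.diff_mem[OF a]] by simp
      qed
    qed
  qed
qed

end

section \<open>Monotonicity of the flux\<close>

lemma AE_limit_measurable_on:
  fixes f :: "nat \<Rightarrow> 'a::euclidean_space \<Rightarrow> real"
  assumes f: "\<And>n. f n \<in> borel_measurable (lebesgue_on S)" and S: "S \<in> sets lebesgue" and lim: "AE x in lebesgue_on S. (\<lambda>n. f n x) \<longlonglongrightarrow> g x"
  shows "g \<in> borel_measurable (lebesgue_on S)"
proof -
  have "(\<lambda>t. lim (\<lambda>n. f n t)) \<in> borel_measurable (lebesgue_on S)" using f by (rule borel_measurable_lim_metric)
  moreover have "AE t in lebesgue_on S. lim (\<lambda>n. f n t) = g t" using lim by eventually_elim (rule limI)
  ultimately show ?thesis by (rule measurable_lebesgue_on_AE[OF _ S])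
qed

text \<open>Rounds every coordinate down to a multiple of \<open>1 / Suc n\<close>; the values form
  a countable set.\<close>

definition round_pt :: "nat \<Rightarrow> 'a::euclidean_space \<Rightarrow> 'a" where
  "round_pt n z = (\<Sum>j\<in>Basis. (of_int \<lfloor>real (Suc n) * (z \<bullet> j)\<rfloor> / real (Suc n)) *\<^sub>R j)"

lemma round_pt_rat: "round_pt n z \<in> rat_points"
  by (auto simp: round_pt_def rat_points_def intro!: Rats_divide Rats_of_int Rats_of_nat simp del: of_nat_Suc)

lemma round_pt_limit: "(\<lambda>n. round_pt n z) \<longlonglongrightarrow> z"
proof -
  have c: "(\<lambda>n. of_int \<lfloor>real (Suc n) * r\<rfloor> / real (Suc n)) \<longlonglongrightarrow> r" for r :: real
  proof (rule LIM_zero_cancel, rule Lim_null_comparison[OF always_eventually LIMSEQ_inverse_real_of_nat], rule allI)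
    fix n
    have f: "of_int \<lfloor>real (Suc n) * r\<rfloor> \<le> real (Suc n) * r" "real (Suc n) * r < of_int \<lfloor>real (Suc n) * r\<rfloor> + 1" by linarith+
    have "of_int \<lfloor>real (Suc n) * r\<rfloor> / real (Suc n) - r = (of_int \<lfloor>real (Suc n) * r\<rfloor> - real (Suc n) * r) / real (Suc n)"
      by (simp add: diff_divide_distrib del: of_nat_Suc)
    also have "norm \<dots> = \<bar>of_int \<lfloor>real (Suc n) * r\<rfloor> - real (Suc n) * r\<bar> / real (Suc n)" by (simp add: abs_divide del: of_nat_Suc)
    also have "\<dots> \<le> 1 / real (Suc n)" by (intro divide_right_mono) (use f in linarith)+
    finally show "norm (of_int \<lfloor>real (Suc n) * r\<rfloor> / real (Suc n) - r) \<le> inverse (real (Suc n))" by (simp add: inverse_eq_divide del: of_nat_Suc)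
  qed
  have "(\<lambda>n. \<Sum>j\<in>Basis. (of_int \<lfloor>real (Suc n) * (z \<bullet> j)\<rfloor> / real (Suc n)) *\<^sub>R j) \<longlonglongrightarrow> (\<Sum>j\<in>Basis. (z \<bullet> j) *\<^sub>R j)"
    by (intro tendsto_sum tendsto_scaleR tendsto_const c)
  then show ?thesis by (simp add: round_pt_def euclidean_representation)
qed

lemma round_pt_measurable: "round_pt n \<in> borel_measurable borel"
  unfolding round_pt_def[abs_def] by measurable

text \<open>Composed with the rounded \<open>z\<close>, the function is glued from countably many
  measurable pieces, one for each rational point. Continuity in the second argument passes to the
  limit of the rounding.\<close>

lemma caratheodory_measurable:
  fixes \<phi> :: "'a::euclidean_space \<Rightarrow> 'c::euclidean_space \<Rightarrow> real"
  assumes S: "S \<in> sets lebesgue" and m: "\<And>r. r \<in> rat_points \<Longrightarrow> (\<lambda>x. \<phi> x r) \<in> borel_measurable (lebesgue_on S)"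
    and c: "AE x in lebesgue_on S. continuous_on UNIV (\<phi> x)" and z: "z \<in> borel_measurable (lebesgue_on S)"
  shows "(\<lambda>x. \<phi> x (z x)) \<in> borel_measurable (lebesgue_on S)"
proof (rule AE_limit_measurable_on[OF _ S])
  fix n
  have g: "(\<lambda>x. round_pt n (z x)) \<in> borel_measurable (lebesgue_on S)" using z round_pt_measurable by (rule measurable_compose)
  have g': "(\<lambda>x. round_pt n (z x)) \<in> lebesgue_on S \<rightarrow>\<^sub>M count_space rat_points"
  proof (rule measurable_count_space_eq_countable[OF countable_rat_points, THEN iffD2], intro conjI ballI)
    show "(\<lambda>x. round_pt n (z x)) \<in> space (lebesgue_on S) \<rightarrow> rat_points" using round_pt_rat by blast
    fix r :: 'c
    show "(\<lambda>x. round_pt n (z x)) -` {r} \<inter> space (lebesgue_on S) \<in> sets (lebesgue_on S)"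
      using measurable_sets[OF g, of "{r}"] by simp
  qed
  show "(\<lambda>x. \<phi> x (round_pt n (z x))) \<in> borel_measurable (lebesgue_on S)"
    by (rule measurable_compose_countable'[where f="\<lambda>r x. \<phi> x r", OF m g' countable_rat_points])
next
  show "AE x in lebesgue_on S. (\<lambda>n. \<phi> x (round_pt n (z x))) \<longlonglongrightarrow> \<phi> x (z x)"
    using c
  proof eventually_elim
    case (elim x)
    then have "isCont (\<phi> x) (z x)" by (simp add: continuous_on_eq_continuous_at)
    then show ?case using round_pt_limit by (rule isCont_tendsto_compose)
  qed
qed

section \<open>Time sections of space-time functions and the flux at a fixed time\<close>

lemma cylinder_sets:
  assumes "open \<Omega>" shows "\<Omega> \<times> {0<..<T::real} \<in> sets borel" "\<Omega> \<times> {0<..<T} \<in> sets lebesgue"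
proof -
  have "open (\<Omega> \<times> {0<..<T})" using assms by (intro open_Times) auto
  then show "\<Omega> \<times> {0<..<T} \<in> sets borel" "\<Omega> \<times> {0<..<T} \<in> sets lebesgue" by (auto intro: open_sets_lebesgue)
qed

text \<open>Fubini for null sets gives the iterated statement with the space variable outside; the
  order is then exchanged, which requires the exceptional set to be Borel.\<close>

lemma lborel_prod_AE_sections:
  fixes P :: "'a::euclidean_space \<times> real \<Rightarrow> bool"
  assumes "AE q in lborel. P q"
  shows "AE t in lborel. AE x in lborel. P (x, t)"
proof -
  obtain N where N: "N \<in> null_sets lborel" "{q. \<not> P q} \<subseteq> N" using assms by (auto simp: eventually_ae_filter)
  have Nb: "N \<in> sets (lborel \<Otimes>\<^sub>M lborel)" unfolding lborel_prod using N(1) by (rule null_setsD2)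
  have "AE q in lborel \<Otimes>\<^sub>M lborel. q \<notin> N" unfolding lborel_prod by (rule AE_not_in[OF N(1)])
  then have "AE x in lborel. AE t in lborel. (x, t) \<notin> N" by (rule lborel_pair.AE_pair)
  moreover have "{x \<in> space (lborel \<Otimes>\<^sub>M lborel). (fst x, snd x) \<notin> N} \<in> sets (lborel \<Otimes>\<^sub>M lborel)"
  proof -
    have "{x \<in> space (lborel \<Otimes>\<^sub>M lborel). (fst x, snd x) \<notin> N} = space (lborel \<Otimes>\<^sub>M lborel) - N" by auto
    then show ?thesis using sets.compl_sets[OF Nb] by (simp only:)
  qed
  ultimately have "AE t in lborel. AE x in lborel. (x, t) \<notin> N"
    using lborel_pair.AE_commute[of "\<lambda>x t. (x, t) \<notin> N"] by simp
  then show ?thesis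
  proof eventually_elim
    case (elim t)
    then show ?case by eventually_elim (use N(2) in auto)
  qed
qed

lemma AE_sections:
  fixes \<Omega> :: "'a::euclidean_space set"
  assumes \<Omega>: "open \<Omega>" and P: "AE q in lebesgue_on (\<Omega> \<times> {0<..<T}). P q"
  shows "AE t in I0 T. AE x in lebesgue_on \<Omega>. P (x, t)"
proof -
  have "AE q in lborel. q \<in> \<Omega> \<times> {0<..<T} \<longrightarrow> P q" using P lebesgue_on_AE_lborel[OF cylinder_sets(1)[OF \<Omega>]] by blast
  then have "AE t in lborel. AE x in lborel. (x, t) \<in> \<Omega> \<times> {0<..<T} \<longrightarrow> P (x, t)" by (rule lborel_prod_AE_sections)
  then have "AE t in lborel. t \<in> {0<..<T} \<longrightarrow> (AE x in lebesgue_on \<Omega>. P (x, t))"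
  proof eventually_elim
    case (elim t)
    show ?case
    proof
      assume "t \<in> {0<..<T}"
      with elim show "AE x in lebesgue_on \<Omega>. P (x, t)"
        using \<Omega> by (subst lebesgue_on_AE_lborel) (auto elim!: eventually_mono)
    qed
  qed
  then show ?thesis by (simp add: AE_I0_lborel)
qed

text \<open>Sections of a Lebesgue measurable function can fail to be measurable at exceptional
  times. A Borel version has measurable sections and agrees with the given function on almost every
  section.\<close>

lemma measurable_sections:
  fixes \<Omega> :: "'a::euclidean_space set" and f :: "'a \<times> real \<Rightarrow> real"
  assumes \<Omega>: "open \<Omega>" and f: "f \<in> borel_measurable (lebesgue_on (\<Omega> \<times> {0<..<T}))"
  shows "AE t in I0 T. (\<lambda>x. f (x, t)) \<in> borel_measurable (lebesgue_on \<Omega>)"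
proof -
  let ?Q = "\<Omega> \<times> {0<..<T}"
  have "(\<lambda>q. if q \<in> ?Q then f q else 0) \<in> borel_measurable (completion lborel)"
    using f cylinder_sets(2)[OF \<Omega>] by (rule borel_measurable_if_I)
  from completion_ex_borel_measurable_real[OF this] obtain g where g: "g \<in> borel_measurable lborel"
    "AE q in lborel. (if q \<in> ?Q then f q else 0) = g q" by blast
  have "AE q in lebesgue_on ?Q. g q = f q"
    unfolding lebesgue_on_AE_lborel[OF cylinder_sets(1)[OF \<Omega>]] using g(2) by eventually_elim auto
  from AE_sections[OF \<Omega> this] show ?thesis
  proof eventually_elim
    case (elim t)
    have "g \<in> borel_measurable borel" using g(1) by simp
    moreover have "(\<lambda>x. (x, t)) \<in> borel_measurable borel" by (intro borel_measurable_continuous_onI continuous_intros)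
    ultimately have "(\<lambda>x. g (x, t)) \<in> borel_measurable borel" by (rule measurable_compose[rotated])
    from borel_measurable_lebesgue_on[OF this] show ?case
      by (rule measurable_lebesgue_on_AE[OF _ open_sets_lebesgue[OF \<Omega>] elim])
  qed
qed

lemma integrable_sections:
  fixes \<Omega> :: "'a::euclidean_space set" and f :: "'a \<times> real \<Rightarrow> real"
  assumes \<Omega>: "open \<Omega>" and f: "integrable (lebesgue_on (\<Omega> \<times> {0<..<T})) f"
  shows "AE t in I0 T. integrable (lebesgue_on \<Omega>) (\<lambda>x. f (x, t))"
proof -
  let ?Q = "\<Omega> \<times> {0<..<T}"
  obtain g where g: "g \<in> borel_measurable borel" "integrable lborel g" "AE q in lebesgue_on ?Q. g q = f q"
    by (rule borel_representative[OF f cylinder_sets(1)[OF \<Omega>]]) (rule that)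
  have "integrable (lborel \<Otimes>\<^sub>M lborel) (\<lambda>(x, t). g (x, t))" using g(2) by (simp add: lborel_prod)
  then have "AE t in lborel. integrable lborel (\<lambda>x. g (x, t))" by (rule lborel_pair.AE_integrable_snd[where f="\<lambda>x t. g (x, t)"])
  then have "AE t in I0 T. integrable lborel (\<lambda>x. g (x, t))" unfolding AE_I0_lborel by eventually_elim simp
  with AE_sections[OF \<Omega> g(3)] show ?thesis
  proof eventually_elim
    case (elim t)
    have "integrable (lebesgue_on UNIV) (\<lambda>x. g (x, t))" using elim(2) by (simp add: integrable_completion lebesgue_on_UNIV_eq)
    then have i: "integrable (lebesgue_on \<Omega>) (\<lambda>x. g (x, t))"
      by (rule integrable_lebesgue_on_subset) (use \<Omega> in \<open>auto intro: open_sets_lebesgue\<close>)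
    have m: "(\<lambda>x. f (x, t)) \<in> borel_measurable (lebesgue_on \<Omega>)"
      by (rule measurable_lebesgue_on_AE[OF borel_measurable_integrable[OF i] open_sets_lebesgue[OF \<Omega>] elim(1)])
    show ?case by (rule integrable_cong_AE[THEN iffD1, OF borel_measurable_integrable[OF i] m elim(1) i])
  qed
qed

text \<open>The \<open>p\<close>-structure at a fixed time.  Measurability is required only at the countably many rational
  points, so that it holds for almost every time; continuity extends it to all points.\<close>

definition flux_regular :: "'a::euclidean_space set \<Rightarrow> real \<Rightarrow> real \<Rightarrow> real \<Rightarrow> ('a \<Rightarrow> 'a \<Rightarrow> 'a) \<Rightarrow> ('a \<Rightarrow> real \<Rightarrow> real) \<Rightarrow> ('a \<Rightarrow> real) \<Rightarrow> bool" where
  "flux_regular \<Omega> p c C A B d \<longleftrightarrow>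
     (\<forall>r\<in>rat_points. \<forall>j\<in>Basis. (\<lambda>x. A x r \<bullet> j) \<in> borel_measurable (lebesgue_on \<Omega>)) \<and>
     (\<forall>r\<in>rat_points. (\<lambda>x. B x r) \<in> borel_measurable (lebesgue_on \<Omega>)) \<and>
     integrable (lebesgue_on \<Omega>) (\<lambda>x. \<bar>d x\<bar> powr (p / (p - 1))) \<and>
     (AE x in lebesgue_on \<Omega>. continuous_on UNIV (A x) \<and> continuous_on UNIV (B x) \<and>
        (\<forall>z. norm (A x z) \<le> C * norm z powr (p - 1) + d x) \<and>
        (\<forall>y. \<bar>B x y\<bar> \<le> C * \<bar>y\<bar> powr (p - 1) + d x) \<and>
        (\<forall>y1 y2 z1 z2. (A x z1 - A x z2) \<bullet> (z1 - z2) + (B x y1 - B x y2) * (y1 - y2) \<ge> c * (norm (z1 - z2) powr p + \<bar>y1 - y2\<bar> powr p)))"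

text \<open>The constants are those of the space-time condition and \<open>d t\<close> is the
  section of \<open>d1\<close> at time \<open>t\<close>. Each measurability requirement has its own
  null set of times; with rational arguments and coordinate directions there are countably
  many.\<close>

lemma p_structure_flux_regular:
  fixes \<Omega> :: "'a::euclidean_space set"
  assumes ps: "p_structure \<Omega> T p \<alpha> \<beta>" and \<Omega>: "open \<Omega>"
  obtains c C d where "c > 0" "C > 0" "AE t in I0 T. flux_regular \<Omega> p c C (\<lambda>x. \<alpha> x t) (\<lambda>x. \<beta> x t) (d t)"
proof -
  let ?Q = "lebesgue_on (\<Omega> \<times> {0<..<T})"
  from ps obtain c C d1 d2 where c: "c > 0" "C > 0"
    and d1: "d1 \<in> Lp_space (\<Omega> \<times> {0<..<T}) (\<lambda>_. 1) (p / (p - 1))"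
    and am: "\<forall>z. (\<lambda>(x, t). \<alpha> x t z) \<in> borel_measurable ?Q"
    and bm: "\<forall>y. (\<lambda>(x, t). \<beta> x t y) \<in> borel_measurable ?Q"
    and ae0: "AE (x, t) in ?Q.
           continuous_on UNIV (\<alpha> x t) \<and> continuous_on UNIV (\<beta> x t) \<and>
           (\<forall>z. norm (\<alpha> x t z) \<le> C * norm z powr (p - 1) + d1 (x, t)) \<and>
           (\<forall>y. \<bar>\<beta> x t y\<bar> \<le> C * \<bar>y\<bar> powr (p - 1) + d1 (x, t)) \<and>
           (\<forall>y1 y2 z1 z2.
              (\<alpha> x t z1 - \<alpha> x t z2) \<bullet> (z1 - z2) + (\<beta> x t y1 - \<beta> x t y2) * (y1 - y2)
                \<ge> c * (norm (z1 - z2) powr p + \<bar>y1 - y2\<bar> powr p)) \<and>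
           (\<forall>y z. \<alpha> x t z \<bullet> z + \<beta> x t y * y
                \<ge> c * (norm z powr p + \<bar>y\<bar> powr p) - d2 (x, t))"
    unfolding p_structure_def Let_def by (elim exE conjE) (rule that)
  have ae: "AE q in ?Q. (\<lambda>(x, t). continuous_on UNIV (\<alpha> x t) \<and> continuous_on UNIV (\<beta> x t) \<and>
           (\<forall>z. norm (\<alpha> x t z) \<le> C * norm z powr (p - 1) + d1 (x, t)) \<and>
           (\<forall>y. \<bar>\<beta> x t y\<bar> \<le> C * \<bar>y\<bar> powr (p - 1) + d1 (x, t)) \<and>
           (\<forall>y1 y2 z1 z2.
              (\<alpha> x t z1 - \<alpha> x t z2) \<bullet> (z1 - z2) + (\<beta> x t y1 - \<beta> x t y2) * (y1 - y2)
                \<ge> c * (norm (z1 - z2) powr p + \<bar>y1 - y2\<bar> powr p))) q"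
    using ae0
  proof eventually_elim
    case (elim q)
    obtain x t where "q = (x, t)" by (cases q)
    with elim show ?case unfolding \<open>q = (x, t)\<close> prod.case by (elim conjE) (intro conjI)
  qed
  have 1: "AE t in I0 T. (\<lambda>x. \<alpha> x t r \<bullet> j) \<in> borel_measurable (lebesgue_on \<Omega>)" for r j
  proof -
    have "(\<lambda>q. (\<lambda>(x, t). \<alpha> x t r) q \<bullet> j) \<in> borel_measurable (lebesgue_on (\<Omega> \<times> {0<..<T}))"
      using am by (intro borel_measurable_inner) auto
    from measurable_sections[OF \<Omega> this] show ?thesis by simp
  qed
  have 2: "AE t in I0 T. (\<lambda>x. \<beta> x t r) \<in> borel_measurable (lebesgue_on \<Omega>)" for r
    using measurable_sections[OF \<Omega> bm[rule_format, of r]] by simp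
  have 3: "AE t in I0 T. integrable (lebesgue_on \<Omega>) (\<lambda>x. \<bar>d1 (x, t)\<bar> powr (p / (p - 1)))"
    using d1 by (intro integrable_sections[OF \<Omega>]) (simp add: Lp_space_def)
  have r1: "AE t in I0 T. \<forall>(r, j)\<in>rat_points \<times> Basis. (\<lambda>x. \<alpha> x t r \<bullet> j) \<in> borel_measurable (lebesgue_on \<Omega>)"
    by (subst AE_ball_countable) (use 1 countable_SIGMA[OF countable_rat_points countable_finite[OF finite_Basis]] in auto)
  have r2: "AE t in I0 T. \<forall>r\<in>rat_points. (\<lambda>x. \<beta> x t r) \<in> borel_measurable (lebesgue_on \<Omega>)"
    by (subst AE_ball_countable) (use 2 in \<open>auto intro: countable_rat_points\<close>)
  have "AE t in I0 T. flux_regular \<Omega> p c C (\<lambda>x. \<alpha> x t) (\<lambda>x. \<beta> x t) ((\<lambda>t x. d1 (x, t)) t)"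
    using r1 r2 3 AE_sections[OF \<Omega> ae]
  proof eventually_elim
    case (elim t)
    show ?case unfolding flux_regular_def
    proof (intro conjI)
      show "\<forall>r\<in>rat_points. \<forall>j\<in>Basis. (\<lambda>x. \<alpha> x t r \<bullet> j) \<in> borel_measurable (lebesgue_on \<Omega>)" using elim(1) by blast
    qed (use elim in simp_all)
  qed
  with c show ?thesis by (rule that)
qed

lemma restrict_measurable_lebesgue_on:
  assumes S: "S \<subseteq> \<Omega>" "S \<in> sets lebesgue" "\<Omega> \<in> sets lebesgue" and f: "f \<in> borel_measurable (lebesgue_on \<Omega>)"
  shows "f \<in> borel_measurable (lebesgue_on S)"
proof -
  have "f \<in> borel_measurable (restrict_space (lebesgue_on \<Omega>) S)" by (rule measurable_restrict_space1[OF f])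
  then show ?thesis using S by (simp add: restrict_restrict_space Int_absorb1)
qed

lemma AE_lebesgue_on_subset:
  assumes S: "S \<subseteq> \<Omega>" "S \<in> sets lebesgue" "\<Omega> \<in> sets lebesgue" and P: "AE x in lebesgue_on \<Omega>. P x"
  shows "AE x in lebesgue_on S. P x"
  using P S by (auto simp: AE_restrict_space_iff elim!: eventually_mono)

text \<open>Young's inequality converts the growth bounds into an integrable majorant. The terms
  with \<open>z\<close> and \<open>y\<close> keep their weights, whereas \<open>d\<close> is
  integrable without weight and is where boundedness of \<open>a\<close> and \<open>b\<close>
  enters.\<close>

lemma flux_regular_integrable:
  fixes \<Omega> S :: "'a::euclidean_space set"
  assumes fr: "flux_regular \<Omega> p c C A B d" and p: "p \<ge> 2" and C: "C > 0"
    and S: "S \<subseteq> \<Omega>" "S \<in> sets lebesgue" "\<Omega> \<in> sets lebesgue"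
    and a: "a \<in> borel_measurable (lebesgue_on S)" "AE x in lebesgue_on S. 0 \<le> a x" "AE x in lebesgue_on S. \<bar>a x\<bar> \<le> M"
    and b: "b \<in> borel_measurable (lebesgue_on S)" "AE x in lebesgue_on S. 0 \<le> b x" "AE x in lebesgue_on S. \<bar>b x\<bar> \<le> M"
    and z: "z \<in> Lp_vec S a p" "z' \<in> Lp_vec S a p" and y: "y \<in> Lp_space S b p" "y' \<in> Lp_space S b p"
  shows "integrable (lebesgue_on S) (\<lambda>x. a x * (A x (z x) \<bullet> z' x) + b x * B x (y x) * y' x)"
proof -
  have p1: "p > 1" "p > 0" using p by auto
  let ?q = "p / (p - 1)"
  have q: "?q > 1" "1 / ?q + 1 / p = 1" using p1 by (auto simp: field_simps)
  have fr': "AE x in lebesgue_on S. continuous_on UNIV (A x) \<and> continuous_on UNIV (B x) \<and>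
        (\<forall>z. norm (A x z) \<le> C * norm z powr (p - 1) + d x) \<and>
        (\<forall>y. \<bar>B x y\<bar> \<le> C * \<bar>y\<bar> powr (p - 1) + d x)"
    using AE_lebesgue_on_subset[OF S, of "\<lambda>x. continuous_on UNIV (A x) \<and> continuous_on UNIV (B x) \<and>
        (\<forall>z. norm (A x z) \<le> C * norm z powr (p - 1) + d x) \<and>
        (\<forall>y. \<bar>B x y\<bar> \<le> C * \<bar>y\<bar> powr (p - 1) + d x)"] fr unfolding flux_regular_def by (auto elim!: eventually_mono)
  have zm: "z \<in> borel_measurable (lebesgue_on S)" "z' \<in> borel_measurable (lebesgue_on S)" using z Lp_vec_measurable by auto
  have ym: "y \<in> borel_measurable (lebesgue_on S)" "y' \<in> borel_measurable (lebesgue_on S)" using y Lp_measurable by auto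
  have Bm: "(\<lambda>x. B x (y x)) \<in> borel_measurable (lebesgue_on S)"
  proof (rule caratheodory_measurable[OF S(2) _ _ ym(1)])
    show "(\<lambda>x. B x r) \<in> borel_measurable (lebesgue_on S)" if "r \<in> rat_points" for r
      using fr that by (intro restrict_measurable_lebesgue_on[OF S]) (auto simp: flux_regular_def)
    show "AE x in lebesgue_on S. continuous_on UNIV (B x)" using fr' by eventually_elim blast
  qed
  have Aj: "(\<lambda>x. A x (z x) \<bullet> j) \<in> borel_measurable (lebesgue_on S)" if j: "j \<in> Basis" for j
  proof (rule caratheodory_measurable[where \<phi>="\<lambda>x r. A x r \<bullet> j", OF S(2) _ _ zm(1)])
    show "(\<lambda>x. A x r \<bullet> j) \<in> borel_measurable (lebesgue_on S)" if "r \<in> rat_points" for r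
      using fr that j by (intro restrict_measurable_lebesgue_on[OF S]) (auto simp: flux_regular_def)
    show "AE x in lebesgue_on S. continuous_on UNIV (\<lambda>r. A x r \<bullet> j)" using fr' by eventually_elim (auto intro!: continuous_intros)
  qed
  have Am: "(\<lambda>x. A x (z x)) \<in> borel_measurable (lebesgue_on S)"
    by (subst borel_measurable_euclidean_space) (use Aj in blast)
  have zi: "integrable (lebesgue_on S) (\<lambda>x. a x * norm (z x) powr p)" "integrable (lebesgue_on S) (\<lambda>x. a x * norm (z' x) powr p)"
    using Lp_vec_norm_integrable[OF z(1) a(1,2) p1(2)] Lp_vec_norm_integrable[OF z(2) a(1,2) p1(2)] .
  have yi: "integrable (lebesgue_on S) (\<lambda>x. b x * \<bar>y x\<bar> powr p)" "integrable (lebesgue_on S) (\<lambda>x. b x * \<bar>y' x\<bar> powr p)"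
    using y by (auto simp: Lp_space_def)
  have di: "integrable (lebesgue_on S) (\<lambda>x. \<bar>d x\<bar> powr ?q)"
    using fr by (intro integrable_lebesgue_on_subset[OF _ S(1,3,2)]) (simp add: flux_regular_def)
  have young: "r * s \<le> r powr ?q + s powr p" if "0 \<le> r" "0 \<le> s" for r s :: real
    using Young_scaled[OF p1(1), of 1 r s] that by simp
  \<comment> \<open>The conjugate exponent \<open>?q\<close> turns the power \<open>p - 1\<close>
    back into \<open>p\<close>, so that gradient and test function appear with the same
    exponent.\<close>
  have pw: "(C * n powr (p - 1) + e) * m \<le> C * (n powr p + m powr p) + (\<bar>e\<bar> powr ?q + m powr p)" if "0 \<le> n" "0 \<le> m" for n m e
  proof -
    have "n powr (p - 1) * m \<le> (n powr (p - 1)) powr ?q + m powr p" using that by (intro young) auto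
    also have "(n powr (p - 1)) powr ?q = n powr p" using p1 by (simp add: powr_powr)
    finally have 1: "C * (n powr (p - 1) * m) \<le> C * (n powr p + m powr p)" using C by (intro mult_left_mono) auto
    have "e * m \<le> \<bar>e\<bar> * m" using that by (intro mult_right_mono) auto
    also have "\<dots> \<le> \<bar>e\<bar> powr ?q + m powr p" using that by (intro young) auto
    finally show ?thesis using 1 by (simp add: distrib_right mult.assoc)
  qed
  show ?thesis
  proof (rule Bochner_Integration.integrable_bound)
    show "integrable (lebesgue_on S) (\<lambda>x. (C * (a x * norm (z x) powr p + a x * norm (z' x) powr p) + (M * \<bar>d x\<bar> powr ?q + a x * norm (z' x) powr p)) +
        (C * (b x * \<bar>y x\<bar> powr p + b x * \<bar>y' x\<bar> powr p) + (M * \<bar>d x\<bar> powr ?q + b x * \<bar>y' x\<bar> powr p)))"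
      using zi yi di by (intro Bochner_Integration.integrable_add integrable_mult_right)
    show "(\<lambda>x. a x * (A x (z x) \<bullet> z' x) + b x * B x (y x) * y' x) \<in> borel_measurable (lebesgue_on S)"
      by (intro borel_measurable_add borel_measurable_times borel_measurable_inner a(1) b(1) Am Bm zm(2) ym(2))
    show "AE x in lebesgue_on S. norm (a x * (A x (z x) \<bullet> z' x) + b x * B x (y x) * y' x) \<le>
      norm ((C * (a x * norm (z x) powr p + a x * norm (z' x) powr p) + (M * \<bar>d x\<bar> powr ?q + a x * norm (z' x) powr p)) +
        (C * (b x * \<bar>y x\<bar> powr p + b x * \<bar>y' x\<bar> powr p) + (M * \<bar>d x\<bar> powr ?q + b x * \<bar>y' x\<bar> powr p)))"
      using fr' a(2) a(3) b(2) b(3)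
    proof eventually_elim
      case (elim x)
      have dq: "a x * \<bar>d x\<bar> powr ?q \<le> M * \<bar>d x\<bar> powr ?q" "b x * \<bar>d x\<bar> powr ?q \<le> M * \<bar>d x\<bar> powr ?q"
        using elim by (auto intro!: mult_right_mono)
      have "\<bar>A x (z x) \<bullet> z' x\<bar> \<le> norm (A x (z x)) * norm (z' x)" by (rule Cauchy_Schwarz_ineq2)
      also have "\<dots> \<le> (C * norm (z x) powr (p - 1) + d x) * norm (z' x)" using elim(1) by (intro mult_right_mono) auto
      also have "\<dots> \<le> C * (norm (z x) powr p + norm (z' x) powr p) + (\<bar>d x\<bar> powr ?q + norm (z' x) powr p)" by (rule pw) auto
      finally have "a x * \<bar>A x (z x) \<bullet> z' x\<bar> \<le> a x * (C * (norm (z x) powr p + norm (z' x) powr p) + (\<bar>d x\<bar> powr ?q + norm (z' x) powr p))"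
        using elim(2) by (rule mult_left_mono)
      also have "\<dots> \<le> C * (a x * norm (z x) powr p + a x * norm (z' x) powr p) + (M * \<bar>d x\<bar> powr ?q + a x * norm (z' x) powr p)"
        using dq(1) by (simp add: algebra_simps)
      finally have 1: "\<bar>a x * (A x (z x) \<bullet> z' x)\<bar> \<le> C * (a x * norm (z x) powr p + a x * norm (z' x) powr p) + (M * \<bar>d x\<bar> powr ?q + a x * norm (z' x) powr p)"
        using elim(2) by (simp add: abs_mult)
      have "\<bar>B x (y x) * y' x\<bar> \<le> (C * \<bar>y x\<bar> powr (p - 1) + d x) * \<bar>y' x\<bar>" unfolding abs_mult using elim(1) by (intro mult_right_mono) auto
      also have "\<dots> \<le> C * (\<bar>y x\<bar> powr p + \<bar>y' x\<bar> powr p) + (\<bar>d x\<bar> powr ?q + \<bar>y' x\<bar> powr p)" by (rule pw) auto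
      finally have "b x * \<bar>B x (y x) * y' x\<bar> \<le> b x * (C * (\<bar>y x\<bar> powr p + \<bar>y' x\<bar> powr p) + (\<bar>d x\<bar> powr ?q + \<bar>y' x\<bar> powr p))"
        using elim(4) by (rule mult_left_mono)
      also have "\<dots> \<le> C * (b x * \<bar>y x\<bar> powr p + b x * \<bar>y' x\<bar> powr p) + (M * \<bar>d x\<bar> powr ?q + b x * \<bar>y' x\<bar> powr p)"
        using dq(2) by (simp add: algebra_simps)
      finally have 2: "\<bar>b x * B x (y x) * y' x\<bar> \<le> C * (b x * \<bar>y x\<bar> powr p + b x * \<bar>y' x\<bar> powr p) + (M * \<bar>d x\<bar> powr ?q + b x * \<bar>y' x\<bar> powr p)"
        using elim(4) by (simp add: abs_mult mult.assoc)
      show ?case unfolding real_norm_def using 1 2 by linarith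
    qed
  qed
qed

text \<open>The gradient of a difference enters the monotonicity estimate only through \<open>zd\<close> and \<open>yd\<close>,
  so that representatives of the gradients need to agree only almost everywhere.\<close>

lemma flux_regular_monotone:
  fixes \<Omega> S :: "'a::euclidean_space set"
  assumes fr: "flux_regular \<Omega> p c C A B d" and p: "p \<ge> 2" and C: "C > 0" and c: "c > 0"
    and S: "S \<subseteq> \<Omega>" "S \<in> sets lebesgue" "\<Omega> \<in> sets lebesgue"
    and a: "a \<in> borel_measurable (lebesgue_on S)" "AE x in lebesgue_on S. 0 \<le> a x" "AE x in lebesgue_on S. \<bar>a x\<bar> \<le> M"
    and b: "b \<in> borel_measurable (lebesgue_on S)" "AE x in lebesgue_on S. 0 \<le> b x" "AE x in lebesgue_on S. \<bar>b x\<bar> \<le> M"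
    and z: "z1 \<in> Lp_vec S a p" "z2 \<in> Lp_vec S a p" "zd \<in> Lp_vec S a p" and y: "y1 \<in> Lp_space S b p" "y2 \<in> Lp_space S b p" "yd \<in> Lp_space S b p"
    and dif: "AE x in lebesgue_on S. zd x = z1 x - z2 x" "AE x in lebesgue_on S. yd x = y1 x - y2 x"
  shows "c * ((LINT x|lebesgue_on S. a x * norm (zd x) powr p) + (LINT x|lebesgue_on S. b x * \<bar>yd x\<bar> powr p)) \<le>
    (LINT x|lebesgue_on S. a x * (A x (z1 x) \<bullet> zd x) + b x * B x (y1 x) * yd x) - (LINT x|lebesgue_on S. a x * (A x (z2 x) \<bullet> zd x) + b x * B x (y2 x) * yd x)"
proof -
  have p0: "p > 0" using p by simp
  note i1 = flux_regular_integrable[OF fr p C S a b z(1,3) y(1,3)]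
  note i2 = flux_regular_integrable[OF fr p C S a b z(2,3) y(2,3)]
  have zi: "integrable (lebesgue_on S) (\<lambda>x. a x * norm (zd x) powr p)" by (rule Lp_vec_norm_integrable[OF z(3) a(1,2) p0])
  have yi: "integrable (lebesgue_on S) (\<lambda>x. b x * \<bar>yd x\<bar> powr p)" using y(3) by (simp add: Lp_space_def)
  have fr': "AE x in lebesgue_on S. \<forall>y1 y2 z1 z2. (A x z1 - A x z2) \<bullet> (z1 - z2) + (B x y1 - B x y2) * (y1 - y2) \<ge> c * (norm (z1 - z2) powr p + \<bar>y1 - y2\<bar> powr p)"
    using AE_lebesgue_on_subset[OF S, of "\<lambda>x. \<forall>y1 y2 z1 z2. (A x z1 - A x z2) \<bullet> (z1 - z2) + (B x y1 - B x y2) * (y1 - y2) \<ge> c * (norm (z1 - z2) powr p + \<bar>y1 - y2\<bar> powr p)"]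
      fr unfolding flux_regular_def by (auto elim!: eventually_mono)
  \<comment> \<open>The joint monotonicity bound cannot be used directly, since the two parts are
    multiplied by different weights. Equal arguments in one of the parts separate it into one
    inequality for each.\<close>
  have sepA: "c * norm (z1 - z2) powr p \<le> (A x z1 - A x z2) \<bullet> (z1 - z2)" and sepB: "c * \<bar>y1 - y2\<bar> powr p \<le> (B x y1 - B x y2) * (y1 - y2)"
    if "\<forall>y1 y2 z1 z2. (A x z1 - A x z2) \<bullet> (z1 - z2) + (B x y1 - B x y2) * (y1 - y2) \<ge> c * (norm (z1 - z2) powr p + \<bar>y1 - y2\<bar> powr p)" for x z1 z2 y1 y2
    using that[rule_format, of z1 z2 0 0] that[rule_format, of 0 0 y1 y2] p0 by simp_all
  have "c * ((LINT x|lebesgue_on S. a x * norm (zd x) powr p) + (LINT x|lebesgue_on S. b x * \<bar>yd x\<bar> powr p)) =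
    (LINT x|lebesgue_on S. c * (a x * norm (zd x) powr p + b x * \<bar>yd x\<bar> powr p))" using zi yi by simp
  also have "\<dots> \<le> (LINT x|lebesgue_on S. (a x * (A x (z1 x) \<bullet> zd x) + b x * B x (y1 x) * yd x) - (a x * (A x (z2 x) \<bullet> zd x) + b x * B x (y2 x) * yd x))"
  proof (rule integral_mono_AE)
    show "AE x in lebesgue_on S. c * (a x * norm (zd x) powr p + b x * \<bar>yd x\<bar> powr p) \<le> (a x * (A x (z1 x) \<bullet> zd x) + b x * B x (y1 x) * yd x) - (a x * (A x (z2 x) \<bullet> zd x) + b x * B x (y2 x) * yd x)"
      using fr' dif a(2) b(2)
    proof eventually_elim
      case (elim x)
      have "a x * (c * norm (zd x) powr p) \<le> a x * ((A x (z1 x) - A x (z2 x)) \<bullet> zd x)"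
        unfolding elim(2) using sepA[OF elim(1)] elim(4) by (rule mult_left_mono)
      moreover have "b x * (c * \<bar>yd x\<bar> powr p) \<le> b x * ((B x (y1 x) - B x (y2 x)) * yd x)"
        unfolding elim(3) using sepB[OF elim(1)] elim(5) by (rule mult_left_mono)
      ultimately show ?case by (simp add: inner_diff_left algebra_simps)
    qed
  qed (use zi yi i1 i2 in auto)
  also have "\<dots> = (LINT x|lebesgue_on S. a x * (A x (z1 x) \<bullet> zd x) + b x * B x (y1 x) * yd x) - (LINT x|lebesgue_on S. a x * (A x (z2 x) \<bullet> zd x) + b x * B x (y2 x) * yd x)"
    using i1 i2 by simp
  finally show ?thesis .
qed

section \<open>Monotonicity of the subdomain operators\<close>

text \<open>Adding the two integrals first avoids having to prove each integrand measurable: a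
  nonnegative function that is not integrable has integral 0.\<close>

lemma integral_add_le:
  fixes A B :: "'b \<Rightarrow> real"
  assumes i: "integrable M (\<lambda>t. A t + B t)" and nn: "\<And>t. 0 \<le> A t" "\<And>t. 0 \<le> B t"
  shows "integral\<^sup>L M A + integral\<^sup>L M B \<le> (LINT t|M. A t + B t)"
proof (cases "integrable M A")
  case True
  then have "integrable M (\<lambda>t. (A t + B t) - A t)" using i by (intro Bochner_Integration.integrable_diff)
  then show ?thesis using True by simp
next
  case False
  have "\<not> integrable M B"
  proof
    assume "integrable M B"
    then have "integrable M (\<lambda>t. (A t + B t) - B t)" using i by (intro Bochner_Integration.integrable_diff)
    then show False using False by simp
  qed
  then show ?thesis using False nn by (simp add: not_integrable_integral_eq)
qed

lemma bochner_norm_Lp_powr: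
  assumes w: "AE x in lebesgue_on S. 0 \<le> w x" and p: "p > 0"
  shows "bochner_norm T (Lp_norm S w p) p h powr p = (LINT t|I0 T. LINT x|lebesgue_on S. w x * norm (h t x) powr p)"
proof -
  have "0 \<le> (LINT x|lebesgue_on S. w x * norm (h t x) powr p)" for t
    by (intro integral_nonneg_AE) (use w in \<open>eventually_elim, simp\<close>)
  then have "0 \<le> (LINT t|I0 T. LINT x|lebesgue_on S. w x * norm (h t x) powr p)" by (rule Bochner_Integration.integral_nonneg)
  then show ?thesis unfolding bochner_norm_def Lp_norm_powr[OF w p] using p by (simp add: powr_powr)
qed

lemma bochner_Lp_mem: "u \<in> bochner_Lp T X N r \<Longrightarrow> AE t in I0 T. u t \<in> X"
  by (simp add: bochner_Lp_def bochner_measurable_def)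

lemma Linf_mult:
  assumes "u \<in> Linf_space S" "v \<in> Linf_space S"
  shows "(\<lambda>x. u x * v x) \<in> Linf_space S"
proof -
  obtain K L where KL: "AE x in lebesgue_on S. \<bar>u x\<bar> \<le> K" "AE x in lebesgue_on S. \<bar>v x\<bar> \<le> L"
    using assms by (auto simp: Linf_space_def)
  then have "AE x in lebesgue_on S. \<bar>u x * v x\<bar> \<le> K * L"
    by eventually_elim (auto simp: abs_mult intro!: mult_mono order_trans[OF abs_ge_zero])
  then show ?thesis using assms by (auto simp: Linf_space_def)
qed

lemma Linf_subset:
  assumes "S \<subseteq> \<Omega>" "S \<in> sets lebesgue" "\<Omega> \<in> sets lebesgue" "u \<in> Linf_space \<Omega>"
  shows "u \<in> Linf_space S"
  using assms restrict_measurable_lebesgue_on[OF assms(1-3)] AE_lebesgue_on_subset[OF assms(1-3)]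
  by (fastforce simp: Linf_space_def)

lemma F_sub_represents:
  assumes "u \<in> F_sub_dom T p \<Omega> S a b g \<gamma> \<alpha> \<beta> f"
  obtains h where "h \<in> L2_time T S" "F_sub T p S a b g \<gamma> \<alpha> \<beta> f u = (\<lambda>t. ext_zero S (h t))"
    "AE t in I0 T. \<forall>v\<in>Vw S a b p. residual_sub T p S a b g \<gamma> \<alpha> \<beta> f (restr_time S u) t v = (LINT x|lebesgue_on S. h t x * v x)"
proof -
  define h where "h = (SOME h. L2_represents T S (Vw S a b p) (residual_sub T p S a b g \<gamma> \<alpha> \<beta> f (restr_time S u)) h)"
  have "\<exists>h. L2_represents T S (Vw S a b p) (residual_sub T p S a b g \<gamma> \<alpha> \<beta> f (restr_time S u)) h"
    using assms unfolding F_sub_dom_def by blast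
  then have "L2_represents T S (Vw S a b p) (residual_sub T p S a b g \<gamma> \<alpha> \<beta> f (restr_time S u)) h"
    unfolding h_def by (rule someI_ex)
  then show ?thesis unfolding L2_represents_def by (elim conjE) (rule that, simp_all add: F_sub_def h_def)
qed

lemma ddt_is_ddt: "m \<in> ddt_dom T X N r \<Longrightarrow> is_ddt T X N r m (ddt T X N r m)"
  unfolding ddt_def by (rule someI_ex[where P="is_ddt T X N r m"]) (auto simp: ddt_dom_def)

lemma multiplier_integrable:
  assumes m: "m \<in> Linf_space S" and u: "u \<in> Lp_space S (\<lambda>_. 1) 2" and v: "v \<in> Lp_space S (\<lambda>_. 1) 2"
  shows "integrable (lebesgue_on S) (\<lambda>x. m x * u x * v x)"
proof -
  obtain M where "m \<in> borel_measurable (lebesgue_on S)" "AE x in lebesgue_on S. \<bar>m x\<bar> \<le> M" using m by (auto simp: Linf_space_def)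
  from Lp_bounded_mult[OF u this] have "(\<lambda>x. m x * u x) \<in> Lp_space S (\<lambda>_. 1) 2" by simp
  from L2_mult_integrable[OF this v] show ?thesis .
qed

context weighted_domain
begin

text \<open>\<open>ddt_pairing_nonneg\<close> for the weighted L^2 form with multiplier
  \<open>m\<close>; its inequality for mixed terms is \<open>m (y - z)^2 \<ge> 0\<close>
  integrated.\<close>

lemma mult_op_monotone:
  assumes m: "m \<in> Linf_space S" "AE x in lebesgue_on S. 0 \<le> m x"
    and u: "u \<in> bochner_Lp T (Vw S a b p) (Vw_norm S a b p) p" "mult_op S m u \<in> ddt_dom T (Vw S a b p) (Vw_norm S a b p) (p / (p - 1))"
    and v: "v \<in> bochner_Lp T (Vw S a b p) (Vw_norm S a b p) p" "mult_op S m v \<in> ddt_dom T (Vw S a b p) (Vw_norm S a b p) (p / (p - 1))"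
  shows "integrable (I0 T) (\<lambda>t. ddt T (Vw S a b p) (Vw_norm S a b p) (p / (p - 1)) (mult_op S m u) t (\<lambda>x. u t x - v t x)
        - ddt T (Vw S a b p) (Vw_norm S a b p) (p / (p - 1)) (mult_op S m v) t (\<lambda>x. u t x - v t x))"
    "0 \<le> (LINT t|I0 T. ddt T (Vw S a b p) (Vw_norm S a b p) (p / (p - 1)) (mult_op S m u) t (\<lambda>x. u t x - v t x)
        - ddt T (Vw S a b p) (Vw_norm S a b p) (p / (p - 1)) (mult_op S m v) t (\<lambda>x. u t x - v t x))"
proof -
  let ?X = "Vw S a b p" and ?N = "Vw_norm S a b p" and ?q = "p / (p - 1)"
  interpret V: seminormed ?X ?N by (rule Vw_seminormed)
  have p1: "p > 1" using p2 by simp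
  define G where "G = (\<lambda>t y. ddt T ?X ?N ?q (mult_op S m u) t y - ddt T ?X ?N ?q (mult_op S m v) t y)"
  have ud: "mult_op S m u \<in> bochner_dual T ?X ?N ?q" "zero_initial T ?X ?N (mult_op S m u)"
    and vd: "mult_op S m v \<in> bochner_dual T ?X ?N ?q" "zero_initial T ?X ?N (mult_op S m v)"
    using u(2) v(2) by (auto simp: ddt_dom_def)
  note D = V.is_ddt_diff[OF p1 ud(1) ddt_is_ddt[OF u(2)] vd(1) ddt_is_ddt[OF v(2)], folded G_def]
  have w: "(\<lambda>t x. u t x - v t x) \<in> bochner_Lp T ?X ?N p" using V.bochner_Lp_lin[OF u(1) v(1) p0, of 1 "-1"] by simp
  have G: "G \<in> bochner_dual T ?X ?N ?q" using D(2) by (simp add: is_ddt_def)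
  show "integrable (I0 T) (\<lambda>t. ddt T ?X ?N ?q (mult_op S m u) t (\<lambda>x. u t x - v t x) - ddt T ?X ?N ?q (mult_op S m v) t (\<lambda>x. u t x - v t x))"
    using V.pairing_integrable[OF G w p1] by (simp add: G_def)
  define B where "B y z = (LINT x|lebesgue_on S. m x * y x * z x)" for y z :: "'a \<Rightarrow> real"
  have i: "integrable (lebesgue_on S) (\<lambda>x. m x * y x * z x)" if "y \<in> ?X" "z \<in> ?X" for y z
    by (rule multiplier_integrable[OF m(1) VwD(5)[OF that(1)] VwD(5)[OF that(2)]])
  have B1: "2 * B z y \<le> B y y + B z z" if "y \<in> ?X" "z \<in> ?X" for y z
  proof -
    have "2 * B z y = (LINT x|lebesgue_on S. 2 * (m x * z x * y x))" by (simp add: B_def)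
    also have "\<dots> \<le> (LINT x|lebesgue_on S. m x * y x * y x + m x * z x * z x)"
    proof (rule integral_mono_AE)
      show "AE x in lebesgue_on S. 2 * (m x * z x * y x) \<le> m x * y x * y x + m x * z x * z x"
        using m(2)
      proof eventually_elim
        case (elim x)
        have "0 \<le> m x * (y x - z x)\<^sup>2" using elim by simp
        then show ?case by (simp add: power2_eq_square algebra_simps)
      qed
    qed (use i that in auto)
    also have "\<dots> = B y y + B z z" using i that by (simp add: B_def)
    finally show ?thesis .
  qed
  have B2: "0 \<le> B y y" if "y \<in> ?X" for y
    unfolding B_def by (intro integral_nonneg_AE) (use m(2) in \<open>eventually_elim, simp add: mult.assoc\<close>)
  have MB: "AE t in I0 T. \<forall>y\<in>?X. mult_op S m u t y - mult_op S m v t y = B (\<lambda>x. u t x - v t x) y"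
    using bochner_Lp_mem[OF u(1)] bochner_Lp_mem[OF v(1)]
  proof eventually_elim
    case (elim t)
    show ?case using i elim by (simp add: B_def mult_op_def left_diff_distrib right_diff_distrib)
  qed
  show "0 \<le> (LINT t|I0 T. ddt T ?X ?N ?q (mult_op S m u) t (\<lambda>x. u t x - v t x) - ddt T ?X ?N ?q (mult_op S m v) t (\<lambda>x. u t x - v t x))"
    using V.ddt_pairing_nonneg[where B=B, OF p1 w B1 B2 D V.zero_initial_diff[OF ud(2) vd(2)] MB] by (simp add: G_def)
qed

theorem F_sub_monotone:
  assumes \<Omega>: "finite_domain \<Omega>" "S \<subseteq> \<Omega>"
    and fr: "AE t in I0 T. flux_regular \<Omega> p c C (\<lambda>x. \<alpha> x t) (\<lambda>x. \<beta> x t) (d t)" and c: "c > 0" "C > 0"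
    and m: "(\<lambda>x. g x * \<gamma> x) \<in> Linf_space S" "AE x in lebesgue_on S. 0 \<le> g x * \<gamma> x"
    and u: "u \<in> F_sub_dom T p \<Omega> S a b g \<gamma> \<alpha> \<beta> f" and v: "v \<in> F_sub_dom T p \<Omega> S a b g \<gamma> \<alpha> \<beta> f"
  shows "c * (bochner_norm T (Lp_norm S a p) p (\<lambda>t. wgrad S a p (restr_time S (\<lambda>t x. u t x - v t x) t)) powr p
      + bochner_norm T (Lp_norm S b p) p (restr_time S (\<lambda>t x. u t x - v t x)) powr p)
    \<le> ip T \<Omega> (\<lambda>t x. F_sub T p S a b g \<gamma> \<alpha> \<beta> f u t x - F_sub T p S a b g \<gamma> \<alpha> \<beta> f v t x) (\<lambda>t x. u t x - v t x)"
proof -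
  let ?X = "Vw S a b p" and ?N = "Vw_norm S a b p" and ?q = "p / (p - 1)"
  let ?F = "F_sub T p S a b g \<gamma> \<alpha> \<beta> f"
  interpret V: seminormed ?X ?N by (rule Vw_seminormed)
  have mO: "\<Omega> \<in> sets lebesgue" by (rule finite_domainD(2)[OF \<Omega>(1)])
  define U V where "U = restr_time S u" and "V = restr_time S v"
  define D where "D t x = U t x - V t x" for t x
  have DS: "D t x = u t x - v t x" "restr_time S (\<lambda>t x. u t x - v t x) t x = D t x" if "x \<in> S" for t x
    using that by (simp_all add: D_def U_def V_def restr_time_def)
  have U: "U \<in> bochner_Lp T ?X ?N p" "mult_op S (\<lambda>x. g x * \<gamma> x) U \<in> ddt_dom T ?X ?N ?q"
    and V: "V \<in> bochner_Lp T ?X ?N p" "mult_op S (\<lambda>x. g x * \<gamma> x) V \<in> ddt_dom T ?X ?N ?q"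
    using u v by (auto simp: F_sub_dom_def W_sub_def evol_space_def U_def V_def)
  note mono = mult_op_monotone[OF m U V]
  obtain hu where hu: "hu \<in> L2_time T S" "?F u = (\<lambda>t. ext_zero S (hu t))"
    "AE t in I0 T. \<forall>y\<in>?X. residual_sub T p S a b g \<gamma> \<alpha> \<beta> f (restr_time S u) t y = (LINT x|lebesgue_on S. hu t x * y x)"
    by (rule F_sub_represents[OF u]) (rule that)
  note hu = hu[folded U_def]
  obtain hv where hv: "hv \<in> L2_time T S" "?F v = (\<lambda>t. ext_zero S (hv t))"
    "AE t in I0 T. \<forall>y\<in>?X. residual_sub T p S a b g \<gamma> \<alpha> \<beta> f (restr_time S v) t y = (LINT x|lebesgue_on S. hv t x * y x)"
    by (rule F_sub_represents[OF v]) (rule that)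
  note hv = hv[folded V_def]
  define K where "K t = (LINT x|lebesgue_on \<Omega>. (?F u t x - ?F v t x) * (u t x - v t x))" for t
  define G where "G t = ddt T ?X ?N ?q (mult_op S (\<lambda>x. g x * \<gamma> x) U) t (D t) - ddt T ?X ?N ?q (mult_op S (\<lambda>x. g x * \<gamma> x) V) t (D t)" for t
  \<comment> \<open>Only the sum of the two is known to be integrable in time, as the
    \<open>p\<close>-th power of the norm of the difference.\<close>
  define J1 J2 where "J1 t = (LINT x|lebesgue_on S. a x * norm (wgrad S a p (D t) x) powr p)"
    and "J2 t = (LINT x|lebesgue_on S. b x * norm (D t x) powr p)" for t
  have Geq: "G = (\<lambda>t. ddt T ?X ?N ?q (mult_op S (\<lambda>x. g x * \<gamma> x) U) t (\<lambda>x. U t x - V t x) - ddt T ?X ?N ?q (mult_op S (\<lambda>x. g x * \<gamma> x) V) t (\<lambda>x. U t x - V t x))"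
    by (simp add: G_def[abs_def] D_def[abs_def])
  have Gi: "integrable (I0 T) G" and Gn: "0 \<le> integral\<^sup>L (I0 T) G" unfolding Geq by (rule mono)+
  have L2: "?F w \<in> L2_time T \<Omega>" if "?F w = (\<lambda>t. ext_zero S (h t))" "h \<in> L2_time T S" for w h
    unfolding that(1) by (rule ext_zero_L2_time[OF \<Omega>(2) mS mO that(2)])
  have Ki: "integrable (I0 T) K"
    using L2_time_mult_integrable[OF L2_time_lin[OF L2[OF hu(2,1)] L2[OF hv(2,1)], of 1 "-1"] L2_time_lin[of u T \<Omega> v 1 "-1"]] u v
    by (simp add: K_def[abs_def] F_sub_dom_def)
  have Kt: "K t = (LINT x|lebesgue_on S. (hu t x - hv t x) * D t x)" for t
  proof -
    have "K t = (LINT x|lebesgue_on \<Omega>. ext_zero S (\<lambda>x. hu t x - hv t x) x * (u t x - v t x))"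
      unfolding K_def hu(2) hv(2) by (intro Bochner_Integration.integral_cong) (auto simp: ext_zero_def)
    also have "\<dots> = (LINT x|lebesgue_on S. (hu t x - hv t x) * (u t x - v t x))" by (rule ext_zero_Lp(3)[OF \<Omega>(2) mS mO])
    also have "\<dots> = (LINT x|lebesgue_on S. (hu t x - hv t x) * D t x)"
      by (intro Bochner_Integration.integral_cong) (simp_all add: DS)
    finally show ?thesis .
  qed
  have DX: "D \<in> bochner_Lp T ?X ?N p" using V.bochner_Lp_lin[OF U(1) V(1) p0, of 1 "-1"] by (simp add: D_def[abs_def])
  have J: "Lp_norm S a p (wgrad S a p (D t)) powr p = J1 t" "Lp_norm S b p (D t) powr p = J2 t" for t
    unfolding J1_def J2_def by (rule Lp_norm_powr[OF a_ge p0], rule Lp_norm_powr[OF b_ge p0])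
  have Jnn: "0 \<le> J1 t" "0 \<le> J2 t" for t using J[of t, symmetric] by simp_all
  have "?N (D t) powr p = J1 t + J2 t" for t
    unfolding Vw_norm_def J using Jnn[of t] p0 by (simp add: powr_powr)
  then have Ji: "integrable (I0 T) (\<lambda>t. J1 t + J2 t)" using DX by (simp add: bochner_Lp_def)
  \<comment> \<open>At almost every time the difference \<open>D t\<close> lies in the weighted
    space, so both residuals may be evaluated at it through their representing functions. The source
    cancels in the difference, and what separates the flux from the residual is the time derivative
    \<open>G\<close>.\<close>
  have key: "AE t in I0 T. c * (J1 t + J2 t) \<le> K t - G t"
    using fr bochner_Lp_mem[OF U(1)] bochner_Lp_mem[OF V(1)] bochner_Lp_mem[OF DX] hu(3) hv(3) L2_time_mem[OF hu(1)] L2_time_mem[OF hv(1)]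
  proof eventually_elim
    case (elim t)
    note X = elim(2,3,4)
    have bd: "AE x in lebesgue_on S. \<bar>a x\<bar> \<le> max Ma Mb" "AE x in lebesgue_on S. \<bar>b x\<bar> \<le> max Ma Mb"
      using Ma Mb by (eventually_elim, simp)+
    have w: "AE x in lebesgue_on S. wgrad S a p (D t) x = wgrad S a p (U t) x - wgrad S a p (V t) x"
      using Vw_lincomb(2)[OF X(1,2), of 1 "-1"] by (simp add: D_def[abs_def])
    have "c * (J1 t + J2 t) \<le> flux_op S a b (wgrad S a p) \<alpha> \<beta> U t (D t) - flux_op S a b (wgrad S a p) \<alpha> \<beta> V t (D t)"
      unfolding J1_def J2_def flux_op_def real_norm_def
      by (rule flux_regular_monotone[OF elim(1) p2 c(2,1) \<Omega>(2) mS mO am a_ge bd(1) bm b_ge bd(2) VwD(4)[OF X(1)] VwD(4)[OF X(2)] VwD(4)[OF X(3)]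
          VwD(1)[OF X(1)] VwD(1)[OF X(2)] VwD(1)[OF X(3)] w]) (simp add: D_def)
    also have "\<dots> = residual_sub T p S a b g \<gamma> \<alpha> \<beta> f U t (D t) - residual_sub T p S a b g \<gamma> \<alpha> \<beta> f V t (D t) - G t"
      by (simp add: residual_sub_def G_def)
    also have "\<dots> = (LINT x|lebesgue_on S. hu t x * D t x) - (LINT x|lebesgue_on S. hv t x * D t x) - G t"
      using elim(5,6) X(3) by simp
    also have "(LINT x|lebesgue_on S. hu t x * D t x) - (LINT x|lebesgue_on S. hv t x * D t x) = K t"
      unfolding Kt left_diff_distrib
      by (rule Bochner_Integration.integral_diff[symmetric]) (rule L2_mult_integrable[OF elim(7) VwD(5)[OF X(3)]], rule L2_mult_integrable[OF elim(8) VwD(5)[OF X(3)]])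
    finally show ?case .
  qed
  have cg: "wgrad S a p (restr_time S (\<lambda>t x. u t x - v t x) t) = wgrad S a p (D t)" for t
    by (rule wgrad_cong) (rule DS(2))
  have J2c: "(LINT x|lebesgue_on S. b x * norm (restr_time S (\<lambda>t x. u t x - v t x) t x) powr p) = J2 t" for t
    unfolding J2_def by (intro Bochner_Integration.integral_cong) (simp_all add: DS)
  \<comment> \<open>The final norms are separate integrals of \<open>J1\<close> and
    \<open>J2\<close>; \<open>integral_add_le\<close> bounds their sum, and the integral of
    \<open>G\<close> is dropped because it is nonnegative.\<close>
  have "c * (integral\<^sup>L (I0 T) J1 + integral\<^sup>L (I0 T) J2) \<le> c * (LINT t|I0 T. J1 t + J2 t)"
    using integral_add_le[OF Ji Jnn] c(1) by (intro mult_left_mono) auto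
  also have "\<dots> = (LINT t|I0 T. c * (J1 t + J2 t))" by simp
  also have "\<dots> \<le> (LINT t|I0 T. K t - G t)" by (rule integral_mono_AE[OF _ _ key]) (use Ji Ki Gi in auto)
  also have "\<dots> = integral\<^sup>L (I0 T) K - integral\<^sup>L (I0 T) G" using Ki Gi by (rule Bochner_Integration.integral_diff)
  also have "\<dots> \<le> integral\<^sup>L (I0 T) K" using Gn by simp
  finally show ?thesis
    unfolding bochner_norm_Lp_powr[OF a_ge p0] bochner_norm_Lp_powr[OF b_ge p0] cg J2c ip_def
    by (simp add: J1_def[abs_def] K_def[abs_def])
qed

end

section \<open>Decomposition of the equation\<close>

text \<open>Applied with the weights \<open>a\<close> to the gradient term of the flux, with
  \<open>b\<close> to the lower order term, and with \<open>g\<close> to the multiplication by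
  \<gamma>.\<close>

lemma partition_integral:
  fixes S :: "nat \<Rightarrow> 'a::euclidean_space set"
  assumes L: "finite L" and \<Omega>: "\<Omega> \<in> sets lebesgue" and S: "\<And>l. l \<in> L \<Longrightarrow> S l \<subseteq> \<Omega>" "\<And>l. l \<in> L \<Longrightarrow> S l \<in> sets lebesgue"
    and w: "\<And>l. l \<in> L \<Longrightarrow> w l \<in> Linf_space (S l)" "AE x in lebesgue_on \<Omega>. (\<Sum>l\<in>L. ext_zero (S l) (w l) x) = 1"
    and P: "integrable (lebesgue_on \<Omega>) P"
  shows "\<And>l. l \<in> L \<Longrightarrow> integrable (lebesgue_on (S l)) (\<lambda>x. w l x * P x)"
    "(\<Sum>l\<in>L. LINT x|lebesgue_on (S l). w l x * P x) = (LINT x|lebesgue_on \<Omega>. P x)"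
proof -
  show i: "integrable (lebesgue_on (S l)) (\<lambda>x. w l x * P x)" if l: "l \<in> L" for l
  proof -
    obtain M where M: "w l \<in> borel_measurable (lebesgue_on (S l))" "AE x in lebesgue_on (S l). \<bar>w l x\<bar> \<le> M"
      using w(1)[OF l] by (auto simp: Linf_space_def)
    have Pl: "integrable (lebesgue_on (S l)) P" by (rule integrable_lebesgue_on_subset[OF P S(1)[OF l] \<Omega> S(2)[OF l]])
    show ?thesis
    proof (rule Bochner_Integration.integrable_bound)
      show "integrable (lebesgue_on (S l)) (\<lambda>x. M * \<bar>P x\<bar>)" using Pl by (intro integrable_mult_right integrable_abs)
      show "(\<lambda>x. w l x * P x) \<in> borel_measurable (lebesgue_on (S l))" using M(1) Pl by (intro borel_measurable_times) auto
      show "AE x in lebesgue_on (S l). norm (w l x * P x) \<le> norm (M * \<bar>P x\<bar>)"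
        using M(2) by eventually_elim (auto simp: abs_mult intro!: mult_right_mono)
    qed
  qed
  have e: "indicator (S l) x * (w l x * P x) = ext_zero (S l) (w l) x * P x" for l x by (simp add: ext_zero_def)
  have ie: "integrable (lebesgue_on \<Omega>) (\<lambda>x. ext_zero (S l) (w l) x * P x)"
    "(LINT x|lebesgue_on \<Omega>. ext_zero (S l) (w l) x * P x) = (LINT x|lebesgue_on (S l). w l x * P x)" if l: "l \<in> L" for l
    using lebesgue_on_subset_integral[OF S(1)[OF l] \<Omega> S(2)[OF l], of "\<lambda>x. w l x * P x"] i[OF l] unfolding e by auto
  have "(\<Sum>l\<in>L. LINT x|lebesgue_on (S l). w l x * P x) = (\<Sum>l\<in>L. LINT x|lebesgue_on \<Omega>. ext_zero (S l) (w l) x * P x)"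
    by (intro sum.cong refl ie(2)[symmetric])
  also have "\<dots> = (LINT x|lebesgue_on \<Omega>. (\<Sum>l\<in>L. ext_zero (S l) (w l) x * P x))"
    using ie(1) by (intro Bochner_Integration.integral_sum[symmetric])
  also have "\<dots> = (LINT x|lebesgue_on \<Omega>. P x)"
  proof (rule integral_cong_AE)
    show "AE x in lebesgue_on \<Omega>. (\<Sum>l\<in>L. ext_zero (S l) (w l) x * P x) = P x"
      using w(2) by eventually_elim (simp add: sum_distrib_right[symmetric])
    show "(\<lambda>x. \<Sum>l\<in>L. ext_zero (S l) (w l) x * P x) \<in> borel_measurable (lebesgue_on \<Omega>)"
      using ie(1) by (intro borel_measurable_sum borel_measurable_integrable)
  qed (use P in auto)
  finally show "(\<Sum>l\<in>L. LINT x|lebesgue_on (S l). w l x * P x) = (LINT x|lebesgue_on \<Omega>. P x)" .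
qed

text \<open>The set where the function is positive is itself admissible, so the positive part has
  integral 0; the same holds for the negative of the function.\<close>

lemma AE_zero_if_set_integrals_zero:
  fixes H :: "real \<Rightarrow> real"
  assumes H: "integrable (I0 T) H" and z: "\<And>E. E \<in> sets lebesgue \<Longrightarrow> (LINT t|I0 T. indicator E t * H t) = 0"
  shows "AE t in I0 T. H t = 0"
proof -
  have le: "AE t in I0 T. k t \<le> 0" if k: "integrable (I0 T) k" and zk: "\<And>E. E \<in> sets lebesgue \<Longrightarrow> (LINT t|I0 T. indicator E t * k t) = 0" for k :: "real \<Rightarrow> real"
  proof -
    define E where "E = {t \<in> space (I0 T). k t > 0}"
    have "E \<in> sets (I0 T)" unfolding E_def using k by measurable
    then have E: "E \<in> sets lebesgue" using I0_sets by (auto simp: sets_restrict_space_iff)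
    have "(LINT t|I0 T. max 0 (k t)) = (LINT t|I0 T. indicator E t * k t)"
      by (intro Bochner_Integration.integral_cong) (auto simp: E_def max_def split: split_indicator)
    then have "(LINT t|I0 T. max 0 (k t)) = 0" using zk[OF E] by simp
    moreover have "integrable (I0 T) (\<lambda>t. max 0 (k t))" using k by (intro integrable_max) auto
    ultimately have "AE t in I0 T. max 0 (k t) = 0" by (subst (asm) integral_nonneg_eq_0_iff_AE) auto
    then show ?thesis by eventually_elim (simp add: max_def split: if_splits)
  qed
  have "AE t in I0 T. H t \<le> 0" using H z by (rule le)
  moreover have "AE t in I0 T. - H t \<le> 0" using H z by (intro le) auto
  ultimately show ?thesis by eventually_elim simp
qed

lemma Lp_vec_bounded_weight:
  assumes "z \<in> Lp_vec S (\<lambda>_. 1) p" "w \<in> borel_measurable (lebesgue_on S)" "AE x in lebesgue_on S. \<bar>w x\<bar> \<le> M"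
  shows "z \<in> Lp_vec S w p"
  using assms(1) Lp_bounded_weight[OF _ assms(2,3)] by (auto simp: Lp_vec_def)

text \<open>The decomposition of the equation is the same for any finite family of subdomains; the
  number two comes in with the schemes.\<close>

locale splitting =
  fixes \<Omega> :: "'a::euclidean_space set" and S :: "nat \<Rightarrow> 'a set" and L :: "nat set" and T p cb :: real
    and a b g :: "nat \<Rightarrow> 'a \<Rightarrow> real" and \<gamma> :: "'a \<Rightarrow> real"
  assumes dom: "finite_domain \<Omega>" and p2: "p \<ge> 2" and L: "finite L" and sub: "\<And>l. l \<in> L \<Longrightarrow> S l \<subseteq> \<Omega>"
    and wd: "\<And>l. l \<in> L \<Longrightarrow> weighted_domain (S l) (a l) (b l) p cb"
    and gL: "\<And>l. l \<in> L \<Longrightarrow> g l \<in> Linf_space (S l)" and \<gamma>L: "\<gamma> \<in> Linf_space \<Omega>"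
    and part: "AE x in lebesgue_on \<Omega>. (\<Sum>l\<in>L. ext_zero (S l) (a l) x) = 1"
      "AE x in lebesgue_on \<Omega>. (\<Sum>l\<in>L. ext_zero (S l) (b l) x) = 1"
      "AE x in lebesgue_on \<Omega>. (\<Sum>l\<in>L. ext_zero (S l) (g l) x) = 1"
begin

abbreviation "V l \<equiv> Vw (S l) (a l) (b l) p"
abbreviation "VN l \<equiv> Vw_norm (S l) (a l) (b l) p"
abbreviation "q \<equiv> p / (p - 1)"

lemma p1: "p > 1" and p0: "p > 0" using p2 by auto

lemma mO: "\<Omega> \<in> sets lebesgue" by (rule finite_domainD(2)[OF dom])
lemma mSl: "l \<in> L \<Longrightarrow> S l \<in> sets lebesgue" using weighted_domain.mS[OF wd] .
lemma domS: "l \<in> L \<Longrightarrow> finite_domain (S l)" using weighted_domain.dom[OF wd] .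
lemma aL: "l \<in> L \<Longrightarrow> a l \<in> Linf_space (S l)" using weighted_domain.aW[OF wd] by (auto simp: W1inf_def)
lemma bL: "l \<in> L \<Longrightarrow> b l \<in> Linf_space (S l)" using weighted_domain.bL[OF wd] .

sublocale W: seminormed "W1p \<Omega> p" "W1p_norm \<Omega> p" by (rule W1p_seminormed[OF dom]) (use p2 in simp)
lemma Vl: "l \<in> L \<Longrightarrow> seminormed (V l) (VN l)" by (rule weighted_domain.Vw_seminormed[OF wd])

lemma restr_eq: "x \<in> S l \<Longrightarrow> restr_time (S l) u t x = u t x" by (simp add: restr_time_def)

text \<open>Combines restriction of weak gradients to the open subset with
  \<open>is_wgrad_W1p\<close>. It is what allows a test function of the full problem to be inserted
  into every subdomain functional.\<close>

lemma W1p_restrict: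
  assumes l: "l \<in> L" and v: "v \<in> W1p \<Omega> p"
  shows "v \<in> V l" "AE x in lebesgue_on (S l). wgrad (S l) (a l) p v x = weak_grad \<Omega> v x"
proof -
  note m = W1p_mono[OF dom domS[OF l] sub[OF l] v]
  show "v \<in> V l" by (rule weighted_domain.W1p_Vw(1)[OF wd[OF l] m(1)])
  show "AE x in lebesgue_on (S l). wgrad (S l) (a l) p v x = weak_grad \<Omega> v x"
    using weighted_domain.W1p_Vw(2)[OF wd[OF l] m(1)] m(2) by eventually_elim simp
qed

lemma restr_V:
  assumes l: "l \<in> L" and v: "u t \<in> W1p \<Omega> p"
  shows "restr_time (S l) u t \<in> V l" "wgrad (S l) (a l) p (restr_time (S l) u t) = wgrad (S l) (a l) p (u t)"
  using Vw_cong[of "S l" "restr_time (S l) u t" "u t"] wgrad_cong[of "S l" "restr_time (S l) u t" "u t"] W1p_restrict(1)[OF l v]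
  by (simp_all add: restr_eq)

lemma W1p_L2: "v \<in> W1p \<Omega> p \<Longrightarrow> v \<in> Lp_space \<Omega> (\<lambda>_. 1) 2"
  using Lp_subset[OF dom W1pD(1)[OF dom], of _ p 2] p2 by simp

lemma mult_op_split:
  assumes u: "u t \<in> W1p \<Omega> p" and v: "v \<in> W1p \<Omega> p"
  shows "mult_op \<Omega> \<gamma> u t v = (\<Sum>l\<in>L. mult_op (S l) (\<lambda>x. g l x * \<gamma> x) (restr_time (S l) u) t v)"
proof -
  have "mult_op (S l) (\<lambda>x. g l x * \<gamma> x) (restr_time (S l) u) t v = (LINT x|lebesgue_on (S l). g l x * (\<gamma> x * u t x * v x))" for l
    unfolding mult_op_def by (intro Bochner_Integration.integral_cong) (simp_all add: restr_eq mult.assoc)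
  then show ?thesis
    using partition_integral(2)[OF L mO sub mSl gL part(3) multiplier_integrable[OF \<gamma>L W1p_L2[OF u] W1p_L2[OF v]]]
    by (simp add: mult_op_def)
qed

text \<open>On each subdomain the weighted gradients of \<open>u\<close> and \<open>v\<close> agree
  almost everywhere with the full ones, so both sides integrate the same two densities, split by the
  partitions \<open>a\<close> and \<open>b\<close>.\<close>

lemma flux_op_split:
  assumes fr: "flux_regular \<Omega> p c C (\<lambda>x. \<alpha> x t) (\<lambda>x. \<beta> x t) d" and C: "C > 0"
    and u: "u t \<in> W1p \<Omega> p" and v: "v \<in> W1p \<Omega> p"
  shows "flux_op \<Omega> (\<lambda>_. 1) (\<lambda>_. 1) (weak_grad \<Omega>) \<alpha> \<beta> u t v =
    (\<Sum>l\<in>L. flux_op (S l) (a l) (b l) (wgrad (S l) (a l) p) \<alpha> \<beta> (restr_time (S l) u) t v)"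
proof -
  define P Q where "P x = \<alpha> x t (weak_grad \<Omega> (u t) x) \<bullet> weak_grad \<Omega> v x" and "Q x = \<beta> x t (u t x) * v x" for x
  have Lp: "w \<in> Lp_space \<Omega> (\<lambda>_. r) p" if "w \<in> W1p \<Omega> p" for w and r :: real
    using W1pD(1)[OF dom that] by (rule Lp_bounded_weight[where M="\<bar>r\<bar>"]) auto
  have Lpv: "weak_grad \<Omega> w \<in> Lp_vec \<Omega> (\<lambda>_. r) p" if "w \<in> W1p \<Omega> p" for w and r :: real
    using W1pD(3)[OF dom that] by (rule Lp_vec_bounded_weight[where M="\<bar>r\<bar>"]) auto
  \<comment> \<open>\<open>flux_regular_integrable\<close> speaks of the sum of the two terms; the
    constant weights 1 and 0, in either order, isolate \<open>P\<close> and
    \<open>Q\<close>.\<close>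
  have fi: "integrable (lebesgue_on \<Omega>) (\<lambda>x. r * P x + e * Q x)" if "0 \<le> r" "r \<le> 1" "0 \<le> e" "e \<le> 1" for r e :: real
    using flux_regular_integrable[OF fr p2 C subset_refl mO mO, of "\<lambda>_. r" 1 "\<lambda>_. e", OF _ _ _ _ _ _ Lpv[OF u] Lpv[OF v] Lp[OF u] Lp[OF v]] that
    by (simp add: P_def Q_def mult.assoc)
  have Pi: "integrable (lebesgue_on \<Omega>) P" and Qi: "integrable (lebesgue_on \<Omega>) Q" using fi[of 1 0] fi[of 0 1] by simp_all
  have PP: "\<And>l. l \<in> L \<Longrightarrow> integrable (lebesgue_on (S l)) (\<lambda>x. a l x * P x)"
    "(\<Sum>l\<in>L. LINT x|lebesgue_on (S l). a l x * P x) = (LINT x|lebesgue_on \<Omega>. P x)"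
    using partition_integral[of L \<Omega> S a P] L mO sub mSl aL part(1) Pi by auto
  have QQ: "\<And>l. l \<in> L \<Longrightarrow> integrable (lebesgue_on (S l)) (\<lambda>x. b l x * Q x)"
    "(\<Sum>l\<in>L. LINT x|lebesgue_on (S l). b l x * Q x) = (LINT x|lebesgue_on \<Omega>. Q x)"
    using partition_integral[of L \<Omega> S b Q] L mO sub mSl bL part(2) Qi by auto
  have "flux_op (S l) (a l) (b l) (wgrad (S l) (a l) p) \<alpha> \<beta> (restr_time (S l) u) t v
      = (LINT x|lebesgue_on (S l). a l x * P x) + (LINT x|lebesgue_on (S l). b l x * Q x)" if l: "l \<in> L" for l
  proof -
    interpret A: weighted_domain "S l" "a l" "b l" p cb by (rule wd[OF l])
    have bd: "AE x in lebesgue_on (S l). \<bar>a l x\<bar> \<le> max A.Ma A.Mb" "AE x in lebesgue_on (S l). \<bar>b l x\<bar> \<le> max A.Ma A.Mb"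
      using A.Ma A.Mb by (eventually_elim, simp)+
    note U = restr_V(1)[where u=u and t=t, OF l u] and Vl = W1p_restrict(1)[OF l v]
    have i: "integrable (lebesgue_on (S l)) (\<lambda>x. a l x * P x + b l x * Q x)" using PP(1)[OF l] QQ(1)[OF l] by simp
    have "flux_op (S l) (a l) (b l) (wgrad (S l) (a l) p) \<alpha> \<beta> (restr_time (S l) u) t v = (LINT x|lebesgue_on (S l). a l x * P x + b l x * Q x)"
      unfolding flux_op_def
    proof (rule integral_cong_AE)
      show "(\<lambda>x. a l x * (\<alpha> x t (wgrad (S l) (a l) p (restr_time (S l) u t) x) \<bullet> wgrad (S l) (a l) p v x) + b l x * \<beta> x t (restr_time (S l) u t x) * v x) \<in> borel_measurable (lebesgue_on (S l))"
        using flux_regular_integrable[OF fr p2 C sub[OF l] mSl[OF l] mO A.am A.a_ge bd(1) A.bm A.b_ge bd(2) A.VwD(4)[OF U] A.VwD(4)[OF Vl] A.VwD(1)[OF U] A.VwD(1)[OF Vl]]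
        by (rule borel_measurable_integrable)
      show "AE x in lebesgue_on (S l). a l x * (\<alpha> x t (wgrad (S l) (a l) p (restr_time (S l) u t) x) \<bullet> wgrad (S l) (a l) p v x) + b l x * \<beta> x t (restr_time (S l) u t x) * v x = a l x * P x + b l x * Q x"
        using W1p_restrict(2)[OF l u] W1p_restrict(2)[OF l v] AE_space[of "lebesgue_on (S l)"]
        by eventually_elim (simp add: restr_V(2)[of l u t, OF l u] restr_eq P_def Q_def)
    qed (use i in auto)
    also have "\<dots> = (LINT x|lebesgue_on (S l). a l x * P x) + (LINT x|lebesgue_on (S l). b l x * Q x)"
      using PP(1)[OF l] QQ(1)[OF l] by (rule Bochner_Integration.integral_add)
    finally show ?thesis .
  qed
  then have "(\<Sum>l\<in>L. flux_op (S l) (a l) (b l) (wgrad (S l) (a l) p) \<alpha> \<beta> (restr_time (S l) u) t v) = integral\<^sup>L (lebesgue_on \<Omega>) P + integral\<^sup>L (lebesgue_on \<Omega>) Q"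
    using PP(2) QQ(2) by (simp add: sum.distrib)
  also have "\<dots> = flux_op \<Omega> (\<lambda>_. 1) (\<lambda>_. 1) (weak_grad \<Omega>) \<alpha> \<beta> u t v"
    using Bochner_Integration.integral_add[OF Pi Qi] by (simp add: flux_op_def P_def Q_def)
  finally show ?thesis ..
qed

text \<open>With \<open>v\<close> fixed, both sides are weak derivatives of the same scalar function
  of time, because the multiplication operator splits by the partition \<open>g\<close>. The
  fundamental lemma on the time interval then identifies them.\<close>

lemma ddt_split:
  assumes u: "u \<in> W_full T p \<Omega> \<gamma>" and ul: "\<And>l. l \<in> L \<Longrightarrow> restr_time (S l) u \<in> W_sub T p (S l) (a l) (b l) (g l) \<gamma>"
    and v: "v \<in> W1p \<Omega> p"
  shows "AE t in I0 T. ddt T (W1p \<Omega> p) (W1p_norm \<Omega> p) q (mult_op \<Omega> \<gamma> u) t v =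
     (\<Sum>l\<in>L. ddt T (V l) (VN l) q (mult_op (S l) (\<lambda>x. g l x * \<gamma> x) (restr_time (S l) u)) t v)"
proof -
  define M where "M = (\<lambda>l. mult_op (S l) (\<lambda>x. g l x * \<gamma> x) (restr_time (S l) u))"
  define G where "G = ddt T (W1p \<Omega> p) (W1p_norm \<Omega> p) q (mult_op \<Omega> \<gamma> u)"
  define Gl where "Gl = (\<lambda>l. ddt T (V l) (VN l) q (M l))"
  have u': "u \<in> bochner_Lp T (W1p \<Omega> p) (W1p_norm \<Omega> p) p" "mult_op \<Omega> \<gamma> u \<in> ddt_dom T (W1p \<Omega> p) (W1p_norm \<Omega> p) q"
    using u by (auto simp: W_full_def evol_space_def)
  have Ml: "M l \<in> ddt_dom T (V l) (VN l) q" if "l \<in> L" for l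
    using ul[OF that] by (auto simp: W_sub_def evol_space_def M_def)
  have G: "is_ddt T (W1p \<Omega> p) (W1p_norm \<Omega> p) q (mult_op \<Omega> \<gamma> u) G" unfolding G_def by (rule ddt_is_ddt[OF u'(2)])
  have Gl: "is_ddt T (V l) (VN l) q (M l) (Gl l)" if "l \<in> L" for l unfolding Gl_def by (rule ddt_is_ddt[OF Ml[OF that]])
  have Gi: "integrable (I0 T) (\<lambda>t. G t v)" using G by (intro W.dual_pairing_integrable_const[OF _ p1 v]) (simp add: is_ddt_def)
  have Mi: "integrable (I0 T) (\<lambda>t. M l t v)" if "l \<in> L" for l
    using Ml[OF that] by (intro seminormed.dual_pairing_integrable_const[OF Vl[OF that] _ p1 W1p_restrict(1)[OF that v]]) (simp add: ddt_dom_def)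
  have Gli: "integrable (I0 T) (\<lambda>t. Gl l t v)" if "l \<in> L" for l
    using Gl[OF that] by (intro seminormed.dual_pairing_integrable_const[OF Vl[OF that] _ p1 W1p_restrict(1)[OF that v]]) (simp add: is_ddt_def)
  have Hi: "integrable (I0 T) (\<lambda>t. G t v - (\<Sum>l\<in>L. Gl l t v))" using Gi Gli by (intro Bochner_Integration.integrable_diff Bochner_Integration.integrable_sum)
  have "AE t in I0 T. G t v - (\<Sum>l\<in>L. Gl l t v) = 0"
  proof (rule AE_zero_if_orthogonal_rat_bumps)
    show "loc_integrable {0<..<T} (\<lambda>t. G t v - (\<Sum>l\<in>L. Gl l t v))" by (rule integrable_loc_integrable[OF I0_sets Hi])
    fix \<phi> assume "\<phi> \<in> rat_bumps {0<..<T}"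
    then have \<phi>: "\<phi> \<in> test_fun {0<..<T}" using rat_bumps_test_fun by blast
    note t = test_fun_times_integrable[OF \<phi>]
    have "(LINT t|I0 T. \<phi> t * G t v) = - (LINT t|I0 T. deriv \<phi> t * mult_op \<Omega> \<gamma> u t v)" using G \<phi> v by (simp add: is_ddt_def)
    also have "(LINT t|I0 T. deriv \<phi> t * mult_op \<Omega> \<gamma> u t v) = (LINT t|I0 T. (\<Sum>l\<in>L. deriv \<phi> t * M l t v))"
    proof (rule integral_cong_AE)
      show "(\<lambda>t. deriv \<phi> t * mult_op \<Omega> \<gamma> u t v) \<in> borel_measurable (I0 T)"
        using u'(2) by (intro borel_measurable_integrable t(2) W.dual_pairing_integrable_const[OF _ p1 v]) (simp add: ddt_dom_def)
      show "(\<lambda>t. \<Sum>l\<in>L. deriv \<phi> t * M l t v) \<in> borel_measurable (I0 T)" using t(2)[OF Mi] by (intro borel_measurable_sum borel_measurable_integrable)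
      show "AE t in I0 T. deriv \<phi> t * mult_op \<Omega> \<gamma> u t v = (\<Sum>l\<in>L. deriv \<phi> t * M l t v)"
        using bochner_Lp_mem[OF u'(1)] by eventually_elim (simp add: mult_op_split[OF _ v] M_def sum_distrib_left)
    qed
    also have "- \<dots> = (\<Sum>l\<in>L. - (LINT t|I0 T. deriv \<phi> t * M l t v))" using t(2)[OF Mi] by (simp add: Bochner_Integration.integral_sum sum_negf)
    also have "\<dots> = (\<Sum>l\<in>L. LINT t|I0 T. \<phi> t * Gl l t v)"
      using Gl \<phi> W1p_restrict(1)[OF _ v] by (intro sum.cong) (simp_all add: is_ddt_def)
    also have "\<dots> = (LINT t|I0 T. (\<Sum>l\<in>L. \<phi> t * Gl l t v))" using t(1)[OF Gli] by (simp add: Bochner_Integration.integral_sum)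
    finally have e: "(LINT t|I0 T. \<phi> t * G t v) = (LINT t|I0 T. (\<Sum>l\<in>L. \<phi> t * Gl l t v))" .
    have "(LINT t|I0 T. (G t v - (\<Sum>l\<in>L. Gl l t v)) * \<phi> t) = (LINT t|I0 T. \<phi> t * G t v - (\<Sum>l\<in>L. \<phi> t * Gl l t v))"
      by (simp add: algebra_simps sum_distrib_left)
    also have "\<dots> = (LINT t|I0 T. \<phi> t * G t v) - (LINT t|I0 T. (\<Sum>l\<in>L. \<phi> t * Gl l t v))"
      using t(1)[OF Gi] t(1)[OF Gli] by (intro Bochner_Integration.integral_diff Bochner_Integration.integrable_sum)
    finally show "(LINT t|I0 T. (G t v - (\<Sum>l\<in>L. Gl l t v)) * \<phi> t) = 0" using e by simp
  qed simp
  then show ?thesis unfolding G_def Gl_def M_def by eventually_elim simp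
qed

text \<open>The hypothesis is integrated over time. Testing with \<open>v\<close> multiplied by the
  indicator of a set of times, for all measurable sets, yields the pointwise identity.\<close>

lemma source_split:
  assumes f: "f \<in> bochner_dual T (W1p \<Omega> p) (W1p_norm \<Omega> p) q" and fs: "\<And>l. l \<in> L \<Longrightarrow> fs l \<in> bochner_dual T (V l) (VN l) q"
    and eq: "\<And>v. v \<in> bochner_Lp T (W1p \<Omega> p) (W1p_norm \<Omega> p) p \<Longrightarrow> pairing T f v = (\<Sum>l\<in>L. pairing T (fs l) (restr_time (S l) v))"
    and v: "v \<in> W1p \<Omega> p"
  shows "AE t in I0 T. f t v = (\<Sum>l\<in>L. fs l t v)"
proof -
  have fi: "integrable (I0 T) (\<lambda>t. f t v)" by (rule W.dual_pairing_integrable_const[OF f p1 v])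
  have fli: "integrable (I0 T) (\<lambda>t. fs l t v)" if "l \<in> L" for l
    by (rule seminormed.dual_pairing_integrable_const[OF Vl[OF that] fs[OF that] p1 W1p_restrict(1)[OF that v]])
  have i: "integrable (I0 T) (\<lambda>t. indicator E t * k t)" if "E \<in> sets lebesgue" "integrable (I0 T) k" for E and k :: "real \<Rightarrow> real"
  proof -
    have "indicator E \<in> borel_measurable (I0 T)" using that(1) by (intro measurable_restrict_space1 borel_measurable_indicator)
    then show ?thesis using that(2)
      by (intro Bochner_Integration.integrable_bound[OF that(2)] AE_I2 borel_measurable_times) (auto split: split_indicator)
  qed
  have "AE t in I0 T. f t v - (\<Sum>l\<in>L. fs l t v) = 0"
  proof (rule AE_zero_if_set_integrals_zero)
    show "integrable (I0 T) (\<lambda>t. f t v - (\<Sum>l\<in>L. fs l t v))" using fi fli by (intro Bochner_Integration.integrable_diff Bochner_Integration.integrable_sum)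
    fix E :: "real set" assume E: "E \<in> sets lebesgue"
    define w where "w = (\<lambda>t y. indicator E t * v y)"
    have w: "w \<in> bochner_Lp T (W1p \<Omega> p) (W1p_norm \<Omega> p) p" unfolding w_def by (rule W.bochner_Lp_simple[OF W.simple_indicator[OF E v]])
    have fd: "AE t in I0 T. f t \<in> dual_space (W1p \<Omega> p) (W1p_norm \<Omega> p)" using f unfolding bochner_dual_def by (rule bochner_Lp_mem)
    have "pairing T f w = (LINT t|I0 T. indicator E t * f t v)" unfolding pairing_def
    proof (rule integral_cong_AE)
      show "(\<lambda>t. f t (w t)) \<in> borel_measurable (I0 T)" using W.pairing_integrable[OF f w p1] by (rule borel_measurable_integrable)
      show "AE t in I0 T. f t (w t) = indicator E t * f t v"
        using fd by eventually_elim (use v in \<open>simp add: w_def dual_space_def\<close>)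
    qed (use i[OF E fi] in auto)
    moreover have "pairing T (fs l) (restr_time (S l) w) = (LINT t|I0 T. indicator E t * fs l t v)" if l: "l \<in> L" for l
    proof -
      interpret N: seminormed "V l" "VN l" by (rule Vl[OF l])
      note vl = W1p_restrict(1)[OF l v]
      have lfd: "AE t in I0 T. fs l t \<in> dual_space (V l) (VN l)" using fs[OF l] unfolding bochner_dual_def by (rule bochner_Lp_mem)
      have ae: "AE t in I0 T. fs l t (restr_time (S l) w t) = indicator E t * fs l t v"
        using lfd
      proof eventually_elim
        case (elim t)
        have wl: "w t \<in> V l" unfolding w_def by (rule N.scale_mem[OF vl])
        have rl: "restr_time (S l) w t \<in> V l" using wl Vw_cong[of "S l" "restr_time (S l) w t" "w t"] by (simp add: restr_eq)
        \<comment> \<open>Functionals act on representatives, and \<open>restr_time\<close> alters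
          \<open>w\<close> outside the subdomain. The change has seminorm 0, so boundedness of the
          functional makes the two values equal.\<close>
        have "VN l (\<lambda>x. restr_time (S l) w t x - w t x) = VN l (\<lambda>x. 0)" by (rule Vw_norm_cong) (simp add: restr_eq)
        then have "\<bar>fs l t (\<lambda>x. restr_time (S l) w t x - w t x)\<bar> \<le> 0"
          using N.dual_bound[OF elim N.diff_mem[OF rl wl]] N.N_zero by simp
        then have "fs l t (restr_time (S l) w t) = fs l t (w t)" using N.dual_linear(2)[OF elim rl wl] by simp
        then show ?case using elim vl by (simp add: w_def dual_space_def)
      qed
      have m: "(\<lambda>t. indicator E t * fs l t v) \<in> borel_measurable (I0 T)" using i[OF E fli[OF l]] by (rule borel_measurable_integrable)
      have "(\<lambda>t. fs l t (restr_time (S l) w t)) \<in> borel_measurable (I0 T)"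
        by (rule measurable_lebesgue_on_AE[OF m I0_sets]) (use ae in \<open>eventually_elim, simp\<close>)
      then show ?thesis unfolding pairing_def by (rule integral_cong_AE[OF _ m ae])
    qed
    ultimately have e: "(LINT t|I0 T. indicator E t * f t v) = (\<Sum>l\<in>L. LINT t|I0 T. indicator E t * fs l t v)" using eq[OF w] by simp
    have "(LINT t|I0 T. indicator E t * (f t v - (\<Sum>l\<in>L. fs l t v))) = (LINT t|I0 T. indicator E t * f t v - (\<Sum>l\<in>L. indicator E t * fs l t v))"
      by (simp add: right_diff_distrib sum_distrib_left)
    also have "\<dots> = (LINT t|I0 T. indicator E t * f t v) - (LINT t|I0 T. (\<Sum>l\<in>L. indicator E t * fs l t v))"
      using i[OF E fi] i[OF E fli] by (intro Bochner_Integration.integral_diff Bochner_Integration.integrable_sum)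
    also have "(LINT t|I0 T. (\<Sum>l\<in>L. indicator E t * fs l t v)) = (\<Sum>l\<in>L. LINT t|I0 T. indicator E t * fs l t v)"
      using i[OF E fli] by (intro Bochner_Integration.integral_sum)
    finally show "(LINT t|I0 T. indicator E t * (f t v - (\<Sum>l\<in>L. fs l t v))) = 0" using e by simp
  qed
  then show ?thesis by eventually_elim simp
qed

theorem F_sub_sum_zero:
  assumes fr: "AE t in I0 T. flux_regular \<Omega> p c C (\<lambda>x. \<alpha> x t) (\<lambda>x. \<beta> x t) (d t)" and C: "C > 0"
    and f: "f \<in> bochner_dual T (W1p \<Omega> p) (W1p_norm \<Omega> p) q" and fs: "\<And>l. l \<in> L \<Longrightarrow> fs l \<in> bochner_dual T (V l) (VN l) q"
    and eq: "\<And>v. v \<in> bochner_Lp T (W1p \<Omega> p) (W1p_norm \<Omega> p) p \<Longrightarrow> pairing T f v = (\<Sum>l\<in>L. pairing T (fs l) (restr_time (S l) v))"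
    and u: "u \<in> W_full T p \<Omega> \<gamma>" "AE t in I0 T. \<forall>v\<in>W1p \<Omega> p. F_full T p \<Omega> \<gamma> \<alpha> \<beta> f u t v = 0"
    and ul: "\<And>l. l \<in> L \<Longrightarrow> u \<in> F_sub_dom T p \<Omega> (S l) (a l) (b l) (g l) \<gamma> \<alpha> \<beta> (fs l)"
  shows "AE t in I0 T. AE x in lebesgue_on \<Omega>. (\<Sum>l\<in>L. F_sub T p (S l) (a l) (b l) (g l) \<gamma> \<alpha> \<beta> (fs l) u t x) = 0"
proof -
  define F where "F l = F_sub T p (S l) (a l) (b l) (g l) \<gamma> \<alpha> \<beta> (fs l) u" for l
  have us: "restr_time (S l) u \<in> W_sub T p (S l) (a l) (b l) (g l) \<gamma>" if "l \<in> L" for l using ul[OF that] by (simp add: F_sub_dom_def)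
  have uW: "AE t in I0 T. u t \<in> W1p \<Omega> p" using u(1) by (intro bochner_Lp_mem) (auto simp: W_full_def evol_space_def)
  have rep: "F l \<in> L2_time T \<Omega>" "AE t in I0 T. \<forall>v\<in>V l. residual_sub T p (S l) (a l) (b l) (g l) \<gamma> \<alpha> \<beta> (fs l) (restr_time (S l) u) t v = (LINT x|lebesgue_on \<Omega>. F l t x * v x)"
    if l: "l \<in> L" for l
  proof -
    obtain h where h: "h \<in> L2_time T (S l)" "F_sub T p (S l) (a l) (b l) (g l) \<gamma> \<alpha> \<beta> (fs l) u = (\<lambda>t. ext_zero (S l) (h t))"
      "AE t in I0 T. \<forall>v\<in>V l. residual_sub T p (S l) (a l) (b l) (g l) \<gamma> \<alpha> \<beta> (fs l) (restr_time (S l) u) t v = (LINT x|lebesgue_on (S l). h t x * v x)"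
      by (rule F_sub_represents[OF ul[OF l]]) (rule that)
    note h = h[folded F_def]
    show "F l \<in> L2_time T \<Omega>" unfolding h(2) by (rule ext_zero_L2_time[OF sub[OF l] mSl[OF l] mO h(1)])
    show "AE t in I0 T. \<forall>v\<in>V l. residual_sub T p (S l) (a l) (b l) (g l) \<gamma> \<alpha> \<beta> (fs l) (restr_time (S l) u) t v = (LINT x|lebesgue_on \<Omega>. F l t x * v x)"
      unfolding h(2) ext_zero_Lp(3)[OF sub[OF l] mSl[OF l] mO] by (rule h(3))
  qed
  have FL: "AE t in I0 T. \<forall>l\<in>L. F l t \<in> Lp_space \<Omega> (\<lambda>_. 1) 2" using L L2_time_mem[OF rep(1)] by (simp add: AE_finite_all)
  have repL: "AE t in I0 T. \<forall>l\<in>L. \<forall>v\<in>V l. residual_sub T p (S l) (a l) (b l) (g l) \<gamma> \<alpha> \<beta> (fs l) (restr_time (S l) u) t v = (LINT x|lebesgue_on \<Omega>. F l t x * v x)"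
    using L rep(2) by (simp add: AE_finite_all)
  have orth: "AE t in I0 T. (LINT x|lebesgue_on \<Omega>. (\<Sum>l\<in>L. F l t x) * v x) = 0" if v: "v \<in> W1p \<Omega> p" for v
  proof -
    have dd: "AE t in I0 T. ddt T (W1p \<Omega> p) (W1p_norm \<Omega> p) q (mult_op \<Omega> \<gamma> u) t v =
      (\<Sum>l\<in>L. ddt T (V l) (VN l) q (mult_op (S l) (\<lambda>x. g l x * \<gamma> x) (restr_time (S l) u)) t v)" by (rule ddt_split[OF u(1) us v])
    have ff: "AE t in I0 T. f t v = (\<Sum>l\<in>L. fs l t v)" by (rule source_split[OF f fs eq v])
    show ?thesis using fr u(2) uW FL repL dd ff
    proof eventually_elim
      case (elim t)
      have "(LINT x|lebesgue_on \<Omega>. (\<Sum>l\<in>L. F l t x) * v x) = (\<Sum>l\<in>L. LINT x|lebesgue_on \<Omega>. F l t x * v x)"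
        unfolding sum_distrib_right using elim(4) W1p_L2[OF v] by (intro Bochner_Integration.integral_sum L2_mult_integrable) auto
      also have "\<dots> = (\<Sum>l\<in>L. residual_sub T p (S l) (a l) (b l) (g l) \<gamma> \<alpha> \<beta> (fs l) (restr_time (S l) u) t v)"
        using elim(5) W1p_restrict(1)[OF _ v] by (intro sum.cong) auto
      also have "\<dots> = F_full T p \<Omega> \<gamma> \<alpha> \<beta> f u t v"
        unfolding residual_sub_def F_full_def flux_op_split[where \<alpha>=\<alpha> and \<beta>=\<beta> and u=u, OF elim(1) C elim(3) v] elim(6,7) sum.distrib ..
      finally show ?case using elim(2) v by simp
    qed
  qed
  \<comment> \<open>In \<open>orth\<close> the null set of times depends on \<open>v\<close>. For
    the countably many rational bumps one null set serves all, and these suffice for the fundamental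
    lemma in space.\<close>
  have "AE t in I0 T. \<forall>v\<in>rat_bumps \<Omega>. (LINT x|lebesgue_on \<Omega>. (\<Sum>l\<in>L. F l t x) * v x) = 0"
  proof (subst AE_ball_countable[OF countable_rat_bumps], rule ballI)
    fix v assume "v \<in> rat_bumps \<Omega>"
    then have "v \<in> W1p \<Omega> p" using rat_bumps_test_fun test_fun_W1p(1)[OF dom p0] by blast
    then show "AE t in I0 T. (LINT x|lebesgue_on \<Omega>. (\<Sum>l\<in>L. F l t x) * v x) = 0" by (rule orth)
  qed
  then show ?thesis using FL
  proof eventually_elim
    case (elim t)
    have "integrable (lebesgue_on \<Omega>) (\<lambda>x. \<Sum>l\<in>L. F l t x)"
      using elim(2) by (intro Bochner_Integration.integrable_sum Lp_integrable[OF dom, of 2]) auto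
    then have "AE x in lebesgue_on \<Omega>. (\<Sum>l\<in>L. F l t x) = 0"
      using elim(1) by (intro AE_zero_if_orthogonal_rat_bumps finite_domainD(1)[OF dom] integrable_loc_integrable[OF mO]) auto
    then show ?case by (simp add: F_def)
  qed
qed

end

section \<open>Convergence of the splitting schemes\<close>

text \<open>Telescoping bounds the partial sums of \<open>m\<close> by \<open>A 0 / s\<close>, so
  \<open>m\<close> is summable.\<close>

lemma energy_descent_tendsto_zero:
  fixes A m :: "nat \<Rightarrow> real"
  assumes A: "\<And>n. 0 \<le> A n" and m: "\<And>n. 0 \<le> m n" and s: "s > 0" and d: "\<And>n. A (Suc n) \<le> A n - s * m n"
  shows "m \<longlonglongrightarrow> 0"
proof -
  have "s * sum m {..n} \<le> A 0 - A (Suc n)" for n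
  proof (induction n)
    case (Suc n)
    then show ?case using d[of "Suc n"] by (simp add: distrib_left)
  qed (use d[of 0] in simp)
  then have "s * sum m {..n} \<le> A 0" for n using A[of "Suc n"] by (smt (verit))
  then have "sum m {..n} \<le> A 0 / s" for n using s by (simp add: pos_le_divide_eq mult.commute)
  then have "summable m" using m by (intro bounded_imp_summable)
  then show ?thesis by (rule summable_LIMSEQ_zero)
qed

text \<open>The energy is the squared norm of \<open>s e + F(u\<^sub>2) - F(u)\<close>, where \<open>e = u\<^sub>2 - u\<close>.  Since the residuals of the
  exact solution cancel, the errors satisfy the schemes with zero data, and
  \<open>\<parallel>s e + r\<parallel>\<^sup>2 - \<parallel>s e - r\<parallel>\<^sup>2 = 4 s (r, e)\<close> with \<open>r = F(u\<^sub>2) - F(u)\<close> makes the energy decrease by monotonicity.\<close>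

lemma splitting_scheme_monotone_limit:
  fixes F1 F2 :: "(real \<Rightarrow> 'a \<Rightarrow> real) \<Rightarrow> real \<Rightarrow> 'a::euclidean_space \<Rightarrow> real"
  assumes s: "s > 0" and u: "u \<in> L2_time T \<Omega>" "F1 u \<in> L2_time T \<Omega>" "F2 u \<in> L2_time T \<Omega>"
    and u1: "\<And>n. u1 (Suc n) \<in> L2_time T \<Omega>" "\<And>n. F1 (u1 (Suc n)) \<in> L2_time T \<Omega>"
    and u2: "\<And>n. u2 n \<in> L2_time T \<Omega>" "\<And>n. F2 (u2 n) \<in> L2_time T \<Omega>"
    and zero: "AE t in I0 T. AE x in lebesgue_on \<Omega>. F1 u t x + F2 u t x = 0"
    and m1: "\<And>n. 0 \<le> ip T \<Omega> (\<lambda>t x. F1 (u1 (Suc n)) t x - F1 u t x) (\<lambda>t x. u1 (Suc n) t x - u t x)"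
    and m2: "\<And>n. 0 \<le> ip T \<Omega> (\<lambda>t x. F2 (u2 n) t x - F2 u t x) (\<lambda>t x. u2 n t x - u t x)"
    and scheme: "peaceman_rachford T \<Omega> s F1 F2 u1 u2 \<or> douglas_rachford T \<Omega> s F1 F2 u1 u2"
  shows "(\<lambda>n. ip T \<Omega> (\<lambda>t x. F1 (u1 (Suc n)) t x - F1 u t x) (\<lambda>t x. u1 (Suc n) t x - u t x)) \<longlonglongrightarrow> 0"
    "(\<lambda>n. ip T \<Omega> (\<lambda>t x. F2 (u2 n) t x - F2 u t x) (\<lambda>t x. u2 n t x - u t x)) \<longlonglongrightarrow> 0"
proof -
  have lin: "(\<lambda>t x. c * v t x + d * w t x) \<in> L2_time T \<Omega>" if "v \<in> L2_time T \<Omega>" "w \<in> L2_time T \<Omega>" for v w c d using that by (rule L2_time_lin)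
  have dif: "(\<lambda>t x. v t x - w t x) \<in> L2_time T \<Omega>" if "v \<in> L2_time T \<Omega>" "w \<in> L2_time T \<Omega>" for v w using lin[OF that, of 1 "-1"] by simp
  define e1 f1 where "e1 n t x = u1 (Suc n) t x - u t x" and "f1 n t x = F1 (u1 (Suc n)) t x - F1 u t x" for n t x
  define e2 f2 where "e2 n t x = u2 n t x - u t x" and "f2 n t x = F2 (u2 n) t x - F2 u t x" for n t x
  have L: "e1 n \<in> L2_time T \<Omega>" "f1 n \<in> L2_time T \<Omega>" "e2 n \<in> L2_time T \<Omega>" "f2 n \<in> L2_time T \<Omega>" for n
    using dif[OF u1(1) u(1)] dif[OF u1(2) u(2)] dif[OF u2(1) u(1)] dif[OF u2(2) u(3)]
    by (simp_all add: e1_def[abs_def] f1_def[abs_def] e2_def[abs_def] f2_def[abs_def])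
  define E R where "E e f = (\<lambda>t x. s * e t x + 1 * f t x)" and "R e f = (\<lambda>t x. s * e t x + (-1) * f t x)" for e f :: "real \<Rightarrow> 'a \<Rightarrow> real"
  have ER: "E v w \<in> L2_time T \<Omega>" "R v w \<in> L2_time T \<Omega>" if "v \<in> L2_time T \<Omega>" "w \<in> L2_time T \<Omega>" for v w
    unfolding E_def R_def by (rule lin[OF that])+
  have reflect: "ip T \<Omega> (R e f) (R e f) = ip T \<Omega> (E e f) (E e f) - 4 * s * ip T \<Omega> f e"
    if "e \<in> L2_time T \<Omega>" "f \<in> L2_time T \<Omega>" for e f
    unfolding E_def R_def ip_sq_lin[OF that] by (simp add: ip_commute[of T \<Omega> f e])
  define m where "m n = ip T \<Omega> (f1 n) (e1 n) + ip T \<Omega> (f2 n) (e2 n)" for n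
  define A where "A n = ip T \<Omega> (E (e2 n) (f2 n)) (E (e2 n) (f2 n))" for n
  have mn: "0 \<le> ip T \<Omega> (f1 n) (e1 n)" "0 \<le> ip T \<Omega> (f2 n) (e2 n)" for n
    using m1 m2 by (simp_all add: e1_def[abs_def] f1_def[abs_def] e2_def[abs_def] f2_def[abs_def])
  \<comment> \<open>\<open>F1 u = - F2 u\<close> adds the missing residuals of the exact solution on
    both sides; the common first line of the schemes becomes
    \<open>s e1 + f1 = s e2 - f2\<close>.\<close>
  have first: "eq_L2 T \<Omega> (E (e1 n) (f1 n)) (R (e2 n) (f2 n))" for n
  proof -
    have "eq_L2 T \<Omega> (\<lambda>t x. s * u1 (Suc n) t x + F1 (u1 (Suc n)) t x) (\<lambda>t x. s * u2 n t x - F2 (u2 n) t x)"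
      using scheme by (auto simp: peaceman_rachford_def douglas_rachford_def)
    with zero show ?thesis unfolding eq_L2_def
    proof eventually_elim
      case (elim t)
      from elim show ?case
        by eventually_elim (simp add: E_def R_def e1_def e2_def f1_def f2_def algebra_simps)
    qed
  qed
  have R1: "ip T \<Omega> (R (e1 n) (f1 n)) (R (e1 n) (f1 n)) = A n - 4 * s * m n" for n
    using reflect[OF L(1,2), of n] reflect[OF L(3,4), of n] ip_cong[OF ER(1)[OF L(1,2)] ER(2)[OF L(3,4)] first ER(1)[OF L(1,2)] ER(2)[OF L(3,4)] first, of n]
    by (simp add: A_def m_def distrib_left)
  have desc: "A (Suc n) \<le> A n - (2 * s) * m n" for n
    using scheme
  proof
    assume "peaceman_rachford T \<Omega> s F1 F2 u1 u2"
    then have "eq_L2 T \<Omega> (\<lambda>t x. s * u2 (Suc n) t x + F2 (u2 (Suc n)) t x) (\<lambda>t x. s * u1 (Suc n) t x - F1 (u1 (Suc n)) t x)"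
      by (auto simp: peaceman_rachford_def)
    \<comment> \<open>The second line reads \<open>s e2' + f2' = s e1 - f1\<close>: one step is the
      composition of two reflections, and the energy drops by exactly
      \<open>4 * s * m n\<close>.\<close>
    with zero have q: "eq_L2 T \<Omega> (E (e2 (Suc n)) (f2 (Suc n))) (R (e1 n) (f1 n))" unfolding eq_L2_def
    proof eventually_elim
      case (elim t)
      from elim show ?case
        by eventually_elim (simp add: E_def R_def e1_def e2_def f1_def f2_def algebra_simps)
    qed
    have "A (Suc n) = A n - 4 * s * m n"
      using ip_cong[OF ER(1)[OF L(3,4)] ER(2)[OF L(1,2)] q ER(1)[OF L(3,4)] ER(2)[OF L(1,2)] q] R1[of n] by (simp add: A_def)
    moreover have "0 \<le> s * m n" using s mn[of n] by (simp add: m_def)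
    ultimately show ?thesis by (simp add: mult.assoc)
  next
    assume "douglas_rachford T \<Omega> s F1 F2 u1 u2"
    then have "eq_L2 T \<Omega> (\<lambda>t x. s * u2 (Suc n) t x + F2 (u2 (Suc n)) t x) (\<lambda>t x. s * u1 (Suc n) t x + F2 (u2 n) t x)"
      by (auto simp: douglas_rachford_def)
    \<comment> \<open>Here the new element \<open>s e2' + f2'\<close> is the mean of the old one and
      its image under the two reflections. Convexity of the squared norm therefore gives half of the
      decrease of Peaceman-Rachford, and \<open>2 * s\<close> is the constant common to both
      schemes.\<close>
    with first[of n] have q: "eq_L2 T \<Omega> (E (e2 (Suc n)) (f2 (Suc n))) (\<lambda>t x. (1/2) * E (e2 n) (f2 n) t x + (1/2) * R (e1 n) (f1 n) t x)"
      unfolding eq_L2_def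
    proof eventually_elim
      case (elim t)
      from elim show ?case
        by eventually_elim (simp add: E_def R_def e1_def e2_def f1_def f2_def field_simps)
    qed
    let ?E = "E (e2 n) (f2 n)" and ?R = "R (e1 n) (f1 n)"
    note ERn = ER(1)[OF L(3,4), of n n] ER(2)[OF L(1,2), of n n]
    have "0 \<le> ip T \<Omega> (\<lambda>t x. 1 * ?E t x + (-1) * ?R t x) (\<lambda>t x. 1 * ?E t x + (-1) * ?R t x)" by (rule ip_self_nonneg)
    also have "\<dots> = A n - 2 * ip T \<Omega> ?E ?R + ip T \<Omega> ?R ?R" unfolding ip_sq_lin[OF ERn] by (simp add: A_def)
    finally have "2 * ip T \<Omega> ?E ?R \<le> A n + ip T \<Omega> ?R ?R" by simp
    moreover have "4 * A (Suc n) = A n + 2 * ip T \<Omega> ?E ?R + ip T \<Omega> ?R ?R"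
      using ip_cong[OF ER(1)[OF L(3,4)] lin[OF ERn] q ER(1)[OF L(3,4)] lin[OF ERn] q] unfolding ip_sq_lin[OF ERn] by (simp add: A_def power2_eq_square)
    ultimately show ?thesis using R1[of n] by simp
  qed
  have "m \<longlonglongrightarrow> 0"
  proof (rule energy_descent_tendsto_zero[where A=A and m=m and s="2 * s", OF _ _ _ desc])
    show "0 \<le> A n" for n unfolding A_def by (rule ip_self_nonneg)
    show "0 \<le> m n" for n using mn by (simp add: m_def)
  qed (use s in simp)
  then have "(\<lambda>n. ip T \<Omega> (f1 n) (e1 n)) \<longlonglongrightarrow> 0" "(\<lambda>n. ip T \<Omega> (f2 n) (e2 n)) \<longlonglongrightarrow> 0"
    by (rule Lim_null_comparison[rotated], intro always_eventually allI, use mn in \<open>simp add: m_def\<close>)+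
  then show "(\<lambda>n. ip T \<Omega> (\<lambda>t x. F1 (u1 (Suc n)) t x - F1 u t x) (\<lambda>t x. u1 (Suc n) t x - u t x)) \<longlonglongrightarrow> 0"
    "(\<lambda>n. ip T \<Omega> (\<lambda>t x. F2 (u2 n) t x - F2 u t x) (\<lambda>t x. u2 n t x - u t x)) \<longlonglongrightarrow> 0"
    by (simp_all add: e1_def[abs_def] f1_def[abs_def] e2_def[abs_def] f2_def[abs_def])
qed

lemma F_sub_L2_time:
  assumes S: "S \<subseteq> \<Omega>" "S \<in> sets lebesgue" "\<Omega> \<in> sets lebesgue" and u: "u \<in> F_sub_dom T p \<Omega> S a b g \<gamma> \<alpha> \<beta> f"
  shows "F_sub T p S a b g \<gamma> \<alpha> \<beta> f u \<in> L2_time T \<Omega>"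
proof -
  obtain h where h: "h \<in> L2_time T S" "F_sub T p S a b g \<gamma> \<alpha> \<beta> f u = (\<lambda>t. ext_zero S (h t))"
    by (rule F_sub_represents[OF u]) (rule that)
  show ?thesis unfolding h(2) by (rule ext_zero_L2_time[OF S h(1)])
qed

lemma lipschitz_domain_union_open: "lipschitz_domain_union S \<Longrightarrow> open S"
  unfolding lipschitz_domain_union_def lipschitz_domain_def by auto

theorem corollary2:
  fixes \<Omega> :: "'a::euclidean_space set" and \<Omega>s :: "nat \<Rightarrow> 'a set"
    and T p s :: real
    and a b g :: "nat \<Rightarrow> 'a \<Rightarrow> real" and \<gamma> :: "'a \<Rightarrow> real"
    and \<alpha> :: "'a \<Rightarrow> real \<Rightarrow> 'a \<Rightarrow> 'a" and \<beta> :: "'a \<Rightarrow> real \<Rightarrow> real \<Rightarrow> real"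
    and f :: "real \<Rightarrow> ('a \<Rightarrow> real) \<Rightarrow> real" and fs :: "nat \<Rightarrow> real \<Rightarrow> ('a \<Rightarrow> real) \<Rightarrow> real"
    and u :: "real \<Rightarrow> 'a \<Rightarrow> real" and us :: "nat \<Rightarrow> nat \<Rightarrow> real \<Rightarrow> 'a \<Rightarrow> real"
  assumes T: "T > 0" and p: "p \<ge> 2"
    and Omega: "bounded \<Omega>" "lipschitz_domain \<Omega>"
    and subdomains: "\<And>l. l \<in> {1, 2} \<Longrightarrow> lipschitz_domain_union (\<Omega>s l)"
      "\<Omega> = \<Omega>s 1 \<union> \<Omega>s 2"
    and weight_a: "\<And>l. l \<in> {1, 2} \<Longrightarrow> a l \<in> W1inf_zero \<Omega> (\<Omega>s l)"
      "\<And>l. l \<in> {1, 2} \<Longrightarrow> AE x in lebesgue_on (\<Omega>s l). a l x > 0"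
      "AE x in lebesgue_on \<Omega>. (\<Sum>l\<in>{1, 2}. ext_zero (\<Omega>s l) (a l) x) = 1"
    and weight_b: "\<And>l. l \<in> {1, 2} \<Longrightarrow> b l \<in> Linf_space (\<Omega>s l)"
      "\<exists>cb>0. \<forall>l\<in>{1, 2}. AE x in lebesgue_on (\<Omega>s l). b l x \<ge> cb"
      "AE x in lebesgue_on \<Omega>. (\<Sum>l\<in>{1, 2}. ext_zero (\<Omega>s l) (b l) x) = 1"
    and weight_g: "\<And>l. l \<in> {1, 2} \<Longrightarrow> g l \<in> Linf_space (\<Omega>s l)"
      "\<And>l. l \<in> {1, 2} \<Longrightarrow> AE x in lebesgue_on (\<Omega>s l). g l x > 0"
      "AE x in lebesgue_on \<Omega>. (\<Sum>l\<in>{1, 2}. ext_zero (\<Omega>s l) (g l) x) = 1"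
    and p_str: "p_structure \<Omega> T p \<alpha> \<beta>"
    and gamma: "\<gamma> \<in> Linf_space \<Omega>" "AE x in lebesgue_on \<Omega>. \<gamma> x \<ge> 0"
    and source: "f \<in> bochner_dual T (W1p \<Omega> p) (W1p_norm \<Omega> p) (p / (p - 1))"
      "\<And>l. l \<in> {1, 2} \<Longrightarrow>
         fs l \<in> bochner_dual T (Vw (\<Omega>s l) (a l) (b l) p) (Vw_norm (\<Omega>s l) (a l) (b l) p) (p / (p - 1))"
      "\<And>v. v \<in> bochner_Lp T (W1p \<Omega> p) (W1p_norm \<Omega> p) p \<Longrightarrow>
         pairing T f v = (\<Sum>l\<in>{1, 2}. pairing T (fs l) (restr_time (\<Omega>s l) v))"
    and solution: "u \<in> W_full T p \<Omega> \<gamma>"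
      "AE t in lebesgue_on {0<..<T}. \<forall>v\<in>W1p \<Omega> p. F_full T p \<Omega> \<gamma> \<alpha> \<beta> f u t v = 0"
      "\<And>l. l \<in> {1, 2} \<Longrightarrow> u \<in> F_sub_dom T p \<Omega> (\<Omega>s l) (a l) (b l) (g l) \<gamma> \<alpha> \<beta> (fs l)"
    and s: "s > 0"
    and iterates: "us 2 0 \<in> F_sub_dom T p \<Omega> (\<Omega>s 2) (a 2) (b 2) (g 2) \<gamma> \<alpha> \<beta> (fs 2)"
      "\<And>l n. l \<in> {1, 2} \<Longrightarrow>
         us l (Suc n) \<in> F_sub_dom T p \<Omega> (\<Omega>s l) (a l) (b l) (g l) \<gamma> \<alpha> \<beta> (fs l)"
    and scheme:
      "peaceman_rachford T \<Omega> s
         (F_sub T p (\<Omega>s 1) (a 1) (b 1) (g 1) \<gamma> \<alpha> \<beta> (fs 1))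
         (F_sub T p (\<Omega>s 2) (a 2) (b 2) (g 2) \<gamma> \<alpha> \<beta> (fs 2)) (us 1) (us 2) \<or>
       douglas_rachford T \<Omega> s
         (F_sub T p (\<Omega>s 1) (a 1) (b 1) (g 1) \<gamma> \<alpha> \<beta> (fs 1))
         (F_sub T p (\<Omega>s 2) (a 2) (b 2) (g 2) \<gamma> \<alpha> \<beta> (fs 2)) (us 1) (us 2)"
  shows "\<exists>c>0. (\<lambda>n. \<Sum>l\<in>{1, 2}.
      c * bochner_norm T (Lp_norm (\<Omega>s l) (a l) p) p
            (\<lambda>t. wgrad (\<Omega>s l) (a l) p (restr_time (\<Omega>s l) (\<lambda>t x. us l n t x - u t x) t)) powr p
    + c * bochner_norm T (Lp_norm (\<Omega>s l) (b l) p) p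
            (restr_time (\<Omega>s l) (\<lambda>t x. us l n t x - u t x)) powr p) \<longlonglongrightarrow> 0"
proof -
  have dom: "finite_domain \<Omega>" using Omega by (simp add: finite_domain_def lipschitz_domain_def)
  have sub: "\<Omega>s l \<subseteq> \<Omega>" if "l \<in> {1, 2}" for l using that subdomains(2) by auto
  have domS: "finite_domain (\<Omega>s l)" if "l \<in> {1, 2}" for l
    using lipschitz_domain_union_open[OF subdomains(1)[OF that]] bounded_subset[OF Omega(1) sub[OF that]] by (simp add: finite_domain_def)
  note mO = finite_domainD(2)[OF dom] and mS = finite_domainD(2)[OF domS]
  obtain cb where cb: "cb > 0" "\<forall>l\<in>{1, 2}. AE x in lebesgue_on (\<Omega>s l). b l x \<ge> cb" using weight_b(2) by blast
  have wd: "weighted_domain (\<Omega>s l) (a l) (b l) p cb" if "l \<in> {1, 2}" for l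
    using domS[OF that] p weight_a(1)[OF that] weight_a(2)[OF that] weight_b(1)[OF that] cb that
    by unfold_locales (auto simp: W1inf_zero_def)
  interpret splitting \<Omega> \<Omega>s "{1, 2}" T p cb a b g \<gamma>
    by (intro splitting.intro dom p sub wd weight_g(1,3) gamma(1) weight_a(3) weight_b(3)) simp_all
  obtain c C d where c: "c > 0" "C > 0" and fr: "AE t in I0 T. flux_regular \<Omega> p c C (\<lambda>x. \<alpha> x t) (\<lambda>x. \<beta> x t) (d t)"
    by (rule p_structure_flux_regular[OF p_str finite_domainD(1)[OF dom]]) (rule that)
  let ?F = "\<lambda>l. F_sub T p (\<Omega>s l) (a l) (b l) (g l) \<gamma> \<alpha> \<beta> (fs l)"
  let ?D = "\<lambda>l. F_sub_dom T p \<Omega> (\<Omega>s l) (a l) (b l) (g l) \<gamma> \<alpha> \<beta> (fs l)"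
  define m where "m l w = ip T \<Omega> (\<lambda>t x. ?F l w t x - ?F l u t x) (\<lambda>t x. w t x - u t x)" for l w
  define e where "e l w = bochner_norm T (Lp_norm (\<Omega>s l) (a l) p) p (\<lambda>t. wgrad (\<Omega>s l) (a l) p (restr_time (\<Omega>s l) (\<lambda>t x. w t x - u t x) t)) powr p
    + bochner_norm T (Lp_norm (\<Omega>s l) (b l) p) p (restr_time (\<Omega>s l) (\<lambda>t x. w t x - u t x)) powr p" for l w
  have mono: "c * e l w \<le> m l w" if l: "l \<in> {1, 2}" and w: "w \<in> ?D l" for l w
  proof -
    have gg: "(\<lambda>x. g l x * \<gamma> x) \<in> Linf_space (\<Omega>s l)"
      by (rule Linf_mult[OF weight_g(1)[OF l] Linf_subset[OF sub[OF l] mS[OF l] mO gamma(1)]])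
    have "AE x in lebesgue_on (\<Omega>s l). 0 \<le> g l x * \<gamma> x"
      using weight_g(2)[OF l] AE_lebesgue_on_subset[OF sub[OF l] mS[OF l] mO gamma(2)] by eventually_elim simp
    from weighted_domain.F_sub_monotone[OF wd[OF l] dom sub[OF l] fr c gg this w solution(3)[OF l]]
    show ?thesis by (simp add: e_def m_def)
  qed
  have en: "0 \<le> e l w" for l w by (simp add: e_def)
  have mn: "0 \<le> m l w" if "l \<in> {1, 2}" "w \<in> ?D l" for l w
    using mono[OF that] en[of l w] c(1) by (meson mult_nonneg_nonneg less_imp_le order_trans)
  have L2: "w \<in> L2_time T \<Omega>" "?F l w \<in> L2_time T \<Omega>" if "l \<in> {1, 2}" "w \<in> ?D l" for l w
    using that(2) F_sub_L2_time[OF sub[OF that(1)] mS[OF that(1)] mO that(2)] by (auto simp: F_sub_dom_def)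
  have d1: "us 1 (Suc n) \<in> ?D 1" for n by (rule iterates(2)) simp
  have d2: "us 2 n \<in> ?D 2" for n by (cases n) (use iterates in auto)
  have du: "u \<in> ?D 1" "u \<in> ?D 2" by (rule solution(3), simp)+
  have "AE t in I0 T. AE x in lebesgue_on \<Omega>. (\<Sum>l\<in>{1, 2}. ?F l u t x) = 0"
    by (rule F_sub_sum_zero[OF fr c(2) source(1) source(2) source(3) solution(1,2) solution(3)])
  then have zero: "AE t in I0 T. AE x in lebesgue_on \<Omega>. ?F 1 u t x + ?F 2 u t x = 0" by simp
  note lim = splitting_scheme_monotone_limit[where ?F1.0="?F 1" and ?F2.0="?F 2" and ?u1.0="us 1" and ?u2.0="us 2",
      OF s L2(1)[OF _ du(1)] L2(2)[OF _ du(1)] L2(2)[OF _ du(2)] L2(1)[OF _ d1] L2(2)[OF _ d1] L2(1)[OF _ d2] L2(2)[OF _ d2] zero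
        mn[OF _ d1, unfolded m_def] mn[OF _ d2, unfolded m_def] scheme, folded m_def, simplified]
  have bound: "e l w \<le> m l w / c" if "l \<in> {1, 2}" "w \<in> ?D l" for l w
    using mono[OF that] c(1) by (simp add: pos_le_divide_eq mult.commute)
  \<comment> \<open>The schemes determine \<open>us 1\<close> from index 1 on, whereas
    \<open>us 2\<close> starts at 0; the value \<open>us 1 0\<close> is arbitrary and is skipped by
    shifting the sequence.\<close>
  have e1: "(\<lambda>n. e 1 (us 1 n)) \<longlonglongrightarrow> 0"
  proof (rule LIMSEQ_imp_Suc, rule tendsto_sandwich[OF _ _ tendsto_const])
    show "\<forall>\<^sub>F n in sequentially. e 1 (us 1 (Suc n)) \<le> m 1 (us 1 (Suc n)) / c" using bound[OF _ d1] by simp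
    show "(\<lambda>n. m 1 (us 1 (Suc n)) / c) \<longlonglongrightarrow> 0" using tendsto_divide_zero[OF lim(1)] by simp
  qed (simp add: en)
  have e2: "(\<lambda>n. e 2 (us 2 n)) \<longlonglongrightarrow> 0"
  proof (rule tendsto_sandwich[OF _ _ tendsto_const])
    show "\<forall>\<^sub>F n in sequentially. e 2 (us 2 n) \<le> m 2 (us 2 n) / c" using bound[OF _ d2] by simp
    show "(\<lambda>n. m 2 (us 2 n) / c) \<longlonglongrightarrow> 0" using tendsto_divide_zero[OF lim(2)] by simp
  qed (simp add: en)
  have "(\<lambda>n. \<Sum>l\<in>{1, 2}. e l (us l n)) \<longlonglongrightarrow> 0" using e1 e2 by (intro tendsto_null_sum) auto
  \<comment> \<open>The monotonicity constant has been divided out in \<open>bound\<close>, so the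
    sum of the norms tends to 0 with factor 1.\<close>
  then show ?thesis unfolding e_def by (intro exI[of _ 1]) simp
qed

end
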